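(* For any quasitriangular quasi-Hopf algebra $H$ (with $R$-matrix $R$) and any cochain twist $F\in H\otimes H$ based on $H$, the equivalence of closed monoidal categories $\mathcal{F}:{}^H\mathscr{M}\to{}^{H_F}\mathscr{M}$ is an equivalence between the braided closed monoidal categories ${}^H\mathscr{M}$ and ${}^{H_F}\mathscr{M}$, where $H_F$ is the twisted quasi-Hopf algebra with $R$-matrix $R_F=F_{21}\,R\,F^{-1}$.
   Context: Fix a commutative ring $k$ with unit; $\otimes=\otimes_k$. A quasi-bialgebra is an associative unital $k$-algebra $H$ with algebra homomorphisms $\Delta:H\to H\otimes H$, $\epsilon:H\to k$ and an invertible $\phi\in H^{\otimes 3}$ such that for all $h\in H$: $(\epsilon\otimes\mathrm{id})\Delta(h)=h=(\mathrm{id}\otimes\epsilon)\Delta(h)$; $(\mathrm{id}\otimes\Delta)\Delta(h)\cdot\phi=\phi\cdot(\Delta\otimes\mathrm{id})\Delta(h)$; $(\mathrm{id}\otimes\mathrm{id}\otimes\Delta)(\phi)\cdot(\Delta\otimes\mathrm{id}\otimes\mathrm{id})(\phi)=(1\otimes\phi)\cdot(\mathrm{id}\otimes\Delta\otimes\mathrm{id})(\phi)\cdot(\phi\otimes1)$; $(\mathrm{id}\otimes\epsilon\otimes\mathrm{id})(\phi)=1\otimes1$. Notation (summation understood): $\Delta(h)=h_{(1)}\otimes h_{(2)}$, $\phi=\phi^{(1)}\otimes\phi^{(2)}\otimes\phi^{(3)}$, $\phi^{-1}=\phi^{(-1)}\otimes\phi^{(-2)}\otimes\phi^{(-3)}$.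 A quasi-Hopf algebra is a quasi-bialgebra with a quasi-antipode $(S,\alpha,\beta)$: an algebra anti-automorphism $S:H\to H$ and $\alpha,\beta\in H$ with $S(h_{(1)})\alpha h_{(2)}=\epsilon(h)\alpha$, $h_{(1)}\beta S(h_{(2)})=\epsilon(h)\beta$ for all $h$, $\phi^{(1)}\beta S(\phi^{(2)})\alpha\phi^{(3)}=1$, $S(\phi^{(-1)})\alpha\phi^{(-2)}\beta S(\phi^{(-3)})=1$. It is quasitriangular if equipped with an invertible $R=R^{(1)}\otimes R^{(2)}\in H\otimes H$ ($R$-matrix) with $\Delta^{\mathrm{op}}(h)=R\Delta(h)R^{-1}$, $(\mathrm{id}\otimes\Delta)(R)=\phi_{231}^{-1}R_{13}\phi_{213}R_{12}\phi_{123}^{-1}$ and $(\Delta\otimes\mathrm{id})(R)=\phi_{312}R_{13}\phi_{132}^{-1}R_{23}\phi_{123}$, where $\Delta^{\mathrm{op}}(h)=h_{(2)}\otimes h_{(1)}$ and $X_{i_1\dots i_p}$ denotes the element with $j$-th leg of $X$ placed in tensor position $i_j$ and $1$ elsewhere (so $F_{21}=F^{(2)}\otimes F^{(1)}$). ${}^H\mathscr{M}$ is the category of left $H$-modules (action $\triangleright$) and $H$-equivariant $k$-linear maps, monoidal with $h\triangleright(v\otimes w)=(h_{(1)}\triangleright v)\otimes(h_{(2)}\triangleright w)$, unit $I=k$ (action via $\epsilon$), associator $\Phi_{V,W,X}((v\otimes w)\otimes x)=(\phi^{(1)}\triangleright v)\otimes((\phi^{(2)}\triangleright w)\otimes(\phi^{(3)}\triangleright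 x))$; closed with internal hom $\hom(V,W)=\mathrm{Hom}_k(V,W)$, $h\triangleright L=(h_{(1)}\triangleright\cdot)\circ L\circ(S(h_{(2)})\triangleright\cdot)$; and braided with $\tau_{V,W}(v\otimes w)=(R^{(2)}\triangleright w)\otimes(R^{(1)}\triangleright v)$. A cochain twist based on $H$ is an invertible $F=F^{(1)}\otimes F^{(2)}\in H\otimes H$ with $(\epsilon\otimes\mathrm{id})(F)=1=(\mathrm{id}\otimes\epsilon)(F)$; write $F^{-1}=F^{(-1)}\otimes F^{(-2)}$. $H_F$ is the algebra $H$ with counit $\epsilon$, $\Delta_F(h)=F\Delta(h)F^{-1}$, $\phi_F=(1\otimes F)(\mathrm{id}\otimes\Delta)(F)\,\phi\,(\Delta\otimes\mathrm{id})(F^{-1})(F^{-1}\otimes1)$, $S_F=S$, $\alpha_F=S(F^{(-1)})\alpha F^{(-2)}$, $\beta_F=F^{(1)}\beta S(F^{(2)})$; it is quasitriangular with $R$-matrix $R_F$, and $\tau^F$ denotes the resulting braiding on ${}^{H_F}\mathscr{M}$. $\mathcal{F}:{}^H\mathscr{M}\to{}^{H_F}\mathscr{M}$ is the identity on underlying modules and maps; it is an equivalence of closed monoidal categories with coherence maps $\varphi_{V,W}:\mathcal{F}(V)\otimes_F\mathcal{F}(W)\to\mathcal{F}(V\otimes W)$, $v\otimes_Fw\mapsto(F^{(-1)}\triangleright v)\otimes(F^{(-2)}\triangleright w)$, $\psi=\mathrm{id}:I_F\to\mathcal{F}(I)$ and $\gamma_{V,W}:\hom_F(\mathcal{F}(V),\mathcal{F}(W))\to\mathcal{F}(\hom(V,W))$,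 $L\mapsto(F^{(-1)}\triangleright\cdot)\circ L\circ(S(F^{(-2)})\triangleright\cdot)$. Being an equivalence of braided closed monoidal categories means additionally $\varphi_{W,V}\circ\tau^F_{\mathcal{F}(V),\mathcal{F}(W)}=\mathcal{F}(\tau_{V,W})\circ\varphi_{V,W}$ for all $V,W$. *)

theory Defs
  imports "HOL-Algebra.Module" "HOL-Algebra.AbelCoset"
begin

section \<open>Modules over a commutative ring: quotients and tensor products\<close>

text \<open>Modules are records \<^typ>\<open>('k, 'v) module\<close> in the sense of the locale \<^locale>\<open>module\<close>;
  the ring multiplication and unit carried by such a record are ignored
  unless it is meant to be an algebra.\<close>

definition free_module :: "'k ring \<Rightarrow> 'b set \<Rightarrow> ('k, 'b \<Rightarrow> 'k) module" where
  "free_module K B =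
     \<lparr>carrier = {f. range f \<subseteq> carrier K \<and> (\<forall>b. b \<notin> B \<longrightarrow> f b = \<zero>\<^bsub>K\<^esub>) \<and> finite {b. f b \<noteq> \<zero>\<^bsub>K\<^esub>}},
      mult = undefined, one = undefined,
      zero = (\<lambda>_. \<zero>\<^bsub>K\<^esub>), add = (\<lambda>f g b. f b \<oplus>\<^bsub>K\<^esub> g b),
      smult = (\<lambda>r f b. r \<otimes>\<^bsub>K\<^esub> f b)\<rparr>"

definition basis_vec :: "'k ring \<Rightarrow> 'b \<Rightarrow> 'b \<Rightarrow> 'k" where
  "basis_vec K b = (\<lambda>c. if c = b then \<one>\<^bsub>K\<^esub> else \<zero>\<^bsub>K\<^esub>)"

definition submodule_span :: "'k ring \<Rightarrow> ('k, 'm) module \<Rightarrow> 'm set \<Rightarrow> 'm set" where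
  "submodule_span K M S = \<Inter>{N. submodule N K M \<and> S \<subseteq> N}"

definition quotient_module :: "('k, 'm) module \<Rightarrow> 'm set \<Rightarrow> ('k, 'm set) module" where
  "quotient_module M N =
     \<lparr>carrier = a_rcosets\<^bsub>M\<^esub> N, mult = undefined, one = undefined,
      zero = N, add = (\<lambda>X Y. X <+>\<^bsub>M\<^esub> Y),
      smult = (\<lambda>r X. \<Union>x\<in>X. N +>\<^bsub>M\<^esub> (r \<odot>\<^bsub>M\<^esub> x))\<rparr>"

text \<open>Linear extension of \<open>\<beta>\<close>, given on a basis, to classes \<open>t\<close> in a quotient of the free module.
  It is independent of the chosen representative whenever the linear extension of \<open>\<beta>\<close> annihilates
  the relations, e.g. for (multi)linear \<open>\<beta>\<close> on the tensor products below.\<close>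

definition lin_ext ::
  "'k ring \<Rightarrow> ('k, 'x, 'm) module_scheme \<Rightarrow> ('b \<Rightarrow> 'x) \<Rightarrow> ('b \<Rightarrow> 'k) set \<Rightarrow> 'x" where
  "lin_ext K X \<beta> t =
     (let f = (SOME f. f \<in> t) in \<Oplus>\<^bsub>X\<^esub>b\<in>{b. f b \<noteq> \<zero>\<^bsub>K\<^esub>}. f b \<odot>\<^bsub>X\<^esub> \<beta> b)"

definition linear_map ::
  "'k ring \<Rightarrow> ('k, 'v, 'm) module_scheme \<Rightarrow> ('k, 'w, 'n) module_scheme \<Rightarrow> ('v \<Rightarrow> 'w) \<Rightarrow> bool" where
  "linear_map K V W f \<longleftrightarrow>
     f \<in> carrier V \<rightarrow> carrier W \<and>
     (\<forall>x\<in>carrier V. \<forall>y\<in>carrier V. f (x \<oplus>\<^bsub>V\<^esub> y) = f x \<oplus>\<^bsub>W\<^esub> f y) \<and>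
     (\<forall>r\<in>carrier K. \<forall>x\<in>carrier V. f (r \<odot>\<^bsub>V\<^esub> x) = r \<odot>\<^bsub>W\<^esub> f x)"

subsection \<open>The tensor product of two modules\<close>

definition tensor_rels ::
  "'k ring \<Rightarrow> ('k, 'v, 'm) module_scheme \<Rightarrow> ('k, 'w, 'n) module_scheme \<Rightarrow> ('v \<times> 'w \<Rightarrow> 'k) set" where
  "tensor_rels K V W =
     (let M = free_module K (carrier V \<times> carrier W); e = basis_vec K in
        {e (v \<oplus>\<^bsub>V\<^esub> v', w) \<ominus>\<^bsub>M\<^esub> e (v, w) \<ominus>\<^bsub>M\<^esub> e (v', w) | v v' w.
            v \<in> carrier V \<and> v' \<in> carrier V \<and> w \<in> carrier W}
      \<union> {e (v, w \<oplus>\<^bsub>W\<^esub> w') \<ominus>\<^bsub>M\<^esub> e (v, w) \<ominus>\<^bsub>M\<^esub> e (v, w') | v w w'.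
            v \<in> carrier V \<and> w \<in> carrier W \<and> w' \<in> carrier W}
      \<union> {e (r \<odot>\<^bsub>V\<^esub> v, w) \<ominus>\<^bsub>M\<^esub> r \<odot>\<^bsub>M\<^esub> e (v, w) | r v w.
            r \<in> carrier K \<and> v \<in> carrier V \<and> w \<in> carrier W}
      \<union> {e (v, r \<odot>\<^bsub>W\<^esub> w) \<ominus>\<^bsub>M\<^esub> r \<odot>\<^bsub>M\<^esub> e (v, w) | r v w.
            r \<in> carrier K \<and> v \<in> carrier V \<and> w \<in> carrier W})"

definition tensor_null ::
  "'k ring \<Rightarrow> ('k, 'v, 'm) module_scheme \<Rightarrow> ('k, 'w, 'n) module_scheme \<Rightarrow> ('v \<times> 'w \<Rightarrow> 'k) set" where
  "tensor_null K V W =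
     submodule_span K (free_module K (carrier V \<times> carrier W)) (tensor_rels K V W)"

definition tensor ::
  "'k ring \<Rightarrow> ('k, 'v, 'm) module_scheme \<Rightarrow> ('k, 'w, 'n) module_scheme
    \<Rightarrow> ('k, ('v \<times> 'w \<Rightarrow> 'k) set) module" where
  "tensor K V W =
     quotient_module (free_module K (carrier V \<times> carrier W)) (tensor_null K V W)"

definition tens ::
  "'k ring \<Rightarrow> ('k, 'v, 'm) module_scheme \<Rightarrow> ('k, 'w, 'n) module_scheme
    \<Rightarrow> 'v \<Rightarrow> 'w \<Rightarrow> ('v \<times> 'w \<Rightarrow> 'k) set" where
  "tens K V W v w =
     tensor_null K V W +>\<^bsub>free_module K (carrier V \<times> carrier W)\<^esub> basis_vec K (v, w)"

definition tensor_map ::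
  "'k ring \<Rightarrow> ('k, 'v, 'm) module_scheme \<Rightarrow> ('k, 'w, 'n) module_scheme
    \<Rightarrow> ('k, 'v2, 'm2) module_scheme \<Rightarrow> ('k, 'w2, 'n2) module_scheme
    \<Rightarrow> ('v \<Rightarrow> 'v2) \<Rightarrow> ('w \<Rightarrow> 'w2) \<Rightarrow> ('v \<times> 'w \<Rightarrow> 'k) set \<Rightarrow> ('v2 \<times> 'w2 \<Rightarrow> 'k) set" where
  "tensor_map K V W V' W' f g =
     (\<lambda>t\<in>carrier (tensor K V W).
        lin_ext K (tensor K V' W') (\<lambda>(v, w). tens K V' W' (f v) (g w)) t)"

subsection \<open>Tensor powers of an algebra\<close>

text \<open>The \<open>n\<close>-th tensor power of \<open>H\<close> is the free module on lists of length \<open>n\<close> modulo the multilinear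
  relations, so that all tensor powers live in one type and no rebracketing is needed.\<close>

definition tpow_basis :: "('k, 'h, 'm) module_scheme \<Rightarrow> nat \<Rightarrow> 'h list set" where
  "tpow_basis H n = {xs. set xs \<subseteq> carrier H \<and> length xs = n}"

definition tpow_rels :: "'k ring \<Rightarrow> ('k, 'h, 'm) module_scheme \<Rightarrow> nat \<Rightarrow> ('h list \<Rightarrow> 'k) set" where
  "tpow_rels K H n =
     (let M = free_module K (tpow_basis H n); e = basis_vec K in
        {e (xs[i := a \<oplus>\<^bsub>H\<^esub> b]) \<ominus>\<^bsub>M\<^esub> e (xs[i := a]) \<ominus>\<^bsub>M\<^esub> e (xs[i := b]) | xs i a b.
            xs \<in> tpow_basis H n \<and> i < n \<and> a \<in> carrier H \<and> b \<in> carrier H}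
      \<union> {e (xs[i := r \<odot>\<^bsub>H\<^esub> a]) \<ominus>\<^bsub>M\<^esub> r \<odot>\<^bsub>M\<^esub> e (xs[i := a]) | xs i r a.
            xs \<in> tpow_basis H n \<and> i < n \<and> r \<in> carrier K \<and> a \<in> carrier H})"

definition tpow_null :: "'k ring \<Rightarrow> ('k, 'h, 'm) module_scheme \<Rightarrow> nat \<Rightarrow> ('h list \<Rightarrow> 'k) set" where
  "tpow_null K H n = submodule_span K (free_module K (tpow_basis H n)) (tpow_rels K H n)"

definition tpow_module ::
  "'k ring \<Rightarrow> ('k, 'h, 'm) module_scheme \<Rightarrow> nat \<Rightarrow> ('k, ('h list \<Rightarrow> 'k) set) module" where
  "tpow_module K H n = quotient_module (free_module K (tpow_basis H n)) (tpow_null K H n)"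

definition ptens :: "'k ring \<Rightarrow> ('k, 'h, 'm) module_scheme \<Rightarrow> 'h list \<Rightarrow> ('h list \<Rightarrow> 'k) set" where
  "ptens K H xs =
     tpow_null K H (length xs) +>\<^bsub>free_module K (tpow_basis H (length xs))\<^esub> basis_vec K xs"

definition tpow ::
  "'k ring \<Rightarrow> ('k, 'h, 'm) module_scheme \<Rightarrow> nat \<Rightarrow> ('k, ('h list \<Rightarrow> 'k) set) module" where
  "tpow K H n = (tpow_module K H n)
     \<lparr>mult := (\<lambda>s t. lin_ext K (tpow_module K H n) (\<lambda>xs.
                       lin_ext K (tpow_module K H n) (\<lambda>ys.
                         ptens K H (map2 (\<lambda>x y. x \<otimes>\<^bsub>H\<^esub> y) xs ys)) t) s),
      one := ptens K H (replicate n \<one>\<^bsub>H\<^esub>)\<rparr>"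

definition leg2 :: "('h \<Rightarrow> 'h \<Rightarrow> 'x) \<Rightarrow> 'h list \<Rightarrow> 'x" where
  "leg2 f xs = f (xs ! 0) (xs ! 1)"

definition leg3 :: "('h \<Rightarrow> 'h \<Rightarrow> 'h \<Rightarrow> 'x) \<Rightarrow> 'h list \<Rightarrow> 'x" where
  "leg3 f xs = f (xs ! 0) (xs ! 1) (xs ! 2)"

text \<open>\<open>place K H n [i\<^sub>1, \<dots>, i\<^sub>p] X\<close> is the element \<open>X\<close> with subscript \<open>i\<^sub>1 \<dots> i\<^sub>p\<close> in the \<open>n\<close>-th
  tensor power: the \<open>j\<close>-th leg of \<open>X\<close> sits in position \<open>i\<^sub>j\<close> (counted from 1).\<close>

definition place ::
  "'k ring \<Rightarrow> ('k, 'h, 'm) module_scheme \<Rightarrow> nat \<Rightarrow> nat list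
    \<Rightarrow> ('h list \<Rightarrow> 'k) set \<Rightarrow> ('h list \<Rightarrow> 'k) set" where
  "place K H n is X =
     lin_ext K (tpow K H n) (\<lambda>xs.
       ptens K H (map (\<lambda>p. case map_of (zip is xs) p of None \<Rightarrow> \<one>\<^bsub>H\<^esub> | Some x \<Rightarrow> x) [1..<Suc n])) X"

section \<open>Quasi-Hopf algebras\<close>

record ('k, 'h) quasi_hopf = "('k, 'h) module" +
  comul :: "'h \<Rightarrow> ('h list \<Rightarrow> 'k) set"
  counit :: "'h \<Rightarrow> 'k"
  reassoc :: "('h list \<Rightarrow> 'k) set"
  antipode :: "'h \<Rightarrow> 'h"
  qalpha :: 'h
  qbeta :: 'h

text \<open>The locale \<^locale>\<open>algebra\<close> of the library is restricted to commutative algebras.\<close>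

locale unital_algebra = module K H + H: ring H
  for K :: "'k ring" (structure) and H :: "('k, 'h, 'm) module_scheme" (structure) +
  assumes smult_mult_left:
      "\<lbrakk>r \<in> carrier K; x \<in> carrier H; y \<in> carrier H\<rbrakk>
        \<Longrightarrow> (r \<odot>\<^bsub>H\<^esub> x) \<otimes>\<^bsub>H\<^esub> y = r \<odot>\<^bsub>H\<^esub> (x \<otimes>\<^bsub>H\<^esub> y)"
    and smult_mult_right:
      "\<lbrakk>r \<in> carrier K; x \<in> carrier H; y \<in> carrier H\<rbrakk>
        \<Longrightarrow> x \<otimes>\<^bsub>H\<^esub> (r \<odot>\<^bsub>H\<^esub> y) = r \<odot>\<^bsub>H\<^esub> (x \<otimes>\<^bsub>H\<^esub> y)"

text \<open>\<open>comul_at K H n i\<close> applies the coproduct to the \<open>i\<close>-th leg (counted from 1) of an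
  element of the \<open>n\<close>-th tensor power.\<close>

definition comul_at ::
  "'k ring \<Rightarrow> ('k, 'h) quasi_hopf \<Rightarrow> nat \<Rightarrow> nat \<Rightarrow> ('h list \<Rightarrow> 'k) set \<Rightarrow> ('h list \<Rightarrow> 'k) set" where
  "comul_at K H n i X =
     lin_ext K (tpow K H (Suc n)) (\<lambda>xs.
       lin_ext K (tpow K H (Suc n)) (\<lambda>ys. ptens K H (take (i - 1) xs @ ys @ drop i xs))
         (comul H (xs ! (i - 1)))) X"

abbreviation tinv ::
  "'k ring \<Rightarrow> ('k, 'h, 'm) module_scheme \<Rightarrow> nat \<Rightarrow> ('h list \<Rightarrow> 'k) set \<Rightarrow> ('h list \<Rightarrow> 'k) set" where
  "tinv K H n X \<equiv> inv\<^bsub>tpow K H n\<^esub> X"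

locale quasi_bialgebra = unital_algebra K H
  for K :: "'k ring" (structure) and H :: "('k, 'h) quasi_hopf" (structure) +
  assumes comul_linear: "linear_map K H (tpow K H 2) (comul H)"
    and comul_hom: "comul H \<in> ring_hom H (tpow K H 2)"
    and counit_hom: "counit H \<in> ring_hom H K"
    and counit_smult:
      "\<lbrakk>r \<in> carrier K; h \<in> carrier H\<rbrakk> \<Longrightarrow> counit H (r \<odot>\<^bsub>H\<^esub> h) = r \<otimes>\<^bsub>K\<^esub> counit H h"
    and reassoc_unit: "reassoc H \<in> Units (tpow K H 3)"
    and counit_left:
      "h \<in> carrier H \<Longrightarrow> lin_ext K H (leg2 (\<lambda>a b. counit H a \<odot>\<^bsub>H\<^esub> b)) (comul H h) = h"
    and counit_right:
      "h \<in> carrier H \<Longrightarrow> lin_ext K H (leg2 (\<lambda>a b. counit H b \<odot>\<^bsub>H\<^esub> a)) (comul H h) = h"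
    and quasi_coassoc:
      "h \<in> carrier H \<Longrightarrow>
        comul_at K H 2 2 (comul H h) \<otimes>\<^bsub>tpow K H 3\<^esub> reassoc H
          = reassoc H \<otimes>\<^bsub>tpow K H 3\<^esub> comul_at K H 2 1 (comul H h)"
    and pentagon:
      "comul_at K H 3 3 (reassoc H) \<otimes>\<^bsub>tpow K H 4\<^esub> comul_at K H 3 1 (reassoc H)
        = place K H 4 [2, 3, 4] (reassoc H) \<otimes>\<^bsub>tpow K H 4\<^esub> comul_at K H 3 2 (reassoc H)
            \<otimes>\<^bsub>tpow K H 4\<^esub> place K H 4 [1, 2, 3] (reassoc H)"
    and reassoc_counit:
      "lin_ext K (tpow K H 2) (leg3 (\<lambda>a b c. counit H b \<odot>\<^bsub>tpow K H 2\<^esub> ptens K H [a, c])) (reassoc H)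
        = \<one>\<^bsub>tpow K H 2\<^esub>"

locale quasi_hopf_algebra = quasi_bialgebra K H
  for K :: "'k ring" (structure) and H :: "('k, 'h) quasi_hopf" (structure) +
  assumes antipode_linear: "linear_map K H H (antipode H)"
    and antipode_bij: "bij_betw (antipode H) (carrier H) (carrier H)"
    and antipode_one: "antipode H \<one>\<^bsub>H\<^esub> = \<one>\<^bsub>H\<^esub>"
    and antipode_mult:
      "\<lbrakk>x \<in> carrier H; y \<in> carrier H\<rbrakk>
        \<Longrightarrow> antipode H (x \<otimes>\<^bsub>H\<^esub> y) = antipode H y \<otimes>\<^bsub>H\<^esub> antipode H x"
    and qalpha_closed: "qalpha H \<in> carrier H"
    and qbeta_closed: "qbeta H \<in> carrier H"
    and antipode_alpha:
      "h \<in> carrier H \<Longrightarrow>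
        lin_ext K H (leg2 (\<lambda>a b. antipode H a \<otimes>\<^bsub>H\<^esub> qalpha H \<otimes>\<^bsub>H\<^esub> b)) (comul H h)
          = counit H h \<odot>\<^bsub>H\<^esub> qalpha H"
    and antipode_beta:
      "h \<in> carrier H \<Longrightarrow>
        lin_ext K H (leg2 (\<lambda>a b. a \<otimes>\<^bsub>H\<^esub> qbeta H \<otimes>\<^bsub>H\<^esub> antipode H b)) (comul H h)
          = counit H h \<odot>\<^bsub>H\<^esub> qbeta H"
    and antipode_reassoc:
      "lin_ext K H (leg3 (\<lambda>a b c. a \<otimes>\<^bsub>H\<^esub> qbeta H \<otimes>\<^bsub>H\<^esub> antipode H b \<otimes>\<^bsub>H\<^esub> qalpha H \<otimes>\<^bsub>H\<^esub> c)) (reassoc H)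
        = \<one>\<^bsub>H\<^esub>"
    and antipode_reassoc_inv:
      "lin_ext K H (leg3 (\<lambda>a b c.
          antipode H a \<otimes>\<^bsub>H\<^esub> qalpha H \<otimes>\<^bsub>H\<^esub> b \<otimes>\<^bsub>H\<^esub> qbeta H \<otimes>\<^bsub>H\<^esub> antipode H c)) (tinv K H 3 (reassoc H))
        = \<one>\<^bsub>H\<^esub>"

locale quasitriangular_quasi_hopf_algebra = quasi_hopf_algebra K H
  for K :: "'k ring" (structure) and H :: "('k, 'h) quasi_hopf" (structure)
    and R :: "('h list \<Rightarrow> 'k) set" +
  assumes R_unit: "R \<in> Units (tpow K H 2)"
    and R_comul:
      "h \<in> carrier H \<Longrightarrow>
        place K H 2 [2, 1] (comul H h)
          = R \<otimes>\<^bsub>tpow K H 2\<^esub> comul H h \<otimes>\<^bsub>tpow K H 2\<^esub> tinv K H 2 R"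
    and R_hexagon_right:
      "comul_at K H 2 2 R
        = tinv K H 3 (place K H 3 [2, 3, 1] (reassoc H))
            \<otimes>\<^bsub>tpow K H 3\<^esub> place K H 3 [1, 3] R
            \<otimes>\<^bsub>tpow K H 3\<^esub> place K H 3 [2, 1, 3] (reassoc H)
            \<otimes>\<^bsub>tpow K H 3\<^esub> place K H 3 [1, 2] R
            \<otimes>\<^bsub>tpow K H 3\<^esub> tinv K H 3 (place K H 3 [1, 2, 3] (reassoc H))"
    and R_hexagon_left:
      "comul_at K H 2 1 R
        = place K H 3 [3, 1, 2] (reassoc H)
            \<otimes>\<^bsub>tpow K H 3\<^esub> place K H 3 [1, 3] R
            \<otimes>\<^bsub>tpow K H 3\<^esub> tinv K H 3 (place K H 3 [1, 3, 2] (reassoc H))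
            \<otimes>\<^bsub>tpow K H 3\<^esub> place K H 3 [2, 3] R
            \<otimes>\<^bsub>tpow K H 3\<^esub> place K H 3 [1, 2, 3] (reassoc H)"

subsection \<open>Cochain twists\<close>

definition cochain_twist :: "'k ring \<Rightarrow> ('k, 'h) quasi_hopf \<Rightarrow> ('h list \<Rightarrow> 'k) set \<Rightarrow> bool" where
  "cochain_twist K H F \<longleftrightarrow>
     F \<in> Units (tpow K H 2) \<and>
     lin_ext K H (leg2 (\<lambda>a b. counit H a \<odot>\<^bsub>H\<^esub> b)) F = \<one>\<^bsub>H\<^esub> \<and>
     lin_ext K H (leg2 (\<lambda>a b. counit H b \<odot>\<^bsub>H\<^esub> a)) F = \<one>\<^bsub>H\<^esub>"

definition twist :: "'k ring \<Rightarrow> ('k, 'h) quasi_hopf \<Rightarrow> ('h list \<Rightarrow> 'k) set \<Rightarrow> ('k, 'h) quasi_hopf" where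
  "twist K H F = H
     \<lparr>comul := (\<lambda>h. F \<otimes>\<^bsub>tpow K H 2\<^esub> comul H h \<otimes>\<^bsub>tpow K H 2\<^esub> tinv K H 2 F),
      reassoc := place K H 3 [2, 3] F \<otimes>\<^bsub>tpow K H 3\<^esub> comul_at K H 2 2 F \<otimes>\<^bsub>tpow K H 3\<^esub> reassoc H
                   \<otimes>\<^bsub>tpow K H 3\<^esub> comul_at K H 2 1 (tinv K H 2 F)
                   \<otimes>\<^bsub>tpow K H 3\<^esub> place K H 3 [1, 2] (tinv K H 2 F),
      qalpha := lin_ext K H (leg2 (\<lambda>a b. antipode H a \<otimes>\<^bsub>H\<^esub> qalpha H \<otimes>\<^bsub>H\<^esub> b)) (tinv K H 2 F),
      qbeta := lin_ext K H (leg2 (\<lambda>a b. a \<otimes>\<^bsub>H\<^esub> qbeta H \<otimes>\<^bsub>H\<^esub> antipode H b)) F\<rparr>"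

definition twist_R ::
  "'k ring \<Rightarrow> ('k, 'h) quasi_hopf \<Rightarrow> ('h list \<Rightarrow> 'k) set \<Rightarrow> ('h list \<Rightarrow> 'k) set \<Rightarrow> ('h list \<Rightarrow> 'k) set" where
  "twist_R K H R F = place K H 2 [2, 1] F \<otimes>\<^bsub>tpow K H 2\<^esub> R \<otimes>\<^bsub>tpow K H 2\<^esub> tinv K H 2 F"

section \<open>The braided closed monoidal category of left modules\<close>

record ('k, 'h, 'v) hmod = "('k, 'v) module" +
  act :: "'h \<Rightarrow> 'v \<Rightarrow> 'v"

locale left_module = H: unital_algebra K H + V: module K V
  for K :: "'k ring" and H :: "('k, 'h) quasi_hopf" and V :: "('k, 'h, 'v) hmod" +
  assumes act_linear: "h \<in> carrier H \<Longrightarrow> linear_map K V V (act V h)"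
    and act_add:
      "\<lbrakk>g \<in> carrier H; h \<in> carrier H; v \<in> carrier V\<rbrakk>
        \<Longrightarrow> act V (g \<oplus>\<^bsub>H\<^esub> h) v = act V g v \<oplus>\<^bsub>V\<^esub> act V h v"
    and act_smult:
      "\<lbrakk>r \<in> carrier K; h \<in> carrier H; v \<in> carrier V\<rbrakk>
        \<Longrightarrow> act V (r \<odot>\<^bsub>H\<^esub> h) v = r \<odot>\<^bsub>V\<^esub> act V h v"
    and act_one: "v \<in> carrier V \<Longrightarrow> act V \<one>\<^bsub>H\<^esub> v = v"
    and act_mult:
      "\<lbrakk>g \<in> carrier H; h \<in> carrier H; v \<in> carrier V\<rbrakk>
        \<Longrightarrow> act V (g \<otimes>\<^bsub>H\<^esub> h) v = act V g (act V h v)"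

text \<open>Morphisms are extensional functions, so that equality of morphisms is equality in HOL.\<close>

definition hmod_hom ::
  "'k ring \<Rightarrow> ('k, 'h) quasi_hopf \<Rightarrow> ('k, 'h, 'v) hmod \<Rightarrow> ('k, 'h, 'w) hmod \<Rightarrow> ('v \<Rightarrow> 'w) set" where
  "hmod_hom K H V W =
     {f \<in> extensional (carrier V). linear_map K V W f \<and>
        (\<forall>h\<in>carrier H. \<forall>v\<in>carrier V. f (act V h v) = act W h (f v))}"

definition hmod_iso ::
  "'k ring \<Rightarrow> ('k, 'h) quasi_hopf \<Rightarrow> ('k, 'h, 'v) hmod \<Rightarrow> ('k, 'h, 'w) hmod \<Rightarrow> ('v \<Rightarrow> 'w) \<Rightarrow> bool" where
  "hmod_iso K H V W f \<longleftrightarrow>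
     left_module K H V \<and> left_module K H W \<and> f \<in> hmod_hom K H V W \<and>
     (\<exists>g\<in>hmod_hom K H W V. (\<forall>v\<in>carrier V. g (f v) = v) \<and> (\<forall>w\<in>carrier W. f (g w) = w))"

definition with_act :: "('k, 'v) module \<Rightarrow> ('h \<Rightarrow> 'v \<Rightarrow> 'v) \<Rightarrow> ('k, 'h, 'v) hmod" where
  "with_act M a =
     \<lparr>carrier = carrier M, mult = mult M, one = one M, zero = zero M, add = add M,
      smult = smult M, act = a\<rparr>"

subsection \<open>Monoidal structure\<close>

definition hmod_tensor ::
  "'k ring \<Rightarrow> ('k, 'h) quasi_hopf \<Rightarrow> ('k, 'h, 'v) hmod \<Rightarrow> ('k, 'h, 'w) hmod
    \<Rightarrow> ('k, 'h, ('v \<times> 'w \<Rightarrow> 'k) set) hmod" where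
  "hmod_tensor K H V W =
     with_act (tensor K V W)
       (\<lambda>h. lin_ext K (tensor K V W) (\<lambda>(v, w).
          lin_ext K (tensor K V W) (leg2 (\<lambda>a b. tens K V W (act V a v) (act W b w))) (comul H h)))"

definition hmod_unit :: "'k ring \<Rightarrow> ('k, 'h) quasi_hopf \<Rightarrow> ('k, 'h, 'k) hmod" where
  "hmod_unit K H =
     \<lparr>carrier = carrier K, mult = mult K, one = one K, zero = zero K, add = add K,
      smult = mult K, act = (\<lambda>h r. counit H h \<otimes>\<^bsub>K\<^esub> r)\<rparr>"

definition hmod_assoc ::
  "'k ring \<Rightarrow> ('k, 'h) quasi_hopf \<Rightarrow> ('k, 'h, 'v) hmod \<Rightarrow> ('k, 'h, 'w) hmod \<Rightarrow> ('k, 'h, 'x) hmod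
    \<Rightarrow> (('v \<times> 'w \<Rightarrow> 'k) set \<times> 'x \<Rightarrow> 'k) set \<Rightarrow> ('v \<times> ('w \<times> 'x \<Rightarrow> 'k) set \<Rightarrow> 'k) set" where
  "hmod_assoc K H V W X =
     (let T = tensor K V (tensor K W X) in
      (\<lambda>t\<in>carrier (tensor K (tensor K V W) X).
        lin_ext K T (\<lambda>(s, x). lin_ext K T (\<lambda>(v, w).
          lin_ext K T (leg3 (\<lambda>a b c.
              tens K V (tensor K W X) (act V a v) (tens K W X (act W b w) (act X c x))))
            (reassoc H)) s) t))"

definition hmod_lunit ::
  "'k ring \<Rightarrow> ('k, 'h) quasi_hopf \<Rightarrow> ('k, 'h, 'v) hmod \<Rightarrow> ('k \<times> 'v \<Rightarrow> 'k) set \<Rightarrow> 'v" where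
  "hmod_lunit K H V =
     (\<lambda>t\<in>carrier (tensor K (hmod_unit K H) V). lin_ext K V (\<lambda>(r, v). r \<odot>\<^bsub>V\<^esub> v) t)"

definition hmod_runit ::
  "'k ring \<Rightarrow> ('k, 'h) quasi_hopf \<Rightarrow> ('k, 'h, 'v) hmod \<Rightarrow> ('v \<times> 'k \<Rightarrow> 'k) set \<Rightarrow> 'v" where
  "hmod_runit K H V =
     (\<lambda>t\<in>carrier (tensor K V (hmod_unit K H)). lin_ext K V (\<lambda>(v, r). r \<odot>\<^bsub>V\<^esub> v) t)"

subsection \<open>Internal homs\<close>

definition hom_module ::
  "'k ring \<Rightarrow> ('k, 'v, 'm) module_scheme \<Rightarrow> ('k, 'w, 'n) module_scheme \<Rightarrow> ('k, 'v \<Rightarrow> 'w) module" where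
  "hom_module K V W =
     \<lparr>carrier = {L \<in> extensional (carrier V). linear_map K V W L},
      mult = undefined, one = undefined,
      zero = (\<lambda>v\<in>carrier V. \<zero>\<^bsub>W\<^esub>), add = (\<lambda>L L'. \<lambda>v\<in>carrier V. L v \<oplus>\<^bsub>W\<^esub> L' v),
      smult = (\<lambda>r L. \<lambda>v\<in>carrier V. r \<odot>\<^bsub>W\<^esub> L v)\<rparr>"

text \<open>For \<open>X = X\<^sub>1 \<otimes> X\<^sub>2\<close> in the second tensor power of \<open>H\<close>, the map sending \<open>L\<close> to
  \<open>(X\<^sub>1 \<rhd> \<cdot>) \<circ> L \<circ> (S(X\<^sub>2) \<rhd> \<cdot>)\<close>.\<close>

definition hom_conj ::
  "'k ring \<Rightarrow> ('k, 'h) quasi_hopf \<Rightarrow> ('k, 'h, 'v) hmod \<Rightarrow> ('k, 'h, 'w) hmod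
    \<Rightarrow> ('h list \<Rightarrow> 'k) set \<Rightarrow> ('v \<Rightarrow> 'w) \<Rightarrow> 'v \<Rightarrow> 'w" where
  "hom_conj K H V W X L =
     lin_ext K (hom_module K V W)
       (leg2 (\<lambda>a b. \<lambda>v\<in>carrier V. act W a (L (act V (antipode H b) v)))) X"

definition hmod_ihom ::
  "'k ring \<Rightarrow> ('k, 'h) quasi_hopf \<Rightarrow> ('k, 'h, 'v) hmod \<Rightarrow> ('k, 'h, 'w) hmod \<Rightarrow> ('k, 'h, 'v \<Rightarrow> 'w) hmod" where
  "hmod_ihom K H V W = with_act (hom_module K V W) (\<lambda>h. hom_conj K H V W (comul H h))"

definition hmod_ihom_map ::
  "'k ring \<Rightarrow> ('k, 'h, 'v) hmod \<Rightarrow> ('k, 'h, 'v2) hmod \<Rightarrow> ('k, 'h, 'w) hmod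
    \<Rightarrow> ('v2 \<Rightarrow> 'v) \<Rightarrow> ('w \<Rightarrow> 'w2) \<Rightarrow> ('v \<Rightarrow> 'w) \<Rightarrow> 'v2 \<Rightarrow> 'w2" where
  "hmod_ihom_map K V V' W f g =
     (\<lambda>L\<in>carrier (hom_module K V W). \<lambda>v\<in>carrier V'. g (L (f v)))"

text \<open>Evaluation \<open>L \<otimes> v \<mapsto> \<phi>\<^sub>1 \<rhd> L (S(\<phi>\<^sub>2) \<alpha> \<phi>\<^sub>3 \<rhd> v)\<close>, the counit of the adjunction between
  tensoring with \<open>V\<close> on the right and the internal hom out of \<open>V\<close>.\<close>

definition hmod_eval ::
  "'k ring \<Rightarrow> ('k, 'h) quasi_hopf \<Rightarrow> ('k, 'h, 'v) hmod \<Rightarrow> ('k, 'h, 'w) hmod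
    \<Rightarrow> (('v \<Rightarrow> 'w) \<times> 'v \<Rightarrow> 'k) set \<Rightarrow> 'w" where
  "hmod_eval K H V W =
     (\<lambda>t\<in>carrier (tensor K (hom_module K V W) V).
        lin_ext K W (\<lambda>(L, v).
          lin_ext K W (leg3 (\<lambda>a b c.
              act W a (L (act V (antipode H b \<otimes>\<^bsub>H\<^esub> qalpha H \<otimes>\<^bsub>H\<^esub> c) v))))
            (reassoc H)) t)"

subsection \<open>Braiding\<close>

definition hmod_braid ::
  "'k ring \<Rightarrow> ('h list \<Rightarrow> 'k) set \<Rightarrow> ('k, 'h, 'v) hmod \<Rightarrow> ('k, 'h, 'w) hmod
    \<Rightarrow> ('v \<times> 'w \<Rightarrow> 'k) set \<Rightarrow> ('w \<times> 'v \<Rightarrow> 'k) set" where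
  "hmod_braid K R V W =
     (\<lambda>t\<in>carrier (tensor K V W).
        lin_ext K (tensor K W V) (\<lambda>(v, w).
          lin_ext K (tensor K W V) (leg2 (\<lambda>a b. tens K W V (act W b w) (act V a v))) R) t)"

section \<open>The twisting functor\<close>

definition tw_obj :: "('k, 'h, 'v) hmod \<Rightarrow> ('k, 'h, 'v) hmod" where
  "tw_obj V = V"

definition tw_mor :: "('v \<Rightarrow> 'w) \<Rightarrow> 'v \<Rightarrow> 'w" where
  "tw_mor f = f"

definition tw_phi ::
  "'k ring \<Rightarrow> ('k, 'h) quasi_hopf \<Rightarrow> ('h list \<Rightarrow> 'k) set \<Rightarrow> ('k, 'h, 'v) hmod \<Rightarrow> ('k, 'h, 'w) hmod
    \<Rightarrow> ('v \<times> 'w \<Rightarrow> 'k) set \<Rightarrow> ('v \<times> 'w \<Rightarrow> 'k) set" where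
  "tw_phi K H F V W =
     (\<lambda>t\<in>carrier (tensor K V W).
        lin_ext K (tensor K V W) (\<lambda>(v, w).
          lin_ext K (tensor K V W) (leg2 (\<lambda>a b. tens K V W (act V a v) (act W b w)))
            (tinv K H 2 F)) t)"

definition tw_psi :: "'k ring \<Rightarrow> 'k \<Rightarrow> 'k" where
  "tw_psi K = (\<lambda>r\<in>carrier K. r)"

definition tw_gamma ::
  "'k ring \<Rightarrow> ('k, 'h) quasi_hopf \<Rightarrow> ('h list \<Rightarrow> 'k) set \<Rightarrow> ('k, 'h, 'v) hmod \<Rightarrow> ('k, 'h, 'w) hmod
    \<Rightarrow> ('v \<Rightarrow> 'w) \<Rightarrow> 'v \<Rightarrow> 'w" where
  "tw_gamma K H F V W =
     (\<lambda>L\<in>carrier (hom_module K V W). hom_conj K H V W (tinv K H 2 F) L)"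

text \<open>A HOL definition cannot quantify over all carrier types at once. The following predicates
  therefore take the carrier types of the modules involved as parameters and quantify over all
  modules on these types; the full notion is their validity for all types.\<close>

definition twist_equivalence ::
  "'k ring \<Rightarrow> ('k, 'h) quasi_hopf \<Rightarrow> ('h list \<Rightarrow> 'k) set \<Rightarrow> 'u itself \<Rightarrow> 'v itself \<Rightarrow> 'w itself \<Rightarrow> bool" where
  "twist_equivalence K H F tu tv tw \<longleftrightarrow>
     (let H' = twist K H F in
      (\<forall>V :: ('k, 'h, 'u) hmod. left_module K H V \<longrightarrow>
         left_module K H' (tw_obj V) \<and>
         tw_mor (\<lambda>v\<in>carrier V. v) = (\<lambda>v\<in>carrier (tw_obj V). v)) \<and>
      (\<forall>(U :: ('k, 'h, 'u) hmod) (V :: ('k, 'h, 'v) hmod) (W :: ('k, 'h, 'w) hmod).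
         left_module K H U \<and> left_module K H V \<and> left_module K H W \<longrightarrow>
         (\<forall>f\<in>hmod_hom K H U V. \<forall>g\<in>hmod_hom K H V W.
            tw_mor (compose (carrier U) g f) = compose (carrier (tw_obj U)) (tw_mor g) (tw_mor f))) \<and>
      (\<forall>(V :: ('k, 'h, 'u) hmod) (W :: ('k, 'h, 'v) hmod).
         left_module K H V \<and> left_module K H W \<longrightarrow>
         bij_betw tw_mor (hmod_hom K H V W) (hmod_hom K H' (tw_obj V) (tw_obj W))) \<and>
      (\<forall>W :: ('k, 'h, 'u) hmod. left_module K H' W \<longrightarrow>
         (\<exists>V f. left_module K H (V :: ('k, 'h, 'u) hmod) \<and> hmod_iso K H' (tw_obj V) W f)))"

definition twist_monoidal ::
  "'k ring \<Rightarrow> ('k, 'h) quasi_hopf \<Rightarrow> ('h list \<Rightarrow> 'k) set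
    \<Rightarrow> 'u itself \<Rightarrow> 'v itself \<Rightarrow> 'w itself \<Rightarrow> 'x itself \<Rightarrow> bool" where
  "twist_monoidal K H F tu tv tw tx \<longleftrightarrow>
     (let H' = twist K H F in
      \<comment> \<open>the coherence maps \<open>tw_phi\<close> form a natural isomorphism\<close>
      (\<forall>(V :: ('k, 'h, 'u) hmod) (W :: ('k, 'h, 'v) hmod).
         left_module K H V \<and> left_module K H W \<longrightarrow>
         hmod_iso K H' (hmod_tensor K H' (tw_obj V) (tw_obj W)) (tw_obj (hmod_tensor K H V W))
           (tw_phi K H F V W)) \<and>
      (\<forall>(V :: ('k, 'h, 'u) hmod) (V' :: ('k, 'h, 'v) hmod)
          (W :: ('k, 'h, 'w) hmod) (W' :: ('k, 'h, 'x) hmod).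
         left_module K H V \<and> left_module K H V' \<and> left_module K H W \<and> left_module K H W' \<longrightarrow>
         (\<forall>f\<in>hmod_hom K H V V'. \<forall>g\<in>hmod_hom K H W W'.
            \<forall>t\<in>carrier (hmod_tensor K H' (tw_obj V) (tw_obj W)).
              tw_phi K H F V' W'
                  (tensor_map K (tw_obj V) (tw_obj W) (tw_obj V') (tw_obj W') (tw_mor f) (tw_mor g) t)
                = tw_mor (tensor_map K V W V' W' f g) (tw_phi K H F V W t))) \<and>
      \<comment> \<open>\<open>tw_psi\<close> is an isomorphism\<close>
      hmod_iso K H' (hmod_unit K H') (tw_obj (hmod_unit K H)) (tw_psi K) \<and>
      \<comment> \<open>coherence with the associators\<close>
      (\<forall>(V :: ('k, 'h, 'u) hmod) (W :: ('k, 'h, 'v) hmod) (X :: ('k, 'h, 'w) hmod).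
         left_module K H V \<and> left_module K H W \<and> left_module K H X \<longrightarrow>
         (\<forall>t\<in>carrier (hmod_tensor K H' (hmod_tensor K H' (tw_obj V) (tw_obj W)) (tw_obj X)).
            tw_phi K H F V (hmod_tensor K H W X)
                (tensor_map K (tw_obj V) (hmod_tensor K H' (tw_obj W) (tw_obj X))
                    (tw_obj V) (tw_obj (hmod_tensor K H W X))
                    (\<lambda>v\<in>carrier (tw_obj V). v) (tw_phi K H F W X)
                  (hmod_assoc K H' (tw_obj V) (tw_obj W) (tw_obj X) t))
              = tw_mor (hmod_assoc K H V W X)
                  (tw_phi K H F (hmod_tensor K H V W) X
                    (tensor_map K (hmod_tensor K H' (tw_obj V) (tw_obj W)) (tw_obj X)
                        (tw_obj (hmod_tensor K H V W)) (tw_obj X)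
                        (tw_phi K H F V W) (\<lambda>x\<in>carrier (tw_obj X). x) t)))) \<and>
      \<comment> \<open>coherence with the unitors\<close>
      (\<forall>V :: ('k, 'h, 'u) hmod. left_module K H V \<longrightarrow>
         (\<forall>t\<in>carrier (hmod_tensor K H' (hmod_unit K H') (tw_obj V)).
            tw_mor (hmod_lunit K H V)
                (tw_phi K H F (hmod_unit K H) V
                  (tensor_map K (hmod_unit K H') (tw_obj V) (tw_obj (hmod_unit K H)) (tw_obj V)
                     (tw_psi K) (\<lambda>v\<in>carrier (tw_obj V). v) t))
              = hmod_lunit K H' (tw_obj V) t) \<and>
         (\<forall>t\<in>carrier (hmod_tensor K H' (tw_obj V) (hmod_unit K H')).
            tw_mor (hmod_runit K H V)
                (tw_phi K H F V (hmod_unit K H)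
                  (tensor_map K (tw_obj V) (hmod_unit K H') (tw_obj V) (tw_obj (hmod_unit K H))
                     (\<lambda>v\<in>carrier (tw_obj V). v) (tw_psi K) t))
              = hmod_runit K H' (tw_obj V) t)))"

definition twist_closed ::
  "'k ring \<Rightarrow> ('k, 'h) quasi_hopf \<Rightarrow> ('h list \<Rightarrow> 'k) set
    \<Rightarrow> 'u itself \<Rightarrow> 'v itself \<Rightarrow> 'w itself \<Rightarrow> 'x itself \<Rightarrow> bool" where
  "twist_closed K H F tu tv tw tx \<longleftrightarrow>
     (let H' = twist K H F in
      \<comment> \<open>the coherence maps \<open>tw_gamma\<close> form a natural isomorphism\<close>
      (\<forall>(V :: ('k, 'h, 'u) hmod) (W :: ('k, 'h, 'v) hmod).
         left_module K H V \<and> left_module K H W \<longrightarrow>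
         hmod_iso K H' (hmod_ihom K H' (tw_obj V) (tw_obj W)) (tw_obj (hmod_ihom K H V W))
           (tw_gamma K H F V W)) \<and>
      (\<forall>(V :: ('k, 'h, 'u) hmod) (V' :: ('k, 'h, 'v) hmod)
          (W :: ('k, 'h, 'w) hmod) (W' :: ('k, 'h, 'x) hmod).
         left_module K H V \<and> left_module K H V' \<and> left_module K H W \<and> left_module K H W' \<longrightarrow>
         (\<forall>f\<in>hmod_hom K H V' V. \<forall>g\<in>hmod_hom K H W W'.
            \<forall>L\<in>carrier (hmod_ihom K H' (tw_obj V) (tw_obj W)).
              tw_gamma K H F V' W'
                  (hmod_ihom_map K (tw_obj V) (tw_obj V') (tw_obj W) (tw_mor f) (tw_mor g) L)
                = tw_mor (hmod_ihom_map K V V' W f g) (tw_gamma K H F V W L))) \<and>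
      \<comment> \<open>coherence with the evaluations\<close>
      (\<forall>(V :: ('k, 'h, 'u) hmod) (W :: ('k, 'h, 'v) hmod).
         left_module K H V \<and> left_module K H W \<longrightarrow>
         (\<forall>t\<in>carrier (hmod_tensor K H' (hmod_ihom K H' (tw_obj V) (tw_obj W)) (tw_obj V)).
            tw_mor (hmod_eval K H V W)
                (tw_phi K H F (hmod_ihom K H V W) V
                  (tensor_map K (hmod_ihom K H' (tw_obj V) (tw_obj W)) (tw_obj V)
                     (tw_obj (hmod_ihom K H V W)) (tw_obj V)
                     (tw_gamma K H F V W) (\<lambda>v\<in>carrier (tw_obj V). v) t))
              = hmod_eval K H' (tw_obj V) (tw_obj W) t)))"

text \<open>Here \<open>R'\<close> is the R-matrix of the twisted quasi-Hopf algebra.\<close>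

definition twist_braided ::
  "'k ring \<Rightarrow> ('k, 'h) quasi_hopf \<Rightarrow> ('h list \<Rightarrow> 'k) set \<Rightarrow> ('h list \<Rightarrow> 'k) set \<Rightarrow> ('h list \<Rightarrow> 'k) set
    \<Rightarrow> 'u itself \<Rightarrow> 'v itself \<Rightarrow> bool" where
  "twist_braided K H R F R' tu tv \<longleftrightarrow>
     (\<forall>(V :: ('k, 'h, 'u) hmod) (W :: ('k, 'h, 'v) hmod).
        left_module K H V \<and> left_module K H W \<longrightarrow>
        (\<forall>t\<in>carrier (hmod_tensor K (twist K H F) (tw_obj V) (tw_obj W)).
           tw_phi K H F W V (hmod_braid K R' (tw_obj V) (tw_obj W) t)
             = tw_mor (hmod_braid K R V W) (tw_phi K H F V W t)))"

definition twist_braided_closed_monoidal_equivalence ::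
  "'k ring \<Rightarrow> ('k, 'h) quasi_hopf \<Rightarrow> ('h list \<Rightarrow> 'k) set \<Rightarrow> ('h list \<Rightarrow> 'k) set \<Rightarrow> ('h list \<Rightarrow> 'k) set
    \<Rightarrow> 'u itself \<Rightarrow> 'v itself \<Rightarrow> 'w itself \<Rightarrow> 'x itself \<Rightarrow> bool" where
  "twist_braided_closed_monoidal_equivalence K H R F R' tu tv tw tx \<longleftrightarrow>
     twist_equivalence K H F tu tv tw \<and>
     twist_monoidal K H F tu tv tw tx \<and>
     twist_closed K H F tu tv tw tx \<and>
     twist_braided K H R F R' tu tv"

end

theory Submission
  imports Defs
begin

text \<open>
  Every piece of structure on \<open>H\<close> and on its modules is an element of some tensor power of \<open>H\<close>
  (\<open>\<Delta>(h)\<close>, \<open>\<phi>\<close>, \<open>R\<close>, \<open>F\<close>), or the image of such an element under a linear map. All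
  assertions reduce to identities between products in the tensor powers, in which \<open>F\<close> meets
  \<open>F\<^sup>-\<^sup>1\<close> once the matching axiom of \<open>H\<close> has been applied.

  The reduction rests on the universal property of a module given by generators and relations
  (\<open>presented_ext\<close>, \<open>lin_ext_linear\<close>, \<open>lin_ext_generator\<close>): a map defined on pure tensors by a
  multilinear expression extends linearly with the expected values, and two linear maps that
  agree on pure tensors are equal. Identities that are linear in each variable may therefore be
  checked on pure tensors, one variable after the other; the collection \<open>linear_intros\<close>
  discharges the linearity conditions.

  Write \<open>T n\<close> for the \<open>n\<close>-th tensor power, \<open>P n is\<close> for the placement of legs and \<open>D n i\<close> for the
  coproduct on the \<open>i\<close>-th leg. These are algebra homomorphisms (\<open>place_alg_hom\<close>,
  \<open>comul_at_alg_hom\<close>), hence they preserve \<open>F F\<^sup>-\<^sup>1 = 1\<close>. Applying the twisted coproduct to a leg is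
  applying \<open>\<Delta>\<close> and then conjugating by \<open>F\<close> on the two new legs (\<open>comul_at_twist\<close>). Substituting
  this into the axioms for \<open>H\<^sub>F\<close> leaves words in placed copies of \<open>F\<close>, \<open>\<phi>\<close> and \<open>R\<close>:
  \<^item> The pentagon follows because \<open>\<phi>\<close> intertwines the two iterated coproducts of a single leg also in
    the presence of a further leg (\<open>quasi_coassoc_1\<close>, \<open>quasi_coassoc_2\<close>) and because elements on
    disjoint legs commute.
  \<^item> For the quasi-antipode, the axioms for \<open>\<alpha>\<close> and \<open>\<beta>\<close> turn each factor \<open>(id \<otimes> \<Delta>)(F)\<close> or
    \<open>(\<Delta> \<otimes> id)(F\<^sup>-\<^sup>1)\<close> of \<open>\<phi>\<^sub>F\<close> into a counit of \<open>F\<close>, that is into \<open>1\<close>, while the two outer factors of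
    \<open>\<phi>\<^sub>F\<close> change \<open>\<alpha>\<^sub>F\<close> and \<open>\<beta>\<^sub>F\<close> back into \<open>\<alpha>\<close> and \<open>\<beta>\<close>.
  \<^item> The hexagons follow because \<open>R\<close> intertwines \<open>\<Delta>\<close> with its opposite, also next to a bystander leg
    (\<open>R_comul_at_31\<close> and its three companions).

  On the side of modules, the algebra \<open>T 2\<close> acts on \<open>V \<otimes> W\<close> (\<open>tensor_act\<close>) and on \<open>Hom(V, W)\<close>
  (\<open>hom_conj\<close>). The coherence maps \<open>\<phi>\<^sub>V\<^sub>,\<^sub>W\<close> and \<open>\<gamma>\<^sub>V\<^sub>,\<^sub>W\<close> are the actions of \<open>F\<^sup>-\<^sup>1\<close>; they are invertible with
  inverse the action of \<open>F\<close>, and equivariant because \<open>F\<^sup>-\<^sup>1 \<Delta>\<^sub>F(h) = \<Delta>(h) F\<^sup>-\<^sup>1\<close>. Associator, evaluation and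
  braiding belong to families of maps that depend linearly on an element of \<open>T 3\<close> or \<open>T 2\<close>
  (\<open>assoc_act\<close>, \<open>eval_act\<close>, \<open>flip_act\<close>), and composing a member of such a family with an action
  multiplies this element. Each coherence diagram is thereby an equation between
  elements, and that equation is the definition of \<open>\<phi>\<^sub>F\<close>, \<open>\<alpha>\<^sub>F\<close> or \<open>R\<^sub>F\<close> with some factors \<open>F\<close> moved to the
  other side; for the braiding it reads \<open>F\<^sub>2\<^sub>1\<^sup>-\<^sup>1 R\<^sub>F = R F\<^sup>-\<^sup>1\<close>.
\<close>

section \<open>Linear maps\<close>

named_theorems linear_intros

lemma linear_mapI:
  assumes "\<And>x. x \<in> carrier V \<Longrightarrow> f x \<in> carrier W"
    and "\<And>x y. \<lbrakk>x \<in> carrier V; y \<in> carrier V\<rbrakk> \<Longrightarrow> f (x \<oplus>\<^bsub>V\<^esub> y) = f x \<oplus>\<^bsub>W\<^esub> f y"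
    and "\<And>r x. \<lbrakk>r \<in> carrier K; x \<in> carrier V\<rbrakk> \<Longrightarrow> f (r \<odot>\<^bsub>V\<^esub> x) = r \<odot>\<^bsub>W\<^esub> f x"
  shows "linear_map K V W f"
  using assms by (auto simp: linear_map_def)

lemma
  assumes "linear_map K V W f"
  shows linear_map_closed: "x \<in> carrier V \<Longrightarrow> f x \<in> carrier W"
    and linear_map_add: "\<lbrakk>x \<in> carrier V; y \<in> carrier V\<rbrakk> \<Longrightarrow> f (x \<oplus>\<^bsub>V\<^esub> y) = f x \<oplus>\<^bsub>W\<^esub> f y"
    and linear_map_smult: "\<lbrakk>r \<in> carrier K; x \<in> carrier V\<rbrakk> \<Longrightarrow> f (r \<odot>\<^bsub>V\<^esub> x) = r \<odot>\<^bsub>W\<^esub> f x"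
  using assms by (auto simp: linear_map_def)

lemma linear_map_id [linear_intros]: "linear_map K V V (\<lambda>v. v)"
  by (auto simp: linear_map_def)

lemma linear_map_comp:
  "\<lbrakk>linear_map K W X g; linear_map K V W f\<rbrakk> \<Longrightarrow> linear_map K V X (\<lambda>v. g (f v))"
  by (auto simp: linear_map_def Pi_iff)

lemma linear_map_cong:
  assumes "module K V" "\<And>v. v \<in> carrier V \<Longrightarrow> f v = g v"
  shows "linear_map K V W f \<longleftrightarrow> linear_map K V W g"
proof -
  interpret V: module K V by fact
  show ?thesis using assms(2) by (auto simp: linear_map_def Pi_iff)
qed

lemma linear_map_zero:
  assumes "module K V" "module K W" "linear_map K V W f"
  shows "f \<zero>\<^bsub>V\<^esub> = \<zero>\<^bsub>W\<^esub>"
proof -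
  interpret V: module K V by fact
  interpret W: module K W by fact
  have "f (\<zero>\<^bsub>K\<^esub> \<odot>\<^bsub>V\<^esub> \<zero>\<^bsub>V\<^esub>) = \<zero>\<^bsub>K\<^esub> \<odot>\<^bsub>W\<^esub> f \<zero>\<^bsub>V\<^esub>"
    using assms(3) by (intro linear_map_smult) auto
  then show ?thesis using linear_map_closed[OF assms(3), of "\<zero>\<^bsub>V\<^esub>"] by simp
qed

lemma linear_map_minus:
  assumes "module K V" "module K W" "linear_map K V W f" "x \<in> carrier V" "y \<in> carrier V"
  shows "f (x \<ominus>\<^bsub>V\<^esub> y) = f x \<ominus>\<^bsub>W\<^esub> f y"
proof -
  interpret V: module K V by fact
  interpret W: module K W by fact
  have "f (x \<ominus>\<^bsub>V\<^esub> y) = f (x \<oplus>\<^bsub>V\<^esub> (\<ominus>\<^bsub>K\<^esub> \<one>\<^bsub>K\<^esub>) \<odot>\<^bsub>V\<^esub> y)"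
    using assms(4,5) by (simp add: V.M.minus_eq V.smult_l_minus)
  also have "\<dots> = f x \<oplus>\<^bsub>W\<^esub> (\<ominus>\<^bsub>K\<^esub> \<one>\<^bsub>K\<^esub>) \<odot>\<^bsub>W\<^esub> f y"
    using assms(4,5) by (simp add: linear_map_add[OF assms(3)] linear_map_smult[OF assms(3)])
  also have "\<dots> = f x \<ominus>\<^bsub>W\<^esub> f y"
    using assms(4,5) linear_map_closed[OF assms(3)] by (simp add: W.M.minus_eq W.smult_l_minus)
  finally show ?thesis .
qed

section \<open>Modules given by generators and relations\<close>

locale base_ring = cring K for K :: "'k ring" (structure)

locale base_module = module K M for K :: "'k ring" (structure) and M :: "('k, 'v) module" (structure)

lemma free_module_simps [simp]:
  "carrier (free_module K B) =
     {f. range f \<subseteq> carrier K \<and> (\<forall>b. b \<notin> B \<longrightarrow> f b = \<zero>\<^bsub>K\<^esub>) \<and> finite {b. f b \<noteq> \<zero>\<^bsub>K\<^esub>}}"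
  "\<zero>\<^bsub>free_module K B\<^esub> = (\<lambda>_. \<zero>\<^bsub>K\<^esub>)"
  "f \<oplus>\<^bsub>free_module K B\<^esub> g = (\<lambda>b. f b \<oplus>\<^bsub>K\<^esub> g b)"
  "r \<odot>\<^bsub>free_module K B\<^esub> f = (\<lambda>b. r \<otimes>\<^bsub>K\<^esub> f b)"
  by (simp_all add: free_module_def)

lemma (in base_ring) free_module_module: "module K (free_module K B)"
proof (rule moduleI)
  show "abelian_group (free_module K B)"
  proof (rule abelian_groupI)
    fix f g assume fg: "f \<in> carrier (free_module K B)" "g \<in> carrier (free_module K B)"
    have "finite {b. f b \<oplus> g b \<noteq> \<zero>}"
      by (rule finite_subset[of _ "{b. f b \<noteq> \<zero>} \<union> {b. g b \<noteq> \<zero>}"]) (use fg in auto)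
    then show "f \<oplus>\<^bsub>free_module K B\<^esub> g \<in> carrier (free_module K B)"
      using fg by auto
  next
    fix f assume f: "f \<in> carrier (free_module K B)"
    have eq: "{b. \<ominus> f b \<noteq> \<zero>} = {b. f b \<noteq> \<zero>}"
      using f by (auto simp: image_subset_iff)
    show "\<exists>g\<in>carrier (free_module K B). g \<oplus>\<^bsub>free_module K B\<^esub> f = \<zero>\<^bsub>free_module K B\<^esub>"
      using f eq by (intro bexI[of _ "\<lambda>b. \<ominus> f b"]) (auto simp: image_subset_iff l_neg)
  qed (auto simp: image_subset_iff a_ac)
next
  fix r f assume rf: "r \<in> carrier K" "f \<in> carrier (free_module K B)"
  have "finite {b. r \<otimes> f b \<noteq> \<zero>}"
    by (rule finite_subset[of _ "{b. f b \<noteq> \<zero>}"]) (use rf in auto)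
  then show "r \<odot>\<^bsub>free_module K B\<^esub> f \<in> carrier (free_module K B)"
    using rf by (auto simp: image_subset_iff)
qed (auto simp: image_subset_iff l_distr r_distr m_assoc is_cring)

lemma (in base_ring) basis_vec_closed [simp]:
  "b \<in> B \<Longrightarrow> basis_vec K b \<in> carrier (free_module K B)"
  by (auto simp: basis_vec_def)

text \<open>Induction on the support: an element with support in \<open>insert a A\<close> is one with support in
  \<open>A\<close> plus a multiple of the basis vector at \<open>a\<close>.\<close>

lemma (in base_ring) free_module_ext:
  assumes "module K X" "linear_map K (free_module K B) X \<phi>" "linear_map K (free_module K B) X \<psi>"
    and eq: "\<And>b. b \<in> B \<Longrightarrow> \<phi> (basis_vec K b) = \<psi> (basis_vec K b)"
    and "f \<in> carrier (free_module K B)"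
  shows "\<phi> f = \<psi> f"
proof -
  interpret F: module K "free_module K B" by (rule free_module_module)
  have "finite A \<Longrightarrow> \<forall>f\<in>carrier (free_module K B). {b. f b \<noteq> \<zero>} \<subseteq> A \<longrightarrow> \<phi> f = \<psi> f" for A
  proof (induction rule: finite_induct)
    case empty
    show ?case
    proof (intro ballI impI)
      fix f assume "f \<in> carrier (free_module K B)" "{b. f b \<noteq> \<zero>} \<subseteq> {}"
      then have "f = \<zero>\<^bsub>free_module K B\<^esub>" by auto
      then show "\<phi> f = \<psi> f"
        using linear_map_zero[OF F.module_axioms assms(1) assms(2)]
          linear_map_zero[OF F.module_axioms assms(1) assms(3)] by simp
    qed
  next
    case (insert a A)
    show ?case
    proof (intro ballI impI)
      fix f assume f: "f \<in> carrier (free_module K B)" and supp: "{b. f b \<noteq> \<zero>} \<subseteq> insert a A"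
      show "\<phi> f = \<psi> f"
      proof (cases "a \<in> B")
        case False
        then have "{b. f b \<noteq> \<zero>} \<subseteq> A" using f supp by auto
        then show ?thesis using insert.IH f by blast
      next
        case True
        define g where "g = f(a := \<zero>)"
        have "finite {b. g b \<noteq> \<zero>}"
          by (rule finite_subset[of _ "{b. f b \<noteq> \<zero>}"]) (use f in \<open>auto simp: g_def\<close>)
        then have g: "g \<in> carrier (free_module K B)" using f by (auto simp: g_def image_subset_iff)
        have fa: "f a \<in> carrier K" using f by auto
        have e: "basis_vec K a \<in> carrier (free_module K B)" using True by (rule basis_vec_closed)
        have dec: "f = g \<oplus>\<^bsub>free_module K B\<^esub> f a \<odot>\<^bsub>free_module K B\<^esub> basis_vec K a"
          using f by (auto simp: g_def basis_vec_def fun_eq_iff image_subset_iff)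
        have "{b. g b \<noteq> \<zero>} \<subseteq> A" using supp by (auto simp: g_def)
        then have eqg: "\<phi> g = \<psi> g" using insert.IH g by blast
        have expand: "\<chi> f = \<chi> g \<oplus>\<^bsub>X\<^esub> f a \<odot>\<^bsub>X\<^esub> \<chi> (basis_vec K a)"
          if "linear_map K (free_module K B) X \<chi>" for \<chi>
          by (subst dec, subst linear_map_add[OF that g F.smult_closed[OF fa e]],
              subst linear_map_smult[OF that fa e]) (rule refl)
        show ?thesis
          unfolding expand[OF assms(2)] expand[OF assms(3)] eqg eq[OF True] by (rule refl)
      qed
    qed
  qed
  then show ?thesis using assms(5) by auto
qed

text \<open>The sum that \<open>lin_ext\<close> evaluates at a chosen representative of a class. As a function on the
  free module it is linear for every \<open>\<beta>\<close>, so the choice only has to be dealt with once, when the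
  relations are divided out.\<close>

definition free_ext ::
  "'k ring \<Rightarrow> ('k, 'x, 'm) module_scheme \<Rightarrow> ('b \<Rightarrow> 'x) \<Rightarrow> ('b \<Rightarrow> 'k) \<Rightarrow> 'x" where
  "free_ext K X \<beta> f = (\<Oplus>\<^bsub>X\<^esub>b\<in>{b. f b \<noteq> \<zero>\<^bsub>K\<^esub>}. f b \<odot>\<^bsub>X\<^esub> \<beta> b)"

lemma lin_ext_free_ext: "lin_ext K X \<beta> t = free_ext K X \<beta> (SOME f. f \<in> t)"
  by (simp add: lin_ext_def free_ext_def Let_def)

text \<open>The supports of two elements and of their sum differ; summing over a common finite superset makes
  the three sums comparable.\<close>

lemma (in base_ring) free_ext_eq:
  assumes "module K X" "\<beta> \<in> B \<rightarrow> carrier X" "f \<in> carrier (free_module K B)"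
    and "finite A" "{b. f b \<noteq> \<zero>} \<subseteq> A" "A \<subseteq> B"
  shows "free_ext K X \<beta> f = (\<Oplus>\<^bsub>X\<^esub>b\<in>A. f b \<odot>\<^bsub>X\<^esub> \<beta> b)"
proof -
  interpret X: module K X by fact
  have "f b \<in> carrier K" "b \<in> A \<Longrightarrow> \<beta> b \<in> carrier X" for b
    using assms by auto
  then show ?thesis unfolding free_ext_def
    using assms(4,5) by (intro X.M.add.finprod_mono_neutral_cong_left) (auto simp: Pi_iff)
qed

lemma (in base_ring) free_ext_linear:
  assumes "module K X" "\<beta> \<in> B \<rightarrow> carrier X"
  shows "linear_map K (free_module K B) X (free_ext K X \<beta>)"
proof (rule linear_mapI)
  interpret X: module K X by fact
  interpret F: module K "free_module K B" by (rule free_module_module)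
  fix f assume f: "f \<in> carrier (free_module K B)"
  have suppf: "finite {b. f b \<noteq> \<zero>}" "{b. f b \<noteq> \<zero>} \<subseteq> B" using f by auto
  have fb: "f b \<in> carrier K" for b using f by auto
  show "free_ext K X \<beta> f \<in> carrier X"
    unfolding free_ext_def using fb suppf assms(2) by (intro X.M.finsum_closed) (auto simp: Pi_iff)
  {
    fix g assume g: "g \<in> carrier (free_module K B)"
    have suppg: "finite {b. g b \<noteq> \<zero>}" "{b. g b \<noteq> \<zero>} \<subseteq> B" using g by auto
    have gb: "g b \<in> carrier K" for b using g by auto
    let ?A = "{b. f b \<noteq> \<zero>} \<union> {b. g b \<noteq> \<zero>}"
    have A: "finite ?A" "?A \<subseteq> B" using suppf suppg by auto
    have \<beta>: "\<beta> b \<in> carrier X" if "b \<in> ?A" for b using that A assms(2) by auto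
    have "free_ext K X \<beta> (f \<oplus>\<^bsub>free_module K B\<^esub> g)
        = (\<Oplus>\<^bsub>X\<^esub>b\<in>?A. (f \<oplus>\<^bsub>free_module K B\<^esub> g) b \<odot>\<^bsub>X\<^esub> \<beta> b)"
      using A fb gb by (intro free_ext_eq[OF assms F.M.add.m_closed[OF f g]]) auto
    also have "\<dots> = (\<Oplus>\<^bsub>X\<^esub>b\<in>?A. f b \<odot>\<^bsub>X\<^esub> \<beta> b \<oplus>\<^bsub>X\<^esub> g b \<odot>\<^bsub>X\<^esub> \<beta> b)"
      using \<beta> fb gb
      by (intro X.M.finsum_cong' funcsetI X.M.add.m_closed X.smult_closed) (simp_all add: X.smult_l_distr)
    also have "\<dots> = (\<Oplus>\<^bsub>X\<^esub>b\<in>?A. f b \<odot>\<^bsub>X\<^esub> \<beta> b) \<oplus>\<^bsub>X\<^esub> (\<Oplus>\<^bsub>X\<^esub>b\<in>?A. g b \<odot>\<^bsub>X\<^esub> \<beta> b)"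
      using \<beta> fb gb by (intro X.M.finsum_addf funcsetI X.smult_closed)
    also have "(\<Oplus>\<^bsub>X\<^esub>b\<in>?A. f b \<odot>\<^bsub>X\<^esub> \<beta> b) = free_ext K X \<beta> f"
      using A by (intro free_ext_eq[OF assms f, symmetric]) auto
    also have "(\<Oplus>\<^bsub>X\<^esub>b\<in>?A. g b \<odot>\<^bsub>X\<^esub> \<beta> b) = free_ext K X \<beta> g"
      using A by (intro free_ext_eq[OF assms g, symmetric]) auto
    finally show "free_ext K X \<beta> (f \<oplus>\<^bsub>free_module K B\<^esub> g) = free_ext K X \<beta> f \<oplus>\<^bsub>X\<^esub> free_ext K X \<beta> g" .
  }
  {
    fix r assume r: "r \<in> carrier K"
    let ?A = "{b. f b \<noteq> \<zero>}"
    have \<beta>: "\<beta> b \<in> carrier X" if "b \<in> ?A" for b using that suppf assms(2) by auto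
    have "free_ext K X \<beta> (r \<odot>\<^bsub>free_module K B\<^esub> f)
        = (\<Oplus>\<^bsub>X\<^esub>b\<in>?A. (r \<odot>\<^bsub>free_module K B\<^esub> f) b \<odot>\<^bsub>X\<^esub> \<beta> b)"
      using suppf r by (intro free_ext_eq[OF assms F.smult_closed[OF r f]]) auto
    also have "\<dots> = (\<Oplus>\<^bsub>X\<^esub>b\<in>?A. r \<odot>\<^bsub>X\<^esub> (f b \<odot>\<^bsub>X\<^esub> \<beta> b))"
      using \<beta> fb r by (intro X.M.finsum_cong') (auto simp: X.smult_assoc1)
    also have "\<dots> = r \<odot>\<^bsub>X\<^esub> free_ext K X \<beta> f"
      unfolding free_ext_def using \<beta> fb r suppf by (intro X.finsum_smult_ldistr[symmetric]) auto
    finally show "free_ext K X \<beta> (r \<odot>\<^bsub>free_module K B\<^esub> f) = r \<odot>\<^bsub>X\<^esub> free_ext K X \<beta> f" .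
  }
qed

lemma (in base_ring) free_ext_basis_vec:
  assumes "module K X" "\<beta> \<in> B \<rightarrow> carrier X" "b \<in> B"
  shows "free_ext K X \<beta> (basis_vec K b) = \<beta> b"
proof -
  interpret X: module K X by fact
  have \<beta>: "\<beta> b \<in> carrier X" using assms by auto
  have "free_ext K X \<beta> (basis_vec K b) = (\<Oplus>\<^bsub>X\<^esub>c\<in>{b}. basis_vec K b c \<odot>\<^bsub>X\<^esub> \<beta> c)"
    using assms by (intro free_ext_eq[where B = B] basis_vec_closed)
      (auto simp: basis_vec_def split: if_splits)
  also have "\<dots> = \<beta> b" using \<beta> by (simp add: basis_vec_def)
  finally show ?thesis .
qed

lemma (in base_module) submodule_kernel:
  assumes "module K X" "linear_map K M X \<phi>"
  shows "submodule {x \<in> carrier M. \<phi> x = \<zero>\<^bsub>X\<^esub>} K M"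
proof -
  interpret X: module K X by fact
  note lin = linear_map_closed[OF assms(2)] linear_map_add[OF assms(2)] linear_map_smult[OF assms(2)]
  show ?thesis
  proof (rule submoduleI)
    fix a assume a: "a \<in> {x \<in> carrier M. \<phi> x = \<zero>\<^bsub>X\<^esub>}"
    have "\<phi> (\<zero>\<^bsub>M\<^esub> \<ominus>\<^bsub>M\<^esub> a) = \<phi> \<zero>\<^bsub>M\<^esub> \<ominus>\<^bsub>X\<^esub> \<phi> a"
      using a by (intro linear_map_minus[OF module_axioms assms]) auto
    then show "\<ominus>\<^bsub>M\<^esub> a \<in> {x \<in> carrier M. \<phi> x = \<zero>\<^bsub>X\<^esub>}"
      using a linear_map_zero[OF module_axioms assms] by (simp add: M.minus_eq X.M.minus_eq)
  qed (auto simp: lin linear_map_zero[OF module_axioms assms])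
qed

lemma (in base_module) submodule_span_submodule:
  assumes "S \<subseteq> carrier M"
  shows "submodule (submodule_span K M S) K M"
proof (rule submoduleI)
  show "submodule_span K M S \<subseteq> carrier M"
    unfolding submodule_span_def using carrier_is_submodule assms by blast
qed (auto simp: submodule_span_def dest: submoduleE
      intro: subgroup.one_closed[OF submodule.axioms(1), of _ _ M, simplified])

lemma submodule_span_superset: "S \<subseteq> submodule_span K M S"
  by (auto simp: submodule_span_def)

lemma submodule_span_least: "\<lbrakk>submodule N K M; S \<subseteq> N\<rbrakk> \<Longrightarrow> submodule_span K M S \<subseteq> N"
  by (auto simp: submodule_span_def)

lemma quotient_module_simps [simp]:
  "carrier (quotient_module M N) = a_rcosets\<^bsub>M\<^esub> N"
  "\<zero>\<^bsub>quotient_module M N\<^esub> = N"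
  "X \<oplus>\<^bsub>quotient_module M N\<^esub> Y = X <+>\<^bsub>M\<^esub> Y"
  "r \<odot>\<^bsub>quotient_module M N\<^esub> X = (\<Union>x\<in>X. N +>\<^bsub>M\<^esub> (r \<odot>\<^bsub>M\<^esub> x))"
  by (simp_all add: quotient_module_def)

context base_module
begin

context
  fixes N assumes sub: "submodule N K M"
begin

lemma submodule_abelian_subgroup: "abelian_subgroup N M"
proof (rule abelian_subgroupI3)
  show "additive_subgroup N M" using sub by (auto simp: additive_subgroup_def submodule_def)
qed unfold_locales

text \<open>The union in the definition of the scalar multiplication runs over all representatives, but they
  all contribute the same coset.\<close>

lemma quotient_smult_coset:
  assumes "r \<in> carrier K" "x \<in> carrier M"
  shows "r \<odot>\<^bsub>quotient_module M N\<^esub> (N +>\<^bsub>M\<^esub> x) = N +>\<^bsub>M\<^esub> (r \<odot>\<^bsub>M\<^esub> x)"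
proof -
  interpret N: abelian_subgroup N M by (rule submodule_abelian_subgroup)
  have "N +>\<^bsub>M\<^esub> (r \<odot>\<^bsub>M\<^esub> y) = N +>\<^bsub>M\<^esub> (r \<odot>\<^bsub>M\<^esub> x)" if "y \<in> N +>\<^bsub>M\<^esub> x" for y
  proof -
    have "y \<in> (\<Union>n\<in>N. {n \<oplus>\<^bsub>M\<^esub> x})" using that unfolding a_r_coset_def' .
    then obtain n where n: "n \<in> N" "y = n \<oplus>\<^bsub>M\<^esub> x" by (elim UN_E singletonE)
    then have nM: "n \<in> carrier M" using submoduleE(1)[OF sub] by blast
    have "r \<odot>\<^bsub>M\<^esub> n \<in> N" using sub n(1) assms(1) by (rule_tac submodule.smult_closed)
    moreover have "r \<odot>\<^bsub>M\<^esub> y = r \<odot>\<^bsub>M\<^esub> n \<oplus>\<^bsub>M\<^esub> r \<odot>\<^bsub>M\<^esub> x"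
      using n nM assms by (simp add: smult_r_distr)
    ultimately have "r \<odot>\<^bsub>M\<^esub> y \<in> N +>\<^bsub>M\<^esub> (r \<odot>\<^bsub>M\<^esub> x)" by (auto simp: a_r_coset_def')
    then show ?thesis using assms by (intro N.a_repr_independence'[symmetric]) auto
  qed
  moreover have "x \<in> N +>\<^bsub>M\<^esub> x" using assms(2) by (rule N.a_rcos_self)
  ultimately show ?thesis unfolding quotient_module_simps by blast
qed

lemma quotient_add_coset:
  "\<lbrakk>x \<in> carrier M; y \<in> carrier M\<rbrakk>
    \<Longrightarrow> (N +>\<^bsub>M\<^esub> x) \<oplus>\<^bsub>quotient_module M N\<^esub> (N +>\<^bsub>M\<^esub> y) = N +>\<^bsub>M\<^esub> (x \<oplus>\<^bsub>M\<^esub> y)"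
  using abelian_subgroup.a_rcos_sum[OF submodule_abelian_subgroup] by simp

lemma quotient_coset_cases:
  assumes "X \<in> carrier (quotient_module M N)"
  obtains x where "x \<in> carrier M" "X = N +>\<^bsub>M\<^esub> x"
  using assms by (auto simp: A_RCOSETS_def')

lemma quotient_coset_closed:
  "x \<in> carrier M \<Longrightarrow> N +>\<^bsub>M\<^esub> x \<in> carrier (quotient_module M N)"
  by (auto simp: A_RCOSETS_def')

lemma quotient_zero_coset: "\<zero>\<^bsub>quotient_module M N\<^esub> = N +>\<^bsub>M\<^esub> \<zero>\<^bsub>M\<^esub>"
  using submoduleE(1)[OF sub] by simp

lemma quotient_coset_eq_zero: "x \<in> N \<Longrightarrow> N +>\<^bsub>M\<^esub> x = \<zero>\<^bsub>quotient_module M N\<^esub>"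
  using abelian_subgroup.a_rcos_const[OF submodule_abelian_subgroup] by simp

lemma quotient_module_module: "module K (quotient_module M N)"
proof -
  interpret N: abelian_subgroup N M by (rule submodule_abelian_subgroup)
  note [simp del] = quotient_module_simps
  note [simp] = quotient_add_coset quotient_smult_coset quotient_coset_closed quotient_zero_coset
  show ?thesis
  proof (rule moduleI)
    show "abelian_group (quotient_module M N)"
    proof (rule abelian_groupI)
      fix X assume "X \<in> carrier (quotient_module M N)"
      then obtain x where x: "x \<in> carrier M" "X = N +>\<^bsub>M\<^esub> x" by (rule quotient_coset_cases)
      then show "\<exists>Y\<in>carrier (quotient_module M N).
          Y \<oplus>\<^bsub>quotient_module M N\<^esub> X = \<zero>\<^bsub>quotient_module M N\<^esub>"
        by (intro bexI[of _ "N +>\<^bsub>M\<^esub> (\<ominus>\<^bsub>M\<^esub> x)"]) (auto simp: M.l_neg)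
    qed (auto elim!: quotient_coset_cases simp: M.a_ac)
  qed (auto elim!: quotient_coset_cases
      simp: smult_l_distr smult_r_distr smult_assoc1 R.cring_axioms)
qed

lemma quotient_projection_linear: "linear_map K M (quotient_module M N) (\<lambda>x. N +>\<^bsub>M\<^esub> x)"
  by (rule linear_mapI) (auto simp del: quotient_module_simps
      simp: quotient_add_coset quotient_smult_coset quotient_coset_closed)

end

end

text \<open>Both the tensor product of two modules and the tensor powers are of the following shape; their
  universal properties are instances of the one proved here.\<close>

definition presented :: "'k ring \<Rightarrow> 'b set \<Rightarrow> ('b \<Rightarrow> 'k) set \<Rightarrow> ('k, ('b \<Rightarrow> 'k) set) module" where
  "presented K B S =
     quotient_module (free_module K B) (submodule_span K (free_module K B) S)"

definition generator :: "'k ring \<Rightarrow> 'b set \<Rightarrow> ('b \<Rightarrow> 'k) set \<Rightarrow> 'b \<Rightarrow> ('b \<Rightarrow> 'k) set" where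
  "generator K B S b =
     submodule_span K (free_module K B) S +>\<^bsub>free_module K B\<^esub> basis_vec K b"

locale presentation = base_ring K for K :: "'k ring" (structure) +
  fixes B :: "'b set" and S :: "('b \<Rightarrow> 'k) set"
  assumes rels: "S \<subseteq> carrier (free_module K B)"
begin

abbreviation M where "M \<equiv> free_module K B"
abbreviation N where "N \<equiv> submodule_span K M S"
abbreviation Q where "Q \<equiv> presented K B S"
abbreviation gen where "gen \<equiv> generator K B S"

sublocale F: base_module K "M"
  unfolding base_module_def by (rule free_module_module)

lemma span_submodule: "submodule (N) K (M)"
  using rels by (rule F.submodule_span_submodule)

lemma presented_module: "module K (Q)"
  unfolding presented_def using span_submodule by (rule F.quotient_module_module)

lemma generator_closed: "b \<in> B \<Longrightarrow> gen b \<in> carrier (Q)"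
  unfolding presented_def generator_def
  by (intro F.quotient_coset_closed[OF span_submodule] basis_vec_closed)

lemma projection_linear:
  "linear_map K (M) (Q)
     (\<lambda>f. N +>\<^bsub>M\<^esub> f)"
  unfolding presented_def using span_submodule by (rule F.quotient_projection_linear)

lemma projection_rel:
  "s \<in> S \<Longrightarrow>
    N +>\<^bsub>M\<^esub> s = \<zero>\<^bsub>Q\<^esub>"
  unfolding presented_def
  by (rule F.quotient_coset_eq_zero[OF span_submodule subsetD[OF submodule_span_superset]])

lemma presented_cases:
  assumes "t \<in> carrier (Q)"
  obtains f where "f \<in> carrier (M)"
    "t = N +>\<^bsub>M\<^esub> f"
  using assms unfolding presented_def by (rule F.quotient_coset_cases[OF span_submodule])

text \<open>Composing with the projection turns two maps on the quotient into two maps on the free module,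
  which are determined by the basis.\<close>

lemma presented_ext:
  assumes "module K X" "linear_map K (Q) X \<phi>" "linear_map K (Q) X \<psi>"
    and "\<And>b. b \<in> B \<Longrightarrow> \<phi> (gen b) = \<psi> (gen b)"
    and "t \<in> carrier (Q)"
  shows "\<phi> t = \<psi> t"
  using assms(5)
proof (rule presented_cases)
  fix f assume f: "f \<in> carrier (M)"
    "t = N +>\<^bsub>M\<^esub> f"
  have "\<phi> (N +>\<^bsub>M\<^esub> f)
      = \<psi> (N +>\<^bsub>M\<^esub> f)"
    using assms(4) unfolding generator_def
    by (intro free_module_ext[OF assms(1) _ _ _ f(1), where
          \<phi> = "\<lambda>f. \<phi> (N +>\<^bsub>M\<^esub> f)" and
          \<psi> = "\<lambda>f. \<psi> (N +>\<^bsub>M\<^esub> f)"]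
        linear_map_comp[OF assms(2) projection_linear] linear_map_comp[OF assms(3) projection_linear])
  then show ?thesis using f by simp
qed

lemma representative_closed:
  assumes "t \<in> carrier (Q)"
  shows "(SOME f. f \<in> t) \<in> t" "(SOME f. f \<in> t) \<in> carrier (M)"
proof -
  interpret N: abelian_subgroup "N" "M"
    using span_submodule by (rule F.submodule_abelian_subgroup)
  obtain f where f: "f \<in> carrier (M)"
    "t = N +>\<^bsub>M\<^esub> f"
    using assms by (rule presented_cases)
  have "f \<in> t" unfolding f(2) using f(1) by (rule N.a_rcos_self)
  then show 1: "(SOME f. f \<in> t) \<in> t" by (rule someI[of "\<lambda>f. f \<in> t"])
  show "(SOME f. f \<in> t) \<in> carrier (M)"
    using 1 f N.a_elemrcos_carrier by metis
qed

text \<open>For fixed \<open>t\<close>, the class \<open>lin_ext K X \<beta> t\<close> depends linearly on \<open>\<beta>\<close>, whether or not \<open>\<beta>\<close>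
  respects the relations, because the representative of \<open>t\<close> does not depend on \<open>\<beta>\<close>.\<close>

lemma lin_ext_param_linear:
  assumes "module K X" "module K V" "t \<in> carrier (Q)"
    and lin: "\<And>b. b \<in> B \<Longrightarrow> linear_map K V X (\<lambda>v. \<beta> v b)"
  shows "linear_map K V X (\<lambda>v. lin_ext K X (\<beta> v) t)"
proof -
  interpret X: module K X by fact
  interpret V: module K V by fact
  define f where "f = (SOME f. f \<in> t)"
  have f: "f \<in> carrier (M)" unfolding f_def using assms(3) by (rule representative_closed)
  have fb: "f b \<in> carrier K" "f b \<noteq> \<zero> \<Longrightarrow> b \<in> B" and fin: "finite {b. f b \<noteq> \<zero>}" for b
    using f by auto
  note lin' = linear_map_closed[OF lin] linear_map_add[OF lin] linear_map_smult[OF lin]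
  show ?thesis
    unfolding lin_ext_free_ext f_def[symmetric] free_ext_def
  proof (rule linear_mapI)
    fix v assume v: "v \<in> carrier V"
    show "(\<Oplus>\<^bsub>X\<^esub>b\<in>{b. f b \<noteq> \<zero>}. f b \<odot>\<^bsub>X\<^esub> \<beta> v b) \<in> carrier X"
      using fb v by (intro X.M.finsum_closed) (auto intro!: lin')
    fix w assume w: "w \<in> carrier V"
    have "(\<Oplus>\<^bsub>X\<^esub>b\<in>{b. f b \<noteq> \<zero>}. f b \<odot>\<^bsub>X\<^esub> \<beta> (v \<oplus>\<^bsub>V\<^esub> w) b)
        = (\<Oplus>\<^bsub>X\<^esub>b\<in>{b. f b \<noteq> \<zero>}. f b \<odot>\<^bsub>X\<^esub> \<beta> v b \<oplus>\<^bsub>X\<^esub> f b \<odot>\<^bsub>X\<^esub> \<beta> w b)"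
      using fb v w by (intro X.M.finsum_cong') (auto simp: lin' X.smult_r_distr)
    also have "\<dots> = (\<Oplus>\<^bsub>X\<^esub>b\<in>{b. f b \<noteq> \<zero>}. f b \<odot>\<^bsub>X\<^esub> \<beta> v b)
        \<oplus>\<^bsub>X\<^esub> (\<Oplus>\<^bsub>X\<^esub>b\<in>{b. f b \<noteq> \<zero>}. f b \<odot>\<^bsub>X\<^esub> \<beta> w b)"
      using fb v w by (intro X.M.finsum_addf) (auto intro!: lin')
    finally show "(\<Oplus>\<^bsub>X\<^esub>b\<in>{b. f b \<noteq> \<zero>}. f b \<odot>\<^bsub>X\<^esub> \<beta> (v \<oplus>\<^bsub>V\<^esub> w) b)
      = (\<Oplus>\<^bsub>X\<^esub>b\<in>{b. f b \<noteq> \<zero>}. f b \<odot>\<^bsub>X\<^esub> \<beta> v b)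
        \<oplus>\<^bsub>X\<^esub> (\<Oplus>\<^bsub>X\<^esub>b\<in>{b. f b \<noteq> \<zero>}. f b \<odot>\<^bsub>X\<^esub> \<beta> w b)" .
  next
    fix r v assume r: "r \<in> carrier K" and v: "v \<in> carrier V"
    have "(\<Oplus>\<^bsub>X\<^esub>b\<in>{b. f b \<noteq> \<zero>}. f b \<odot>\<^bsub>X\<^esub> \<beta> (r \<odot>\<^bsub>V\<^esub> v) b)
        = (\<Oplus>\<^bsub>X\<^esub>b\<in>{b. f b \<noteq> \<zero>}. r \<odot>\<^bsub>X\<^esub> (f b \<odot>\<^bsub>X\<^esub> \<beta> v b))"
      using fb v r by (intro X.M.finsum_cong')
        (auto simp: lin' X.smult_assoc1[symmetric] m_comm)
    also have "\<dots> = r \<odot>\<^bsub>X\<^esub> (\<Oplus>\<^bsub>X\<^esub>b\<in>{b. f b \<noteq> \<zero>}. f b \<odot>\<^bsub>X\<^esub> \<beta> v b)"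
      using fb v r fin by (intro X.finsum_smult_ldistr[symmetric]) (auto intro!: lin')
    finally show "(\<Oplus>\<^bsub>X\<^esub>b\<in>{b. f b \<noteq> \<zero>}. f b \<odot>\<^bsub>X\<^esub> \<beta> (r \<odot>\<^bsub>V\<^esub> v) b)
      = r \<odot>\<^bsub>X\<^esub> (\<Oplus>\<^bsub>X\<^esub>b\<in>{b. f b \<noteq> \<zero>}. f b \<odot>\<^bsub>X\<^esub> \<beta> v b)" .
  qed
qed

context
  fixes X :: "('k, 'x, 'm) module_scheme" and \<beta> :: "'b \<Rightarrow> 'x"
  assumes X: "module K X" and \<beta>: "\<beta> \<in> B \<rightarrow> carrier X"
    and annihilates: "\<And>s. s \<in> S \<Longrightarrow> free_ext K X \<beta> s = \<zero>\<^bsub>X\<^esub>"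
begin

text \<open>Independence of the representative: the linear extension to the free module annihilates the
  relations, hence their span, because its kernel is a submodule.\<close>

lemma lin_ext_projection:
  assumes f: "f \<in> carrier (M)"
  shows "lin_ext K X \<beta> (N +>\<^bsub>M\<^esub> f)
    = free_ext K X \<beta> f"
proof -
  interpret X: module K X by (rule X)
  interpret N: abelian_subgroup "N" "M"
    using span_submodule by (rule F.submodule_abelian_subgroup)
  let ?t = "N +>\<^bsub>M\<^esub> f"
  have lin: "linear_map K (M) X (free_ext K X \<beta>)" using X \<beta> by (rule free_ext_linear)
  have t: "?t \<in> carrier (Q)"
    unfolding presented_def by (rule F.quotient_coset_closed[OF span_submodule f])
  have "N
      \<subseteq> {x \<in> carrier (M). free_ext K X \<beta> x = \<zero>\<^bsub>X\<^esub>}"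
    using rels annihilates by (intro submodule_span_least F.submodule_kernel X lin) blast
  moreover obtain n where "n \<in> N"
    "(SOME f. f \<in> ?t) = n \<oplus>\<^bsub>M\<^esub> f"
    using representative_closed(1)[OF t] by (auto simp: a_r_coset_def' simp del: free_module_simps)
  ultimately show ?thesis
    unfolding lin_ext_free_ext using linear_map_add[OF lin _ f, of n] linear_map_closed[OF lin f]
    by (auto simp del: free_module_simps)
qed

lemma lin_ext_linear: "linear_map K (Q) X (lin_ext K X \<beta>)"
proof (rule linear_mapI)
  note lin = free_ext_linear[OF X \<beta>]
  note proj = projection_linear
  fix s assume "s \<in> carrier (Q)"
  then obtain f where f: "f \<in> carrier (M)"
    "s = N +>\<^bsub>M\<^esub> f" by (rule presented_cases)
  then show "lin_ext K X \<beta> s \<in> carrier X"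
    using linear_map_closed[OF lin f(1)] by (simp only: lin_ext_projection)
  show "lin_ext K X \<beta> (r \<odot>\<^bsub>Q\<^esub> s) = r \<odot>\<^bsub>X\<^esub> lin_ext K X \<beta> s"
    if "r \<in> carrier K" for r
    unfolding f(2)
    by (simp only: linear_map_smult[OF proj that f(1), symmetric] F.smult_closed[OF that f(1)]
        lin_ext_projection f(1) linear_map_smult[OF lin that f(1)])
  fix t assume "t \<in> carrier (Q)"
  then obtain g where g: "g \<in> carrier (M)"
    "t = N +>\<^bsub>M\<^esub> g" by (rule presented_cases)
  show "lin_ext K X \<beta> (s \<oplus>\<^bsub>Q\<^esub> t) = lin_ext K X \<beta> s \<oplus>\<^bsub>X\<^esub> lin_ext K X \<beta> t"
    unfolding f(2) g(2)
    by (simp only: linear_map_add[OF proj f(1) g(1), symmetric] F.add.m_closed[OF f(1) g(1)]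
        lin_ext_projection f(1) g(1) linear_map_add[OF lin f(1) g(1)])
qed

lemma lin_ext_generator: "b \<in> B \<Longrightarrow> lin_ext K X \<beta> (gen b) = \<beta> b"
  unfolding generator_def
  by (simp only: lin_ext_projection basis_vec_closed free_ext_basis_vec[OF X \<beta>])

end

end

section \<open>The tensor product\<close>

definition bilinear_map ::
  "'k ring \<Rightarrow> ('k, 'v, 'm) module_scheme \<Rightarrow> ('k, 'w, 'n) module_scheme \<Rightarrow> ('k, 'x, 'p) module_scheme
    \<Rightarrow> ('v \<Rightarrow> 'w \<Rightarrow> 'x) \<Rightarrow> bool" where
  "bilinear_map K V W X b \<longleftrightarrow>
     (\<forall>w\<in>carrier W. linear_map K V X (\<lambda>v. b v w)) \<and> (\<forall>v\<in>carrier V. linear_map K W X (b v))"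

lemma tensor_presented:
  "tensor K V W = presented K (carrier V \<times> carrier W) (tensor_rels K V W)"
  by (simp add: tensor_def tensor_null_def presented_def)

lemma tens_generator:
  "tens K V W v w = generator K (carrier V \<times> carrier W) (tensor_rels K V W) (v, w)"
  by (simp add: tens_def tensor_null_def generator_def)

lemma minus_eq_zero_iff:
  assumes "module K X" "x \<in> carrier X" "y \<in> carrier X"
  shows "x \<ominus>\<^bsub>X\<^esub> y = \<zero>\<^bsub>X\<^esub> \<longleftrightarrow> x = y"
proof -
  interpret X: module K X by fact
  have "x = y" if "x \<oplus>\<^bsub>X\<^esub> \<ominus>\<^bsub>X\<^esub> y = \<zero>\<^bsub>X\<^esub>"
    using X.M.minus_equality[OF that] assms(2,3) by simp
  then show ?thesis using assms(2,3) by (auto simp: X.M.minus_eq X.M.r_neg)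
qed

lemma eq_minus_minus:
  assumes "module K X" "x = a \<oplus>\<^bsub>X\<^esub> b" "a \<in> carrier X" "b \<in> carrier X"
  shows "x \<ominus>\<^bsub>X\<^esub> a \<ominus>\<^bsub>X\<^esub> b = \<zero>\<^bsub>X\<^esub>"
proof -
  interpret X: module K X by fact
  have "x \<ominus>\<^bsub>X\<^esub> a \<ominus>\<^bsub>X\<^esub> b = (a \<oplus>\<^bsub>X\<^esub> \<ominus>\<^bsub>X\<^esub> a) \<oplus>\<^bsub>X\<^esub> (b \<oplus>\<^bsub>X\<^esub> \<ominus>\<^bsub>X\<^esub> b)"
    using assms(3,4) unfolding assms(2) X.M.minus_eq by (simp add: X.M.a_ac)
  then show ?thesis using assms(3,4) by (simp add: X.M.r_neg)
qed

lemma minus_minus_eq: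
  assumes "module K X" "x \<ominus>\<^bsub>X\<^esub> a \<ominus>\<^bsub>X\<^esub> b = \<zero>\<^bsub>X\<^esub>" "x \<in> carrier X" "a \<in> carrier X" "b \<in> carrier X"
  shows "x = a \<oplus>\<^bsub>X\<^esub> b"
proof -
  interpret X: module K X by fact
  have "x \<ominus>\<^bsub>X\<^esub> a = b" using assms by (simp add: minus_eq_zero_iff[OF assms(1)])
  then have "a \<oplus>\<^bsub>X\<^esub> b = a \<oplus>\<^bsub>X\<^esub> (x \<ominus>\<^bsub>X\<^esub> a)" by simp
  also have "\<dots> = x \<oplus>\<^bsub>X\<^esub> (a \<oplus>\<^bsub>X\<^esub> \<ominus>\<^bsub>X\<^esub> a)"
    using assms(3,4) unfolding X.M.minus_eq by (simp add: X.M.a_ac)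
  also have "\<dots> = x" using assms(3,4) by (simp add: X.M.r_neg)
  finally show ?thesis by simp
qed

context
  fixes K :: "'k ring" and V :: "('k, 'v, 'm) module_scheme" and W :: "('k, 'w, 'n) module_scheme"
  assumes V: "module K V" and W: "module K W"
begin

interpretation V: module K V by (rule V)
interpretation W: module K W by (rule W)
interpretation base_ring K unfolding base_ring_def by (rule V.R.cring_axioms)

lemma tensor_presentation: "presentation K (carrier V \<times> carrier W) (tensor_rels K V W)"
proof (intro presentation.intro presentation_axioms.intro base_ring_axioms)
  interpret F: module K "free_module K (carrier V \<times> carrier W)" by (rule free_module_module)
  show "tensor_rels K V W \<subseteq> carrier (free_module K (carrier V \<times> carrier W))"
    unfolding tensor_rels_def Let_def
    by (auto simp del: free_module_simps
        intro!: F.M.minus_closed F.smult_closed basis_vec_closed)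
qed

interpretation P: presentation K "carrier V \<times> carrier W" "tensor_rels K V W"
  by (rule tensor_presentation)

lemma tensor_module [simp]: "module K (tensor K V W)"
  unfolding tensor_presented by (rule P.presented_module)

lemma tens_closed [simp]:
  "\<lbrakk>v \<in> carrier V; w \<in> carrier W\<rbrakk> \<Longrightarrow> tens K V W v w \<in> carrier (tensor K V W)"
  unfolding tens_generator tensor_presented by (intro P.generator_closed) auto

lemma tensor_ext:
  assumes "module K X" "linear_map K (tensor K V W) X \<phi>" "linear_map K (tensor K V W) X \<psi>"
    and "\<And>v w. \<lbrakk>v \<in> carrier V; w \<in> carrier W\<rbrakk> \<Longrightarrow> \<phi> (tens K V W v w) = \<psi> (tens K V W v w)"
  shows "\<forall>t\<in>carrier (tensor K V W). \<phi> t = \<psi> t"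
proof
  fix t assume "t \<in> carrier (tensor K V W)"
  then show "\<phi> t = \<psi> t"
    using assms unfolding tens_generator tensor_presented
    by (rule_tac P.presented_ext[OF assms(1)]) (assumption | clarsimp)+
qed

text \<open>Each family of relations, once divided out, is one of the four laws of bilinearity.\<close>

lemma tens_bilinear: "bilinear_map K V W (tensor K V W) (tens K V W)"
proof -
  interpret F: module K "free_module K (carrier V \<times> carrier W)" by (rule free_module_module)
  interpret T: module K "tensor K V W" by (rule tensor_module)
  let ?F = "free_module K (carrier V \<times> carrier W)"
  let ?\<pi> = "\<lambda>f. submodule_span K ?F (tensor_rels K V W) +>\<^bsub>?F\<^esub> f"
  let ?e = "basis_vec K"
  have lin: "linear_map K ?F (tensor K V W) ?\<pi>"
    unfolding tensor_presented by (rule P.projection_linear)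
  have \<pi>e: "?\<pi> (?e (v, w)) = tens K V W v w" for v w
    by (simp add: tens_generator generator_def)
  have zero: "s \<in> tensor_rels K V W \<Longrightarrow> ?\<pi> s = \<zero>\<^bsub>tensor K V W\<^esub>" for s
    unfolding tensor_presented by (rule P.projection_rel)
  have e: "v \<in> carrier V \<Longrightarrow> w \<in> carrier W \<Longrightarrow> ?e (v, w) \<in> carrier ?F" for v w
    by (rule basis_vec_closed) simp
  note minus = linear_map_minus[OF free_module_module tensor_module lin]
  note [simp del] = free_module_simps
  have add: "a = b \<oplus>\<^bsub>tensor K V W\<^esub> c"
    if "x \<ominus>\<^bsub>?F\<^esub> y \<ominus>\<^bsub>?F\<^esub> z \<in> tensor_rels K V W"
      "x \<in> carrier ?F" "y \<in> carrier ?F" "z \<in> carrier ?F" "?\<pi> x = a" "?\<pi> y = b" "?\<pi> z = c" for x y z a b c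
    using zero[OF that(1)] that(2-4)
    by (simp add: minus linear_map_closed[OF lin] that(5-7)[symmetric]
        minus_minus_eq[OF tensor_module])
  have scal: "a = r \<odot>\<^bsub>tensor K V W\<^esub> b"
    if "x \<ominus>\<^bsub>?F\<^esub> r \<odot>\<^bsub>?F\<^esub> y \<in> tensor_rels K V W"
      "x \<in> carrier ?F" "y \<in> carrier ?F" "r \<in> carrier K" "?\<pi> x = a" "?\<pi> y = b" for x y r a b
    using zero[OF that(1)] that(2-4)
    by (simp add: minus linear_map_closed[OF lin] linear_map_smult[OF lin] that(5-6)[symmetric]
        minus_eq_zero_iff[OF T.module_axioms])
  show ?thesis unfolding bilinear_map_def
  proof (intro conjI ballI linear_mapI)
    fix v w assume v: "v \<in> carrier V" and w: "w \<in> carrier W"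
    show "tens K V W v w \<in> carrier (tensor K V W)" using v w by simp
    show "tens K V W (v \<oplus>\<^bsub>V\<^esub> v') w = tens K V W v w \<oplus>\<^bsub>tensor K V W\<^esub> tens K V W v' w"
      if "v' \<in> carrier V" for v'
    proof (rule add[of "?e (v \<oplus>\<^bsub>V\<^esub> v', w)" "?e (v, w)" "?e (v', w)"])
      show "?e (v \<oplus>\<^bsub>V\<^esub> v', w) \<ominus>\<^bsub>?F\<^esub> ?e (v, w) \<ominus>\<^bsub>?F\<^esub> ?e (v', w) \<in> tensor_rels K V W"
        unfolding tensor_rels_def Let_def
        by (rule UnI1, rule UnI1, rule UnI1) (use v w that in blast)
    qed (use v w that in \<open>simp_all add: \<pi>e e\<close>)
    show "tens K V W v (w \<oplus>\<^bsub>W\<^esub> w') = tens K V W v w \<oplus>\<^bsub>tensor K V W\<^esub> tens K V W v w'"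
      if "w' \<in> carrier W" for w'
    proof (rule add[of "?e (v, w \<oplus>\<^bsub>W\<^esub> w')" "?e (v, w)" "?e (v, w')"])
      show "?e (v, w \<oplus>\<^bsub>W\<^esub> w') \<ominus>\<^bsub>?F\<^esub> ?e (v, w) \<ominus>\<^bsub>?F\<^esub> ?e (v, w') \<in> tensor_rels K V W"
        unfolding tensor_rels_def Let_def
        by (rule UnI1, rule UnI1, rule UnI2) (use v w that in blast)
    qed (use v w that in \<open>simp_all add: \<pi>e e\<close>)
    show "tens K V W (r \<odot>\<^bsub>V\<^esub> v) w = r \<odot>\<^bsub>tensor K V W\<^esub> tens K V W v w"
      if "r \<in> carrier K" for r
    proof (rule scal[of "?e (r \<odot>\<^bsub>V\<^esub> v, w)" r "?e (v, w)"])
      show "?e (r \<odot>\<^bsub>V\<^esub> v, w) \<ominus>\<^bsub>?F\<^esub> r \<odot>\<^bsub>?F\<^esub> ?e (v, w) \<in> tensor_rels K V W"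
        unfolding tensor_rels_def Let_def
        by (rule UnI1, rule UnI2) (use v w that in blast)
    qed (use v w that in \<open>simp_all add: \<pi>e e\<close>)
    show "tens K V W v (r \<odot>\<^bsub>W\<^esub> w) = r \<odot>\<^bsub>tensor K V W\<^esub> tens K V W v w"
      if "r \<in> carrier K" for r
    proof (rule scal[of "?e (v, r \<odot>\<^bsub>W\<^esub> w)" r "?e (v, w)"])
      show "?e (v, r \<odot>\<^bsub>W\<^esub> w) \<ominus>\<^bsub>?F\<^esub> r \<odot>\<^bsub>?F\<^esub> ?e (v, w) \<in> tensor_rels K V W"
        unfolding tensor_rels_def Let_def
        by (rule UnI2) (use v w that in blast)
    qed (use v w that in \<open>simp_all add: \<pi>e e\<close>)
  qed auto
qed

lemma linear_map_tens_left [linear_intros]: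
  "\<lbrakk>linear_map K U V f; w \<in> carrier W\<rbrakk> \<Longrightarrow> linear_map K U (tensor K V W) (\<lambda>u. tens K V W (f u) w)"
  using tens_bilinear linear_map_comp[of K V "tensor K V W" "\<lambda>v. tens K V W v w" U f]
  by (simp add: bilinear_map_def)

lemma linear_map_tens_right [linear_intros]:
  "\<lbrakk>linear_map K U W f; v \<in> carrier V\<rbrakk> \<Longrightarrow> linear_map K U (tensor K V W) (\<lambda>u. tens K V W v (f u))"
  using tens_bilinear linear_map_comp[of K W "tensor K V W" "\<lambda>w. tens K V W v w" U f]
  by (simp add: bilinear_map_def)

lemma linear_map_lin_ext_tensor_param [linear_intros]:
  assumes "module K X" "module K U" "t \<in> carrier (tensor K V W)"
    and "\<And>v w. \<lbrakk>v \<in> carrier V; w \<in> carrier W\<rbrakk> \<Longrightarrow> linear_map K U X (\<lambda>u. b u v w)"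
  shows "linear_map K U X (\<lambda>u. lin_ext K X (\<lambda>(v, w). b u v w) t)"
  using assms unfolding tensor_presented by (intro P.lin_ext_param_linear) auto

context
  fixes X :: "('k, 'x, 'p) module_scheme" and b :: "'v \<Rightarrow> 'w \<Rightarrow> 'x"
  assumes X: "module K X"
    and b: "\<And>w. w \<in> carrier W \<Longrightarrow> linear_map K V X (\<lambda>v. b v w)"
      "\<And>v. v \<in> carrier V \<Longrightarrow> linear_map K W X (\<lambda>w. b v w)"
begin

text \<open>Bilinearity of \<open>b\<close> is exactly what makes the four families of relations vanish.\<close>

lemma free_ext_tensor_rels:
  assumes s: "s \<in> tensor_rels K V W"
  shows "free_ext K X (\<lambda>(v, w). b v w) s = \<zero>\<^bsub>X\<^esub>"
proof -
  interpret F: module K "free_module K (carrier V \<times> carrier W)" by (rule free_module_module)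
  interpret X: module K X by (rule X)
  let ?F = "free_module K (carrier V \<times> carrier W)"
  let ?\<psi> = "free_ext K X (\<lambda>(v, w). b v w)"
  have b_closed: "v \<in> carrier V \<Longrightarrow> w \<in> carrier W \<Longrightarrow> b v w \<in> carrier X" for v w
    using linear_map_closed[OF b(1)] .
  then have \<beta>: "(\<lambda>(v, w). b v w) \<in> carrier V \<times> carrier W \<rightarrow> carrier X" by auto
  have lin: "linear_map K ?F X ?\<psi>" using X \<beta> by (rule free_ext_linear)
  have \<psi>e: "v \<in> carrier V \<Longrightarrow> w \<in> carrier W \<Longrightarrow> ?\<psi> (basis_vec K (v, w)) = b v w" for v w
    using free_ext_basis_vec[OF X \<beta>, of "(v, w)"] by simp
  have e: "v \<in> carrier V \<Longrightarrow> w \<in> carrier W \<Longrightarrow> basis_vec K (v, w) \<in> carrier ?F" for v w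
    by (rule basis_vec_closed) simp
  note [simp del] = free_module_simps
  note [simp] = e \<psi>e b_closed linear_map_minus[OF free_module_module X lin] linear_map_smult[OF lin]
    linear_map_add[OF b(1)] linear_map_add[OF b(2)] linear_map_smult[OF b(1)] linear_map_smult[OF b(2)]
    eq_minus_minus[OF X] minus_eq_zero_iff[OF X]
  show ?thesis using s unfolding tensor_rels_def Let_def by auto
qed

lemma
  shows linear_map_lin_ext_tensor: "linear_map K (tensor K V W) X (lin_ext K X (\<lambda>(v, w). b v w))"
    and lin_ext_tens: "\<lbrakk>v \<in> carrier V; w \<in> carrier W\<rbrakk>
      \<Longrightarrow> lin_ext K X (\<lambda>(v, w). b v w) (tens K V W v w) = b v w"
proof -
  have \<beta>: "(\<lambda>(v, w). b v w) \<in> carrier V \<times> carrier W \<rightarrow> carrier X"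
    using linear_map_closed[OF b(1)] by auto
  show "linear_map K (tensor K V W) X (lin_ext K X (\<lambda>(v, w). b v w))"
    unfolding tensor_presented using X \<beta> free_ext_tensor_rels by (rule P.lin_ext_linear)
  show "lin_ext K X (\<lambda>(v, w). b v w) (tens K V W v w) = b v w"
    if "v \<in> carrier V" "w \<in> carrier W"
    unfolding tens_generator
    using P.lin_ext_generator[OF X \<beta> free_ext_tensor_rels, of "(v, w)"] that by simp
qed

end

end

section \<open>Tensor powers\<close>

definition multilinear_map ::
  "'k ring \<Rightarrow> ('k, 'h, 'm) module_scheme \<Rightarrow> nat \<Rightarrow> ('k, 'x, 'p) module_scheme \<Rightarrow> ('h list \<Rightarrow> 'x) \<Rightarrow> bool"
  where
  "multilinear_map K H n X \<beta> \<longleftrightarrow>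
     \<beta> \<in> tpow_basis H n \<rightarrow> carrier X \<and>
     (\<forall>xs\<in>tpow_basis H n. \<forall>i<n. linear_map K H X (\<lambda>a. \<beta> (xs[i := a])))"

lemma module_cong:
  assumes "module K M" "carrier M' = carrier M" "zero M' = zero M" "add M' = add M" "smult M' = smult M"
  shows "module K M'"
proof -
  interpret M: module K M by fact
  show ?thesis
  proof (rule moduleI)
    show "abelian_group M'"
    proof (rule abelian_groupI)
      show "\<exists>y\<in>carrier M'. y \<oplus>\<^bsub>M'\<^esub> x = \<zero>\<^bsub>M'\<^esub>" if "x \<in> carrier M'" for x
        using that by (intro bexI[of _ "\<ominus>\<^bsub>M\<^esub> x"]) (auto simp: assms(2-5) M.M.l_neg)
    qed (auto simp: assms(2-5) M.M.a_ac)
  qed (auto simp: assms(2-5) M.smult_l_distr M.smult_r_distr M.smult_assoc1 M.R.cring_axioms)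
qed

lemma lin_ext_module_cong:
  assumes "carrier M' = carrier M" "zero M' = zero M" "add M' = add M" "smult M' = smult M"
  shows "lin_ext K M' = lin_ext K M"
  unfolding lin_ext_def finsum_def finprod_def Let_def using assms by (intro ext) simp

text \<open>\<open>tpow\<close> differs from \<open>tpow_module\<close> only in the multiplication and the unit, so everything about
  its module structure can be read off from \<open>tpow_module\<close>.\<close>

lemma tpow_fields [simp]:
  "carrier (tpow K H n) = carrier (tpow_module K H n)"
  "zero (tpow K H n) = zero (tpow_module K H n)"
  "add (tpow K H n) = add (tpow_module K H n)"
  "smult (tpow K H n) = smult (tpow_module K H n)"
  by (simp_all add: tpow_def)

lemma tpow_module_presented:
  "tpow_module K H n = presented K (tpow_basis H n) (tpow_rels K H n)"
  by (simp add: tpow_module_def tpow_null_def presented_def)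

lemma linear_map_from_tpow: "linear_map K (tpow K H n) X f \<longleftrightarrow> linear_map K (tpow_module K H n) X f"
  by (simp add: linear_map_def)

lemma linear_map_into_tpow: "linear_map K X (tpow K H n) f \<longleftrightarrow> linear_map K X (tpow_module K H n) f"
  by (simp add: linear_map_def)

lemma ptens_generator:
  "length xs = n \<Longrightarrow> ptens K H xs = generator K (tpow_basis H n) (tpow_rels K H n) xs"
  by (auto simp: ptens_def tpow_null_def generator_def)

lemma tpow_basis_update: "\<lbrakk>xs \<in> tpow_basis H n; a \<in> carrier H\<rbrakk> \<Longrightarrow> xs[i := a] \<in> tpow_basis H n"
  by (auto simp: tpow_basis_def dest: set_update_subset_insert[THEN subsetD])

lemma tpow_basis_nth: "\<lbrakk>xs \<in> tpow_basis H n; i < n\<rbrakk> \<Longrightarrow> xs ! i \<in> carrier H"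
  by (auto simp: tpow_basis_def)

lemma tpow_basisI: "\<lbrakk>length xs = n; \<And>i. i < n \<Longrightarrow> xs ! i \<in> carrier H\<rbrakk> \<Longrightarrow> xs \<in> tpow_basis H n"
  by (auto simp: tpow_basis_def in_set_conv_nth)

lemma tpow_basis_Cons [simp]:
  "x # xs \<in> tpow_basis H n \<longleftrightarrow> x \<in> carrier H \<and> n > 0 \<and> xs \<in> tpow_basis H (n - 1)"
  by (cases n) (auto simp: tpow_basis_def)

lemma tpow_basis_Nil [simp]: "[] \<in> tpow_basis H n \<longleftrightarrow> n = 0"
  by (auto simp: tpow_basis_def)

context
  fixes K :: "'k ring" and H :: "('k, 'h, 'm) module_scheme"
  assumes H: "module K H"
begin

interpretation H: module K H by (rule H)
interpretation base_ring K unfolding base_ring_def by (rule H.R.cring_axioms)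

lemma tpow_presentation: "presentation K (tpow_basis H n) (tpow_rels K H n)"
proof (intro presentation.intro presentation_axioms.intro base_ring_axioms)
  interpret F: module K "free_module K (tpow_basis H n)" by (rule free_module_module)
  show "tpow_rels K H n \<subseteq> carrier (free_module K (tpow_basis H n))"
    unfolding tpow_rels_def Let_def
    by (auto simp del: free_module_simps
        intro!: F.M.minus_closed F.smult_closed basis_vec_closed tpow_basis_update)
qed

interpretation P: presentation K "tpow_basis H n" "tpow_rels K H n" for n
  by (rule tpow_presentation)

lemma tpow_module_is_module: "module K (tpow_module K H n)"
  unfolding tpow_module_presented by (rule P.presented_module)

lemma module_tpow [simp]: "module K (tpow K H n)"
  by (rule module_cong[OF tpow_module_is_module]) simp_all

lemma ptens_closed: "xs \<in> tpow_basis H n \<Longrightarrow> ptens K H xs \<in> carrier (tpow K H n)"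
  using P.generator_closed[of xs n]
  by (simp add: ptens_generator[of xs n] tpow_module_presented) (simp add: tpow_basis_def ptens_generator)

lemma tpow_ext:
  assumes "module K X" "linear_map K (tpow K H n) X \<phi>" "linear_map K (tpow K H n) X \<psi>"
    and "\<And>xs. xs \<in> tpow_basis H n \<Longrightarrow> \<phi> (ptens K H xs) = \<psi> (ptens K H xs)"
  shows "\<forall>t\<in>carrier (tpow K H n). \<phi> t = \<psi> t"
proof -
  have "\<phi> (generator K (tpow_basis H n) (tpow_rels K H n) xs)
      = \<psi> (generator K (tpow_basis H n) (tpow_rels K H n) xs)" if "xs \<in> tpow_basis H n" for xs
    using assms(4)[OF that] that by (simp add: ptens_generator tpow_basis_def)
  with assms(2,3) show ?thesis
    unfolding linear_map_from_tpow tpow_fields tpow_module_presented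
    by (intro ballI) (rule P.presented_ext[OF assms(1)]; assumption)
qed

lemma ptens_multilinear: "multilinear_map K H n (tpow K H n) (ptens K H)"
proof -
  interpret F: module K "free_module K (tpow_basis H n)" by (rule free_module_module)
  interpret T: module K "tpow K H n" by (rule module_tpow)
  let ?F = "free_module K (tpow_basis H n)"
  let ?\<pi> = "\<lambda>f. submodule_span K ?F (tpow_rels K H n) +>\<^bsub>?F\<^esub> f"
  let ?e = "basis_vec K"
  have lin: "linear_map K ?F (tpow K H n) ?\<pi>"
    unfolding linear_map_into_tpow tpow_module_presented by (rule P.projection_linear)
  have \<pi>e: "xs \<in> tpow_basis H n \<Longrightarrow> ?\<pi> (?e xs) = ptens K H xs" for xs
    by (simp add: ptens_generator generator_def tpow_basis_def)
  have zero: "s \<in> tpow_rels K H n \<Longrightarrow> ?\<pi> s = \<zero>\<^bsub>tpow K H n\<^esub>" for s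
    unfolding tpow_fields tpow_module_presented by (rule P.projection_rel)
  note minus = linear_map_minus[OF free_module_module module_tpow lin]
  note [simp del] = free_module_simps tpow_fields
  show ?thesis unfolding multilinear_map_def
  proof (intro conjI ballI allI impI linear_mapI)
    show "ptens K H \<in> tpow_basis H n \<rightarrow> carrier (tpow K H n)" by (auto intro: ptens_closed)
    fix xs i a assume xs: "xs \<in> tpow_basis H n" and i: "i < n" and a: "a \<in> carrier H"
    note upd = tpow_basis_update[OF xs]
    show "ptens K H (xs[i := a]) \<in> carrier (tpow K H n)" using upd[OF a] by (rule ptens_closed)
    show "ptens K H (xs[i := a \<oplus>\<^bsub>H\<^esub> b])
        = ptens K H (xs[i := a]) \<oplus>\<^bsub>tpow K H n\<^esub> ptens K H (xs[i := b])" if b: "b \<in> carrier H" for b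
    proof -
      have "?e (xs[i := a \<oplus>\<^bsub>H\<^esub> b]) \<ominus>\<^bsub>?F\<^esub> ?e (xs[i := a]) \<ominus>\<^bsub>?F\<^esub> ?e (xs[i := b]) \<in> tpow_rels K H n"
        unfolding tpow_rels_def Let_def using xs i a b by blast
      from zero[OF this] show ?thesis
        using a b by (intro minus_minus_eq[OF module_tpow]) (simp_all add: minus \<pi>e upd ptens_closed)
    qed
    show "ptens K H (xs[i := r \<odot>\<^bsub>H\<^esub> a]) = r \<odot>\<^bsub>tpow K H n\<^esub> ptens K H (xs[i := a])"
      if r: "r \<in> carrier K" for r
    proof -
      have "?e (xs[i := r \<odot>\<^bsub>H\<^esub> a]) \<ominus>\<^bsub>?F\<^esub> r \<odot>\<^bsub>?F\<^esub> ?e (xs[i := a]) \<in> tpow_rels K H n"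
        unfolding tpow_rels_def Let_def using xs i a r by blast
      from zero[OF this] show ?thesis
        using a r by (simp add: minus \<pi>e upd ptens_closed linear_map_smult[OF lin] minus_eq_zero_iff[OF T.module_axioms])
    qed
  qed
qed

text \<open>This form, with \<open>t\<close> fixed and \<open>\<beta>\<close> varying, is what makes iterated linear extensions multilinear,
  for instance the product of tensor powers and the actions on tensor products of modules.\<close>

lemma linear_map_lin_ext_tpow_param:
  assumes "module K X" "module K U" "t \<in> carrier (tpow K H n)"
    and "\<And>xs. xs \<in> tpow_basis H n \<Longrightarrow> linear_map K U X (\<lambda>u. \<beta> u xs)"
  shows "linear_map K U X (\<lambda>u. lin_ext K X (\<beta> u) t)"
  using assms unfolding tpow_fields tpow_module_presented by (intro P.lin_ext_param_linear) auto

context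
  fixes X :: "('k, 'x, 'p) module_scheme" and \<beta> :: "'h list \<Rightarrow> 'x" and n
  assumes X: "module K X" and ml: "multilinear_map K H n X \<beta>"
begin

lemma free_ext_tpow_rels:
  assumes s: "s \<in> tpow_rels K H n"
  shows "free_ext K X \<beta> s = \<zero>\<^bsub>X\<^esub>"
proof -
  interpret F: module K "free_module K (tpow_basis H n)" by (rule free_module_module)
  interpret X: module K X by (rule X)
  let ?F = "free_module K (tpow_basis H n)"
  let ?\<psi> = "free_ext K X \<beta>"
  have \<beta>: "\<beta> \<in> tpow_basis H n \<rightarrow> carrier X" using ml by (simp add: multilinear_map_def)
  then have \<beta>_closed: "xs \<in> tpow_basis H n \<Longrightarrow> \<beta> xs \<in> carrier X" for xs by auto
  have lin: "linear_map K ?F X ?\<psi>" using X \<beta> by (rule free_ext_linear)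
  have slot: "linear_map K H X (\<lambda>a. \<beta> (xs[i := a]))" if "xs \<in> tpow_basis H n" "i < n" for xs i
    using ml that by (simp add: multilinear_map_def)
  note [simp del] = free_module_simps
  note [simp] = free_ext_basis_vec[OF X \<beta>] tpow_basis_update \<beta>_closed
    linear_map_minus[OF free_module_module X lin] linear_map_smult[OF lin]
    linear_map_add[OF slot] linear_map_smult[OF slot] eq_minus_minus[OF X] minus_eq_zero_iff[OF X]
  show ?thesis using s unfolding tpow_rels_def Let_def by auto
qed

lemma
  shows linear_map_lin_ext_tpow: "linear_map K (tpow K H n) X (lin_ext K X \<beta>)"
    and lin_ext_ptens: "xs \<in> tpow_basis H n \<Longrightarrow> lin_ext K X \<beta> (ptens K H xs) = \<beta> xs"
proof -
  have \<beta>: "\<beta> \<in> tpow_basis H n \<rightarrow> carrier X" using ml by (simp add: multilinear_map_def)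
  show "linear_map K (tpow K H n) X (lin_ext K X \<beta>)"
    unfolding linear_map_from_tpow tpow_module_presented
    using X \<beta> free_ext_tpow_rels by (rule P.lin_ext_linear)
  show "lin_ext K X \<beta> (ptens K H xs) = \<beta> xs" if "xs \<in> tpow_basis H n"
    using P.lin_ext_generator[OF X \<beta> free_ext_tpow_rels that] that
    by (simp add: ptens_generator tpow_basis_def)
qed

end

end

declare tpow_fields [simp del] \<comment> \<open>from here on tensor powers are algebras, not only modules\<close>
section \<open>Algebra homomorphisms\<close>

definition alg_hom ::
  "'k ring \<Rightarrow> ('k, 'a, 'm) module_scheme \<Rightarrow> ('k, 'b, 'n) module_scheme \<Rightarrow> ('a \<Rightarrow> 'b) \<Rightarrow> bool" where
  "alg_hom K A B f \<longleftrightarrow> linear_map K A B f \<and> f \<one>\<^bsub>A\<^esub> = \<one>\<^bsub>B\<^esub> \<and>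
     (\<forall>x\<in>carrier A. \<forall>y\<in>carrier A. f (x \<otimes>\<^bsub>A\<^esub> y) = f x \<otimes>\<^bsub>B\<^esub> f y)"

lemma
  assumes "alg_hom K A B f"
  shows alg_hom_linear: "linear_map K A B f"
    and alg_hom_closed: "x \<in> carrier A \<Longrightarrow> f x \<in> carrier B"
    and alg_hom_one: "f \<one>\<^bsub>A\<^esub> = \<one>\<^bsub>B\<^esub>"
    and alg_hom_mult: "\<lbrakk>x \<in> carrier A; y \<in> carrier A\<rbrakk> \<Longrightarrow> f (x \<otimes>\<^bsub>A\<^esub> y) = f x \<otimes>\<^bsub>B\<^esub> f y"
  using assms linear_map_closed[of K A B f] by (auto simp: alg_hom_def)

lemma (in monoid) Units_inverseI:
  assumes "x \<in> carrier G" "y \<in> carrier G" "x \<otimes> y = \<one>" "y \<otimes> x = \<one>"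
  shows "x \<in> Units G" "inv x = y"
  using assms by (auto simp: Units_def intro: inv_char)

lemma alg_hom_Units:
  assumes "unital_algebra K A" "unital_algebra K B" "alg_hom K A B f" "x \<in> Units A"
  shows "f x \<in> Units B" "f (inv\<^bsub>A\<^esub> x) = inv\<^bsub>B\<^esub> (f x)"
proof -
  interpret A: unital_algebra K A by fact
  interpret B: unital_algebra K B by fact
  have x: "x \<in> carrier A" "inv\<^bsub>A\<^esub> x \<in> carrier A" using assms(4) by auto
  note hom = alg_hom_mult[OF assms(3), symmetric] alg_hom_one[OF assms(3)] alg_hom_closed[OF assms(3)]
  have "f x \<otimes>\<^bsub>B\<^esub> f (inv\<^bsub>A\<^esub> x) = \<one>\<^bsub>B\<^esub>" "f (inv\<^bsub>A\<^esub> x) \<otimes>\<^bsub>B\<^esub> f x = \<one>\<^bsub>B\<^esub>"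
    using x assms(4) by (simp_all add: hom)
  then show "f x \<in> Units B" "f (inv\<^bsub>A\<^esub> x) = inv\<^bsub>B\<^esub> (f x)"
    using x by (auto intro: B.H.Units_inverseI B.H.inv_char[symmetric] hom)
qed

lemma linear_map_mult_left [linear_intros]:
  assumes "unital_algebra K A" "linear_map K V A f" "y \<in> carrier A"
  shows "linear_map K V A (\<lambda>v. f v \<otimes>\<^bsub>A\<^esub> y)"
proof -
  interpret A: unital_algebra K A by fact
  note f = linear_map_closed[OF assms(2)] linear_map_add[OF assms(2)] linear_map_smult[OF assms(2)]
  show ?thesis using assms(3) by (intro linear_mapI) (auto simp: f A.H.l_distr A.smult_mult_left)
qed

lemma linear_map_mult_right [linear_intros]:
  assumes "unital_algebra K A" "linear_map K V A f" "y \<in> carrier A"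
  shows "linear_map K V A (\<lambda>v. y \<otimes>\<^bsub>A\<^esub> f v)"
proof -
  interpret A: unital_algebra K A by fact
  note f = linear_map_closed[OF assms(2)] linear_map_add[OF assms(2)] linear_map_smult[OF assms(2)]
  show ?thesis using assms(3) by (intro linear_mapI) (auto simp: f A.H.r_distr A.smult_mult_right)
qed

section \<open>The algebra structure of tensor powers\<close>

context unital_algebra
begin

lemma unital_algebra_self: "unital_algebra K H" by unfold_locales

lemma module_self [simp]: "module K H" by unfold_locales

abbreviation T :: "nat \<Rightarrow> ('k, ('h list \<Rightarrow> 'k) set) module" where
  "T n \<equiv> tpow K H n"

abbreviation pt :: "'h list \<Rightarrow> ('h list \<Rightarrow> 'k) set" where
  "pt xs \<equiv> ptens K H xs"

abbreviation multH (infixl "\<cdot>" 70) where "x \<cdot> y \<equiv> x \<otimes>\<^bsub>H\<^esub> y"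
abbreviation oneH ("\<one>\<^sub>H") where "\<one>\<^sub>H \<equiv> \<one>\<^bsub>H\<^esub>"

abbreviation list_mult :: "'h list \<Rightarrow> 'h list \<Rightarrow> 'h list" where
  "list_mult xs ys \<equiv> map2 (\<lambda>x y. x \<cdot> y) xs ys"

abbreviation P :: "nat \<Rightarrow> nat list \<Rightarrow> ('h list \<Rightarrow> 'k) set \<Rightarrow> ('h list \<Rightarrow> 'k) set" where
  "P \<equiv> place K H"

abbreviation mult2 (infixl "\<cdot>\<^sub>2" 70) where "s \<cdot>\<^sub>2 t \<equiv> s \<otimes>\<^bsub>T 2\<^esub> t"
abbreviation mult3 (infixl "\<cdot>\<^sub>3" 70) where "s \<cdot>\<^sub>3 t \<equiv> s \<otimes>\<^bsub>T 3\<^esub> t"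
abbreviation mult4 (infixl "\<cdot>\<^sub>4" 70) where "s \<cdot>\<^sub>4 t \<equiv> s \<otimes>\<^bsub>T 4\<^esub> t"

lemma linear_map_pt_slot:
  assumes "xs \<in> tpow_basis H n" "i < n" "linear_map K V H f"
  shows "linear_map K V (T n) (\<lambda>v. pt (xs[i := f v]))"
proof (rule linear_map_comp[OF _ assms(3)])
  show "linear_map K H (T n) (\<lambda>a. pt (xs[i := a]))"
    using ptens_multilinear[of K H n] assms(1,2) by (simp add: multilinear_map_def)
qed

text \<open>If changing one entry of \<open>xs\<close> changes \<open>g xs\<close> in one entry only, and linearly, then the pure tensor
  with legs \<open>g xs\<close> is multilinear in \<open>xs\<close>. Legwise products, the placement of legs and the
  insertion of legs are all of this form.\<close>

lemma multilinear_map_pt_comp: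
  assumes "\<And>xs. xs \<in> tpow_basis H m \<Longrightarrow> g xs \<in> tpow_basis H n"
    and "\<And>xs i. \<lbrakk>xs \<in> tpow_basis H m; i < m\<rbrakk> \<Longrightarrow>
      \<exists>j<n. \<exists>f. linear_map K H H f \<and> (\<forall>a\<in>carrier H. g (xs[i := a]) = (g xs)[j := f a])"
  shows "multilinear_map K H m (T n) (\<lambda>xs. pt (g xs))"
  unfolding multilinear_map_def
proof (intro conjI ballI allI impI)
  show "(\<lambda>xs. pt (g xs)) \<in> tpow_basis H m \<rightarrow> carrier (T n)"
    using assms(1) by (auto intro: ptens_closed)
  fix xs i assume xs: "xs \<in> tpow_basis H m" and i: "i < m"
  obtain j f where j: "j < n" and f: "linear_map K H H f"
    and eq: "\<forall>a\<in>carrier H. g (xs[i := a]) = (g xs)[j := f a]"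
    using assms(2)[OF xs i] by blast
  have "linear_map K H (T n) (\<lambda>a. pt ((g xs)[j := f a]))"
    using assms(1)[OF xs] j f by (rule linear_map_pt_slot)
  then show "linear_map K H (T n) (\<lambda>a. pt (g (xs[i := a])))"
    using eq by (subst linear_map_cong[where g = "\<lambda>a. pt ((g xs)[j := f a])"]) auto
qed

lemma tpow_basis_length: "xs \<in> tpow_basis H n \<Longrightarrow> length xs = n"
  by (simp add: tpow_basis_def)

lemma map2_update_right:
  "i < length xs \<Longrightarrow> map2 f xs (ys[i := a]) = (map2 f xs ys)[i := f (xs ! i) a]"
proof (rule nth_equalityI)
  show "(map2 f xs (ys[i := a])) ! j = ((map2 f xs ys)[i := f (xs ! i) a]) ! j" if "j < length (map2 f xs (ys[i := a]))" for j
    using that by (cases "j = i") auto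
qed simp

lemma map2_update_left:
  "i < length ys \<Longrightarrow> map2 f (xs[i := a]) ys = (map2 f xs ys)[i := f a (ys ! i)]"
proof (rule nth_equalityI)
  show "(map2 f (xs[i := a]) ys) ! j = ((map2 f xs ys)[i := f a (ys ! i)]) ! j" if "j < length (map2 f (xs[i := a]) ys)" for j
    using that by (cases "j = i") auto
qed simp

lemma map2_mult_basis:
  assumes "xs \<in> tpow_basis H n" "ys \<in> tpow_basis H n"
  shows "list_mult xs ys \<in> tpow_basis H n"
  by (rule tpow_basisI)
    (simp_all add: tpow_basis_length[OF assms(1)] tpow_basis_length[OF assms(2)]
      tpow_basis_nth[OF assms(1)] tpow_basis_nth[OF assms(2)])

lemma multilinear_map2_right:
  assumes "xs \<in> tpow_basis H n"
  shows "multilinear_map K H n (T n) (\<lambda>ys. pt (list_mult xs ys))"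
proof (rule multilinear_map_pt_comp)
  fix ys i assume i: "i < n"
  show "\<exists>j<n. \<exists>f. linear_map K H H f \<and> (\<forall>a\<in>carrier H.
      list_mult xs (ys[i := a]) = (list_mult xs ys)[j := f a])"
    using assms i tpow_basis_nth[OF assms i]
    by (intro exI[of _ i] exI[of _ "\<lambda>a. xs ! i \<cdot> a"] conjI linear_intros unital_algebra_self)
      (auto simp: map2_update_right tpow_basis_def)
qed (use assms map2_mult_basis in auto)

lemma multilinear_map2_left:
  assumes "ys \<in> tpow_basis H n"
  shows "multilinear_map K H n (T n) (\<lambda>xs. pt (list_mult xs ys))"
proof (rule multilinear_map_pt_comp)
  fix xs i assume i: "i < n"
  show "\<exists>j<n. \<exists>f. linear_map K H H f \<and> (\<forall>a\<in>carrier H.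
      list_mult (xs[i := a]) ys = (list_mult xs ys)[j := f a])"
    using assms i tpow_basis_nth[OF assms i]
    by (intro exI[of _ i] exI[of _ "\<lambda>a. a \<cdot> ys ! i"] conjI linear_intros unital_algebra_self)
      (auto simp: map2_update_left tpow_basis_def)
qed (use assms map2_mult_basis in auto)

lemma lin_ext_tpow: "lin_ext K (T n) = lin_ext K (tpow_module K H n)"
  by (rule lin_ext_module_cong) (simp_all add: tpow_fields)

lemma tpow_mult_def:
  "s \<otimes>\<^bsub>T n\<^esub> t = lin_ext K (T n) (\<lambda>xs. lin_ext K (T n) (\<lambda>ys. pt (list_mult xs ys)) t) s"
  unfolding lin_ext_tpow by (simp add: tpow_def)

lemma tpow_one: "\<one>\<^bsub>T n\<^esub> = pt (replicate n \<one>\<^sub>H)"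
  by (simp add: tpow_def)

lemma replicate_one_basis: "replicate n \<one>\<^sub>H \<in> tpow_basis H n"
  by (auto simp: tpow_basis_def)

lemma tpow_mult_multilinear:
  assumes "t \<in> carrier (T n)"
  shows "multilinear_map K H n (T n) (\<lambda>xs. lin_ext K (T n) (\<lambda>ys. pt (list_mult xs ys)) t)"
  unfolding multilinear_map_def
proof (intro conjI ballI allI impI funcsetI)
  fix xs assume "xs \<in> tpow_basis H n"
  then show "lin_ext K (T n) (\<lambda>ys. pt (list_mult xs ys)) t \<in> carrier (T n)"
    using assms by (intro linear_map_closed[OF linear_map_lin_ext_tpow[where H = H and n = n]]
        multilinear_map2_right) simp_all
next
  fix xs i assume xs: "xs \<in> tpow_basis H n" and i: "i < n"
  show "linear_map K H (T n)
      (\<lambda>a. lin_ext K (T n) (\<lambda>ys. pt (list_mult (xs[i := a]) ys)) t)"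
  proof (rule linear_map_lin_ext_tpow_param[OF _ _ _ assms])
    fix ys assume "ys \<in> tpow_basis H n"
    then show "linear_map K H (T n) (\<lambda>a. pt (list_mult (xs[i := a]) ys))"
      using multilinear_map2_left xs i by (simp add: multilinear_map_def)
  qed simp_all
qed

lemma tpow_mult_linear_left:
  "t \<in> carrier (T n) \<Longrightarrow> linear_map K (T n) (T n) (\<lambda>s. s \<otimes>\<^bsub>T n\<^esub> t)"
  unfolding tpow_mult_def by (intro linear_map_lin_ext_tpow tpow_mult_multilinear) simp_all

lemma tpow_mult_linear_right:
  "s \<in> carrier (T n) \<Longrightarrow> linear_map K (T n) (T n) (\<lambda>t. s \<otimes>\<^bsub>T n\<^esub> t)"
  unfolding tpow_mult_def
  by (intro linear_map_lin_ext_tpow_param linear_map_lin_ext_tpow multilinear_map2_right) simp_all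

lemma tpow_mult_closed:
  "\<lbrakk>s \<in> carrier (T n); t \<in> carrier (T n)\<rbrakk> \<Longrightarrow> s \<otimes>\<^bsub>T n\<^esub> t \<in> carrier (T n)"
  by (rule linear_map_closed[OF tpow_mult_linear_left])

text \<open>The product of tensor powers is defined by two nested linear extensions; on pure tensors it is the
  legwise product.\<close>

lemma ptens_mult:
  assumes "xs \<in> tpow_basis H n" "ys \<in> tpow_basis H n"
  shows "pt xs \<otimes>\<^bsub>T n\<^esub> pt ys = pt (list_mult xs ys)"
  unfolding tpow_mult_def using assms
  by (simp add: lin_ext_ptens[where n = n] tpow_mult_multilinear multilinear_map2_right ptens_closed)

lemma unital_algebra_tpow [simp]: "unital_algebra K (T n)"
proof -
  interpret T: module K "T n" by (rule module_tpow) simp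
  note lin = tpow_mult_linear_left tpow_mult_linear_right
  have one_closed: "\<one>\<^bsub>T n\<^esub> \<in> carrier (T n)"
    using replicate_one_basis by (simp add: tpow_one ptens_closed)
  have l_one: "\<forall>s\<in>carrier (T n). \<one>\<^bsub>T n\<^esub> \<otimes>\<^bsub>T n\<^esub> s = s"
  proof (rule tpow_ext)
    fix xs assume xs: "xs \<in> tpow_basis H n"
    have "list_mult (replicate n \<one>\<^sub>H) xs = xs"
      by (rule nth_equalityI) (simp_all add: tpow_basis_length[OF xs] tpow_basis_nth[OF xs])
    then show "\<one>\<^bsub>T n\<^esub> \<otimes>\<^bsub>T n\<^esub> pt xs = pt xs"
      using xs by (simp add: tpow_one ptens_mult replicate_one_basis)
  qed (auto intro: lin one_closed linear_map_id)
  have r_one: "\<forall>s\<in>carrier (T n). s \<otimes>\<^bsub>T n\<^esub> \<one>\<^bsub>T n\<^esub> = s"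
  proof (rule tpow_ext)
    fix xs assume xs: "xs \<in> tpow_basis H n"
    have "list_mult xs (replicate n \<one>\<^sub>H) = xs"
      by (rule nth_equalityI) (simp_all add: tpow_basis_length[OF xs] tpow_basis_nth[OF xs])
    then show "pt xs \<otimes>\<^bsub>T n\<^esub> \<one>\<^bsub>T n\<^esub> = pt xs"
      using xs by (simp add: tpow_one ptens_mult replicate_one_basis)
  qed (auto intro: lin one_closed linear_map_id)
  have "\<forall>s\<in>carrier (T n). (s \<otimes>\<^bsub>T n\<^esub> t) \<otimes>\<^bsub>T n\<^esub> u = s \<otimes>\<^bsub>T n\<^esub> (t \<otimes>\<^bsub>T n\<^esub> u)"
    if t: "t \<in> carrier (T n)" and u: "u \<in> carrier (T n)" for t u
  proof (rule tpow_ext)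
    fix xs assume xs: "xs \<in> tpow_basis H n"
    have "\<forall>t\<in>carrier (T n). (pt xs \<otimes>\<^bsub>T n\<^esub> t) \<otimes>\<^bsub>T n\<^esub> u = pt xs \<otimes>\<^bsub>T n\<^esub> (t \<otimes>\<^bsub>T n\<^esub> u)"
    proof (rule tpow_ext)
      fix ys assume ys: "ys \<in> tpow_basis H n"
      have "\<forall>u\<in>carrier (T n). (pt xs \<otimes>\<^bsub>T n\<^esub> pt ys) \<otimes>\<^bsub>T n\<^esub> u = pt xs \<otimes>\<^bsub>T n\<^esub> (pt ys \<otimes>\<^bsub>T n\<^esub> u)"
      proof (rule tpow_ext)
        fix zs assume zs: "zs \<in> tpow_basis H n"
        have "list_mult (list_mult xs ys) zs
            = list_mult xs (list_mult ys zs)"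
          by (rule nth_equalityI)
            (simp_all add: tpow_basis_length[OF xs] tpow_basis_length[OF ys] tpow_basis_length[OF zs]
              tpow_basis_nth[OF xs] tpow_basis_nth[OF ys] tpow_basis_nth[OF zs] H.m_assoc)
        then show "(pt xs \<otimes>\<^bsub>T n\<^esub> pt ys) \<otimes>\<^bsub>T n\<^esub> pt zs = pt xs \<otimes>\<^bsub>T n\<^esub> (pt ys \<otimes>\<^bsub>T n\<^esub> pt zs)"
          using xs ys zs by (simp add: ptens_mult map2_mult_basis)
      qed (use xs ys in \<open>auto intro!: linear_map_comp[OF lin(2) lin(2)] lin ptens_closed tpow_mult_closed\<close>)
      then show "(pt xs \<otimes>\<^bsub>T n\<^esub> pt ys) \<otimes>\<^bsub>T n\<^esub> u = pt xs \<otimes>\<^bsub>T n\<^esub> (pt ys \<otimes>\<^bsub>T n\<^esub> u)" using u by blast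
    qed (use xs u in \<open>auto intro!: linear_map_comp[OF lin(1) lin(2)] linear_map_comp[OF lin(2) lin(1)]
          ptens_closed tpow_mult_closed\<close>)
    then show "(pt xs \<otimes>\<^bsub>T n\<^esub> t) \<otimes>\<^bsub>T n\<^esub> u = pt xs \<otimes>\<^bsub>T n\<^esub> (t \<otimes>\<^bsub>T n\<^esub> u)" using t by blast
  qed (use t u in \<open>auto intro!: linear_map_comp[OF lin(1) lin(1)] lin ptens_closed tpow_mult_closed\<close>)
  then have assoc: "(s \<otimes>\<^bsub>T n\<^esub> t) \<otimes>\<^bsub>T n\<^esub> u = s \<otimes>\<^bsub>T n\<^esub> (t \<otimes>\<^bsub>T n\<^esub> u)"
    if "s \<in> carrier (T n)" "t \<in> carrier (T n)" "u \<in> carrier (T n)" for s t u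
    using that by blast
  have "ring (T n)"
  proof (rule ringI)
    show "monoid (T n)"
      using tpow_mult_closed one_closed assoc l_one r_one by (intro monoidI) auto
  qed (use linear_map_add[OF lin(1)] linear_map_add[OF lin(2)] T.M.abelian_group_axioms in auto)
  then show ?thesis
    using linear_map_smult[OF lin(1)] linear_map_smult[OF lin(2)] T.module_axioms
    by (intro unital_algebra.intro unital_algebra_axioms.intro) auto
qed

interpretation T: unital_algebra K "T n" for n by (rule unital_algebra_tpow)

text \<open>Multiplicativity is linear in both factors, so it is enough to have it for pure tensors.\<close>

lemma alg_hom_tpowI:
  assumes A: "unital_algebra K A" and f: "linear_map K (T n) A f" and one: "f \<one>\<^bsub>T n\<^esub> = \<one>\<^bsub>A\<^esub>"
    and mult: "\<And>xs ys. \<lbrakk>xs \<in> tpow_basis H n; ys \<in> tpow_basis H n\<rbrakk> \<Longrightarrow>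
      f (pt (list_mult xs ys)) = f (pt xs) \<otimes>\<^bsub>A\<^esub> f (pt ys)"
  shows "alg_hom K (T n) A f"
proof -
  interpret A: unital_algebra K A by fact
  have "\<forall>s\<in>carrier (T n). f (s \<otimes>\<^bsub>T n\<^esub> t) = f s \<otimes>\<^bsub>A\<^esub> f t" if t: "t \<in> carrier (T n)" for t
  proof (rule tpow_ext)
    fix xs assume xs: "xs \<in> tpow_basis H n"
    have "\<forall>t\<in>carrier (T n). f (pt xs \<otimes>\<^bsub>T n\<^esub> t) = f (pt xs) \<otimes>\<^bsub>A\<^esub> f t"
    proof (rule tpow_ext)
      show "linear_map K (T n) A (\<lambda>t. f (pt xs \<otimes>\<^bsub>T n\<^esub> t))"
        by (intro linear_map_comp[OF f] linear_intros) (simp_all add: xs ptens_closed)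
      show "linear_map K (T n) A (\<lambda>t. f (pt xs) \<otimes>\<^bsub>A\<^esub> f t)"
        by (intro linear_intros f A linear_map_closed[OF f] ptens_closed xs) simp
    qed (use xs mult in \<open>simp_all add: ptens_mult\<close>)
    then show "f (pt xs \<otimes>\<^bsub>T n\<^esub> t) = f (pt xs) \<otimes>\<^bsub>A\<^esub> f t" using t by blast
  next
    show "linear_map K (T n) A (\<lambda>s. f (s \<otimes>\<^bsub>T n\<^esub> t))"
      by (intro linear_map_comp[OF f] linear_intros) (simp_all add: t)
    show "linear_map K (T n) A (\<lambda>s. f s \<otimes>\<^bsub>A\<^esub> f t)"
      by (intro linear_intros f A linear_map_closed[OF f] t)
  qed simp_all
  then show ?thesis using f one by (simp add: alg_hom_def)
qed

subsection \<open>Legs\<close>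

lemma length_two: "length xs = 2 \<longleftrightarrow> (\<exists>a b. xs = [a, b])"
  by (auto simp: numeral_2_eq_2 length_Suc_conv)

lemma length_three: "length xs = 3 \<longleftrightarrow> (\<exists>a b c. xs = [a, b, c])"
  by (auto simp: numeral_3_eq_3 length_Suc_conv)

lemma tpow2_cases:
  assumes "xs \<in> tpow_basis H 2"
  obtains a b where "xs = [a, b]" "a \<in> carrier H" "b \<in> carrier H"
  using assms by (auto simp: tpow_basis_def length_two)

lemma tpow3_cases:
  assumes "xs \<in> tpow_basis H 3"
  obtains a b c where "xs = [a, b, c]" "a \<in> carrier H" "b \<in> carrier H" "c \<in> carrier H"
  using assms by (auto simp: tpow_basis_def length_three)

lemma tpow2_ext:
  assumes "module K X" "linear_map K (T 2) X \<phi>" "linear_map K (T 2) X \<psi>"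
    and "\<And>a b. \<lbrakk>a \<in> carrier H; b \<in> carrier H\<rbrakk> \<Longrightarrow> \<phi> (pt [a, b]) = \<psi> (pt [a, b])"
  shows "\<forall>t\<in>carrier (T 2). \<phi> t = \<psi> t"
  using assms by (intro tpow_ext) (auto elim!: tpow2_cases)

lemma tpow3_ext:
  assumes "module K X" "linear_map K (T 3) X \<phi>" "linear_map K (T 3) X \<psi>"
    and "\<And>a b c. \<lbrakk>a \<in> carrier H; b \<in> carrier H; c \<in> carrier H\<rbrakk> \<Longrightarrow> \<phi> (pt [a, b, c]) = \<psi> (pt [a, b, c])"
  shows "\<forall>t\<in>carrier (T 3). \<phi> t = \<psi> t"
  using assms by (intro tpow_ext) (auto elim!: tpow3_cases)

text \<open>For equations in two variables: the first one is reduced to pure tensors while the second one is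
  still arbitrary, so that \<open>tpow2_ext\<close> or \<open>tpow3_ext\<close> applies to it afterwards.\<close>

lemma tpow2_ext2:
  assumes "module K X"
    and "\<And>y. y \<in> A \<Longrightarrow> linear_map K (T 2) X (\<lambda>t. \<phi> t y)" "\<And>y. y \<in> A \<Longrightarrow> linear_map K (T 2) X (\<lambda>t. \<psi> t y)"
    and "\<And>a b. \<lbrakk>a \<in> carrier H; b \<in> carrier H\<rbrakk> \<Longrightarrow> \<forall>y\<in>A. \<phi> (pt [a, b]) y = \<psi> (pt [a, b]) y"
  shows "\<forall>t\<in>carrier (T 2). \<forall>y\<in>A. \<phi> t y = \<psi> t y"
proof -
  have "\<forall>t\<in>carrier (T 2). \<phi> t y = \<psi> t y" if "y \<in> A" for y
    using that assms(4) by (intro tpow2_ext[OF assms(1-3)]) simp_all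
  then show ?thesis by simp
qed

lemma pt2_closed [simp]: "\<lbrakk>a \<in> carrier H; b \<in> carrier H\<rbrakk> \<Longrightarrow> pt [a, b] \<in> carrier (T 2)"
  by (rule ptens_closed) simp_all

lemma pt3_closed [simp]:
  "\<lbrakk>a \<in> carrier H; b \<in> carrier H; c \<in> carrier H\<rbrakk> \<Longrightarrow> pt [a, b, c] \<in> carrier (T 3)"
  by (rule ptens_closed) simp_all

lemma pt2_mult [simp]:
  "\<lbrakk>a \<in> carrier H; b \<in> carrier H; c \<in> carrier H; d \<in> carrier H\<rbrakk>
    \<Longrightarrow> pt [a, b] \<cdot>\<^sub>2 pt [c, d] = pt [a \<cdot> c, b \<cdot> d]"
  by (subst ptens_mult) simp_all

lemma pt3_mult [simp]:
  "\<lbrakk>a \<in> carrier H; b \<in> carrier H; c \<in> carrier H; d \<in> carrier H; e \<in> carrier H; f \<in> carrier H\<rbrakk>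
    \<Longrightarrow> pt [a, b, c] \<cdot>\<^sub>3 pt [d, e, f] = pt [a \<cdot> d, b \<cdot> e, c \<cdot> f]"
  by (subst ptens_mult) simp_all

lemma linear_map_pt2_1 [linear_intros]:
  "\<lbrakk>linear_map K V H f; b \<in> carrier H\<rbrakk> \<Longrightarrow> linear_map K V (T 2) (\<lambda>v. pt [f v, b])"
  using linear_map_pt_slot[of "[\<one>\<^sub>H, b]" 2 0 V f] by simp

lemma linear_map_pt2_2 [linear_intros]:
  "\<lbrakk>linear_map K V H f; a \<in> carrier H\<rbrakk> \<Longrightarrow> linear_map K V (T 2) (\<lambda>v. pt [a, f v])"
  using linear_map_pt_slot[of "[a, \<one>\<^sub>H]" 2 1 V f] by simp

lemma linear_map_leg2_param [linear_intros]:
  assumes "module K X" "module K U" "t \<in> carrier (T 2)"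
    and "\<And>a b. \<lbrakk>a \<in> carrier H; b \<in> carrier H\<rbrakk> \<Longrightarrow> linear_map K U X (\<lambda>u. f u a b)"
  shows "linear_map K U X (\<lambda>u. lin_ext K X (leg2 (f u)) t)"
  using assms by (intro linear_map_lin_ext_tpow_param[where n = 2])
    (auto simp: leg2_def elim!: tpow2_cases)

lemma linear_map_leg3_param [linear_intros]:
  assumes "module K X" "module K U" "t \<in> carrier (T 3)"
    and "\<And>a b c. \<lbrakk>a \<in> carrier H; b \<in> carrier H; c \<in> carrier H\<rbrakk> \<Longrightarrow> linear_map K U X (\<lambda>u. f u a b c)"
  shows "linear_map K U X (\<lambda>u. lin_ext K X (leg3 (f u)) t)"
  using assms by (intro linear_map_lin_ext_tpow_param[where n = 3])
    (auto simp: leg3_def elim!: tpow3_cases)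

lemma multilinear_leg2:
  assumes "\<And>b. b \<in> carrier H \<Longrightarrow> linear_map K H X (\<lambda>a. f a b)"
    and "\<And>a. a \<in> carrier H \<Longrightarrow> linear_map K H X (\<lambda>b. f a b)"
  shows "multilinear_map K H 2 X (leg2 f)"
  unfolding multilinear_map_def
  using assms linear_map_closed[OF assms(1)]
  by (auto elim!: tpow2_cases simp: leg2_def less_2_cases_iff)

lemma multilinear_leg3:
  assumes "\<And>b c. \<lbrakk>b \<in> carrier H; c \<in> carrier H\<rbrakk> \<Longrightarrow> linear_map K H X (\<lambda>a. f a b c)"
    and "\<And>a c. \<lbrakk>a \<in> carrier H; c \<in> carrier H\<rbrakk> \<Longrightarrow> linear_map K H X (\<lambda>b. f a b c)"
    and "\<And>a b. \<lbrakk>a \<in> carrier H; b \<in> carrier H\<rbrakk> \<Longrightarrow> linear_map K H X (\<lambda>c. f a b c)"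
  shows "multilinear_map K H 3 X (leg3 f)"
proof -
  have "i < 3 \<longleftrightarrow> i = 0 \<or> i = 1 \<or> i = 2" for i :: nat by auto
  then show ?thesis
    unfolding multilinear_map_def
    using assms linear_map_closed[OF assms(1)]
    by (auto elim!: tpow3_cases simp: leg3_def)
qed

lemma linear_map_leg2 [linear_intros]:
  assumes "module K X" "linear_map K U (T 2) g"
    and "\<And>b. b \<in> carrier H \<Longrightarrow> linear_map K H X (\<lambda>a. f a b)"
    and "\<And>a. a \<in> carrier H \<Longrightarrow> linear_map K H X (\<lambda>b. f a b)"
  shows "linear_map K U X (\<lambda>u. lin_ext K X (leg2 f) (g u))"
  using assms by (intro linear_map_comp[OF linear_map_lin_ext_tpow assms(2)] multilinear_leg2) simp_all

lemma lin_ext_leg2 [simp]: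
  assumes "module K X" "a \<in> carrier H" "b \<in> carrier H"
    and "\<And>b. b \<in> carrier H \<Longrightarrow> linear_map K H X (\<lambda>a. f a b)"
    and "\<And>a. a \<in> carrier H \<Longrightarrow> linear_map K H X (\<lambda>b. f a b)"
  shows "lin_ext K X (leg2 f) (pt [a, b]) = f a b"
  using assms by (subst lin_ext_ptens[OF _ _ multilinear_leg2]) (auto simp: leg2_def)

lemma linear_map_leg3 [linear_intros]:
  assumes "module K X" "linear_map K U (T 3) g"
    and "\<And>b c. \<lbrakk>b \<in> carrier H; c \<in> carrier H\<rbrakk> \<Longrightarrow> linear_map K H X (\<lambda>a. f a b c)"
    and "\<And>a c. \<lbrakk>a \<in> carrier H; c \<in> carrier H\<rbrakk> \<Longrightarrow> linear_map K H X (\<lambda>b. f a b c)"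
    and "\<And>a b. \<lbrakk>a \<in> carrier H; b \<in> carrier H\<rbrakk> \<Longrightarrow> linear_map K H X (\<lambda>c. f a b c)"
  shows "linear_map K U X (\<lambda>u. lin_ext K X (leg3 f) (g u))"
  using assms by (intro linear_map_comp[OF linear_map_lin_ext_tpow assms(2)] multilinear_leg3) simp_all

lemma lin_ext_leg3 [simp]:
  assumes "module K X" "a \<in> carrier H" "b \<in> carrier H" "c \<in> carrier H"
    and "\<And>b c. \<lbrakk>b \<in> carrier H; c \<in> carrier H\<rbrakk> \<Longrightarrow> linear_map K H X (\<lambda>a. f a b c)"
    and "\<And>a c. \<lbrakk>a \<in> carrier H; c \<in> carrier H\<rbrakk> \<Longrightarrow> linear_map K H X (\<lambda>b. f a b c)"
    and "\<And>a b. \<lbrakk>a \<in> carrier H; b \<in> carrier H\<rbrakk> \<Longrightarrow> linear_map K H X (\<lambda>c. f a b c)"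
  shows "lin_ext K X (leg3 f) (pt [a, b, c]) = f a b c"
  using assms by (subst lin_ext_ptens[OF _ _ multilinear_leg3]) (auto simp: leg3_def)

subsection \<open>Placing legs\<close>

definition place_list :: "nat \<Rightarrow> nat list \<Rightarrow> 'h list \<Rightarrow> 'h list" where
  "place_list n is xs =
     map (\<lambda>p. case map_of (zip is xs) p of None \<Rightarrow> \<one>\<^sub>H | Some x \<Rightarrow> x) [1..<Suc n]"

lemma length_place_list [simp]: "length (place_list n is xs) = n"
  by (simp add: place_list_def)

lemma place_list_nth:
  assumes "p < n"
  shows "place_list n is xs ! p = (case map_of (zip is xs) (Suc p) of None \<Rightarrow> \<one>\<^sub>H | Some x \<Rightarrow> x)"
  using assms by (simp add: place_list_def del: upt_Suc)

lemma place_list_nth_leg: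
  assumes "distinct is" "length xs = length is" "p < n"
  shows "i < length is \<Longrightarrow> is ! i = Suc p \<Longrightarrow> place_list n is xs ! p = xs ! i"
    and "Suc p \<notin> set is \<Longrightarrow> place_list n is xs ! p = \<one>\<^sub>H"
proof -
  show "place_list n is xs ! p = xs ! i" if "i < length is" "is ! i = Suc p"
  proof -
    have "(Suc p, xs ! i) \<in> set (zip is xs)"
      using that assms by (auto simp: in_set_zip intro!: exI[of _ i])
    then have "map_of (zip is xs) (Suc p) = Some (xs ! i)"
      using assms by (intro map_of_is_SomeI) auto
    then show ?thesis by (simp add: place_list_nth assms)
  qed
  show "place_list n is xs ! p = \<one>\<^sub>H" if "Suc p \<notin> set is"
  proof -
    have None: "map_of (zip is xs) (Suc p) = None" using that assms by simp
    show ?thesis unfolding place_list_nth[OF assms(3)] None by simp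
  qed
qed

context
  fixes n m :: nat and "is" :: "nat list"
  assumes ok: "distinct is" "set is \<subseteq> {1..n}" "length is = m"
begin

text \<open>A position either carries the leg of a uniquely determined index or is filled with the unit; the
  distinction depends only on the positions \<open>is\<close>, so that it can be made before the legs are known.\<close>

lemma place_list_cases:
  assumes "p < n"
  obtains i where "i < m" "is ! i = Suc p" "\<And>xs. length xs = m \<Longrightarrow> place_list n is xs ! p = xs ! i"
  | "Suc p \<notin> set is" "\<And>xs. length xs = m \<Longrightarrow> place_list n is xs ! p = \<one>\<^sub>H"
  using place_list_nth_leg[OF ok(1) _ assms] ok(3)
  by (cases "Suc p \<in> set is") (auto simp: in_set_conv_nth)

lemma place_list_basis: "xs \<in> tpow_basis H m \<Longrightarrow> place_list n is xs \<in> tpow_basis H n"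
proof (rule tpow_basisI)
  fix p assume xs: "xs \<in> tpow_basis H m" and p: "p < n"
  then have l: "length xs = m" by (simp add: tpow_basis_def)
  show "place_list n is xs ! p \<in> carrier H"
    by (rule place_list_cases[OF p]) (use l xs in \<open>auto simp: tpow_basis_nth\<close>)
qed simp

lemma place_list_update:
  assumes "length xs = m" "i < m"
  shows "place_list n is (xs[i := a]) = (place_list n is xs)[is ! i - 1 := a]"
proof (rule nth_equalityI)
  fix p assume "p < length (place_list n is (xs[i := a]))"
  then have p: "p < n" by simp
  have pos: "is ! k \<ge> 1" if "k < m" for k
    using ok(2,3) that nth_mem[of k "is"] by force
  have inj: "is ! k = is ! i \<longleftrightarrow> k = i" if "k < m" for k
    using ok(1,3) that assms(2) by (simp add: nth_eq_iff_index_eq)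
  show "place_list n is (xs[i := a]) ! p = (place_list n is xs)[is ! i - 1 := a] ! p"
  proof (rule place_list_cases[OF p])
    fix k assume k: "k < m" "is ! k = Suc p"
      and eq: "\<And>xs. length xs = m \<Longrightarrow> place_list n is xs ! p = xs ! k"
    have "is ! i - 1 = p \<longleftrightarrow> k = i" using inj[OF k(1)] k pos[OF assms(2)] by auto
    then show ?thesis using k p assms eq by (auto simp: nth_list_update)
  next
    assume np: "Suc p \<notin> set is" and eq: "\<And>xs. length xs = m \<Longrightarrow> place_list n is xs ! p = \<one>\<^sub>H"
    have "is ! i \<noteq> Suc p" using np nth_mem[of i "is"] assms(2) ok(3) by metis
    then have "is ! i - 1 \<noteq> p" using pos[OF assms(2)] by auto
    then show ?thesis using assms eq by simp
  qed
qed simp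

lemma multilinear_place: "multilinear_map K H m (T n) (\<lambda>xs. pt (place_list n is xs))"
proof (rule multilinear_map_pt_comp)
  fix xs i assume xs: "xs \<in> tpow_basis H m" and i: "i < m"
  have "is ! i \<in> {1..n}" using ok(2,3) i nth_mem[of i "is"] by blast
  then show "\<exists>j<n. \<exists>f. linear_map K H H f \<and>
      (\<forall>a\<in>carrier H. place_list n is (xs[i := a]) = (place_list n is xs)[j := f a])"
    using xs i by (intro exI[of _ "is ! i - 1"] exI[of _ "\<lambda>a. a"] conjI linear_map_id)
      (auto simp: place_list_update tpow_basis_def)
qed (rule place_list_basis)

lemma place_eq: "place K H n is = lin_ext K (T n) (\<lambda>xs. pt (place_list n is xs))"
  by (simp add: place_def place_list_def fun_eq_iff)

lemma place_pt: "xs \<in> tpow_basis H m \<Longrightarrow> P n is (pt xs) = pt (place_list n is xs)"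
  unfolding place_eq using lin_ext_ptens[OF _ _ multilinear_place] by simp

lemma place_linear: "linear_map K (T m) (T n) (P n is)"
  unfolding place_eq by (intro linear_map_lin_ext_tpow multilinear_place) simp_all

lemma place_alg_hom: "alg_hom K (T m) (T n) (P n is)"
proof (rule alg_hom_tpowI[OF unital_algebra_tpow place_linear])
  have "place_list n is (replicate m \<one>\<^sub>H) = replicate n \<one>\<^sub>H"
  proof (rule nth_equalityI)
    fix p assume "p < length (place_list n is (replicate m \<one>\<^sub>H))"
    then have p: "p < n" by simp
    then show "place_list n is (replicate m \<one>\<^sub>H) ! p = replicate n \<one>\<^sub>H ! p"
      using p by (cases rule: place_list_cases) simp_all
  qed simp
  then show "P n is \<one>\<^bsub>T m\<^esub> = \<one>\<^bsub>T n\<^esub>"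
    by (simp add: tpow_one place_pt replicate_one_basis)
next
  fix xs ys assume xs: "xs \<in> tpow_basis H m" and ys: "ys \<in> tpow_basis H m"
  have l: "length xs = m" "length ys = m" using xs ys by (simp_all add: tpow_basis_def)
  have "place_list n is (list_mult xs ys)
      = list_mult (place_list n is xs) (place_list n is ys)"
  proof (rule nth_equalityI)
    fix p assume "p < length (place_list n is (list_mult xs ys))"
    then have p: "p < n" by simp
    then show "place_list n is (list_mult xs ys) ! p
        = list_mult (place_list n is xs) (place_list n is ys) ! p"
      using p by (cases rule: place_list_cases) (simp_all add: l)
  qed simp
  then show "P n is (pt (list_mult xs ys))
      = P n is (pt xs) \<otimes>\<^bsub>T n\<^esub> P n is (pt ys)"
    using xs ys by (simp add: place_pt map2_mult_basis ptens_mult place_list_basis)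
qed

end

lemma place_list_2: "place_list 2 is xs =
    map (\<lambda>p. case map_of (zip is xs) p of None \<Rightarrow> \<one>\<^sub>H | Some x \<Rightarrow> x) [1, 2]"
  and place_list_3: "place_list 3 is xs =
    map (\<lambda>p. case map_of (zip is xs) p of None \<Rightarrow> \<one>\<^sub>H | Some x \<Rightarrow> x) [1, 2, 3]"
  and place_list_4: "place_list 4 is xs =
    map (\<lambda>p. case map_of (zip is xs) p of None \<Rightarrow> \<one>\<^sub>H | Some x \<Rightarrow> x) [1, 2, 3, 4]"
  unfolding place_list_def by (simp_all add: upt_rec numeral_eq_Suc)

lemmas place_list_simps = place_list_2 place_list_3 place_list_4

lemma linear_map_place2 [linear_intros]:
  "\<lbrakk>linear_map K V (T 2) f; i \<noteq> j; i \<in> {1..n}; j \<in> {1..n}\<rbrakk>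
    \<Longrightarrow> linear_map K V (T n) (\<lambda>v. P n [i, j] (f v))"
  by (rule linear_map_comp[OF place_linear]) auto

lemma linear_map_place3 [linear_intros]:
  "\<lbrakk>linear_map K V (T 3) f; distinct [i, j, k]; i \<in> {1..n}; j \<in> {1..n}; k \<in> {1..n}\<rbrakk>
    \<Longrightarrow> linear_map K V (T n) (\<lambda>v. P n [i, j, k] (f v))"
  by (rule linear_map_comp[OF place_linear]) auto

lemma place2_closed [simp]:
  "\<lbrakk>X \<in> carrier (T 2); i \<noteq> j; i \<in> {1..n}; j \<in> {1..n}\<rbrakk> \<Longrightarrow> P n [i, j] X \<in> carrier (T n)"
  by (rule linear_map_closed[OF linear_map_place2[OF linear_map_id]])

lemma place3_closed [simp]:
  "\<lbrakk>X \<in> carrier (T 3); distinct [i, j, k]; i \<in> {1..n}; j \<in> {1..n}; k \<in> {1..n}\<rbrakk>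
    \<Longrightarrow> P n [i, j, k] X \<in> carrier (T n)"
  by (rule linear_map_closed[OF linear_map_place3[OF linear_map_id]])

lemma place2_pt [simp]:
  "\<lbrakk>a \<in> carrier H; b \<in> carrier H; i \<noteq> j; i \<in> {1..n}; j \<in> {1..n}\<rbrakk>
    \<Longrightarrow> P n [i, j] (pt [a, b]) = pt (place_list n [i, j] [a, b])"
  by (rule place_pt[where m = 2]) auto

lemma place3_pt [simp]:
  "\<lbrakk>a \<in> carrier H; b \<in> carrier H; c \<in> carrier H; distinct [i, j, k]; i \<in> {1..n}; j \<in> {1..n}; k \<in> {1..n}\<rbrakk>
    \<Longrightarrow> P n [i, j, k] (pt [a, b, c]) = pt (place_list n [i, j, k] [a, b, c])"
  by (rule place_pt[where m = 3]) auto

lemma place2_mult [simp]: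
  "\<lbrakk>X \<in> carrier (T 2); Y \<in> carrier (T 2); i \<noteq> j; i \<in> {1..n}; j \<in> {1..n}\<rbrakk>
    \<Longrightarrow> P n [i, j] (X \<cdot>\<^sub>2 Y) = P n [i, j] X \<otimes>\<^bsub>T n\<^esub> P n [i, j] Y"
  by (rule alg_hom_mult[OF place_alg_hom]) auto

lemma place3_mult [simp]:
  "\<lbrakk>X \<in> carrier (T 3); Y \<in> carrier (T 3); distinct [i, j, k]; i \<in> {1..n}; j \<in> {1..n}; k \<in> {1..n}\<rbrakk>
    \<Longrightarrow> P n [i, j, k] (X \<cdot>\<^sub>3 Y) = P n [i, j, k] X \<otimes>\<^bsub>T n\<^esub> P n [i, j, k] Y"
  by (rule alg_hom_mult[OF place_alg_hom]) auto

lemma place2_one [simp]: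
  "\<lbrakk>i \<noteq> j; i \<in> {1..n}; j \<in> {1..n}\<rbrakk> \<Longrightarrow> P n [i, j] \<one>\<^bsub>T 2\<^esub> = \<one>\<^bsub>T n\<^esub>"
  by (rule alg_hom_one[OF place_alg_hom]) auto

lemma nth_leg: "\<lbrakk>set js \<subseteq> A; length js = m; i \<in> {1..m}\<rbrakk> \<Longrightarrow> js ! (i - 1) \<in> A"
  by (auto intro!: subsetD[of "set js" A] nth_mem)

lemma place_list_place_list:
  assumes "distinct is" "set is \<subseteq> {1..m}" "distinct js" "set js \<subseteq> {1..n}" "length js = m"
    and xs: "length xs = length is"
  shows "place_list n js (place_list m is xs) = place_list n (map (\<lambda>i. js ! (i - 1)) is) xs"
proof (rule nth_equalityI)
  let ?ks = "map (\<lambda>i. js ! (i - 1)) is"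
  have inj: "inj_on (\<lambda>i. js ! (i - 1)) (set is)"
  proof (rule inj_onI)
    fix i i' assume i: "i \<in> set is" "i' \<in> set is" "js ! (i - 1) = js ! (i' - 1)"
    then have "i \<in> {1..m}" "i' \<in> {1..m}" using assms(2) by auto
    then show "i = i'" using i(3) assms(3,5) by (auto simp: nth_eq_iff_index_eq)
  qed
  have ks: "distinct ?ks" using assms(1) inj by (simp add: distinct_map)
  fix p assume "p < length (place_list n js (place_list m is xs))"
  then have p: "p < n" by simp
  show "place_list n js (place_list m is xs) ! p = place_list n ?ks xs ! p"
  proof (cases "Suc p \<in> set js")
    case True
    then obtain q where q: "q < m" "js ! q = Suc p" using assms(5) by (auto simp: in_set_conv_nth)
    then have eq: "place_list n js (place_list m is xs) ! p = place_list m is xs ! q"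
      using p assms by (intro place_list_nth_leg) auto
    show ?thesis
    proof (cases "Suc q \<in> set is")
      case True
      then obtain i where i: "i < length is" "is ! i = Suc q" by (auto simp: in_set_conv_nth)
      have "place_list m is xs ! q = xs ! i" using i q assms by (intro place_list_nth_leg) auto
      moreover have "place_list n ?ks xs ! p = xs ! i"
        using i q p xs ks by (intro place_list_nth_leg) auto
      ultimately show ?thesis using eq by simp
    next
      case False
      have "Suc p \<notin> set ?ks"
      proof
        assume "Suc p \<in> set ?ks"
        then obtain i where i: "i \<in> set is" "js ! (i - 1) = Suc p" by auto
        then have "i \<in> {1..m}" using assms(2) by auto
        then have "i - 1 < length js" using assms(5) by auto
        then have "i - 1 = q"
          using i(2) q assms(3,5) nth_eq_iff_index_eq[of js "i - 1" q] by simp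
        then show False using False i(1) \<open>i \<in> {1..m}\<close> by auto
      qed
      then have "place_list n ?ks xs ! p = \<one>\<^sub>H" using p xs ks by (intro place_list_nth_leg) auto
      moreover have "place_list m is xs ! q = \<one>\<^sub>H"
        using False q assms by (intro place_list_nth_leg) auto
      ultimately show ?thesis using eq by simp
    qed
  next
    case False
    have "set ?ks \<subseteq> set js" using nth_leg[of js "set js" m] assms(2,5) by auto
    then have "Suc p \<notin> set ?ks" using False by auto
    then have "place_list n ?ks xs ! p = \<one>\<^sub>H" using p xs ks by (intro place_list_nth_leg) auto
    moreover have "place_list n js (place_list m is xs) ! p = \<one>\<^sub>H"
      using False p assms by (intro place_list_nth_leg) auto
    ultimately show ?thesis by simp
  qed
qed simp

lemma place_place2 [simp]:
  assumes js: "distinct js" "set js \<subseteq> {1..n}" "length js = m"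
    and ij: "i \<noteq> j" "i \<in> {1..m}" "j \<in> {1..m}" and X: "X \<in> carrier (T 2)"
  shows "P n js (P m [i, j] X) = P n [js ! (i - 1), js ! (j - 1)] X"
proof -
  have ne: "js ! (i - 1) \<noteq> js ! (j - 1)" "js ! (i - 1) \<in> {1..n}" "js ! (j - 1) \<in> {1..n}"
    using nth_leg[OF js(2,3) ij(2)] nth_leg[OF js(2,3) ij(3)] js ij
    by (auto simp: nth_eq_iff_index_eq)
  have "\<forall>X\<in>carrier (T 2). P n js (P m [i, j] X) = P n [js ! (i - 1), js ! (j - 1)] X"
  proof (rule tpow2_ext)
    show "linear_map K (T 2) (T n) (\<lambda>X. P n js (P m [i, j] X))"
      using ij by (intro linear_map_comp[OF place_linear[OF js] place_linear]) auto
    show "linear_map K (T 2) (T n) (P n [js ! (i - 1), js ! (j - 1)])"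
      using ne by (intro place_linear) auto
    fix a b assume ab: "a \<in> carrier H" "b \<in> carrier H"
    have "place_list m [i, j] [a, b] \<in> tpow_basis H m"
      using ij ab by (intro place_list_basis[where m = 2]) auto
    then show "P n js (P m [i, j] (pt [a, b]))
        = P n [js ! (i - 1), js ! (j - 1)] (pt [a, b])"
      using ab ij js ne by (simp add: place_pt[OF js] place_list_place_list del: One_nat_def)
  qed simp
  then show ?thesis using X by blast
qed

end

declare One_nat_def [simp del] \<comment> \<open>leg positions stay numerals, as in \<open>P 3 [1, 2]\<close> and \<open>D 2 1\<close>\<close>

lemma drop_Cons_1 [simp]: "drop 1 (x # xs) = xs"
  by (simp add: One_nat_def)

section \<open>Coproducts on the legs of a tensor power\<close>

context unital_algebra
begin

lemma pt4_closed [simp]: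
  "\<lbrakk>a \<in> carrier H; b \<in> carrier H; c \<in> carrier H; d \<in> carrier H\<rbrakk> \<Longrightarrow> pt [a, b, c, d] \<in> carrier (T 4)"
  by (rule ptens_closed) simp_all

lemma pt4_mult [simp]:
  "\<lbrakk>a \<in> carrier H; b \<in> carrier H; c \<in> carrier H; d \<in> carrier H;
    e \<in> carrier H; f \<in> carrier H; g \<in> carrier H; h \<in> carrier H\<rbrakk>
    \<Longrightarrow> pt [a, b, c, d] \<cdot>\<^sub>4 pt [e, f, g, h]
      = pt [a \<cdot> e, b \<cdot> f, c \<cdot> g, d \<cdot> h]"
  by (subst ptens_mult) simp_all

lemma pt2_one: "pt [\<one>\<^sub>H, \<one>\<^sub>H] = \<one>\<^bsub>T 2\<^esub>"
  by (simp add: tpow_one numeral_eq_Suc)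

lemma pt3_one: "pt [\<one>\<^sub>H, \<one>\<^sub>H, \<one>\<^sub>H] = \<one>\<^bsub>T 3\<^esub>"
  by (simp add: tpow_one numeral_eq_Suc)

lemma pt4_one: "pt [\<one>\<^sub>H, \<one>\<^sub>H, \<one>\<^sub>H, \<one>\<^sub>H] = \<one>\<^bsub>T 4\<^esub>"
  by (simp add: tpow_one numeral_eq_Suc)

end

text \<open>The theory of \<open>comul_at\<close> is needed for \<open>H\<close> and for its twist, and for the latter before the twisted
  reassociator is known to satisfy the axioms of a quasi-bialgebra.\<close>

locale coproduct_algebra = unital_algebra K H
  for K :: "'k ring" (structure) and H :: "('k, 'h) quasi_hopf" (structure) +
  assumes comul_alg_hom: "alg_hom K H (tpow K H 2) (comul H)"
begin

interpretation T: unital_algebra K "T n" for n by (rule unital_algebra_tpow)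

lemmas comul_closed [simp] = alg_hom_closed[OF comul_alg_hom]
lemmas comul_mult [simp] = alg_hom_mult[OF comul_alg_hom]
lemmas comul_one [simp] = alg_hom_one[OF comul_alg_hom]

lemma linear_map_comul [linear_intros]:
  "linear_map K V H f \<Longrightarrow> linear_map K V (T 2) (\<lambda>v. comul H (f v))"
  by (rule linear_map_comp[OF alg_hom_linear[OF comul_alg_hom]])

subsection \<open>The coproduct on one leg\<close>

abbreviation D :: "nat \<Rightarrow> nat \<Rightarrow> ('h list \<Rightarrow> 'k) set \<Rightarrow> ('h list \<Rightarrow> 'k) set" where
  "D \<equiv> comul_at K H"

text \<open>The value of \<open>comul_at\<close> on the pure tensor with legs \<open>xs\<close> is the case \<open>Z = \<Delta>(xs\<^sub>i)\<close>. A free \<open>Z\<close>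
  allows arguments by linearity in \<open>Z\<close>, although \<open>\<Delta>(xs\<^sub>i)\<close> is not a pure tensor.\<close>

definition insert_legs :: "nat \<Rightarrow> nat \<Rightarrow> 'h list \<Rightarrow> ('h list \<Rightarrow> 'k) set \<Rightarrow> ('h list \<Rightarrow> 'k) set" where
  "insert_legs n i xs Z = lin_ext K (T (Suc n)) (\<lambda>ys. pt (take (i - 1) xs @ ys @ drop i xs)) Z"

context
  fixes n i :: nat assumes i: "0 < i" "i \<le> n"
begin

lemma insert_list_basis:
  assumes "xs \<in> tpow_basis H n" "ys \<in> tpow_basis H 2"
  shows "take (i - 1) xs @ ys @ drop i xs \<in> tpow_basis H (Suc n)"
  using assms i by (auto simp: tpow_basis_def dest!: in_set_takeD in_set_dropD)

lemma multilinear_insert_legs: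
  assumes "xs \<in> tpow_basis H n"
  shows "multilinear_map K H 2 (T (Suc n)) (\<lambda>ys. pt (take (i - 1) xs @ ys @ drop i xs))"
proof (rule multilinear_map_pt_comp)
  fix ys and k :: nat assume ys: "ys \<in> tpow_basis H 2" and k: "k < 2"
  have l: "length xs = n" "length ys = 2" using assms ys by (simp_all add: tpow_basis_def)
  then have "take (i - 1) xs @ ys[k := a] @ drop i xs
      = (take (i - 1) xs @ ys @ drop i xs)[i - 1 + k := a]" for a
    using i k by (auto simp: list_update_append)
  then show "\<exists>j<Suc n. \<exists>f. linear_map K H H f \<and> (\<forall>a\<in>carrier H.
      take (i - 1) xs @ ys[k := a] @ drop i xs = (take (i - 1) xs @ ys @ drop i xs)[j := f a])"
    using i k by (intro exI[of _ "i - 1 + k"] exI[of _ "\<lambda>a. a"] conjI linear_map_id) auto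
qed (rule insert_list_basis[OF assms])

lemma linear_map_insert_legs:
  assumes "linear_map K V (T 2) f" "xs \<in> tpow_basis H n"
  shows "linear_map K V (T (Suc n)) (\<lambda>v. insert_legs n i xs (f v))"
  unfolding insert_legs_def
  by (intro linear_map_comp[OF linear_map_lin_ext_tpow assms(1)] multilinear_insert_legs assms(2)) simp_all

lemma insert_legs_pt:
  "\<lbrakk>xs \<in> tpow_basis H n; ys \<in> tpow_basis H 2\<rbrakk>
    \<Longrightarrow> insert_legs n i xs (pt ys) = pt (take (i - 1) xs @ ys @ drop i xs)"
  unfolding insert_legs_def using lin_ext_ptens[OF _ _ multilinear_insert_legs] by simp

lemma insert_legs_mult:
  assumes xs: "xs \<in> tpow_basis H n" and xs': "xs' \<in> tpow_basis H n"
    and Z: "Z \<in> carrier (T 2)" and Z': "Z' \<in> carrier (T 2)"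
  shows "insert_legs n i (list_mult xs xs') (Z \<cdot>\<^sub>2 Z')
    = insert_legs n i xs Z \<otimes>\<^bsub>T (Suc n)\<^esub> insert_legs n i xs' Z'"
proof -
  let ?m = "list_mult"
  note l = tpow_basis_length
  have m: "?m xs xs' \<in> tpow_basis H n" using xs xs' by (rule map2_mult_basis)
  note ins_closed = linear_map_closed[OF linear_map_insert_legs[OF linear_map_id]]
  have "\<forall>Z\<in>carrier (T 2). insert_legs n i (?m xs xs') (Z \<cdot>\<^sub>2 Z')
      = insert_legs n i xs Z \<otimes>\<^bsub>T (Suc n)\<^esub> insert_legs n i xs' Z'"
  proof (rule tpow_ext)
    fix ys assume ys: "ys \<in> tpow_basis H 2"
    have "\<forall>Z'\<in>carrier (T 2). insert_legs n i (?m xs xs') (pt ys \<cdot>\<^sub>2 Z')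
        = insert_legs n i xs (pt ys) \<otimes>\<^bsub>T (Suc n)\<^esub> insert_legs n i xs' Z'"
    proof (rule tpow_ext)
      fix ys' assume ys': "ys' \<in> tpow_basis H 2"
      have "take (i - 1) (?m xs xs') @ ?m ys ys' @ drop i (?m xs xs')
          = ?m (take (i - 1) xs @ ys @ drop i xs) (take (i - 1) xs' @ ys' @ drop i xs')"
        using l[OF xs] l[OF xs'] l[OF ys] l[OF ys']
        by (simp add: zip_append take_map drop_map take_zip drop_zip)
      then show "insert_legs n i (?m xs xs') (pt ys \<cdot>\<^sub>2 pt ys')
          = insert_legs n i xs (pt ys) \<otimes>\<^bsub>T (Suc n)\<^esub> insert_legs n i xs' (pt ys')"
        using xs xs' ys ys' m
        by (simp add: ptens_mult map2_mult_basis insert_legs_pt insert_list_basis)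
    qed (use xs xs' ys m in \<open>auto intro!: linear_map_insert_legs linear_intros ins_closed ptens_closed\<close>)
    then show "insert_legs n i (?m xs xs') (pt ys \<cdot>\<^sub>2 Z')
        = insert_legs n i xs (pt ys) \<otimes>\<^bsub>T (Suc n)\<^esub> insert_legs n i xs' Z'" using Z' by blast
  qed (use xs xs' m Z' in \<open>auto intro!: linear_map_insert_legs linear_intros ins_closed\<close>)
  then show ?thesis using Z by blast
qed

text \<open>Changing the \<open>i\<close>-th leg acts through \<open>\<Delta>\<close>; changing another leg changes one leg of the result, whose
  position is shifted by one if it lies to the right of the inserted legs.\<close>

lemma multilinear_comul_at:
  "multilinear_map K H n (T (Suc n)) (\<lambda>xs. insert_legs n i xs (comul H (xs ! (i - 1))))"
  unfolding multilinear_map_def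
proof (intro conjI ballI allI impI funcsetI)
  fix xs assume xs: "xs \<in> tpow_basis H n"
  have "xs ! (i - 1) \<in> carrier H" using xs i by (intro tpow_basis_nth) auto
  then show "insert_legs n i xs (comul H (xs ! (i - 1))) \<in> carrier (T (Suc n))"
    using xs by (intro linear_map_closed[OF linear_map_insert_legs[OF linear_map_id]]) auto
  fix k assume k: "k < n"
  have l: "length xs = n" using xs by (rule tpow_basis_length)
  show "linear_map K H (T (Suc n)) (\<lambda>a. insert_legs n i (xs[k := a]) (comul H (xs[k := a] ! (i - 1))))"
  proof (cases "k = i - 1")
    case True
    have "insert_legs n i (xs[k := a]) (comul H (xs[k := a] ! (i - 1))) = insert_legs n i xs (comul H a)" for a
      using True l i by (simp add: insert_legs_def)
    then show ?thesis using xs by (auto intro!: linear_map_insert_legs linear_map_comul linear_map_id)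
  next
    case False
    have mem: "xs ! (i - 1) \<in> carrier H" using xs i by (intro tpow_basis_nth) auto
    have "linear_map K H (T (Suc n)) (\<lambda>a. pt (take (i - 1) (xs[k := a]) @ ys @ drop i (xs[k := a])))"
      if ys: "ys \<in> tpow_basis H 2" for ys
    proof -
      let ?k = "if k < i - 1 then k else Suc k"
      have "take (i - 1) (xs[k := a]) @ ys @ drop i (xs[k := a])
          = (take (i - 1) xs @ ys @ drop i xs)[?k := a]" for a
        using False i k l tpow_basis_length[OF ys]
        by (auto simp: list_update_append take_update_swap drop_update_swap Suc_diff_le list_update_beyond)
      moreover have "linear_map K H (T (Suc n)) (\<lambda>a. pt ((take (i - 1) xs @ ys @ drop i xs)[?k := a]))"
        using xs ys k by (intro linear_map_pt_slot insert_list_basis linear_map_id) auto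
      ultimately show ?thesis by simp
    qed
    then show ?thesis
      using False mem unfolding insert_legs_def
      by (auto intro!: linear_map_lin_ext_tpow_param[where n = 2 and H = H])
  qed
qed

lemma comul_at_eq: "comul_at K H n i = lin_ext K (T (Suc n)) (\<lambda>xs. insert_legs n i xs (comul H (xs ! (i - 1))))"
  by (simp add: comul_at_def insert_legs_def fun_eq_iff)

lemma comul_at_linear: "linear_map K (T n) (T (Suc n)) (D n i)"
  unfolding comul_at_eq by (intro linear_map_lin_ext_tpow multilinear_comul_at) simp_all

lemma comul_at_pt:
  "xs \<in> tpow_basis H n \<Longrightarrow> D n i (pt xs) = insert_legs n i xs (comul H (xs ! (i - 1)))"
  unfolding comul_at_eq using lin_ext_ptens[OF _ _ multilinear_comul_at] by simp

lemma comul_at_alg_hom: "alg_hom K (T n) (T (Suc n)) (D n i)"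
proof (rule alg_hom_tpowI[OF unital_algebra_tpow comul_at_linear])
  have "take (i - 1) (replicate n \<one>\<^sub>H) @ replicate 2 \<one>\<^sub>H @ drop i (replicate n \<one>\<^sub>H)
      = replicate (Suc n) \<one>\<^sub>H"
    using i by (simp add: replicate_add[symmetric] del: replicate_Suc)
  then show "D n i \<one>\<^bsub>T n\<^esub> = \<one>\<^bsub>T (Suc n)\<^esub>"
    using i by (simp add: tpow_one comul_at_pt replicate_one_basis insert_legs_pt
        comul_one[unfolded tpow_one] del: replicate_Suc)
next
  fix xs ys assume xs: "xs \<in> tpow_basis H n" and ys: "ys \<in> tpow_basis H n"
  have "xs ! (i - 1) \<in> carrier H" "ys ! (i - 1) \<in> carrier H"
    using xs ys i by (auto intro!: tpow_basis_nth)
  then show "D n i (pt (list_mult xs ys))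
      = D n i (pt xs) \<otimes>\<^bsub>T (Suc n)\<^esub> D n i (pt ys)"
    using xs ys i tpow_basis_length[OF xs] tpow_basis_length[OF ys]
    by (simp add: comul_at_pt map2_mult_basis insert_legs_mult)
qed

end

text \<open>Any linear map that reproduces the insertion on pure tensors computes \<open>comul_at\<close>. It is used with
  products of a pure tensor and a placement.\<close>

lemma comul_at_eqI:
  assumes "0 < i" "i \<le> n" "xs \<in> tpow_basis H n"
    and "linear_map K (T 2) (T (Suc n)) f"
    and "\<And>p q. \<lbrakk>p \<in> carrier H; q \<in> carrier H\<rbrakk> \<Longrightarrow> pt (take (i - 1) xs @ [p, q] @ drop i xs) = f (pt [p, q])"
  shows "D n i (pt xs) = f (comul H (xs ! (i - 1)))"
proof -
  have "\<forall>Z\<in>carrier (T 2). insert_legs n i xs Z = f Z"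
    using assms linear_map_insert_legs[OF assms(1,2) linear_map_id assms(3)]
    by (intro tpow2_ext[where X = "T (Suc n)"]) (simp_all add: insert_legs_pt)
  moreover have "xs ! (i - 1) \<in> carrier H" using assms(1-3) by (auto intro!: tpow_basis_nth)
  ultimately show ?thesis using assms(1-3) by (simp add: comul_at_pt)
qed

text \<open>On pure tensors \<open>comul_at\<close> is a product of a placed coproduct and the unaffected legs. In this form the
  identities below follow from the calculus of placements.\<close>

lemma comul_at_2_1_pt:
  assumes "a \<in> carrier H" "b \<in> carrier H"
  shows "D 2 1 (pt [a, b]) = pt [\<one>\<^sub>H, \<one>\<^sub>H, b] \<cdot>\<^sub>3 P 3 [1, 2] (comul H a)"
proof -
  have "D 2 1 (pt [a, b])
      = (\<lambda>Z. pt [\<one>\<^sub>H, \<one>\<^sub>H, b] \<cdot>\<^sub>3 P 3 [1, 2] Z) (comul H ([a, b] ! (1 - 1)))"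
    using assms by (intro comul_at_eqI) (auto simp: place_list_simps intro!: linear_intros)
  then show ?thesis by simp
qed

lemma comul_at_2_2_pt [simp]:
  assumes "a \<in> carrier H" "b \<in> carrier H"
  shows "D 2 2 (pt [a, b]) = pt [a, \<one>\<^sub>H, \<one>\<^sub>H] \<cdot>\<^sub>3 P 3 [2, 3] (comul H b)"
proof -
  have "D 2 2 (pt [a, b])
      = (\<lambda>Z. pt [a, \<one>\<^sub>H, \<one>\<^sub>H] \<cdot>\<^sub>3 P 3 [2, 3] Z) (comul H ([a, b] ! (2 - 1)))"
    using assms by (intro comul_at_eqI) (auto simp: place_list_simps intro!: linear_intros)
  then show ?thesis by simp
qed

lemma comul_at_3_1_pt:
  assumes "a \<in> carrier H" "b \<in> carrier H" "c \<in> carrier H"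
  shows "D 3 1 (pt [a, b, c])
    = pt [\<one>\<^sub>H, \<one>\<^sub>H, b, c] \<cdot>\<^sub>4 P 4 [1, 2] (comul H a)"
proof -
  have "D 3 1 (pt [a, b, c])
      = (\<lambda>Z. pt [\<one>\<^sub>H, \<one>\<^sub>H, b, c] \<cdot>\<^sub>4 P 4 [1, 2] Z) (comul H ([a, b, c] ! (1 - 1)))"
    using assms by (intro comul_at_eqI) (auto simp: place_list_simps intro!: linear_intros)
  then show ?thesis by simp
qed

lemma comul_at_3_2_pt [simp]:
  assumes "a \<in> carrier H" "b \<in> carrier H" "c \<in> carrier H"
  shows "D 3 2 (pt [a, b, c])
    = pt [a, \<one>\<^sub>H, \<one>\<^sub>H, c] \<cdot>\<^sub>4 P 4 [2, 3] (comul H b)"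
proof -
  have "D 3 2 (pt [a, b, c])
      = (\<lambda>Z. pt [a, \<one>\<^sub>H, \<one>\<^sub>H, c] \<cdot>\<^sub>4 P 4 [2, 3] Z) (comul H ([a, b, c] ! (2 - 1)))"
    using assms by (intro comul_at_eqI) (auto simp: place_list_simps intro!: linear_intros)
  then show ?thesis by simp
qed

lemma comul_at_3_3_pt [simp]:
  assumes "a \<in> carrier H" "b \<in> carrier H" "c \<in> carrier H"
  shows "D 3 3 (pt [a, b, c])
    = pt [a, b, \<one>\<^sub>H, \<one>\<^sub>H] \<cdot>\<^sub>4 P 4 [3, 4] (comul H c)"
proof -
  have "D 3 3 (pt [a, b, c])
      = (\<lambda>Z. pt [a, b, \<one>\<^sub>H, \<one>\<^sub>H] \<cdot>\<^sub>4 P 4 [3, 4] Z) (comul H ([a, b, c] ! (3 - 1)))"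
    using assms by (intro comul_at_eqI) (auto simp: place_list_simps intro!: linear_intros)
  then show ?thesis by simp
qed

lemmas [simp] = comul_at_2_1_pt comul_at_3_1_pt

lemma linear_map_comul_at [linear_intros]:
  "\<lbrakk>linear_map K V (T n) f; 0 < i; i \<le> n; m = Suc n\<rbrakk>
    \<Longrightarrow> linear_map K V (T m) (\<lambda>v. D n i (f v))"
  using linear_map_comp[OF comul_at_linear] by blast

lemma comul_at_closed [simp]:
  "\<lbrakk>X \<in> carrier (T n); 0 < i; i \<le> n; m = Suc n\<rbrakk> \<Longrightarrow> D n i X \<in> carrier (T m)"
  using linear_map_closed[OF comul_at_linear] by blast

lemma comul_at_mult [simp]:
  "\<lbrakk>X \<in> carrier (T n); Y \<in> carrier (T n); 0 < i; i \<le> n\<rbrakk>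
    \<Longrightarrow> D n i (X \<otimes>\<^bsub>T n\<^esub> Y) = D n i X \<otimes>\<^bsub>T (Suc n)\<^esub> D n i Y"
  using alg_hom_mult[OF comul_at_alg_hom] by blast

lemma place_12_34_commute [rule_format]:
  "\<forall>X\<in>carrier (T 2). \<forall>Y\<in>carrier (T 2). P 4 [3, 4] Y \<cdot>\<^sub>4 P 4 [1, 2] X = P 4 [1, 2] X \<cdot>\<^sub>4 P 4 [3, 4] Y"
  by (intro tpow2_ext2[where X = "T 4"] tpow2_ext[where X = "T 4"] linear_intros) (simp_all add: place_list_simps)

text \<open>Elements supported on disjoint sets of legs commute: in each position one of the two factors is the
  unit.\<close>

lemma pt_place_commute:
  assumes xs: "xs \<in> tpow_basis H n" and js: "distinct js" "set js \<subseteq> {1..n}" "length js = m"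
    and one: "\<And>j. j \<in> set js \<Longrightarrow> xs ! (j - 1) = \<one>\<^sub>H" and Y: "Y \<in> carrier (T m)"
  shows "P n js Y \<otimes>\<^bsub>T n\<^esub> pt xs = pt xs \<otimes>\<^bsub>T n\<^esub> P n js Y"
proof -
  have "\<forall>Y\<in>carrier (T m). P n js Y \<otimes>\<^bsub>T n\<^esub> pt xs = pt xs \<otimes>\<^bsub>T n\<^esub> P n js Y"
  proof (rule tpow_ext)
    fix ys assume ys: "ys \<in> tpow_basis H m"
    have basis: "place_list n js ys \<in> tpow_basis H n" using js ys by (rule place_list_basis)
    have "list_mult (place_list n js ys) xs = list_mult xs (place_list n js ys)"
    proof (rule nth_equalityI)
      fix p assume "p < length (list_mult (place_list n js ys) xs)"
      then have p: "p < n" by simp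
      have xp: "xs ! p \<in> carrier H" using xs p by (rule tpow_basis_nth)
      show "list_mult (place_list n js ys) xs ! p
          = list_mult xs (place_list n js ys) ! p"
        using js p
      proof (cases rule: place_list_cases)
        case (1 i)
        then have "xs ! p = \<one>\<^sub>H" using one[of "js ! i"] js(3) nth_mem[of i js] by simp
        then show ?thesis
          using p tpow_basis_length[OF xs] tpow_basis_nth[OF basis p] by simp
      next
        case 2
        then show ?thesis using p xp tpow_basis_length[OF xs] tpow_basis_length[OF ys] by simp
      qed
    qed (simp add: tpow_basis_length[OF xs])
    then show "P n js (pt ys) \<otimes>\<^bsub>T n\<^esub> pt xs = pt xs \<otimes>\<^bsub>T n\<^esub> P n js (pt ys)"
      using xs ys basis by (simp add: place_pt[OF js] ptens_mult)
  next
    show "linear_map K (T m) (T n) (\<lambda>Y. P n js Y \<otimes>\<^bsub>T n\<^esub> pt xs)"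
      by (intro linear_intros place_linear js ptens_closed xs) simp_all
    show "linear_map K (T m) (T n) (\<lambda>Y. pt xs \<otimes>\<^bsub>T n\<^esub> P n js Y)"
      by (intro linear_intros place_linear js ptens_closed xs) simp_all
  qed simp_all
  then show ?thesis using Y by blast
qed

text \<open>The coproduct on a leg of a placed element either acts on the element itself or, if the leg is a
  unit, only shifts the placement.\<close>

lemma comul_at_3_3_place_12 [rule_format]:
  "\<forall>X\<in>carrier (T 2). D 3 3 (P 3 [1, 2] X) = P 4 [1, 2] X"
  by (intro tpow2_ext[where X = "T 4"] linear_intros) (simp_all add: place_list_simps pt4_one)

lemma comul_at_3_3_place_23 [rule_format]:
  "\<forall>X\<in>carrier (T 2). D 3 3 (P 3 [2, 3] X) = P 4 [2, 3, 4] (D 2 2 X)"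
  by (intro tpow2_ext[where X = "T 4"] linear_intros) (simp_all add: place_list_simps)

lemma comul_at_3_2_place_23 [rule_format]:
  "\<forall>X\<in>carrier (T 2). D 3 2 (P 3 [2, 3] X) = P 4 [2, 3, 4] (D 2 1 X)"
  by (intro tpow2_ext[where X = "T 4"] linear_intros) (simp_all add: place_list_simps)

lemma comul_at_3_2_place_12 [rule_format]:
  "\<forall>X\<in>carrier (T 2). D 3 2 (P 3 [1, 2] X) = P 4 [1, 2, 3] (D 2 2 X)"
  by (intro tpow2_ext[where X = "T 4"] linear_intros) (simp_all add: place_list_simps)

lemma comul_at_3_1_place_23 [rule_format]:
  "\<forall>X\<in>carrier (T 2). D 3 1 (P 3 [2, 3] X) = P 4 [3, 4] X"
  by (intro tpow2_ext[where X = "T 4"] linear_intros) (simp_all add: place_list_simps)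

lemma comul_at_3_1_place_12 [rule_format]:
  "\<forall>X\<in>carrier (T 2). D 3 1 (P 3 [1, 2] X) = P 4 [1, 2, 3] (D 2 1 X)"
  by (intro tpow2_ext[where X = "T 4"] linear_intros) (simp_all add: place_list_simps)

lemmas comul_at_place = comul_at_3_3_place_12 comul_at_3_3_place_23 comul_at_3_2_place_23
  comul_at_3_2_place_12 comul_at_3_1_place_23 comul_at_3_1_place_12

lemma comul_at_3_3_2_1 [rule_format]:
  "\<forall>X\<in>carrier (T 2). D 3 3 (D 2 1 X) = D 3 1 (D 2 2 X)"
  by (intro tpow2_ext[where X = "T 4"] linear_intros) (simp_all add: place_list_simps comul_at_place pt4_one place_12_34_commute)

lemma comul_at_2_2_place_21 [rule_format]:
  "\<forall>X\<in>carrier (T 2). D 2 2 (P 2 [2, 1] X) = P 3 [2, 3, 1] (D 2 1 X)"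
  by (intro tpow2_ext[where X = "T 3"] linear_intros) (simp_all add: place_list_simps)

lemma comul_at_2_1_place_21 [rule_format]:
  "\<forall>X\<in>carrier (T 2). D 2 1 (P 2 [2, 1] X) = P 3 [3, 1, 2] (D 2 2 X)"
  by (intro tpow2_ext[where X = "T 3"] linear_intros) (simp_all add: place_list_simps)

end

section \<open>Quasi-bialgebras\<close>

sublocale quasi_bialgebra \<subseteq> coproduct_algebra
  using comul_linear comul_hom
  by unfold_locales (auto simp: alg_hom_def ring_hom_def)

context quasi_bialgebra
begin

interpretation T: unital_algebra K "T n" for n by (rule unital_algebra_tpow)

abbreviation \<phi> where "\<phi> \<equiv> reassoc H"
abbreviation \<phi>i where "\<phi>i \<equiv> tinv K H 3 (reassoc H)"

lemma reassoc_closed [simp]: "\<phi> \<in> carrier (T 3)" "\<phi>i \<in> carrier (T 3)"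
  using reassoc_unit by auto

lemma reassoc_inv [simp]: "\<phi> \<cdot>\<^sub>3 \<phi>i = \<one>\<^bsub>T 3\<^esub>" "\<phi>i \<cdot>\<^sub>3 \<phi> = \<one>\<^bsub>T 3\<^esub>"
  using reassoc_unit by auto

lemma counit_closed [simp]: "h \<in> carrier H \<Longrightarrow> counit H h \<in> carrier K"
  using counit_hom by (auto simp: ring_hom_def)

lemma counit_mult [simp]:
  "\<lbrakk>g \<in> carrier H; h \<in> carrier H\<rbrakk> \<Longrightarrow> counit H (g \<cdot> h) = counit H g \<otimes>\<^bsub>K\<^esub> counit H h"
  using counit_hom by (auto simp: ring_hom_def)

lemma counit_add:
  "\<lbrakk>g \<in> carrier H; h \<in> carrier H\<rbrakk> \<Longrightarrow> counit H (g \<oplus>\<^bsub>H\<^esub> h) = counit H g \<oplus>\<^bsub>K\<^esub> counit H h"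
  using counit_hom by (auto simp: ring_hom_def)

lemma counit_one [simp]: "counit H \<one>\<^sub>H = \<one>\<^bsub>K\<^esub>"
  using counit_hom by (auto simp: ring_hom_def)

lemma linear_map_counit [linear_intros]:
  assumes "module K X" "linear_map K V H f" "x \<in> carrier X"
  shows "linear_map K V X (\<lambda>v. counit H (f v) \<odot>\<^bsub>X\<^esub> x)"
proof -
  interpret X: module K X by fact
  note f = linear_map_closed[OF assms(2)] linear_map_add[OF assms(2)] linear_map_smult[OF assms(2)]
  show ?thesis using assms(3)
    by (intro linear_mapI) (auto simp: f counit_add counit_smult X.smult_l_distr X.smult_assoc1)
qed

lemma linear_map_smult_right [linear_intros]:
  assumes "module K X" "linear_map K V X f" "r \<in> carrier K"
  shows "linear_map K V X (\<lambda>v. r \<odot>\<^bsub>X\<^esub> f v)"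
proof -
  interpret X: module K X by fact
  note f = linear_map_closed[OF assms(2)] linear_map_add[OF assms(2)] linear_map_smult[OF assms(2)]
  show ?thesis using assms(3)
    by (intro linear_mapI) (auto simp: f X.smult_r_distr X.smult_assoc1[symmetric] R.m_comm)
qed

subsection \<open>The counit on one leg\<close>

definition counit1 :: "('h list \<Rightarrow> 'k) set \<Rightarrow> 'h" where
  "counit1 = lin_ext K H (leg2 (\<lambda>a b. counit H a \<odot>\<^bsub>H\<^esub> b))"

definition counit2 :: "('h list \<Rightarrow> 'k) set \<Rightarrow> 'h" where
  "counit2 = lin_ext K H (leg2 (\<lambda>a b. counit H b \<odot>\<^bsub>H\<^esub> a))"

definition counit_mid :: "('h list \<Rightarrow> 'k) set \<Rightarrow> ('h list \<Rightarrow> 'k) set" where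
  "counit_mid = lin_ext K (T 2) (leg3 (\<lambda>a b c. counit H b \<odot>\<^bsub>T 2\<^esub> pt [a, c]))"

lemma linear_map_counit1 [linear_intros]:
  "linear_map K V (T 2) f \<Longrightarrow> linear_map K V H (\<lambda>v. counit1 (f v))"
  unfolding counit1_def by (intro linear_intros) simp_all

lemma linear_map_counit2 [linear_intros]:
  "linear_map K V (T 2) f \<Longrightarrow> linear_map K V H (\<lambda>v. counit2 (f v))"
  unfolding counit2_def by (intro linear_intros) simp_all

lemma linear_map_counit_mid [linear_intros]:
  "linear_map K V (T 3) f \<Longrightarrow> linear_map K V (T 2) (\<lambda>v. counit_mid (f v))"
  unfolding counit_mid_def by (intro linear_intros) simp_all

lemma counit1_pt [simp]:
  "\<lbrakk>a \<in> carrier H; b \<in> carrier H\<rbrakk> \<Longrightarrow> counit1 (pt [a, b]) = counit H a \<odot>\<^bsub>H\<^esub> b"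
  unfolding counit1_def by (intro lin_ext_leg2 linear_intros) simp_all

lemma counit2_pt [simp]:
  "\<lbrakk>a \<in> carrier H; b \<in> carrier H\<rbrakk> \<Longrightarrow> counit2 (pt [a, b]) = counit H b \<odot>\<^bsub>H\<^esub> a"
  unfolding counit2_def by (intro lin_ext_leg2 linear_intros) simp_all

lemma counit_mid_pt [simp]:
  "\<lbrakk>a \<in> carrier H; b \<in> carrier H; c \<in> carrier H\<rbrakk>
    \<Longrightarrow> counit_mid (pt [a, b, c]) = counit H b \<odot>\<^bsub>T 2\<^esub> pt [a, c]"
  unfolding counit_mid_def by (intro lin_ext_leg3 linear_intros) simp_all

lemma smult_mult_smult:
  assumes "unital_algebra K A" "r \<in> carrier K" "s \<in> carrier K" "x \<in> carrier A" "y \<in> carrier A"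
  shows "(r \<odot>\<^bsub>A\<^esub> x) \<otimes>\<^bsub>A\<^esub> (s \<odot>\<^bsub>A\<^esub> y) = (r \<otimes>\<^bsub>K\<^esub> s) \<odot>\<^bsub>A\<^esub> (x \<otimes>\<^bsub>A\<^esub> y)"
proof -
  interpret A: unital_algebra K A by fact
  show ?thesis using assms(2-)
    by (simp add: A.smult_mult_left) (simp add: A.smult_mult_right A.smult_assoc1)
qed

lemma counit1_alg_hom: "alg_hom K (T 2) H counit1"
proof (rule alg_hom_tpowI)
  show "linear_map K (T 2) H counit1" using linear_map_counit1[OF linear_map_id] .
  show "counit1 \<one>\<^bsub>T 2\<^esub> = \<one>\<^sub>H" by (simp add: pt2_one[symmetric])
qed (auto elim!: tpow2_cases simp: smult_mult_smult unital_algebra_self)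

lemma counit2_alg_hom: "alg_hom K (T 2) H counit2"
proof (rule alg_hom_tpowI)
  show "linear_map K (T 2) H counit2" using linear_map_counit2[OF linear_map_id] .
  show "counit2 \<one>\<^bsub>T 2\<^esub> = \<one>\<^sub>H" by (simp add: pt2_one[symmetric])
qed (auto elim!: tpow2_cases simp: smult_mult_smult unital_algebra_self)

lemma counit_mid_alg_hom: "alg_hom K (T 3) (T 2) counit_mid"
proof (rule alg_hom_tpowI)
  show "linear_map K (T 3) (T 2) counit_mid" using linear_map_counit_mid[OF linear_map_id] .
  show "counit_mid \<one>\<^bsub>T 3\<^esub> = \<one>\<^bsub>T 2\<^esub>"
    by (simp add: pt3_one[symmetric] pt2_one T.smult_one)
qed (auto elim!: tpow3_cases simp: smult_mult_smult)

lemmas counit1_closed [simp] = alg_hom_closed[OF counit1_alg_hom]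
lemmas counit2_closed [simp] = alg_hom_closed[OF counit2_alg_hom]
lemmas counit1_mult [simp] = alg_hom_mult[OF counit1_alg_hom]
lemmas counit2_mult [simp] = alg_hom_mult[OF counit2_alg_hom]
lemmas counit_mid_mult [simp] = alg_hom_mult[OF counit_mid_alg_hom]

lemma counit1_comul [simp]: "h \<in> carrier H \<Longrightarrow> counit1 (comul H h) = h"
  unfolding counit1_def by (rule counit_left)

lemma counit2_comul [simp]: "h \<in> carrier H \<Longrightarrow> counit2 (comul H h) = h"
  unfolding counit2_def by (rule counit_right)

lemma counit_mid_reassoc [simp]: "counit_mid \<phi> = \<one>\<^bsub>T 2\<^esub>"
  unfolding counit_mid_def by (rule reassoc_counit)

lemma counit_mid_place_12 [rule_format]:
  "\<forall>X\<in>carrier (T 2). counit_mid (P 3 [1, 2] X) = pt [counit2 X, \<one>\<^sub>H]"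
  by (intro tpow2_ext[where X = "T 2"] linear_intros)
    (simp_all add: place_list_simps linear_map_smult[OF linear_map_pt2_1[OF linear_map_id]])

lemma counit_mid_place_23 [rule_format]:
  "\<forall>X\<in>carrier (T 2). counit_mid (P 3 [2, 3] X) = pt [\<one>\<^sub>H, counit1 X]"
  by (intro tpow2_ext[where X = "T 2"] linear_intros)
    (simp_all add: place_list_simps linear_map_smult[OF linear_map_pt2_2[OF linear_map_id]])

text \<open>Either coproduct of \<open>X\<close> produces the middle leg, on which the counit undoes it.\<close>

lemma counit_mid_comul_at_1 [rule_format, simp]: "\<forall>X\<in>carrier (T 2). counit_mid (D 2 1 X) = X"
  by (intro tpow2_ext[where X = "T 2"] linear_intros)
    (simp_all add: place_list_simps counit_mid_place_12 T.smult_one)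

lemma counit_mid_comul_at_2 [rule_format, simp]: "\<forall>X\<in>carrier (T 2). counit_mid (D 2 2 X) = X"
  by (intro tpow2_ext[where X = "T 2"] linear_intros)
    (simp_all add: place_list_simps counit_mid_place_23 T.smult_one)

subsection \<open>Quasi-coassociativity on one leg\<close>

text \<open>The first leg of \<open>X\<close> is a bystander: it commutes with \<open>\<phi>\<close> on the other three legs, and
  quasi-coassociativity applies to the second leg of \<open>X\<close>.\<close>

lemma quasi_coassoc_2 [rule_format]:
  "\<forall>X\<in>carrier (T 2). D 3 3 (D 2 2 X) \<cdot>\<^sub>4 P 4 [2, 3, 4] \<phi>
    = P 4 [2, 3, 4] \<phi> \<cdot>\<^sub>4 D 3 2 (D 2 2 X)"
proof (rule tpow2_ext)
  fix a b assume ab: "a \<in> carrier H" "b \<in> carrier H"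
  let ?a = "pt [a, \<one>\<^sub>H, \<one>\<^sub>H, \<one>\<^sub>H]"
  let ?P = "P 4 [2, 3, 4]"
  have "?a \<cdot>\<^sub>4 ?P (D 2 2 (comul H b)) \<cdot>\<^sub>4 ?P \<phi>
      = ?a \<cdot>\<^sub>4 ?P (D 2 2 (comul H b) \<cdot>\<^sub>3 \<phi>)"
    using ab by (simp add: T.H.m_assoc)
  also have "\<dots> = ?a \<cdot>\<^sub>4 ?P \<phi> \<cdot>\<^sub>4 ?P (D 2 1 (comul H b))"
    using ab by (simp add: quasi_coassoc T.H.m_assoc)
  also have "?a \<cdot>\<^sub>4 ?P \<phi> = ?P \<phi> \<cdot>\<^sub>4 ?a"
    using ab by (intro pt_place_commute[where m = 3, symmetric]) auto
  finally show "D 3 3 (D 2 2 (pt [a, b])) \<cdot>\<^sub>4 ?P \<phi>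
      = ?P \<phi> \<cdot>\<^sub>4 D 3 2 (D 2 2 (pt [a, b]))"
    using ab by (simp add: comul_at_place T.H.m_assoc pt4_one)
qed (auto intro!: linear_intros)

lemma quasi_coassoc_1 [rule_format]:
  "\<forall>X\<in>carrier (T 2). D 3 2 (D 2 1 X) \<cdot>\<^sub>4 P 4 [1, 2, 3] \<phi>
    = P 4 [1, 2, 3] \<phi> \<cdot>\<^sub>4 D 3 1 (D 2 1 X)"
proof (rule tpow2_ext)
  fix a b assume ab: "a \<in> carrier H" "b \<in> carrier H"
  let ?b = "pt [\<one>\<^sub>H, \<one>\<^sub>H, \<one>\<^sub>H, b]"
  let ?P = "P 4 [1, 2, 3]"
  have "?b \<cdot>\<^sub>4 ?P (D 2 2 (comul H a)) \<cdot>\<^sub>4 ?P \<phi>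
      = ?b \<cdot>\<^sub>4 ?P (D 2 2 (comul H a) \<cdot>\<^sub>3 \<phi>)"
    using ab by (simp add: T.H.m_assoc)
  also have "\<dots> = ?b \<cdot>\<^sub>4 ?P \<phi> \<cdot>\<^sub>4 ?P (D 2 1 (comul H a))"
    using ab by (simp add: quasi_coassoc T.H.m_assoc)
  also have "?b \<cdot>\<^sub>4 ?P \<phi> = ?P \<phi> \<cdot>\<^sub>4 ?b"
    using ab by (intro pt_place_commute[where m = 3, symmetric]) auto
  finally show "D 3 2 (D 2 1 (pt [a, b])) \<cdot>\<^sub>4 ?P \<phi>
      = ?P \<phi> \<cdot>\<^sub>4 D 3 1 (D 2 1 (pt [a, b]))"
    using ab by (simp add: comul_at_place T.H.m_assoc pt4_one)
qed (auto intro!: linear_intros)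

end

section \<open>Twisting a quasi-bialgebra\<close>

lemma twist_fields [simp]:
  "carrier (twist K H F) = carrier H" "mult (twist K H F) = mult H" "one (twist K H F) = one H"
  "zero (twist K H F) = zero H" "add (twist K H F) = add H" "smult (twist K H F) = smult H"
  "counit (twist K H F) = counit H" "antipode (twist K H F) = antipode H"
  "comul (twist K H F) = (\<lambda>h. F \<otimes>\<^bsub>tpow K H 2\<^esub> comul H h \<otimes>\<^bsub>tpow K H 2\<^esub> tinv K H 2 F)"
  by (simp_all add: twist_def)

text \<open>Twisting keeps the algebra, hence all tensor powers and placements.\<close>

lemma tpow_twist [simp]:
  "tpow_basis (twist K H F) n = tpow_basis H n"
  "tpow K (twist K H F) n = tpow K H n"
  "ptens K (twist K H F) = ptens K H"
proof -
  show basis: "tpow_basis (twist K H F) n = tpow_basis H n" for n by (simp add: tpow_basis_def)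
  have null: "tpow_null K (twist K H F) n = tpow_null K H n" for n
    by (simp add: tpow_null_def tpow_rels_def basis)
  show pt: "ptens K (twist K H F) = ptens K H"
    by (simp add: ptens_def null basis fun_eq_iff)
  have "tpow_module K (twist K H F) n = tpow_module K H n"
    by (simp add: tpow_module_def null basis)
  then show "tpow K (twist K H F) n = tpow K H n"
    by (simp add: tpow_def pt)
qed

lemma place_twist [simp]: "place K (twist K H F) = place K H"
proof (intro ext)
  show "place K (twist K H F) n is X = place K H n is X" for n "is" X
    unfolding place_def twist_fields tpow_twist by (rule refl)
qed

lemma lin_ext_twist [simp]: "lin_ext K (twist K H F) = lin_ext K H"
  by (rule lin_ext_module_cong) simp_all

lemma linear_map_twist [simp]:
  "linear_map K (twist K H F) V = linear_map K H V" "linear_map K V (twist K H F) = linear_map K V H"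
  by (simp_all add: linear_map_def fun_eq_iff)

lemma unital_algebra_twist:
  assumes "unital_algebra K H"
  shows "unital_algebra K (twist K H F)"
proof -
  interpret H: unital_algebra K H by fact
  have m: "module K (twist K H F)" by (rule module_cong[OF H.module_self]) simp_all
  interpret H': module K "twist K H F" by fact
  have "monoid (twist K H F)" by (rule monoidI) (simp_all add: H.H.m_assoc)
  then have "ring (twist K H F)"
    by (intro ringI H'.M.abelian_group_axioms) (simp_all add: H.H.l_distr H.H.r_distr)
  with m show ?thesis
    by (intro unital_algebra.intro unital_algebra_axioms.intro)
      (simp_all add: H.smult_mult_left H.smult_mult_right)
qed

text \<open>A homomorphism preserves inverses. The second form cancels them inside products that are bracketed to
  the right, the normal form of the calculations below.\<close>

lemma alg_hom_cancel:
  assumes "unital_algebra K A" "unital_algebra K B" "alg_hom K A B f"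
    "x \<in> carrier A" "y \<in> carrier A" "x \<otimes>\<^bsub>A\<^esub> y = \<one>\<^bsub>A\<^esub>"
  shows "f x \<otimes>\<^bsub>B\<^esub> f y = \<one>\<^bsub>B\<^esub>"
    and "z \<in> carrier B \<Longrightarrow> f x \<otimes>\<^bsub>B\<^esub> (f y \<otimes>\<^bsub>B\<^esub> z) = z"
proof -
  interpret B: unital_algebra K B by fact
  show eq: "f x \<otimes>\<^bsub>B\<^esub> f y = \<one>\<^bsub>B\<^esub>"
    using assms by (simp add: alg_hom_mult[OF assms(3), symmetric] alg_hom_one)
  show "f x \<otimes>\<^bsub>B\<^esub> (f y \<otimes>\<^bsub>B\<^esub> z) = z" if "z \<in> carrier B"
    using that assms(4,5) eq by (simp add: B.H.m_assoc[symmetric] alg_hom_closed[OF assms(3)])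
qed

locale twisted_quasi_bialgebra = quasi_bialgebra K H
  for K :: "'k ring" (structure) and H :: "('k, 'h) quasi_hopf" (structure) +
  fixes F :: "('h list \<Rightarrow> 'k) set"
  assumes cochain: "cochain_twist K H F"
begin

interpretation T: unital_algebra K "T n" for n by (rule unital_algebra_tpow)

abbreviation Fi where "Fi \<equiv> tinv K H 2 F"
abbreviation H' where "H' \<equiv> twist K H F"

lemma F_unit: "F \<in> Units (T 2)"
  using cochain by (simp add: cochain_twist_def)

lemma F_closed [simp]: "F \<in> carrier (T 2)" "Fi \<in> carrier (T 2)"
  using F_unit by auto

lemma F_inv [simp]: "F \<cdot>\<^sub>2 Fi = \<one>\<^bsub>T 2\<^esub>" "Fi \<cdot>\<^sub>2 F = \<one>\<^bsub>T 2\<^esub>"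
  using F_unit by auto

lemma F_cancel [simp]:
  "Z \<in> carrier (T 2) \<Longrightarrow> F \<cdot>\<^sub>2 (Fi \<cdot>\<^sub>2 Z) = Z"
  "Z \<in> carrier (T 2) \<Longrightarrow> Fi \<cdot>\<^sub>2 (F \<cdot>\<^sub>2 Z) = Z"
  by (simp_all add: T.H.m_assoc[symmetric])

lemma counit_F [simp]: "counit1 F = \<one>\<^sub>H" "counit2 F = \<one>\<^sub>H"
  using cochain by (simp_all add: cochain_twist_def counit1_def counit2_def)

lemma counit_Fi [simp]: "counit1 Fi = \<one>\<^sub>H" "counit2 Fi = \<one>\<^sub>H"
proof -
  have "counit1 Fi = counit1 F \<cdot> counit1 Fi" by simp
  also have "\<dots> = counit1 (F \<cdot>\<^sub>2 Fi)" by (rule counit1_mult[symmetric]) simp_all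
  finally show "counit1 Fi = \<one>\<^sub>H" using alg_hom_one[OF counit1_alg_hom] by simp
  have "counit2 Fi = counit2 F \<cdot> counit2 Fi" by simp
  also have "\<dots> = counit2 (F \<cdot>\<^sub>2 Fi)" by (rule counit2_mult[symmetric]) simp_all
  finally show "counit2 Fi = \<one>\<^sub>H" using alg_hom_one[OF counit2_alg_hom] by simp
qed

lemma place_F_cancel [simp]:
  assumes "i \<noteq> j" "i \<in> {1..n}" "j \<in> {1..n}"
  shows "P n [i, j] F \<otimes>\<^bsub>T n\<^esub> P n [i, j] Fi = \<one>\<^bsub>T n\<^esub>"
    "P n [i, j] Fi \<otimes>\<^bsub>T n\<^esub> P n [i, j] F = \<one>\<^bsub>T n\<^esub>"
    "Z \<in> carrier (T n) \<Longrightarrow> P n [i, j] F \<otimes>\<^bsub>T n\<^esub> (P n [i, j] Fi \<otimes>\<^bsub>T n\<^esub> Z) = Z"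
    "Z \<in> carrier (T n) \<Longrightarrow> P n [i, j] Fi \<otimes>\<^bsub>T n\<^esub> (P n [i, j] F \<otimes>\<^bsub>T n\<^esub> Z) = Z"
proof -
  have "alg_hom K (T 2) (T n) (P n [i, j])" using assms by (intro place_alg_hom) auto
  note hom = alg_hom_cancel[OF unital_algebra_tpow unital_algebra_tpow this]
  show "P n [i, j] F \<otimes>\<^bsub>T n\<^esub> P n [i, j] Fi = \<one>\<^bsub>T n\<^esub>"
    "P n [i, j] Fi \<otimes>\<^bsub>T n\<^esub> P n [i, j] F = \<one>\<^bsub>T n\<^esub>"
    "Z \<in> carrier (T n) \<Longrightarrow> P n [i, j] F \<otimes>\<^bsub>T n\<^esub> (P n [i, j] Fi \<otimes>\<^bsub>T n\<^esub> Z) = Z"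
    "Z \<in> carrier (T n) \<Longrightarrow> P n [i, j] Fi \<otimes>\<^bsub>T n\<^esub> (P n [i, j] F \<otimes>\<^bsub>T n\<^esub> Z) = Z"
    by (simp_all add: hom)
qed

lemma comul_at_F_cancel [simp]:
  assumes "0 < i" "i \<le> 2"
  shows "D 2 i F \<cdot>\<^sub>3 D 2 i Fi = \<one>\<^bsub>T 3\<^esub>"
    "D 2 i Fi \<cdot>\<^sub>3 D 2 i F = \<one>\<^bsub>T 3\<^esub>"
    "Z \<in> carrier (T 3) \<Longrightarrow> D 2 i F \<cdot>\<^sub>3 (D 2 i Fi \<cdot>\<^sub>3 Z) = Z"
    "Z \<in> carrier (T 3) \<Longrightarrow> D 2 i Fi \<cdot>\<^sub>3 (D 2 i F \<cdot>\<^sub>3 Z) = Z"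
proof -
  have "alg_hom K (T 2) (T 3) (D 2 i)" using comul_at_alg_hom[OF assms] by simp
  note hom = alg_hom_cancel[OF unital_algebra_tpow unital_algebra_tpow this]
  show "D 2 i F \<cdot>\<^sub>3 D 2 i Fi = \<one>\<^bsub>T 3\<^esub>"
    "D 2 i Fi \<cdot>\<^sub>3 D 2 i F = \<one>\<^bsub>T 3\<^esub>"
    "Z \<in> carrier (T 3) \<Longrightarrow> D 2 i F \<cdot>\<^sub>3 (D 2 i Fi \<cdot>\<^sub>3 Z) = Z"
    "Z \<in> carrier (T 3) \<Longrightarrow> D 2 i Fi \<cdot>\<^sub>3 (D 2 i F \<cdot>\<^sub>3 Z) = Z"
    by (simp_all add: hom)
qed

lemma alg_hom_comul_at_F_cancel:
  assumes "alg_hom K (T 3) (T n) f" "0 < i" "i \<le> 2" "Z \<in> carrier (T n)"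
  shows "f (D 2 i F) \<otimes>\<^bsub>T n\<^esub> (f (D 2 i Fi) \<otimes>\<^bsub>T n\<^esub> Z) = Z"
    "f (D 2 i Fi) \<otimes>\<^bsub>T n\<^esub> (f (D 2 i F) \<otimes>\<^bsub>T n\<^esub> Z) = Z"
  using assms by (simp_all add: alg_hom_cancel[OF unital_algebra_tpow unital_algebra_tpow assms(1)])

lemma place_comul_at_F_cancel [simp]:
  assumes "distinct [j, k, l]" "j \<in> {1..n}" "k \<in> {1..n}" "l \<in> {1..n}"
    "0 < i" "i \<le> 2" "Z \<in> carrier (T n)"
  shows "P n [j, k, l] (D 2 i F) \<otimes>\<^bsub>T n\<^esub> (P n [j, k, l] (D 2 i Fi) \<otimes>\<^bsub>T n\<^esub> Z) = Z"
    "P n [j, k, l] (D 2 i Fi) \<otimes>\<^bsub>T n\<^esub> (P n [j, k, l] (D 2 i F) \<otimes>\<^bsub>T n\<^esub> Z) = Z"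
  using assms by (intro alg_hom_comul_at_F_cancel place_alg_hom; simp)+

lemma comul_at_comul_at_F_cancel [simp]:
  assumes "0 < i" "i \<le> 2" "0 < j" "j \<le> 3" "Z \<in> carrier (T 4)"
  shows "D 3 j (D 2 i F) \<cdot>\<^sub>4 (D 3 j (D 2 i Fi) \<cdot>\<^sub>4 Z) = Z"
    "D 3 j (D 2 i Fi) \<cdot>\<^sub>4 (D 3 j (D 2 i F) \<cdot>\<^sub>4 Z) = Z"
proof -
  have "alg_hom K (T 3) (T 4) (D 3 j)" using comul_at_alg_hom[OF assms(3,4)] by simp
  then show "D 3 j (D 2 i F) \<cdot>\<^sub>4 (D 3 j (D 2 i Fi) \<cdot>\<^sub>4 Z) = Z"
    "D 3 j (D 2 i Fi) \<cdot>\<^sub>4 (D 3 j (D 2 i F) \<cdot>\<^sub>4 Z) = Z"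
    using alg_hom_comul_at_F_cancel[OF _ assms(1,2,5)] by blast+
qed

lemma reassoc_cancel [simp]:
  "Z \<in> carrier (T 3) \<Longrightarrow> \<phi> \<cdot>\<^sub>3 (\<phi>i \<cdot>\<^sub>3 Z) = Z"
  "Z \<in> carrier (T 3) \<Longrightarrow> \<phi>i \<cdot>\<^sub>3 (\<phi> \<cdot>\<^sub>3 Z) = Z"
  by (simp_all add: T.H.m_assoc[symmetric])

lemma coproduct_algebra_twist: "coproduct_algebra K H'"
proof (intro coproduct_algebra.intro coproduct_algebra_axioms.intro)
  show "unital_algebra K H'" using unital_algebra_self by (rule unital_algebra_twist)
  have "linear_map K H (T 2) (\<lambda>h. F \<cdot>\<^sub>2 comul H h \<cdot>\<^sub>2 Fi)"
    by (intro linear_intros) simp_all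
  then show "alg_hom K H' (tpow K H' 2) (comul H')"
    by (simp add: alg_hom_def T.H.m_assoc)
qed

sublocale tw: coproduct_algebra K H' by (rule coproduct_algebra_twist)

text \<open>This identifies the factor that multiplicativity of \<open>insert_legs\<close> splits off in the proof of
  \<open>comul_at_twist\<close>.\<close>

lemma insert_legs_ones:
  assumes "0 < i" "i \<le> n" "Z \<in> carrier (T 2)"
  shows "insert_legs n i (replicate n \<one>\<^sub>H) Z = P (Suc n) [i, Suc i] Z"
proof -
  have "\<forall>Z\<in>carrier (T 2). insert_legs n i (replicate n \<one>\<^sub>H) Z = P (Suc n) [i, Suc i] Z"
  proof (rule tpow2_ext)
    fix a b assume ab: "a \<in> carrier H" "b \<in> carrier H"
    have "take (i - 1) (replicate n \<one>\<^sub>H) @ [a, b] @ drop i (replicate n \<one>\<^sub>H)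
        = place_list (Suc n) [i, Suc i] [a, b]"
      using assms by (intro nth_equalityI) (auto simp: place_list_nth nth_append nth_Cons')
    then show "insert_legs n i (replicate n \<one>\<^sub>H) (pt [a, b]) = P (Suc n) [i, Suc i] (pt [a, b])"
      using assms ab by (simp add: insert_legs_pt replicate_one_basis)
  qed (use assms in \<open>auto intro!: linear_map_insert_legs linear_intros replicate_one_basis\<close>)
  then show ?thesis using assms by blast
qed

text \<open>Since \<open>insert_legs\<close> is multiplicative and the legs \<open>xs\<close> are the product \<open>1 xs 1\<close>, inserting
  \<open>F \<Delta>(x) F\<^sup>-\<^sup>1\<close> into \<open>xs\<close> yields three factors: \<open>F\<close> inserted into units, \<open>\<Delta>(x)\<close> inserted into \<open>xs\<close>, and
  \<open>F\<^sup>-\<^sup>1\<close> inserted into units.\<close>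

lemma comul_at_twist:
  assumes i: "0 < i" "i \<le> n" and X: "X \<in> carrier (T n)"
  shows "comul_at K H' n i X = P (Suc n) [i, Suc i] F \<otimes>\<^bsub>T (Suc n)\<^esub> D n i X
    \<otimes>\<^bsub>T (Suc n)\<^esub> P (Suc n) [i, Suc i] Fi"
proof -
  have "\<forall>X\<in>carrier (T n). comul_at K H' n i X
      = P (Suc n) [i, Suc i] F \<otimes>\<^bsub>T (Suc n)\<^esub> D n i X
        \<otimes>\<^bsub>T (Suc n)\<^esub> P (Suc n) [i, Suc i] Fi"
  proof (rule tpow_ext)
    fix xs assume xs: "xs \<in> tpow_basis H n"
    let ?x = "xs ! (i - 1)" and ?os = "replicate n \<one>\<^sub>H" and ?m = "list_mult"
    have x: "?x \<in> carrier H" using xs i by (intro tpow_basis_nth) auto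
    have os: "?os \<in> tpow_basis H n" by (rule replicate_one_basis)
    have "tw.insert_legs n i xs Z = insert_legs n i xs Z" for xs Z
      by (simp add: tw.insert_legs_def insert_legs_def)
    then have "comul_at K H' n i (pt xs) = insert_legs n i xs (F \<cdot>\<^sub>2 comul H ?x \<cdot>\<^sub>2 Fi)"
      using tw.comul_at_pt[OF i, of xs] xs by simp
    also have "\<dots> = insert_legs n i (?m (?m ?os xs) ?os) (F \<cdot>\<^sub>2 comul H ?x \<cdot>\<^sub>2 Fi)"
    proof -
      have "?m (?m ?os xs) ?os = xs"
        by (rule nth_equalityI) (simp_all add: tpow_basis_length[OF xs] tpow_basis_nth[OF xs])
      then show ?thesis by (simp only:)
    qed
    also have "insert_legs n i (?m (?m ?os xs) ?os) (F \<cdot>\<^sub>2 comul H ?x \<cdot>\<^sub>2 Fi)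
        = P (Suc n) [i, Suc i] F \<otimes>\<^bsub>T (Suc n)\<^esub> insert_legs n i xs (comul H ?x)
          \<otimes>\<^bsub>T (Suc n)\<^esub> P (Suc n) [i, Suc i] Fi"
      using i xs os x by (simp add: insert_legs_mult map2_mult_basis insert_legs_ones)
    finally show "comul_at K H' n i (pt xs) = P (Suc n) [i, Suc i] F
        \<otimes>\<^bsub>T (Suc n)\<^esub> D n i (pt xs) \<otimes>\<^bsub>T (Suc n)\<^esub> P (Suc n) [i, Suc i] Fi"
      using i xs by (simp add: comul_at_pt)
  next
    show "linear_map K (T n) (T (Suc n)) (comul_at K H' n i)"
      using tw.comul_at_linear[OF i] by simp
    show "linear_map K (T n) (T (Suc n)) (\<lambda>X. P (Suc n) [i, Suc i] F
        \<otimes>\<^bsub>T (Suc n)\<^esub> D n i X \<otimes>\<^bsub>T (Suc n)\<^esub> P (Suc n) [i, Suc i] Fi)"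
      using i by (intro linear_intros) auto
  qed simp_all
  then show ?thesis using X by blast
qed

lemma comul_at_twist_numeral [simp]:
  "X \<in> carrier (T 2) \<Longrightarrow> comul_at K H' 2 1 X
    = P 3 [1, 2] F \<cdot>\<^sub>3 D 2 1 X \<cdot>\<^sub>3 P 3 [1, 2] Fi"
  "X \<in> carrier (T 2) \<Longrightarrow> comul_at K H' 2 2 X
    = P 3 [2, 3] F \<cdot>\<^sub>3 D 2 2 X \<cdot>\<^sub>3 P 3 [2, 3] Fi"
  "Y \<in> carrier (T 3) \<Longrightarrow> comul_at K H' 3 1 Y
    = P 4 [1, 2] F \<cdot>\<^sub>4 D 3 1 Y \<cdot>\<^sub>4 P 4 [1, 2] Fi"
  "Y \<in> carrier (T 3) \<Longrightarrow> comul_at K H' 3 2 Y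
    = P 4 [2, 3] F \<cdot>\<^sub>4 D 3 2 Y \<cdot>\<^sub>4 P 4 [2, 3] Fi"
  "Y \<in> carrier (T 3) \<Longrightarrow> comul_at K H' 3 3 Y
    = P 4 [3, 4] F \<cdot>\<^sub>4 D 3 3 Y \<cdot>\<^sub>4 P 4 [3, 4] Fi"
  using comul_at_twist[of 1 2 X] comul_at_twist[of 2 2 X] comul_at_twist[of 1 3 Y]
    comul_at_twist[of 2 3 Y] comul_at_twist[of 3 3 Y] by simp_all

abbreviation \<phi>F where "\<phi>F \<equiv> reassoc H'"

lemma reassoc_twist:
  "\<phi>F = P 3 [2, 3] F \<cdot>\<^sub>3 D 2 2 F \<cdot>\<^sub>3 \<phi>
    \<cdot>\<^sub>3 D 2 1 Fi \<cdot>\<^sub>3 P 3 [1, 2] Fi"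
  by (simp add: twist_def)

lemma reassoc_twist_Units:
  "\<phi>F \<in> Units (T 3)"
  "tinv K H 3 \<phi>F = P 3 [1, 2] F \<cdot>\<^sub>3 D 2 1 F \<cdot>\<^sub>3 \<phi>i
    \<cdot>\<^sub>3 D 2 2 Fi \<cdot>\<^sub>3 P 3 [2, 3] Fi"
  by (rule T.H.Units_inverseI[where y = "P 3 [1, 2] F \<cdot>\<^sub>3 D 2 1 F \<cdot>\<^sub>3 \<phi>i
    \<cdot>\<^sub>3 D 2 2 Fi \<cdot>\<^sub>3 P 3 [2, 3] Fi"];
      simp add: reassoc_twist T.H.m_assoc)+

lemma quasi_coassoc_twist:
  assumes h: "h \<in> carrier H"
  shows "comul_at K H' 2 2 (comul H' h) \<cdot>\<^sub>3 \<phi>F = \<phi>F \<cdot>\<^sub>3 comul_at K H' 2 1 (comul H' h)"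
proof -
  have coassoc: "D 2 2 (comul H h) \<cdot>\<^sub>3 (\<phi> \<cdot>\<^sub>3 Z)
      = \<phi> \<cdot>\<^sub>3 (D 2 1 (comul H h) \<cdot>\<^sub>3 Z)" if "Z \<in> carrier (T 3)" for Z
    using that h quasi_coassoc[OF h] by (simp add: T.H.m_assoc[symmetric])
  show ?thesis using h by (simp add: reassoc_twist T.H.m_assoc coassoc)
qed

text \<open>After substituting \<open>\<phi>\<^sub>F\<close>, the inner factors \<open>F\<close> cancel. What remains is moved into the shape of the
  pentagon for \<open>\<phi>\<close> with \<open>quasi_coassoc_2\<close> for \<open>F\<close>, \<open>quasi_coassoc_1\<close> for \<open>F\<^sup>-\<^sup>1\<close>, and commutation of legs
  \<open>1, 2\<close> with legs \<open>3, 4\<close>. The rules carry a factor \<open>Z\<close> on the right since products are bracketed to the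
  right.\<close>

lemma pentagon_twist:
  "comul_at K H' 3 3 \<phi>F \<cdot>\<^sub>4 comul_at K H' 3 1 \<phi>F
    = P 4 [2, 3, 4] \<phi>F \<cdot>\<^sub>4 comul_at K H' 3 2 \<phi>F \<cdot>\<^sub>4 P 4 [1, 2, 3] \<phi>F"
proof -
  have pentagon': "D 3 3 \<phi> \<cdot>\<^sub>4 (D 3 1 \<phi> \<cdot>\<^sub>4 Z)
      = P 4 [2, 3, 4] \<phi> \<cdot>\<^sub>4 (D 3 2 \<phi> \<cdot>\<^sub>4 (P 4 [1, 2, 3] \<phi> \<cdot>\<^sub>4 Z))"
    if "Z \<in> carrier (T 4)" for Z
    using that pentagon by (simp add: T.H.m_assoc[symmetric])
  have coassoc2: "D 3 3 (D 2 2 F) \<cdot>\<^sub>4 (P 4 [2, 3, 4] \<phi> \<cdot>\<^sub>4 Z)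
      = P 4 [2, 3, 4] \<phi> \<cdot>\<^sub>4 (D 3 2 (D 2 2 F) \<cdot>\<^sub>4 Z)"
    if "Z \<in> carrier (T 4)" for Z
    using that quasi_coassoc_2[of F] by (simp add: T.H.m_assoc[symmetric])
  have coassoc1: "D 3 2 (D 2 1 Fi) \<cdot>\<^sub>4 (P 4 [1, 2, 3] \<phi> \<cdot>\<^sub>4 Z)
      = P 4 [1, 2, 3] \<phi> \<cdot>\<^sub>4 (D 3 1 (D 2 1 Fi) \<cdot>\<^sub>4 Z)"
    if "Z \<in> carrier (T 4)" for Z
    using that quasi_coassoc_1[of Fi] by (simp add: T.H.m_assoc[symmetric])
  have commute: "P 4 [3, 4] Y \<cdot>\<^sub>4 (P 4 [1, 2] X \<cdot>\<^sub>4 Z)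
      = P 4 [1, 2] X \<cdot>\<^sub>4 (P 4 [3, 4] Y \<cdot>\<^sub>4 Z)"
    if "X \<in> carrier (T 2)" "Y \<in> carrier (T 2)" "Z \<in> carrier (T 4)" for X Y Z
    using that place_12_34_commute[of X Y] by (simp add: T.H.m_assoc[symmetric])
  show ?thesis
    by (simp add: reassoc_twist comul_at_place comul_at_3_3_2_1 T.H.m_assoc pentagon' coassoc2 coassoc1 commute)
qed

theorem quasi_bialgebra_twist: "quasi_bialgebra K H'"
proof (intro quasi_bialgebra.intro quasi_bialgebra_axioms.intro)
  show "unital_algebra K H'" by (rule tw.unital_algebra_self)
  show "linear_map K H' (tpow K H' 2) (comul H')" by (rule alg_hom_linear[OF tw.comul_alg_hom])
  show "comul H' \<in> ring_hom H' (tpow K H' 2)"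
    using tw.comul_alg_hom linear_map_add[OF alg_hom_linear[OF tw.comul_alg_hom]]
    by (auto simp: ring_hom_def alg_hom_def)
  show "counit H' \<in> ring_hom H' K" using counit_hom by (simp add: ring_hom_def)
  show "counit H' (r \<odot>\<^bsub>H'\<^esub> h) = r \<otimes>\<^bsub>K\<^esub> counit H' h" if "r \<in> carrier K" "h \<in> carrier H'" for r h
    using that by (simp add: counit_smult)
  show "\<phi>F \<in> Units (tpow K H' 3)" using reassoc_twist_Units by simp
  fix h assume h: "h \<in> carrier H'"
  show "lin_ext K H' (leg2 (\<lambda>a b. counit H' a \<odot>\<^bsub>H'\<^esub> b)) (comul H' h) = h"
    using h by (simp add: counit1_def[symmetric])
  show "lin_ext K H' (leg2 (\<lambda>a b. counit H' b \<odot>\<^bsub>H'\<^esub> a)) (comul H' h) = h"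
    using h by (simp add: counit2_def[symmetric])
  show "comul_at K H' 2 2 (comul H' h) \<otimes>\<^bsub>tpow K H' 3\<^esub> \<phi>F = \<phi>F \<otimes>\<^bsub>tpow K H' 3\<^esub> comul_at K H' 2 1 (comul H' h)"
    using h quasi_coassoc_twist by simp
next
  show "comul_at K H' 3 3 \<phi>F \<otimes>\<^bsub>tpow K H' 4\<^esub> comul_at K H' 3 1 \<phi>F
    = place K H' 4 [2, 3, 4] \<phi>F \<otimes>\<^bsub>tpow K H' 4\<^esub> comul_at K H' 3 2 \<phi>F \<otimes>\<^bsub>tpow K H' 4\<^esub> place K H' 4 [1, 2, 3] \<phi>F"
    using pentagon_twist by simp
  have "counit_mid \<phi>F = \<one>\<^bsub>T 2\<^esub>"
    by (simp add: reassoc_twist counit_mid_place_12 counit_mid_place_23 pt2_one)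
  then show "lin_ext K (tpow K H' 2) (leg3 (\<lambda>a b c. counit H' b \<odot>\<^bsub>tpow K H' 2\<^esub> ptens K H' [a, c])) \<phi>F
      = \<one>\<^bsub>tpow K H' 2\<^esub>"
    by (simp add: counit_mid_def)
qed

end

section \<open>Twisting the quasi-antipode\<close>

context quasi_hopf_algebra
begin

interpretation T: unital_algebra K "T n" for n by (rule unital_algebra_tpow)

abbreviation S where "S \<equiv> antipode H"
abbreviation \<alpha> where "\<alpha> \<equiv> qalpha H"
abbreviation \<beta> where "\<beta> \<equiv> qbeta H"

lemma antipode_closed [simp]: "h \<in> carrier H \<Longrightarrow> S h \<in> carrier H"
  by (rule linear_map_closed[OF antipode_linear])

lemma linear_map_antipode [linear_intros]:
  "linear_map K V H f \<Longrightarrow> linear_map K V H (\<lambda>v. S (f v))"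
  by (rule linear_map_comp[OF antipode_linear])

declare qalpha_closed [simp] qbeta_closed [simp] antipode_one [simp] antipode_mult [simp]

text \<open>For \<open>X = X\<^sub>1 \<otimes> X\<^sub>2\<close> these are \<open>S(X\<^sub>1) g X\<^sub>2\<close> and \<open>X\<^sub>1 g S(X\<^sub>2)\<close>. With variable \<open>g\<close> the tensor square acts on
  \<open>H\<close>, from the right and from the left respectively, and the twist replaces \<open>\<alpha>\<close> and \<open>\<beta>\<close> by their images
  under \<open>F\<^sup>-\<^sup>1\<close> and \<open>F\<close>.\<close>

definition conj_alpha :: "'h \<Rightarrow> ('h list \<Rightarrow> 'k) set \<Rightarrow> 'h" where
  "conj_alpha g = lin_ext K H (leg2 (\<lambda>a b. S a \<cdot> g \<cdot> b))"

definition conj_beta :: "'h \<Rightarrow> ('h list \<Rightarrow> 'k) set \<Rightarrow> 'h" where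
  "conj_beta g = lin_ext K H (leg2 (\<lambda>a b. a \<cdot> g \<cdot> S b))"

lemma linear_map_conj_alpha [linear_intros]:
  "\<lbrakk>linear_map K V (T 2) f; g \<in> carrier H\<rbrakk> \<Longrightarrow> linear_map K V H (\<lambda>v. conj_alpha g (f v))"
  unfolding conj_alpha_def by (intro linear_intros) (simp_all add: unital_algebra_self)

lemma linear_map_conj_alpha_param [linear_intros]:
  "\<lbrakk>module K V; linear_map K V H f; X \<in> carrier (T 2)\<rbrakk> \<Longrightarrow> linear_map K V H (\<lambda>v. conj_alpha (f v) X)"
  unfolding conj_alpha_def by (intro linear_intros) (simp_all add: unital_algebra_self)

lemma linear_map_conj_beta [linear_intros]:
  "\<lbrakk>linear_map K V (T 2) f; g \<in> carrier H\<rbrakk> \<Longrightarrow> linear_map K V H (\<lambda>v. conj_beta g (f v))"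
  unfolding conj_beta_def by (intro linear_intros) (simp_all add: unital_algebra_self)

lemma linear_map_conj_beta_param [linear_intros]:
  "\<lbrakk>module K V; linear_map K V H f; X \<in> carrier (T 2)\<rbrakk> \<Longrightarrow> linear_map K V H (\<lambda>v. conj_beta (f v) X)"
  unfolding conj_beta_def by (intro linear_intros) (simp_all add: unital_algebra_self)

lemma conj_alpha_closed [simp]:
  "\<lbrakk>X \<in> carrier (T 2); g \<in> carrier H\<rbrakk> \<Longrightarrow> conj_alpha g X \<in> carrier H"
  by (rule linear_map_closed[OF linear_map_conj_alpha[OF linear_map_id]])

lemma conj_beta_closed [simp]:
  "\<lbrakk>X \<in> carrier (T 2); g \<in> carrier H\<rbrakk> \<Longrightarrow> conj_beta g X \<in> carrier H"
  by (rule linear_map_closed[OF linear_map_conj_beta[OF linear_map_id]])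

lemma conj_alpha_pt [simp]:
  "\<lbrakk>a \<in> carrier H; b \<in> carrier H; g \<in> carrier H\<rbrakk> \<Longrightarrow> conj_alpha g (pt [a, b]) = S a \<cdot> g \<cdot> b"
  unfolding conj_alpha_def by (intro lin_ext_leg2 linear_intros) (simp_all add: unital_algebra_self)

lemma conj_beta_pt [simp]:
  "\<lbrakk>a \<in> carrier H; b \<in> carrier H; g \<in> carrier H\<rbrakk> \<Longrightarrow> conj_beta g (pt [a, b]) = a \<cdot> g \<cdot> S b"
  unfolding conj_beta_def by (intro lin_ext_leg2 linear_intros) (simp_all add: unital_algebra_self)

lemma conj_alpha_mult [rule_format]:
  "g \<in> carrier H \<Longrightarrow> \<forall>X\<in>carrier (T 2). \<forall>Y\<in>carrier (T 2). conj_alpha g (X \<cdot>\<^sub>2 Y) = conj_alpha (conj_alpha g X) Y"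
  by (intro tpow2_ext2[where X = H] tpow2_ext[where X = H] linear_intros) (simp_all add: H.m_assoc)

lemma conj_beta_mult [rule_format]:
  "g \<in> carrier H \<Longrightarrow> \<forall>X\<in>carrier (T 2). \<forall>Y\<in>carrier (T 2). conj_beta g (X \<cdot>\<^sub>2 Y) = conj_beta (conj_beta g Y) X"
  by (intro tpow2_ext2[where X = H] tpow2_ext[where X = H] linear_intros) (simp_all add: H.m_assoc)

lemma conj_one [simp]:
  "g \<in> carrier H \<Longrightarrow> conj_alpha g \<one>\<^bsub>T 2\<^esub> = g" "g \<in> carrier H \<Longrightarrow> conj_beta g \<one>\<^bsub>T 2\<^esub> = g"
  by (simp_all add: pt2_one[symmetric])

lemma conj_alpha_comul [simp]: "h \<in> carrier H \<Longrightarrow> conj_alpha \<alpha> (comul H h) = counit H h \<odot>\<^bsub>H\<^esub> \<alpha>"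
  unfolding conj_alpha_def by (rule antipode_alpha)

lemma conj_beta_comul [simp]: "h \<in> carrier H \<Longrightarrow> conj_beta \<beta> (comul H h) = counit H h \<odot>\<^bsub>H\<^esub> \<beta>"
  unfolding conj_beta_def by (rule antipode_beta)

text \<open>For \<open>\<theta> = x \<otimes> y \<otimes> z\<close> these are \<open>x b S(y) a z\<close> and \<open>S(x) a y b S(z)\<close>. The last two axioms of a
  quasi-antipode state that they are \<open>1\<close> at \<open>\<phi>\<close> and at \<open>\<phi>\<^sup>-\<^sup>1\<close> for \<open>a = \<alpha>\<close>, \<open>b = \<beta>\<close>; the twisted axioms
  concern \<open>\<alpha>\<^sub>F\<close>, \<open>\<beta>\<^sub>F\<close> and \<open>\<phi>\<^sub>F\<close>.\<close>

definition zigzag :: "'h \<Rightarrow> 'h \<Rightarrow> ('h list \<Rightarrow> 'k) set \<Rightarrow> 'h" where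
  "zigzag b a = lin_ext K H (leg3 (\<lambda>x y z. x \<cdot> b \<cdot> S y \<cdot> a \<cdot> z))"

definition zigzag_inv :: "'h \<Rightarrow> 'h \<Rightarrow> ('h list \<Rightarrow> 'k) set \<Rightarrow> 'h" where
  "zigzag_inv a b = lin_ext K H (leg3 (\<lambda>x y z. S x \<cdot> a \<cdot> y \<cdot> b \<cdot> S z))"

context
  fixes a b assumes ab [simp]: "a \<in> carrier H" "b \<in> carrier H"
begin

lemma linear_map_zigzag [linear_intros]:
  "linear_map K V (T 3) f \<Longrightarrow> linear_map K V H (\<lambda>v. zigzag b a (f v))"
  unfolding zigzag_def by (intro linear_intros) (simp_all add: unital_algebra_self)

lemma linear_map_zigzag_inv [linear_intros]:
  "linear_map K V (T 3) f \<Longrightarrow> linear_map K V H (\<lambda>v. zigzag_inv a b (f v))"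
  unfolding zigzag_inv_def by (intro linear_intros) (simp_all add: unital_algebra_self)

lemma zigzag_closed [simp]: "\<theta> \<in> carrier (T 3) \<Longrightarrow> zigzag b a \<theta> \<in> carrier H"
  by (rule linear_map_closed[OF linear_map_zigzag[OF linear_map_id]])

lemma zigzag_inv_closed [simp]: "\<theta> \<in> carrier (T 3) \<Longrightarrow> zigzag_inv a b \<theta> \<in> carrier H"
  by (rule linear_map_closed[OF linear_map_zigzag_inv[OF linear_map_id]])

lemma zigzag_pt [simp]:
  "\<lbrakk>x \<in> carrier H; y \<in> carrier H; z \<in> carrier H\<rbrakk>
    \<Longrightarrow> zigzag b a (pt [x, y, z]) = x \<cdot> b \<cdot> S y \<cdot> a \<cdot> z"
  unfolding zigzag_def by (intro lin_ext_leg3 linear_intros) (simp_all add: unital_algebra_self)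

lemma zigzag_inv_pt [simp]:
  "\<lbrakk>x \<in> carrier H; y \<in> carrier H; z \<in> carrier H\<rbrakk>
    \<Longrightarrow> zigzag_inv a b (pt [x, y, z]) = S x \<cdot> a \<cdot> y \<cdot> b \<cdot> S z"
  unfolding zigzag_inv_def by (intro lin_ext_leg3 linear_intros) (simp_all add: unital_algebra_self)

end

lemma linear_map_zigzag_left [linear_intros]:
  "\<lbrakk>module K V; linear_map K V H f; a \<in> carrier H; \<theta> \<in> carrier (T 3)\<rbrakk>
    \<Longrightarrow> linear_map K V H (\<lambda>v. zigzag (f v) a \<theta>)"
  unfolding zigzag_def by (intro linear_intros) (simp_all add: unital_algebra_self)

lemma linear_map_zigzag_right [linear_intros]:
  "\<lbrakk>module K V; linear_map K V H f; b \<in> carrier H; \<theta> \<in> carrier (T 3)\<rbrakk>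
    \<Longrightarrow> linear_map K V H (\<lambda>v. zigzag b (f v) \<theta>)"
  unfolding zigzag_def by (intro linear_intros) (simp_all add: unital_algebra_self)

lemma linear_map_zigzag_inv_left [linear_intros]:
  "\<lbrakk>module K V; linear_map K V H f; b \<in> carrier H; \<theta> \<in> carrier (T 3)\<rbrakk>
    \<Longrightarrow> linear_map K V H (\<lambda>v. zigzag_inv (f v) b \<theta>)"
  unfolding zigzag_inv_def by (intro linear_intros) (simp_all add: unital_algebra_self)

lemma linear_map_zigzag_inv_right [linear_intros]:
  "\<lbrakk>module K V; linear_map K V H f; a \<in> carrier H; \<theta> \<in> carrier (T 3)\<rbrakk>
    \<Longrightarrow> linear_map K V H (\<lambda>v. zigzag_inv a (f v) \<theta>)"
  unfolding zigzag_inv_def by (intro linear_intros) (simp_all add: unital_algebra_self)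

text \<open>An outer factor of \<open>\<theta>\<close> on two adjacent legs only meets the \<open>a\<close> or the \<open>b\<close> between these legs and
  can be absorbed into it.\<close>

lemma zigzag_place_23 [rule_format]:
  "\<lbrakk>a \<in> carrier H; b \<in> carrier H\<rbrakk> \<Longrightarrow> \<forall>X\<in>carrier (T 2). \<forall>\<theta>\<in>carrier (T 3).
    zigzag b a (P 3 [2, 3] X \<cdot>\<^sub>3 \<theta>) = zigzag b (conj_alpha a X) \<theta>"
  by (intro tpow2_ext2[where X = H] tpow3_ext[where X = H] linear_intros) (simp_all add: place_list_simps H.m_assoc)

lemma zigzag_place_12 [rule_format]:
  "\<lbrakk>a \<in> carrier H; b \<in> carrier H\<rbrakk> \<Longrightarrow> \<forall>X\<in>carrier (T 2). \<forall>\<theta>\<in>carrier (T 3).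
    zigzag b a (\<theta> \<cdot>\<^sub>3 P 3 [1, 2] X) = zigzag (conj_beta b X) a \<theta>"
  by (intro tpow2_ext2[where X = H] tpow3_ext[where X = H] linear_intros) (simp_all add: place_list_simps H.m_assoc)

lemma zigzag_inv_place_12 [rule_format]:
  "\<lbrakk>a \<in> carrier H; b \<in> carrier H\<rbrakk> \<Longrightarrow> \<forall>X\<in>carrier (T 2). \<forall>\<theta>\<in>carrier (T 3).
    zigzag_inv a b (P 3 [1, 2] X \<cdot>\<^sub>3 \<theta>) = zigzag_inv (conj_alpha a X) b \<theta>"
  by (intro tpow2_ext2[where X = H] tpow3_ext[where X = H] linear_intros) (simp_all add: place_list_simps H.m_assoc)

lemma zigzag_inv_place_23 [rule_format]:
  "\<lbrakk>a \<in> carrier H; b \<in> carrier H\<rbrakk> \<Longrightarrow> \<forall>X\<in>carrier (T 2). \<forall>\<theta>\<in>carrier (T 3).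
    zigzag_inv a b (\<theta> \<cdot>\<^sub>3 P 3 [2, 3] X) = zigzag_inv a (conj_beta b X) \<theta>"
  by (intro tpow2_ext2[where X = H] tpow3_ext[where X = H] linear_intros) (simp_all add: place_list_simps H.m_assoc)

lemma zigzag_pt_mult_left [rule_format]:
  "\<lbrakk>a \<in> carrier H; b \<in> carrier H; x \<in> carrier H\<rbrakk> \<Longrightarrow> \<forall>\<theta>\<in>carrier (T 3).
    zigzag b a (pt [x, \<one>\<^sub>H, \<one>\<^sub>H] \<cdot>\<^sub>3 \<theta>) = x \<cdot> zigzag b a \<theta>"
  by (intro tpow3_ext[where X = H] linear_intros) (simp_all add: H.m_assoc unital_algebra_self)

lemma zigzag_pt_mult_right [rule_format]:
  "\<lbrakk>a \<in> carrier H; b \<in> carrier H; x \<in> carrier H\<rbrakk> \<Longrightarrow> \<forall>\<theta>\<in>carrier (T 3).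
    zigzag b a (\<theta> \<cdot>\<^sub>3 pt [\<one>\<^sub>H, \<one>\<^sub>H, x]) = zigzag b a \<theta> \<cdot> x"
  by (intro tpow3_ext[where X = H] linear_intros) (simp_all add: H.m_assoc unital_algebra_self)

lemma zigzag_inv_pt_mult_left [rule_format]:
  "\<lbrakk>a \<in> carrier H; b \<in> carrier H; x \<in> carrier H\<rbrakk> \<Longrightarrow> \<forall>\<theta>\<in>carrier (T 3).
    zigzag_inv a b (pt [\<one>\<^sub>H, \<one>\<^sub>H, x] \<cdot>\<^sub>3 \<theta>) = zigzag_inv a b \<theta> \<cdot> S x"
  by (intro tpow3_ext[where X = H] linear_intros) (simp_all add: H.m_assoc unital_algebra_self)

lemma zigzag_inv_pt_mult_right [rule_format]:
  "\<lbrakk>a \<in> carrier H; b \<in> carrier H; x \<in> carrier H\<rbrakk> \<Longrightarrow> \<forall>\<theta>\<in>carrier (T 3).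
    zigzag_inv a b (\<theta> \<cdot>\<^sub>3 pt [x, \<one>\<^sub>H, \<one>\<^sub>H]) = S x \<cdot> zigzag_inv a b \<theta>"
  by (intro tpow3_ext[where X = H] linear_intros) (simp_all add: H.m_assoc unital_algebra_self)

text \<open>A coproduct on adjacent legs surrounds \<open>\<alpha>\<close> or \<open>\<beta>\<close>, where the antipode axioms reduce it to a counit;
  the remaining leg of \<open>X\<close> can be taken out of the expression.\<close>

lemma zigzag_comul_at_2 [rule_format]:
  "\<lbrakk>b \<in> carrier H; \<theta> \<in> carrier (T 3)\<rbrakk> \<Longrightarrow> \<forall>X\<in>carrier (T 2).
    zigzag b \<alpha> (D 2 2 X \<cdot>\<^sub>3 \<theta>) = counit2 X \<cdot> zigzag b \<alpha> \<theta>"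
  by (intro tpow2_ext[where X = H] linear_intros)
    (simp_all add: unital_algebra_self T.H.m_assoc zigzag_pt_mult_left zigzag_place_23 smult_mult_left smult_mult_right
      linear_map_smult[OF linear_map_zigzag_right[OF module_self linear_map_id]] linear_map_smult[OF antipode_linear])

lemma zigzag_comul_at_1 [rule_format]:
  "\<lbrakk>a \<in> carrier H; \<theta> \<in> carrier (T 3)\<rbrakk> \<Longrightarrow> \<forall>X\<in>carrier (T 2).
    zigzag \<beta> a (\<theta> \<cdot>\<^sub>3 D 2 1 X) = zigzag \<beta> a \<theta> \<cdot> counit1 X"
  by (intro tpow2_ext[where X = H] linear_intros)
    (simp_all add: unital_algebra_self T.H.m_assoc[symmetric] zigzag_pt_mult_right zigzag_place_12 smult_mult_left smult_mult_right
      linear_map_smult[OF linear_map_zigzag_left[OF module_self linear_map_id]] linear_map_smult[OF antipode_linear])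

lemma zigzag_inv_comul_at_1 [rule_format]:
  "\<lbrakk>b \<in> carrier H; \<theta> \<in> carrier (T 3)\<rbrakk> \<Longrightarrow> \<forall>X\<in>carrier (T 2).
    zigzag_inv \<alpha> b (D 2 1 X \<cdot>\<^sub>3 \<theta>) = zigzag_inv \<alpha> b \<theta> \<cdot> S (counit1 X)"
  by (intro tpow2_ext[where X = H] linear_intros)
    (simp_all add: unital_algebra_self T.H.m_assoc zigzag_inv_pt_mult_left zigzag_inv_place_12 smult_mult_left smult_mult_right
      linear_map_smult[OF linear_map_zigzag_inv_left[OF module_self linear_map_id]] linear_map_smult[OF antipode_linear])

lemma zigzag_inv_comul_at_2 [rule_format]:
  "\<lbrakk>a \<in> carrier H; \<theta> \<in> carrier (T 3)\<rbrakk> \<Longrightarrow> \<forall>X\<in>carrier (T 2).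
    zigzag_inv a \<beta> (\<theta> \<cdot>\<^sub>3 D 2 2 X) = S (counit2 X) \<cdot> zigzag_inv a \<beta> \<theta>"
  by (intro tpow2_ext[where X = H] linear_intros)
    (simp_all add: unital_algebra_self T.H.m_assoc[symmetric] zigzag_inv_pt_mult_right zigzag_inv_place_23 smult_mult_left smult_mult_right
      linear_map_smult[OF linear_map_zigzag_inv_right[OF module_self linear_map_id]] linear_map_smult[OF antipode_linear])

end

locale twisted_quasi_hopf = quasi_hopf_algebra K H + twisted_quasi_bialgebra K H F
  for K :: "'k ring" (structure) and H :: "('k, 'h) quasi_hopf" (structure) and F
begin

interpretation T: unital_algebra K "T n" for n by (rule unital_algebra_tpow)

lemma qalpha_twist: "qalpha H' = conj_alpha \<alpha> Fi"
  by (simp add: twist_def conj_alpha_def)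

lemma qbeta_twist: "qbeta H' = conj_beta \<beta> F"
  by (simp add: twist_def conj_beta_def)

lemma conj_alpha_F_Fi [simp]: "g \<in> carrier H \<Longrightarrow> conj_alpha (conj_alpha g Fi) F = g"
  using conj_alpha_mult[of g Fi F] by simp

lemma conj_beta_F_Fi [simp]: "g \<in> carrier H \<Longrightarrow> conj_beta (conj_beta g F) Fi = g"
  using conj_beta_mult[of g Fi F] by simp

theorem quasi_hopf_algebra_twist: "quasi_hopf_algebra K H'"
proof (intro quasi_hopf_algebra.intro quasi_hopf_algebra_axioms.intro quasi_bialgebra_twist)
  show "linear_map K H' H' (antipode H')" using antipode_linear by simp
  show "bij_betw (antipode H') (carrier H') (carrier H')" using antipode_bij by simp
  show "qalpha H' \<in> carrier H'" "qbeta H' \<in> carrier H'" by (simp_all add: qalpha_twist qbeta_twist)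
  fix h assume "h \<in> carrier H'"
  then have h: "h \<in> carrier H" by simp
  have "conj_alpha (qalpha H') (comul H' h) = counit H h \<odot>\<^bsub>H\<^esub> qalpha H'"
    using h linear_map_smult[OF linear_map_conj_alpha_param[OF module_self linear_map_id]]
    by (simp add: qalpha_twist conj_alpha_mult T.H.m_assoc)
  then show "lin_ext K H' (leg2 (\<lambda>a b. antipode H' a \<otimes>\<^bsub>H'\<^esub> qalpha H' \<otimes>\<^bsub>H'\<^esub> b)) (comul H' h)
      = counit H' h \<odot>\<^bsub>H'\<^esub> qalpha H'"
    by (simp add: conj_alpha_def)
  have "conj_beta (qbeta H') (comul H' h) = counit H h \<odot>\<^bsub>H\<^esub> qbeta H'"
    using h linear_map_smult[OF linear_map_conj_beta_param[OF module_self linear_map_id]]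
    by (simp add: qbeta_twist conj_beta_mult T.H.m_assoc)
  then show "lin_ext K H' (leg2 (\<lambda>a b. a \<otimes>\<^bsub>H'\<^esub> qbeta H' \<otimes>\<^bsub>H'\<^esub> antipode H' b)) (comul H' h)
      = counit H' h \<odot>\<^bsub>H'\<^esub> qbeta H'"
    by (simp add: conj_beta_def)
next
  have "zigzag (qbeta H') (qalpha H') \<phi>F = zigzag (qbeta H') \<alpha> (\<phi> \<cdot>\<^sub>3 D 2 1 Fi \<cdot>\<^sub>3 P 3 [1, 2] Fi)"
    by (simp add: reassoc_twist qalpha_twist qbeta_twist T.H.m_assoc zigzag_place_23 zigzag_comul_at_2)
  also have "\<dots> = zigzag \<beta> \<alpha> \<phi>"
    by (simp add: qbeta_twist zigzag_place_12 zigzag_comul_at_1)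
  also have "\<dots> = \<one>\<^sub>H"
    unfolding zigzag_def by (rule antipode_reassoc)
  finally show "lin_ext K H' (leg3 (\<lambda>a b c. a \<otimes>\<^bsub>H'\<^esub> qbeta H' \<otimes>\<^bsub>H'\<^esub> antipode H' b \<otimes>\<^bsub>H'\<^esub> qalpha H' \<otimes>\<^bsub>H'\<^esub> c))
      (reassoc H') = \<one>\<^bsub>H'\<^esub>"
    by (simp add: zigzag_def)
  have "zigzag_inv (qalpha H') (qbeta H') (tinv K H 3 \<phi>F)
      = zigzag_inv \<alpha> (qbeta H') (\<phi>i \<cdot>\<^sub>3 D 2 2 Fi \<cdot>\<^sub>3 P 3 [2, 3] Fi)"
    by (simp add: reassoc_twist_Units qalpha_twist qbeta_twist T.H.m_assoc zigzag_inv_place_12 zigzag_inv_comul_at_1)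
  also have "\<dots> = zigzag_inv \<alpha> \<beta> \<phi>i"
    by (simp add: qbeta_twist zigzag_inv_place_23 zigzag_inv_comul_at_2)
  also have "\<dots> = \<one>\<^sub>H"
    unfolding zigzag_inv_def by (rule antipode_reassoc_inv)
  finally show "lin_ext K H' (leg3 (\<lambda>a b c. antipode H' a \<otimes>\<^bsub>H'\<^esub> qalpha H' \<otimes>\<^bsub>H'\<^esub> b \<otimes>\<^bsub>H'\<^esub> qbeta H' \<otimes>\<^bsub>H'\<^esub> antipode H' c))
      (tinv K H' 3 (reassoc H')) = \<one>\<^bsub>H'\<^esub>"
    by (simp add: zigzag_inv_def)
qed simp_all

end

section \<open>Twisting the R-matrix\<close>

locale twisted_quasitriangular =
  quasitriangular_quasi_hopf_algebra K H R + twisted_quasi_hopf K H F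
  for K :: "'k ring" (structure) and H :: "('k, 'h) quasi_hopf" (structure) and R F
begin

interpretation T: unital_algebra K "T n" for n by (rule unital_algebra_tpow)

abbreviation Ri where "Ri \<equiv> tinv K H 2 R"
abbreviation RF where "RF \<equiv> twist_R K H R F"

lemma R_closed [simp]: "R \<in> carrier (T 2)" "Ri \<in> carrier (T 2)"
  using R_unit by auto

lemma R_inv [simp]: "R \<cdot>\<^sub>2 Ri = \<one>\<^bsub>T 2\<^esub>" "Ri \<cdot>\<^sub>2 R = \<one>\<^bsub>T 2\<^esub>"
  using R_unit by auto

lemma R_cancel [simp]:
  "Z \<in> carrier (T 2) \<Longrightarrow> R \<cdot>\<^sub>2 (Ri \<cdot>\<^sub>2 Z) = Z"
  "Z \<in> carrier (T 2) \<Longrightarrow> Ri \<cdot>\<^sub>2 (R \<cdot>\<^sub>2 Z) = Z"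
  by (simp_all add: T.H.m_assoc[symmetric])

lemma twist_R_eq: "RF = P 2 [2, 1] F \<cdot>\<^sub>2 R \<cdot>\<^sub>2 Fi"
  by (simp add: twist_R_def)

lemma twist_R_Units:
  "RF \<in> Units (T 2)" "tinv K H 2 RF = F \<cdot>\<^sub>2 Ri \<cdot>\<^sub>2 P 2 [2, 1] Fi"
  by (rule T.H.Units_inverseI[where y = "F \<cdot>\<^sub>2 Ri \<cdot>\<^sub>2 P 2 [2, 1] Fi"];
      simp add: twist_R_eq T.H.m_assoc)+

lemma R_comul_swap:
  "h \<in> carrier H \<Longrightarrow> P 2 [2, 1] (comul H h) \<cdot>\<^sub>2 R = R \<cdot>\<^sub>2 comul H h"
  by (simp add: R_comul T.H.m_assoc)

text \<open>The relation between \<open>R\<close> and the coproduct, transported to any two legs by the homomorphism that places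
  them.\<close>

lemma R_comul_place:
  assumes h: "h \<in> carrier H" and ij: "i \<noteq> j" "i \<in> {1..n}" "j \<in> {1..n}"
  shows "P n [j, i] (comul H h) \<otimes>\<^bsub>T n\<^esub> P n [i, j] R
    = P n [i, j] R \<otimes>\<^bsub>T n\<^esub> P n [i, j] (comul H h)"
proof -
  have "P n [i, j] (P 2 [2, 1] (comul H h) \<cdot>\<^sub>2 R)
      = P n [i, j] (R \<cdot>\<^sub>2 comul H h)"
    using h by (simp add: R_comul_swap)
  then show ?thesis using h ij by simp
qed

text \<open>The next four identities say that \<open>R\<close> intertwines the two orders in which a coproduct can be
  placed on the two legs that \<open>R\<close> occupies, with a bystander in the third leg.\<close>

lemma R_comul_at_31 [rule_format]:
  "\<forall>X\<in>carrier (T 2). P 3 [3, 1, 2] (D 2 1 X) \<cdot>\<^sub>3 P 3 [1, 3] R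
    = P 3 [1, 3] R \<cdot>\<^sub>3 P 3 [1, 3, 2] (D 2 1 X)"
proof (rule tpow2_ext)
  fix a b assume ab: "a \<in> carrier H" "b \<in> carrier H"
  have "P 3 [1, 3] R \<cdot>\<^sub>3 pt [\<one>\<^sub>H, b, \<one>\<^sub>H] = pt [\<one>\<^sub>H, b, \<one>\<^sub>H] \<cdot>\<^sub>3 P 3 [1, 3] R"
    using ab by (intro pt_place_commute[where m = 2]) auto
  then show "P 3 [3, 1, 2] (D 2 1 (pt [a, b])) \<cdot>\<^sub>3 P 3 [1, 3] R
    = P 3 [1, 3] R \<cdot>\<^sub>3 P 3 [1, 3, 2] (D 2 1 (pt [a, b]))"
    using ab R_comul_place[of a 1 3 3]
    by (simp add: place_list_simps T.H.m_assoc) (simp add: T.H.m_assoc[symmetric])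
qed (auto intro!: linear_intros)

lemma R_comul_at_32 [rule_format]:
  "\<forall>X\<in>carrier (T 2). P 3 [1, 3, 2] (D 2 2 X) \<cdot>\<^sub>3 P 3 [2, 3] R
    = P 3 [2, 3] R \<cdot>\<^sub>3 D 2 2 X"
proof (rule tpow2_ext)
  fix a b assume ab: "a \<in> carrier H" "b \<in> carrier H"
  have "P 3 [2, 3] R \<cdot>\<^sub>3 pt [a, \<one>\<^sub>H, \<one>\<^sub>H] = pt [a, \<one>\<^sub>H, \<one>\<^sub>H] \<cdot>\<^sub>3 P 3 [2, 3] R"
    using ab by (intro pt_place_commute[where m = 2]) auto
  then show "P 3 [1, 3, 2] (D 2 2 (pt [a, b])) \<cdot>\<^sub>3 P 3 [2, 3] R
    = P 3 [2, 3] R \<cdot>\<^sub>3 D 2 2 (pt [a, b])"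
    using ab R_comul_place[of b 2 3 3]
    by (simp add: place_list_simps T.H.m_assoc) (simp add: T.H.m_assoc[symmetric])
qed (auto intro!: linear_intros)

lemma R_comul_at_13 [rule_format]:
  "\<forall>X\<in>carrier (T 2). P 3 [2, 3, 1] (D 2 2 X) \<cdot>\<^sub>3 P 3 [1, 3] R
    = P 3 [1, 3] R \<cdot>\<^sub>3 P 3 [2, 1, 3] (D 2 2 X)"
proof (rule tpow2_ext)
  fix a b assume ab: "a \<in> carrier H" "b \<in> carrier H"
  have "P 3 [1, 3] R \<cdot>\<^sub>3 pt [\<one>\<^sub>H, a, \<one>\<^sub>H] = pt [\<one>\<^sub>H, a, \<one>\<^sub>H] \<cdot>\<^sub>3 P 3 [1, 3] R"
    using ab by (intro pt_place_commute[where m = 2]) auto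
  then show "P 3 [2, 3, 1] (D 2 2 (pt [a, b])) \<cdot>\<^sub>3 P 3 [1, 3] R
    = P 3 [1, 3] R \<cdot>\<^sub>3 P 3 [2, 1, 3] (D 2 2 (pt [a, b]))"
    using ab R_comul_place[of b 1 3 3]
    by (simp add: place_list_simps T.H.m_assoc) (simp add: T.H.m_assoc[symmetric])
qed (auto intro!: linear_intros)

lemma R_comul_at_21 [rule_format]:
  "\<forall>X\<in>carrier (T 2). P 3 [2, 1, 3] (D 2 1 X) \<cdot>\<^sub>3 P 3 [1, 2] R
    = P 3 [1, 2] R \<cdot>\<^sub>3 D 2 1 X"
proof (rule tpow2_ext)
  fix a b assume ab: "a \<in> carrier H" "b \<in> carrier H"
  have "P 3 [1, 2] R \<cdot>\<^sub>3 pt [\<one>\<^sub>H, \<one>\<^sub>H, b] = pt [\<one>\<^sub>H, \<one>\<^sub>H, b] \<cdot>\<^sub>3 P 3 [1, 2] R"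
    using ab by (intro pt_place_commute[where m = 2]) auto
  then show "P 3 [2, 1, 3] (D 2 1 (pt [a, b])) \<cdot>\<^sub>3 P 3 [1, 2] R
    = P 3 [1, 2] R \<cdot>\<^sub>3 D 2 1 (pt [a, b])"
    using ab R_comul_place[of a 1 2 3]
    by (simp add: place_list_simps T.H.m_assoc) (simp add: T.H.m_assoc[symmetric])
qed (auto intro!: linear_intros)

lemma tinv_place3:
  assumes "X \<in> Units (T 3)" "distinct [i, j, k]" "i \<in> {1..3}" "j \<in> {1..3}" "k \<in> {1..3}"
  shows "tinv K H 3 (P 3 [i, j, k] X) = P 3 [i, j, k] (tinv K H 3 X)"
  using assms
  by (intro alg_hom_Units(2)[OF unital_algebra_tpow unital_algebra_tpow place_alg_hom, symmetric]) auto

lemma place_123 [rule_format, simp]: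
  "\<forall>X\<in>carrier (T 3). P 3 [1, 2, 3] X = X"
  by (intro tpow3_ext[where X = "T 3"] linear_intros) (simp_all add: place_list_simps)

text \<open>Substituting \<open>\<phi>\<^sub>F\<close> and \<open>R\<^sub>F\<close> leaves coproducts of \<open>F\<^sup>-\<^sup>1\<close> next to \<open>R\<^sub>1\<^sub>3\<close> and \<open>R\<^sub>1\<^sub>2\<close>. Moving them through \<open>R\<close>
  changes their placement into the one in which they cancel with the next factor.\<close>

lemma hexagon_right_twist:
  "comul_at K H' 2 2 RF
    = tinv K H 3 (P 3 [2, 3, 1] \<phi>F) \<cdot>\<^sub>3 P 3 [1, 3] RF \<cdot>\<^sub>3 P 3 [2, 1, 3] \<phi>F
      \<cdot>\<^sub>3 P 3 [1, 2] RF \<cdot>\<^sub>3 tinv K H 3 (P 3 [1, 2, 3] \<phi>F)"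
proof -
  have r13: "P 3 [2, 3, 1] (D 2 2 Fi) \<cdot>\<^sub>3 (P 3 [1, 3] R \<cdot>\<^sub>3 Z)
    = P 3 [1, 3] R \<cdot>\<^sub>3 (P 3 [2, 1, 3] (D 2 2 Fi) \<cdot>\<^sub>3 Z)"
    if "Z \<in> carrier (T 3)" for Z
    using that R_comul_at_13[of Fi] by (simp add: T.H.m_assoc[symmetric])
  have r12: "P 3 [2, 1, 3] (D 2 1 Fi) \<cdot>\<^sub>3 (P 3 [1, 2] R \<cdot>\<^sub>3 Z)
    = P 3 [1, 2] R \<cdot>\<^sub>3 (D 2 1 Fi \<cdot>\<^sub>3 Z)"
    if "Z \<in> carrier (T 3)" for Z
    using that R_comul_at_21[of Fi] by (simp add: T.H.m_assoc[symmetric])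
  have inv: "tinv K H 3 (P 3 [2, 3, 1] \<phi>F) = P 3 [2, 3, 1] (tinv K H 3 \<phi>F)"
    "tinv K H 3 (P 3 [1, 2, 3] \<phi>F) = P 3 [1, 2, 3] (tinv K H 3 \<phi>F)"
    "tinv K H 3 (P 3 [2, 3, 1] \<phi>) = P 3 [2, 3, 1] \<phi>i"
    using reassoc_twist_Units(1) reassoc_unit by (intro tinv_place3; simp)+
  show ?thesis
    unfolding inv(1,2) reassoc_twist_Units(2)
    by (simp add: inv(3) reassoc_twist twist_R_eq comul_at_2_2_place_21 R_hexagon_right T.H.m_assoc r13 r12)
qed

lemma hexagon_left_twist:
  "comul_at K H' 2 1 RF
    = P 3 [3, 1, 2] \<phi>F \<cdot>\<^sub>3 P 3 [1, 3] RF \<cdot>\<^sub>3 tinv K H 3 (P 3 [1, 3, 2] \<phi>F)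
      \<cdot>\<^sub>3 P 3 [2, 3] RF \<cdot>\<^sub>3 P 3 [1, 2, 3] \<phi>F"
proof -
  have r13: "P 3 [3, 1, 2] (D 2 1 Fi) \<cdot>\<^sub>3 (P 3 [1, 3] R \<cdot>\<^sub>3 Z)
    = P 3 [1, 3] R \<cdot>\<^sub>3 (P 3 [1, 3, 2] (D 2 1 Fi) \<cdot>\<^sub>3 Z)"
    if "Z \<in> carrier (T 3)" for Z
    using that R_comul_at_31[of Fi] by (simp add: T.H.m_assoc[symmetric])
  have r23: "P 3 [1, 3, 2] (D 2 2 Fi) \<cdot>\<^sub>3 (P 3 [2, 3] R \<cdot>\<^sub>3 Z)
    = P 3 [2, 3] R \<cdot>\<^sub>3 (D 2 2 Fi \<cdot>\<^sub>3 Z)"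
    if "Z \<in> carrier (T 3)" for Z
    using that R_comul_at_32[of Fi] by (simp add: T.H.m_assoc[symmetric])
  have inv: "tinv K H 3 (P 3 [1, 3, 2] \<phi>F) = P 3 [1, 3, 2] (tinv K H 3 \<phi>F)"
    "tinv K H 3 (P 3 [1, 3, 2] \<phi>) = P 3 [1, 3, 2] \<phi>i"
    using reassoc_twist_Units(1) reassoc_unit by (intro tinv_place3; simp)+
  show ?thesis
    unfolding inv(1) reassoc_twist_Units(2)
    by (simp add: inv(2) reassoc_twist twist_R_eq comul_at_2_1_place_21 R_hexagon_left T.H.m_assoc r13 r23)
qed

theorem quasitriangular_twist: "quasitriangular_quasi_hopf_algebra K H' RF"
proof (intro quasitriangular_quasi_hopf_algebra.intro quasitriangular_quasi_hopf_algebra_axioms.intro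
    quasi_hopf_algebra_twist)
  show "RF \<in> Units (tpow K H' 2)" using twist_R_Units(1) by simp
  show "place K H' 2 [2, 1] (comul H' h)
      = RF \<otimes>\<^bsub>tpow K H' 2\<^esub> comul H' h \<otimes>\<^bsub>tpow K H' 2\<^esub> tinv K H' 2 RF" if "h \<in> carrier H'" for h
    using that unfolding tpow_twist twist_R_Units(2)
    by (simp add: twist_R_eq R_comul T.H.m_assoc)
qed (simp_all only: tpow_twist place_twist hexagon_right_twist hexagon_left_twist)

end

section \<open>Modules and their tensor products\<close>

lemma with_act_fields [simp]:
  "carrier (with_act M a) = carrier M" "zero (with_act M a) = zero M" "add (with_act M a) = add M"
  "smult (with_act M a) = smult M" "act (with_act M a) = a"
  by (simp_all add: with_act_def)

lemma tensor_cong: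
  assumes "carrier V' = carrier V" "add V' = add V" "smult V' = smult V"
    "carrier W' = carrier W" "add W' = add W" "smult W' = smult W"
  shows "tensor K V' W' = tensor K V W" "tens K V' W' = tens K V W"
proof -
  have "tensor_null K V' W' = tensor_null K V W"
    using assms by (simp add: tensor_null_def tensor_rels_def)
  then show "tensor K V' W' = tensor K V W" "tens K V' W' = tens K V W"
    using assms by (simp_all add: tensor_def tens_def fun_eq_iff)
qed

lemma with_act_simps [simp]:
  "tensor K (with_act M a) W = tensor K M W" "tens K (with_act M a) W = tens K M W"
  "tensor K W (with_act M a) = tensor K W M" "tens K W (with_act M a) = tens K W M"
  "lin_ext K (with_act M a) = lin_ext K M"
  "linear_map K (with_act M a) W f = linear_map K M W f"
  "linear_map K W (with_act M a) g = linear_map K W M g"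
  by (intro tensor_cong lin_ext_module_cong; simp)+ (simp_all add: linear_map_def)

lemma module_with_act [simp]: "module K M \<Longrightarrow> module K (with_act M a)"
  by (rule module_cong) simp_all

lemma tensor_triple_ext:
  assumes "module K U" "module K V" "module K W" "module K X"
    and "linear_map K (tensor K (tensor K U V) W) X \<phi>" "linear_map K (tensor K (tensor K U V) W) X \<psi>"
    and eq: "\<And>u v w. \<lbrakk>u \<in> carrier U; v \<in> carrier V; w \<in> carrier W\<rbrakk> \<Longrightarrow>
      \<phi> (tens K (tensor K U V) W (tens K U V u v) w) = \<psi> (tens K (tensor K U V) W (tens K U V u v) w)"
  shows "\<forall>t\<in>carrier (tensor K (tensor K U V) W). \<phi> t = \<psi> t"
proof (rule tensor_ext)
  fix s w assume s: "s \<in> carrier (tensor K U V)" and w: "w \<in> carrier W"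
  have "\<forall>s\<in>carrier (tensor K U V). \<phi> (tens K (tensor K U V) W s w) = \<psi> (tens K (tensor K U V) W s w)"
    using assms w
    by (intro tensor_ext[where X = X] linear_map_comp[OF assms(5)] linear_map_comp[OF assms(6)]
        linear_map_tens_left linear_map_id) simp_all
  then show "\<phi> (tens K (tensor K U V) W s w) = \<psi> (tens K (tensor K U V) W s w)" using s by blast
qed (use assms in simp_all)

lemma linear_map_restrict:
  "module K V \<Longrightarrow> linear_map K V W (\<lambda>v\<in>carrier V. f v) \<longleftrightarrow> linear_map K V W f"
  by (rule linear_map_cong) simp_all

lemma linear_map_restrict_id: "module K V \<Longrightarrow> linear_map K V V (\<lambda>v\<in>carrier V. v)"
  by (simp add: linear_map_restrict linear_map_id)

context
  fixes K :: "'k ring" and V :: "('k, 'v, 'm) module_scheme" and W :: "('k, 'w, 'n) module_scheme"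
    and V' :: "('k, 'v2, 'm2) module_scheme" and W' :: "('k, 'w2, 'n2) module_scheme" and f g
  assumes modules: "module K V" "module K W" "module K V'" "module K W'"
    and lin: "linear_map K V V' f" "linear_map K W W' g"
begin

lemma tensor_map_bilinear:
  "w \<in> carrier W \<Longrightarrow> linear_map K V (tensor K V' W') (\<lambda>v. tens K V' W' (f v) (g w))"
  "v \<in> carrier V \<Longrightarrow> linear_map K W (tensor K V' W') (\<lambda>w. tens K V' W' (f v) (g w))"
  using linear_map_closed[OF lin(1)] linear_map_closed[OF lin(2)]
  by (intro linear_intros modules lin; simp)+

lemma tensor_map_linear: "linear_map K (tensor K V W) (tensor K V' W') (tensor_map K V W V' W' f g)"
  unfolding tensor_map_def using modules tensor_map_bilinear
  by (simp add: linear_map_restrict linear_map_lin_ext_tensor)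

lemma tensor_map_tens:
  "\<lbrakk>v \<in> carrier V; w \<in> carrier W\<rbrakk>
    \<Longrightarrow> tensor_map K V W V' W' f g (tens K V W v w) = tens K V' W' (f v) (g w)"
  unfolding tensor_map_def using modules tensor_map_bilinear by (simp add: lin_ext_tens)

lemma tensor_map_closed [simp]:
  "t \<in> carrier (tensor K V W) \<Longrightarrow> tensor_map K V W V' W' f g t \<in> carrier (tensor K V' W')"
  by (rule linear_map_closed[OF tensor_map_linear])

end

context coproduct_algebra
begin

interpretation T: unital_algebra K "T n" for n by (rule unital_algebra_tpow)

lemma left_module_module [simp]: "left_module K H V \<Longrightarrow> module K V"
  by (simp add: left_module_def)

lemma act_closed [simp]:
  "\<lbrakk>left_module K H V; h \<in> carrier H; v \<in> carrier V\<rbrakk> \<Longrightarrow> act V h v \<in> carrier V"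
  by (rule linear_map_closed[OF left_module.act_linear])

lemma act_mult' [simp]:
  "\<lbrakk>left_module K H V; g \<in> carrier H; h \<in> carrier H; v \<in> carrier V\<rbrakk>
    \<Longrightarrow> act V (g \<cdot> h) v = act V g (act V h v)"
  by (rule left_module.act_mult)

lemma act_one' [simp]: "\<lbrakk>left_module K H V; v \<in> carrier V\<rbrakk> \<Longrightarrow> act V \<one>\<^sub>H v = v"
  by (rule left_module.act_one)

lemma linear_map_act_left [linear_intros]:
  "\<lbrakk>left_module K H V; linear_map K U H f; v \<in> carrier V\<rbrakk> \<Longrightarrow> linear_map K U V (\<lambda>u. act V (f u) v)"
  by (rule linear_mapI)
    (auto simp: linear_map_add linear_map_smult linear_map_closed
      left_module.act_add left_module.act_smult)

lemma linear_map_act_right [linear_intros]: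
  "\<lbrakk>left_module K H V; h \<in> carrier H; linear_map K U V f\<rbrakk> \<Longrightarrow> linear_map K U V (\<lambda>u. act V h (f u))"
  by (rule linear_map_comp[OF left_module.act_linear])

lemma left_moduleI:
  assumes "module K V" "\<And>h. h \<in> carrier H \<Longrightarrow> linear_map K V V (act V h)"
    and "\<And>v. v \<in> carrier V \<Longrightarrow> linear_map K H V (\<lambda>h. act V h v)"
    and "\<And>v. v \<in> carrier V \<Longrightarrow> act V \<one>\<^sub>H v = v"
    and "\<And>g h v. \<lbrakk>g \<in> carrier H; h \<in> carrier H; v \<in> carrier V\<rbrakk>
      \<Longrightarrow> act V (g \<cdot> h) v = act V g (act V h v)"
  shows "left_module K H V"
  using assms(1,2,4,5) linear_map_add[OF assms(3)] linear_map_smult[OF assms(3)]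
  by (intro left_module.intro left_module_axioms.intro unital_algebra_self) auto

subsection \<open>The action of the tensor square\<close>

text \<open>\<open>X = X\<^sub>1 \<otimes> X\<^sub>2\<close> acts by \<open>X\<^sub>1\<close> on the left and \<open>X\<^sub>2\<close> on the right tensor factor. The action of \<open>h\<close> on
  \<open>V \<otimes> W\<close> is the case \<open>X = \<Delta>(h)\<close>, and the coherence map of the twisting functor is the case
  \<open>X = F\<^sup>-\<^sup>1\<close>.\<close>

definition tensor_act ::
  "('k, 'h, 'v) hmod \<Rightarrow> ('k, 'h, 'w) hmod \<Rightarrow> ('h list \<Rightarrow> 'k) set
    \<Rightarrow> ('v \<times> 'w \<Rightarrow> 'k) set \<Rightarrow> ('v \<times> 'w \<Rightarrow> 'k) set" where
  "tensor_act V W X = lin_ext K (tensor K V W) (\<lambda>(v, w).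
     lin_ext K (tensor K V W) (leg2 (\<lambda>a b. tens K V W (act V a v) (act W b w))) X)"

context
  fixes V :: "('k, 'h, 'v) hmod" and W :: "('k, 'h, 'w) hmod"
  assumes V [simp]: "left_module K H V" and W [simp]: "left_module K H W"
begin

lemma tensor_act_bilinear:
  "\<lbrakk>X \<in> carrier (T 2); w \<in> carrier W\<rbrakk> \<Longrightarrow> linear_map K V (tensor K V W)
     (\<lambda>v. lin_ext K (tensor K V W) (leg2 (\<lambda>a b. tens K V W (act V a v) (act W b w))) X)"
  "\<lbrakk>X \<in> carrier (T 2); v \<in> carrier V\<rbrakk> \<Longrightarrow> linear_map K W (tensor K V W)
     (\<lambda>w. lin_ext K (tensor K V W) (leg2 (\<lambda>a b. tens K V W (act V a v) (act W b w))) X)"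
  by (intro linear_intros; simp)+

lemma linear_map_tensor_act [linear_intros]:
  assumes "X \<in> carrier (T 2)" "linear_map K U (tensor K V W) f"
  shows "linear_map K U (tensor K V W) (\<lambda>u. tensor_act V W X (f u))"
  unfolding tensor_act_def using tensor_act_bilinear[OF assms(1)]
  by (intro linear_map_comp[OF linear_map_lin_ext_tensor assms(2)]) simp_all

lemma linear_map_tensor_act_left [linear_intros]:
  assumes "module K U" "linear_map K U (T 2) f" "t \<in> carrier (tensor K V W)"
  shows "linear_map K U (tensor K V W) (\<lambda>u. tensor_act V W (f u) t)"
  unfolding tensor_act_def
proof (rule linear_map_lin_ext_tensor_param[OF _ _ _ _ assms(3)])
  fix v w assume "v \<in> carrier V" "w \<in> carrier W"
  then show "linear_map K U (tensor K V W) (\<lambda>u. lin_ext K (tensor K V W)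
      (leg2 (\<lambda>a b. tens K V W (act V a v) (act W b w))) (f u))"
    by (intro linear_intros assms(2); simp)
qed (simp_all add: assms(1))

lemma linear_map_restrict_tensor_act:
  "X \<in> carrier (T 2) \<Longrightarrow> linear_map K (tensor K V W) (tensor K V W)
     (\<lambda>t\<in>carrier (tensor K V W). tensor_act V W X t)"
  using linear_map_tensor_act[OF _ linear_map_id, of X] by (simp add: linear_map_restrict)

lemma tensor_act_closed [simp]:
  "\<lbrakk>X \<in> carrier (T 2); t \<in> carrier (tensor K V W)\<rbrakk> \<Longrightarrow> tensor_act V W X t \<in> carrier (tensor K V W)"
  by (rule linear_map_closed[OF linear_map_tensor_act[OF _ linear_map_id]])

lemma tensor_act_pt [simp]:
  assumes "a \<in> carrier H" "b \<in> carrier H" "v \<in> carrier V" "w \<in> carrier W"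
  shows "tensor_act V W (pt [a, b]) (tens K V W v w) = tens K V W (act V a v) (act W b w)"
proof -
  have "tensor_act V W (pt [a, b]) (tens K V W v w)
      = lin_ext K (tensor K V W) (leg2 (\<lambda>a b. tens K V W (act V a v) (act W b w))) (pt [a, b])"
    unfolding tensor_act_def using tensor_act_bilinear[of "pt [a, b]"] assms by (simp add: lin_ext_tens)
  also have "\<dots> = tens K V W (act V a v) (act W b w)"
    using assms by (intro lin_ext_leg2 linear_intros) simp_all
  finally show ?thesis .
qed

lemma tensor_act_one [rule_format, simp]: "\<forall>t\<in>carrier (tensor K V W). tensor_act V W \<one>\<^bsub>T 2\<^esub> t = t"
  by (intro tensor_ext[where X = "tensor K V W"] linear_intros) (simp_all add: pt2_one[symmetric])

lemma tensor_act_mult_tens [rule_format]: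
  "\<lbrakk>v \<in> carrier V; w \<in> carrier W\<rbrakk> \<Longrightarrow> \<forall>X\<in>carrier (T 2). \<forall>Y\<in>carrier (T 2).
    tensor_act V W (X \<cdot>\<^sub>2 Y) (tens K V W v w) = tensor_act V W X (tensor_act V W Y (tens K V W v w))"
  by (intro tpow2_ext2[where X = "tensor K V W"] tpow2_ext[where X = "tensor K V W"] linear_intros) simp_all

lemma tensor_act_mult [rule_format, simp]:
  "\<lbrakk>X \<in> carrier (T 2); Y \<in> carrier (T 2)\<rbrakk> \<Longrightarrow> \<forall>t\<in>carrier (tensor K V W).
    tensor_act V W (X \<cdot>\<^sub>2 Y) t = tensor_act V W X (tensor_act V W Y t)"
  by (intro tensor_ext[where X = "tensor K V W"] linear_intros) (simp_all add: tensor_act_mult_tens)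

end

lemma act_hmod_tensor [simp]: "act (hmod_tensor K H V W) h = tensor_act V W (comul H h)"
  by (simp add: hmod_tensor_def tensor_act_def)

lemma hmod_tensor_simps [simp]:
  "carrier (hmod_tensor K G V W) = carrier (tensor K V W)"
  "tensor K (hmod_tensor K G V W) X = tensor K (tensor K V W) X"
  "tensor K X (hmod_tensor K G V W) = tensor K X (tensor K V W)"
  "tens K (hmod_tensor K G V W) X = tens K (tensor K V W) X"
  "tens K X (hmod_tensor K G V W) = tens K X (tensor K V W)"
  "lin_ext K (hmod_tensor K G V W) = lin_ext K (tensor K V W)"
  "linear_map K (hmod_tensor K G V W) X f = linear_map K (tensor K V W) X f"
  "linear_map K X (hmod_tensor K G V W) g = linear_map K X (tensor K V W) g"
  by (simp_all add: hmod_tensor_def)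

lemma left_module_hmod_tensor [simp]:
  assumes [simp]: "left_module K H V" "left_module K H W"
  shows "left_module K H (hmod_tensor K H V W)"
proof (rule left_moduleI)
  show "module K (hmod_tensor K H V W)" by (simp add: hmod_tensor_def)
  show "linear_map K (hmod_tensor K H V W) (hmod_tensor K H V W) (act (hmod_tensor K H V W) h)"
    if "h \<in> carrier H" for h
    using linear_map_tensor_act[OF assms _ linear_map_id, of "comul H h"] that by simp
  show "linear_map K H (hmod_tensor K H V W) (\<lambda>h. act (hmod_tensor K H V W) h t)"
    if "t \<in> carrier (hmod_tensor K H V W)" for t
    using that by simp (intro linear_intros; simp)
qed simp_all

subsection \<open>The action of the tensor cube along the associator\<close>

text \<open>Rebracketing followed by the action of \<open>\<theta>\<close>, that is, the associator with \<open>\<theta>\<close> in place of \<open>\<phi>\<close>. A variable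
  \<open>\<theta>\<close> records what happens to the reassociator when the associator is composed with other maps.\<close>

definition assoc_act ::
  "('k, 'h, 'v) hmod \<Rightarrow> ('k, 'h, 'w) hmod \<Rightarrow> ('k, 'h, 'x) hmod \<Rightarrow> ('h list \<Rightarrow> 'k) set
    \<Rightarrow> (('v \<times> 'w \<Rightarrow> 'k) set \<times> 'x \<Rightarrow> 'k) set \<Rightarrow> ('v \<times> ('w \<times> 'x \<Rightarrow> 'k) set \<Rightarrow> 'k) set" where
  "assoc_act V W X \<theta> = lin_ext K (tensor K V (tensor K W X)) (\<lambda>(s, x).
     lin_ext K (tensor K V (tensor K W X)) (\<lambda>(v, w).
       lin_ext K (tensor K V (tensor K W X)) (leg3 (\<lambda>a b c.
         tens K V (tensor K W X) (act V a v) (tens K W X (act W b w) (act X c x)))) \<theta>) s)"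

context
  fixes V :: "('k, 'h, 'v) hmod" and W :: "('k, 'h, 'w) hmod" and X :: "('k, 'h, 'x) hmod"
  assumes V [simp]: "left_module K H V" and W [simp]: "left_module K H W"
    and X [simp]: "left_module K H X"
begin

abbreviation (input) source where "source \<equiv> tensor K (tensor K V W) X"
abbreviation (input) target where "target \<equiv> tensor K V (tensor K W X)"

text \<open>The value at \<open>(v \<otimes> w) \<otimes> x\<close>. Naming it keeps the innermost linear extension folded while linearity in each
  argument is established.\<close>

definition assoc_val where
  "assoc_val \<theta> v w x = lin_ext K target (leg3 (\<lambda>a b c.
     tens K V (tensor K W X) (act V a v) (tens K W X (act W b w) (act X c x)))) \<theta>"

lemma linear_map_assoc_val:
  "\<lbrakk>linear_map K U (T 3) f; v \<in> carrier V; w \<in> carrier W; x \<in> carrier X\<rbrakk>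
    \<Longrightarrow> linear_map K U target (\<lambda>u. assoc_val (f u) v w x)"
  "\<lbrakk>\<theta> \<in> carrier (T 3); w \<in> carrier W; x \<in> carrier X\<rbrakk> \<Longrightarrow> linear_map K V target (\<lambda>v. assoc_val \<theta> v w x)"
  "\<lbrakk>\<theta> \<in> carrier (T 3); v \<in> carrier V; x \<in> carrier X\<rbrakk> \<Longrightarrow> linear_map K W target (\<lambda>w. assoc_val \<theta> v w x)"
  "\<lbrakk>\<theta> \<in> carrier (T 3); v \<in> carrier V; w \<in> carrier W\<rbrakk> \<Longrightarrow> linear_map K X target (\<lambda>x. assoc_val \<theta> v w x)"
  unfolding assoc_val_def by (intro linear_intros; simp)+

lemma assoc_act_eq:
  "assoc_act V W X \<theta> = lin_ext K target (\<lambda>(s, x). lin_ext K target (\<lambda>(v, w). assoc_val \<theta> v w x) s)"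
  by (simp add: assoc_act_def assoc_val_def)

lemma assoc_act_bilinear:
  "\<lbrakk>\<theta> \<in> carrier (T 3); x \<in> carrier X\<rbrakk>
    \<Longrightarrow> linear_map K (tensor K V W) target (\<lambda>s. lin_ext K target (\<lambda>(v, w). assoc_val \<theta> v w x) s)"
  "\<lbrakk>\<theta> \<in> carrier (T 3); s \<in> carrier (tensor K V W)\<rbrakk>
    \<Longrightarrow> linear_map K X target (\<lambda>x. lin_ext K target (\<lambda>(v, w). assoc_val \<theta> v w x) s)"
proof -
  show "linear_map K (tensor K V W) target (\<lambda>s. lin_ext K target (\<lambda>(v, w). assoc_val \<theta> v w x) s)"
    if "\<theta> \<in> carrier (T 3)" "x \<in> carrier X"
    by (rule linear_map_lin_ext_tensor) (simp_all add: that linear_map_assoc_val)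
  show "linear_map K X target (\<lambda>x. lin_ext K target (\<lambda>(v, w). assoc_val \<theta> v w x) s)"
    if "\<theta> \<in> carrier (T 3)" "s \<in> carrier (tensor K V W)"
    by (rule linear_map_lin_ext_tensor_param[OF _ _ _ _ that(2)]) (simp_all add: that linear_map_assoc_val)
qed

lemma linear_map_assoc_act [linear_intros]:
  assumes "\<theta> \<in> carrier (T 3)" "linear_map K U source f"
  shows "linear_map K U target (\<lambda>u. assoc_act V W X \<theta> (f u))"
  unfolding assoc_act_eq using assoc_act_bilinear[OF assms(1)]
  by (intro linear_map_comp[OF linear_map_lin_ext_tensor assms(2)]) simp_all

lemma linear_map_assoc_act_left [linear_intros]:
  assumes U: "module K U" and f: "linear_map K U (T 3) f" and t: "t \<in> carrier source"
  shows "linear_map K U target (\<lambda>u. assoc_act V W X (f u) t)"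
  unfolding assoc_act_eq
proof (rule linear_map_lin_ext_tensor_param[OF _ _ _ _ t])
  show "linear_map K U target (\<lambda>u. lin_ext K target (\<lambda>(v, w). assoc_val (f u) v w x) s)"
    if "s \<in> carrier (tensor K V W)" "x \<in> carrier X" for s x
    by (rule linear_map_lin_ext_tensor_param[OF _ _ _ _ that(1)])
      (simp_all add: U linear_map_assoc_val f that)
qed (simp_all add: U)

lemma assoc_act_closed [simp]:
  "\<lbrakk>\<theta> \<in> carrier (T 3); t \<in> carrier source\<rbrakk> \<Longrightarrow> assoc_act V W X \<theta> t \<in> carrier target"
  by (rule linear_map_closed[OF linear_map_assoc_act[OF _ linear_map_id]])

lemma assoc_act_pt [simp]:
  assumes "a \<in> carrier H" "b \<in> carrier H" "c \<in> carrier H" "v \<in> carrier V" "w \<in> carrier W" "x \<in> carrier X"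
  shows "assoc_act V W X (pt [a, b, c]) (tens K (tensor K V W) X (tens K V W v w) x)
    = tens K V (tensor K W X) (act V a v) (tens K W X (act W b w) (act X c x))"
proof -
  have "assoc_act V W X (pt [a, b, c]) (tens K (tensor K V W) X (tens K V W v w) x)
      = lin_ext K target (\<lambda>(v, w). assoc_val (pt [a, b, c]) v w x) (tens K V W v w)"
    unfolding assoc_act_eq using assms assoc_act_bilinear[of "pt [a, b, c]"] by (simp add: lin_ext_tens)
  also have "\<dots> = assoc_val (pt [a, b, c]) v w x"
    using assms by (simp add: lin_ext_tens linear_map_assoc_val)
  also have "\<dots> = tens K V (tensor K W X) (act V a v) (tens K W X (act W b w) (act X c x))"
    unfolding assoc_val_def using assms by (intro lin_ext_leg3 linear_intros) simp_all
  finally show ?thesis .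
qed

lemma hmod_assoc_eq: "hmod_assoc K G V W X = (\<lambda>t\<in>carrier source. assoc_act V W X (reassoc G) t)"
  by (simp add: hmod_assoc_def assoc_act_def Let_def)

lemma assoc_act_ext:
  assumes "module K Z" "t \<in> carrier source" "\<theta> \<in> carrier (T 3)"
    and "\<And>\<theta>. \<theta> \<in> carrier (T 3) \<Longrightarrow> linear_map K source Z (f \<theta>)"
    and "\<And>\<theta>. \<theta> \<in> carrier (T 3) \<Longrightarrow> linear_map K source Z (g \<theta>)"
    and "\<And>t. t \<in> carrier source \<Longrightarrow> linear_map K (T 3) Z (\<lambda>\<theta>. f \<theta> t)"
    and "\<And>t. t \<in> carrier source \<Longrightarrow> linear_map K (T 3) Z (\<lambda>\<theta>. g \<theta> t)"
    and eq: "\<And>a b c v w x. \<lbrakk>a \<in> carrier H; b \<in> carrier H; c \<in> carrier H;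
        v \<in> carrier V; w \<in> carrier W; x \<in> carrier X\<rbrakk> \<Longrightarrow>
      f (pt [a, b, c]) (tens K (tensor K V W) X (tens K V W v w) x)
      = g (pt [a, b, c]) (tens K (tensor K V W) X (tens K V W v w) x)"
  shows "f \<theta> t = g \<theta> t"
proof -
  have "\<forall>\<theta>\<in>carrier (T 3). f \<theta> t = g \<theta> t"
  proof (rule tpow3_ext)
    fix a b c assume abc: "a \<in> carrier H" "b \<in> carrier H" "c \<in> carrier H"
    have "\<forall>t\<in>carrier source. f (pt [a, b, c]) t = g (pt [a, b, c]) t"
      using eq abc by (intro tensor_triple_ext[OF _ _ _ assms(1)] assms(4,5)) simp_all
    then show "f (pt [a, b, c]) t = g (pt [a, b, c]) t" using assms(2) by blast
  qed (use assms in simp_all)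
  then show ?thesis using assms(3) by blast
qed

text \<open>Composing \<open>assoc_act\<close> with the action of \<open>Y\<close> on two tensor factors multiplies \<open>\<theta>\<close> by \<open>Y\<close>, placed on the two
  legs concerned: from the left if \<open>Y\<close> acts afterwards and from the right if it acts before. If one of the
  factors is itself a tensor product, on which a leg of \<open>Y\<close> acts through its coproduct, the placement becomes a
  coproduct on this leg.\<close>

lemma assoc_act_place_23:
  assumes Y: "Y \<in> carrier (T 2)" and "\<theta> \<in> carrier (T 3)" "t \<in> carrier source"
  shows "tensor_map K V (tensor K W X) V (tensor K W X) (\<lambda>v\<in>carrier V. v)
      (\<lambda>s\<in>carrier (tensor K W X). tensor_act W X Y s) (assoc_act V W X \<theta> t)
    = assoc_act V W X (P 3 [2, 3] Y \<cdot>\<^sub>3 \<theta>) t" (is "?M (assoc_act V W X \<theta> t) = _")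
proof (rule assoc_act_ext[OF _ assms(3,2), where Z = target])
  have lin: "linear_map K target target ?M"
    by (intro tensor_map_linear linear_map_restrict_id linear_map_restrict_tensor_act Y) simp_all
  show "linear_map K source target (\<lambda>t. ?M (assoc_act V W X \<theta> t))" if "\<theta> \<in> carrier (T 3)" for \<theta>
    using that by (intro linear_map_comp[OF lin] linear_intros)
  show "linear_map K (T 3) target (\<lambda>\<theta>. ?M (assoc_act V W X \<theta> t))" if "t \<in> carrier source" for t
    using that by (intro linear_map_comp[OF lin] linear_intros) simp_all
  fix a b c v w x assume abc: "a \<in> carrier H" "b \<in> carrier H" "c \<in> carrier H"
    and vwx: "v \<in> carrier V" "w \<in> carrier W" "x \<in> carrier X"
  let ?t = "tens K (tensor K V W) X (tens K V W v w) x"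
  have "\<forall>Y\<in>carrier (T 2). tens K V (tensor K W X) (act V a v) (tensor_act W X Y (tens K W X (act W b w) (act X c x)))
      = assoc_act V W X (P 3 [2, 3] Y \<cdot>\<^sub>3 pt [a, b, c]) ?t"
    using abc vwx by (intro tpow2_ext[where X = target] linear_intros) (simp_all add: place_list_simps)
  moreover have "?M (assoc_act V W X (pt [a, b, c]) ?t)
      = tens K V (tensor K W X) (act V a v) (tensor_act W X Y (tens K W X (act W b w) (act X c x)))"
    using abc vwx unfolding assoc_act_pt[OF abc vwx]
    by (subst tensor_map_tens; simp add: linear_map_restrict_id linear_map_restrict_tensor_act Y)
  ultimately show "?M (assoc_act V W X (pt [a, b, c]) ?t)
      = assoc_act V W X (P 3 [2, 3] Y \<cdot>\<^sub>3 pt [a, b, c]) ?t" using Y by simp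
qed (use Y in \<open>auto intro!: linear_intros\<close>)

lemma assoc_act_place_12:
  assumes Y: "Y \<in> carrier (T 2)" and "\<theta> \<in> carrier (T 3)" "t \<in> carrier source"
  shows "assoc_act V W X \<theta> (tensor_map K (tensor K V W) X (tensor K V W) X
      (\<lambda>s\<in>carrier (tensor K V W). tensor_act V W Y s) (\<lambda>x\<in>carrier X. x) t)
    = assoc_act V W X (\<theta> \<cdot>\<^sub>3 P 3 [1, 2] Y) t" (is "assoc_act V W X \<theta> (?M t) = _")
proof (rule assoc_act_ext[OF _ assms(3,2), where Z = target])
  have lin: "linear_map K source source ?M"
    by (intro tensor_map_linear linear_map_restrict_id linear_map_restrict_tensor_act Y) simp_all
  show "linear_map K source target (\<lambda>t. assoc_act V W X \<theta> (?M t))" if "\<theta> \<in> carrier (T 3)" for \<theta>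
    using that by (intro linear_intros lin)
  show "linear_map K (T 3) target (\<lambda>\<theta>. assoc_act V W X \<theta> (?M t))" if "t \<in> carrier source" for t
    using that linear_map_closed[OF lin] by (intro linear_intros) simp_all
  fix a b c v w x assume abc: "a \<in> carrier H" "b \<in> carrier H" "c \<in> carrier H"
    and vwx: "v \<in> carrier V" "w \<in> carrier W" "x \<in> carrier X"
  let ?t = "tens K (tensor K V W) X (tens K V W v w) x"
  have "\<forall>Y\<in>carrier (T 2). assoc_act V W X (pt [a, b, c]) (tens K (tensor K V W) X (tensor_act V W Y (tens K V W v w)) x)
      = assoc_act V W X (pt [a, b, c] \<cdot>\<^sub>3 P 3 [1, 2] Y) ?t"
    using abc vwx by (intro tpow2_ext[where X = target] linear_intros) (simp_all add: place_list_simps)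
  moreover have "?M ?t = tens K (tensor K V W) X (tensor_act V W Y (tens K V W v w)) x"
    using abc vwx
    by (subst tensor_map_tens; simp add: linear_map_restrict_id linear_map_restrict_tensor_act Y)
  ultimately show "assoc_act V W X (pt [a, b, c]) (?M ?t)
      = assoc_act V W X (pt [a, b, c] \<cdot>\<^sub>3 P 3 [1, 2] Y) ?t" using Y by simp
qed (use Y in \<open>auto intro!: linear_intros\<close>)

lemma linear_map_tensor_act_right_tensor:
  "\<lbrakk>Y \<in> carrier (T 2); linear_map K U target f\<rbrakk>
    \<Longrightarrow> linear_map K U target (\<lambda>u. tensor_act V (hmod_tensor K H W X) Y (f u))"
  using linear_map_tensor_act[OF V left_module_hmod_tensor[OF W X], of Y U f] by simp

lemma linear_map_tensor_act_left_tensor: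
  "\<lbrakk>Y \<in> carrier (T 2); linear_map K U source f\<rbrakk>
    \<Longrightarrow> linear_map K U source (\<lambda>u. tensor_act (hmod_tensor K H V W) X Y (f u))"
  using linear_map_tensor_act[OF left_module_hmod_tensor[OF V W] X, of Y U f] by simp

lemma assoc_act_comul_2:
  assumes Y: "Y \<in> carrier (T 2)" and "\<theta> \<in> carrier (T 3)" "t \<in> carrier source"
  shows "tensor_act V (hmod_tensor K H W X) Y (assoc_act V W X \<theta> t)
    = assoc_act V W X (D 2 2 Y \<cdot>\<^sub>3 \<theta>) t"
proof (rule assoc_act_ext[OF _ assms(3,2), where Z = target])
  note lin = linear_map_tensor_act_right_tensor
  show "linear_map K source target (\<lambda>t. tensor_act V (hmod_tensor K H W X) Y (assoc_act V W X \<theta> t))"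
    if "\<theta> \<in> carrier (T 3)" for \<theta> using that Y by (intro lin linear_intros)
  show "linear_map K (T 3) target (\<lambda>\<theta>. tensor_act V (hmod_tensor K H W X) Y (assoc_act V W X \<theta> t))"
    if "t \<in> carrier source" for t using that Y by (intro lin linear_intros) simp_all
  fix a b c v w x assume abc: "a \<in> carrier H" "b \<in> carrier H" "c \<in> carrier H"
    and vwx: "v \<in> carrier V" "w \<in> carrier W" "x \<in> carrier X"
  let ?t = "tens K (tensor K V W) X (tens K V W v w) x"
  let ?r = "tens K W X (act W b w) (act X c x)"
  have "\<forall>Y\<in>carrier (T 2). tensor_act V (hmod_tensor K H W X) Y (tens K V (tensor K W X) (act V a v) ?r)
      = assoc_act V W X (D 2 2 Y \<cdot>\<^sub>3 pt [a, b, c]) ?t"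
  proof (rule tpow2_ext)
    fix p q assume pq: "p \<in> carrier H" "q \<in> carrier H"
    have "\<forall>Z\<in>carrier (T 2). tens K V (tensor K W X) (act V p (act V a v)) (tensor_act W X Z ?r)
        = assoc_act V W X (pt [p, \<one>\<^sub>H, \<one>\<^sub>H] \<cdot>\<^sub>3 P 3 [2, 3] Z \<cdot>\<^sub>3 pt [a, b, c]) ?t"
      using abc vwx pq by (intro tpow2_ext[where X = target] linear_intros) (simp_all add: place_list_simps)
    moreover have "tensor_act V (hmod_tensor K H W X) (pt [p, q]) (tens K V (tensor K W X) (act V a v) ?r)
        = tens K V (tensor K W X) (act V p (act V a v)) (tensor_act W X (comul H q) ?r)"
      using abc vwx pq tensor_act_pt[OF V left_module_hmod_tensor[OF W X], of p q "act V a v" ?r] by simp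
    ultimately show "tensor_act V (hmod_tensor K H W X) (pt [p, q]) (tens K V (tensor K W X) (act V a v) ?r)
        = assoc_act V W X (D 2 2 (pt [p, q]) \<cdot>\<^sub>3 pt [a, b, c]) ?t"
      using pq by simp
  next
    show "linear_map K (T 2) target
        (\<lambda>Y. tensor_act V (hmod_tensor K H W X) Y (tens K V (tensor K W X) (act V a v) ?r))"
      using linear_map_tensor_act_left[OF V left_module_hmod_tensor[OF W X] _ linear_map_id] abc vwx by simp
    show "linear_map K (T 2) target (\<lambda>Y. assoc_act V W X (D 2 2 Y \<cdot>\<^sub>3 pt [a, b, c]) ?t)"
      using abc vwx by (intro linear_intros) simp_all
  qed simp
  then show "tensor_act V (hmod_tensor K H W X) Y (assoc_act V W X (pt [a, b, c]) ?t)
      = assoc_act V W X (D 2 2 Y \<cdot>\<^sub>3 pt [a, b, c]) ?t" using abc vwx Y by simp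
qed (use Y in \<open>auto intro!: linear_intros\<close>)

lemma assoc_act_comul_1:
  assumes Y: "Y \<in> carrier (T 2)" and "\<theta> \<in> carrier (T 3)" "t \<in> carrier source"
  shows "assoc_act V W X \<theta> (tensor_act (hmod_tensor K H V W) X Y t)
    = assoc_act V W X (\<theta> \<cdot>\<^sub>3 D 2 1 Y) t"
proof (rule assoc_act_ext[OF _ assms(3,2), where Z = target])
  note lin = linear_map_tensor_act_left_tensor[OF _ linear_map_id]
  show "linear_map K source target (\<lambda>t. assoc_act V W X \<theta> (tensor_act (hmod_tensor K H V W) X Y t))"
    if "\<theta> \<in> carrier (T 3)" for \<theta> using that Y by (intro lin linear_intros)
  show "linear_map K (T 3) target (\<lambda>\<theta>. assoc_act V W X \<theta> (tensor_act (hmod_tensor K H V W) X Y t))"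
    if "t \<in> carrier source" for t using that Y linear_map_closed[OF lin] by (intro linear_intros) simp_all
  fix a b c v w x assume abc: "a \<in> carrier H" "b \<in> carrier H" "c \<in> carrier H"
    and vwx: "v \<in> carrier V" "w \<in> carrier W" "x \<in> carrier X"
  let ?s = "tens K V W v w"
  let ?t = "tens K (tensor K V W) X ?s x"
  have "\<forall>Y\<in>carrier (T 2). assoc_act V W X (pt [a, b, c]) (tensor_act (hmod_tensor K H V W) X Y ?t)
      = assoc_act V W X (pt [a, b, c] \<cdot>\<^sub>3 D 2 1 Y) ?t"
  proof (rule tpow2_ext)
    fix p q assume pq: "p \<in> carrier H" "q \<in> carrier H"
    have "\<forall>Z\<in>carrier (T 2). assoc_act V W X (pt [a, b, c]) (tens K (tensor K V W) X (tensor_act V W Z ?s) (act X q x))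
        = assoc_act V W X (pt [a, b, c] \<cdot>\<^sub>3 (pt [\<one>\<^sub>H, \<one>\<^sub>H, q] \<cdot>\<^sub>3 P 3 [1, 2] Z)) ?t"
      using abc vwx pq by (intro tpow2_ext[where X = target] linear_intros) (simp_all add: place_list_simps)
    moreover have "tensor_act (hmod_tensor K H V W) X (pt [p, q]) ?t
        = tens K (tensor K V W) X (tensor_act V W (comul H p) ?s) (act X q x)"
      using abc vwx pq tensor_act_pt[OF left_module_hmod_tensor[OF V W] X, of p q ?s x] by simp
    ultimately show "assoc_act V W X (pt [a, b, c]) (tensor_act (hmod_tensor K H V W) X (pt [p, q]) ?t)
        = assoc_act V W X (pt [a, b, c] \<cdot>\<^sub>3 D 2 1 (pt [p, q])) ?t"
      using pq by simp
  next
    show "linear_map K (T 2) target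
        (\<lambda>Y. assoc_act V W X (pt [a, b, c]) (tensor_act (hmod_tensor K H V W) X Y ?t))"
      using linear_map_tensor_act_left[OF left_module_hmod_tensor[OF V W] X _ linear_map_id] abc vwx
      by (intro linear_intros) simp_all
    show "linear_map K (T 2) target (\<lambda>Y. assoc_act V W X (pt [a, b, c] \<cdot>\<^sub>3 D 2 1 Y) ?t)"
      using abc vwx by (intro linear_intros) simp_all
  qed simp
  then show "assoc_act V W X (pt [a, b, c]) (tensor_act (hmod_tensor K H V W) X Y ?t)
      = assoc_act V W X (pt [a, b, c] \<cdot>\<^sub>3 D 2 1 Y) ?t" using Y by blast
qed (use Y in \<open>auto intro!: linear_intros\<close>)

end

subsection \<open>The action of the tensor square along the flip\<close>

text \<open>The braiding with \<open>X\<close> in place of \<open>R\<close>.\<close>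

definition flip_act ::
  "('k, 'h, 'v) hmod \<Rightarrow> ('k, 'h, 'w) hmod \<Rightarrow> ('h list \<Rightarrow> 'k) set
    \<Rightarrow> ('v \<times> 'w \<Rightarrow> 'k) set \<Rightarrow> ('w \<times> 'v \<Rightarrow> 'k) set" where
  "flip_act V W X = lin_ext K (tensor K W V) (\<lambda>(v, w).
     lin_ext K (tensor K W V) (leg2 (\<lambda>a b. tens K W V (act W b w) (act V a v))) X)"

lemma hmod_braid_eq: "hmod_braid K X V W = (\<lambda>t\<in>carrier (tensor K V W). flip_act V W X t)"
  by (simp add: hmod_braid_def flip_act_def)

context
  fixes V :: "('k, 'h, 'v) hmod" and W :: "('k, 'h, 'w) hmod"
  assumes V [simp]: "left_module K H V" and W [simp]: "left_module K H W"
begin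

lemma flip_act_bilinear:
  "\<lbrakk>X \<in> carrier (T 2); w \<in> carrier W\<rbrakk> \<Longrightarrow> linear_map K V (tensor K W V)
     (\<lambda>v. lin_ext K (tensor K W V) (leg2 (\<lambda>a b. tens K W V (act W b w) (act V a v))) X)"
  "\<lbrakk>X \<in> carrier (T 2); v \<in> carrier V\<rbrakk> \<Longrightarrow> linear_map K W (tensor K W V)
     (\<lambda>w. lin_ext K (tensor K W V) (leg2 (\<lambda>a b. tens K W V (act W b w) (act V a v))) X)"
  by (intro linear_intros; simp)+

lemma linear_map_flip_act [linear_intros]:
  assumes "X \<in> carrier (T 2)" "linear_map K U (tensor K V W) f"
  shows "linear_map K U (tensor K W V) (\<lambda>u. flip_act V W X (f u))"
  unfolding flip_act_def using flip_act_bilinear[OF assms(1)]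
  by (intro linear_map_comp[OF linear_map_lin_ext_tensor assms(2)]) simp_all

lemma linear_map_flip_act_left [linear_intros]:
  assumes "module K U" "linear_map K U (T 2) f" "t \<in> carrier (tensor K V W)"
  shows "linear_map K U (tensor K W V) (\<lambda>u. flip_act V W (f u) t)"
  unfolding flip_act_def
proof (rule linear_map_lin_ext_tensor_param[OF _ _ _ _ assms(3)])
  fix v w assume "v \<in> carrier V" "w \<in> carrier W"
  then show "linear_map K U (tensor K W V) (\<lambda>u. lin_ext K (tensor K W V)
      (leg2 (\<lambda>a b. tens K W V (act W b w) (act V a v))) (f u))"
    by (intro linear_intros assms(2); simp)
qed (simp_all add: assms(1))

lemma flip_act_closed [simp]:
  "\<lbrakk>X \<in> carrier (T 2); t \<in> carrier (tensor K V W)\<rbrakk> \<Longrightarrow> flip_act V W X t \<in> carrier (tensor K W V)"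
  by (rule linear_map_closed[OF linear_map_flip_act[OF _ linear_map_id]])

lemma flip_act_pt [simp]:
  assumes "a \<in> carrier H" "b \<in> carrier H" "v \<in> carrier V" "w \<in> carrier W"
  shows "flip_act V W (pt [a, b]) (tens K V W v w) = tens K W V (act W b w) (act V a v)"
proof -
  have "flip_act V W (pt [a, b]) (tens K V W v w)
      = lin_ext K (tensor K W V) (leg2 (\<lambda>a b. tens K W V (act W b w) (act V a v))) (pt [a, b])"
    unfolding flip_act_def using flip_act_bilinear[of "pt [a, b]"] assms by (simp add: lin_ext_tens)
  also have "\<dots> = tens K W V (act W b w) (act V a v)"
    using assms by (intro lin_ext_leg2 linear_intros) simp_all
  finally show ?thesis .
qed

lemma flip_act_ext:
  assumes "module K Z" "X \<in> carrier (T 2)" "Y \<in> carrier (T 2)" "t \<in> carrier (tensor K V W)"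
    and "\<And>X Y. \<lbrakk>X \<in> carrier (T 2); Y \<in> carrier (T 2)\<rbrakk> \<Longrightarrow> linear_map K (tensor K V W) Z (f X Y)"
    and "\<And>X Y. \<lbrakk>X \<in> carrier (T 2); Y \<in> carrier (T 2)\<rbrakk> \<Longrightarrow> linear_map K (tensor K V W) Z (g X Y)"
    and "\<And>X t. \<lbrakk>X \<in> carrier (T 2); t \<in> carrier (tensor K V W)\<rbrakk> \<Longrightarrow> linear_map K (T 2) Z (\<lambda>Y. f X Y t)"
    and "\<And>X t. \<lbrakk>X \<in> carrier (T 2); t \<in> carrier (tensor K V W)\<rbrakk> \<Longrightarrow> linear_map K (T 2) Z (\<lambda>Y. g X Y t)"
    and "\<And>Y t. \<lbrakk>Y \<in> carrier (T 2); t \<in> carrier (tensor K V W)\<rbrakk> \<Longrightarrow> linear_map K (T 2) Z (\<lambda>X. f X Y t)"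
    and "\<And>Y t. \<lbrakk>Y \<in> carrier (T 2); t \<in> carrier (tensor K V W)\<rbrakk> \<Longrightarrow> linear_map K (T 2) Z (\<lambda>X. g X Y t)"
    and eq: "\<And>a b c d v w. \<lbrakk>a \<in> carrier H; b \<in> carrier H; c \<in> carrier H; d \<in> carrier H;
        v \<in> carrier V; w \<in> carrier W\<rbrakk> \<Longrightarrow>
      f (pt [a, b]) (pt [c, d]) (tens K V W v w) = g (pt [a, b]) (pt [c, d]) (tens K V W v w)"
  shows "f X Y t = g X Y t"
proof -
  have "\<forall>X\<in>carrier (T 2). f X Y t = g X Y t"
  proof (rule tpow2_ext)
    fix a b assume ab: "a \<in> carrier H" "b \<in> carrier H"
    have "\<forall>Y\<in>carrier (T 2). f (pt [a, b]) Y t = g (pt [a, b]) Y t"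
    proof (rule tpow2_ext)
      fix c d assume cd: "c \<in> carrier H" "d \<in> carrier H"
      have "\<forall>t\<in>carrier (tensor K V W). f (pt [a, b]) (pt [c, d]) t = g (pt [a, b]) (pt [c, d]) t"
        using eq ab cd by (intro tensor_ext[OF _ _ assms(1)] assms(5,6)) simp_all
      then show "f (pt [a, b]) (pt [c, d]) t = g (pt [a, b]) (pt [c, d]) t" using assms(4) by blast
    qed (use ab assms(4) in \<open>auto intro!: assms(1,7,8)\<close>)
    then show "f (pt [a, b]) Y t = g (pt [a, b]) Y t" using assms(3) by blast
  qed (use assms(3,4) in \<open>auto intro!: assms(1,9,10)\<close>)
  then show ?thesis using assms(2) by blast
qed

lemma flip_act_tensor_act:
  assumes "X \<in> carrier (T 2)" "Y \<in> carrier (T 2)" "t \<in> carrier (tensor K V W)"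
  shows "flip_act V W X (tensor_act V W Y t) = flip_act V W (X \<cdot>\<^sub>2 Y) t"
  by (rule flip_act_ext[OF _ assms, where Z = "tensor K W V"]) (auto intro!: linear_intros)

lemma tensor_act_flip_act:
  assumes "X \<in> carrier (T 2)" "Y \<in> carrier (T 2)" "t \<in> carrier (tensor K V W)"
  shows "tensor_act W V Y (flip_act V W X t) = flip_act V W (P 2 [2, 1] Y \<cdot>\<^sub>2 X) t"
  by (rule flip_act_ext[OF _ assms, where Z = "tensor K W V"])
    (auto intro!: linear_intros simp: place_list_simps)

end

end

section \<open>Internal homs\<close>

lemma hom_module_fields [simp]:
  "carrier (hom_module K V W) = {L \<in> extensional (carrier V). linear_map K V W L}"
  "\<zero>\<^bsub>hom_module K V W\<^esub> = (\<lambda>v\<in>carrier V. \<zero>\<^bsub>W\<^esub>)"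
  "L \<oplus>\<^bsub>hom_module K V W\<^esub> L' = (\<lambda>v\<in>carrier V. L v \<oplus>\<^bsub>W\<^esub> L' v)"
  "r \<odot>\<^bsub>hom_module K V W\<^esub> L = (\<lambda>v\<in>carrier V. r \<odot>\<^bsub>W\<^esub> L v)"
  by (simp_all add: hom_module_def)

context
  fixes K :: "'k ring" and V :: "('k, 'v, 'm) module_scheme" and W :: "('k, 'w, 'n) module_scheme"
  assumes V: "module K V" and W: "module K W"
begin

interpretation V: module K V by (rule V)
interpretation W: module K W by (rule W)

lemma restrict_hom_module:
  "linear_map K V W f \<Longrightarrow> (\<lambda>v\<in>carrier V. f v) \<in> carrier (hom_module K V W)"
  using V by (simp add: linear_map_restrict)

lemma hom_module_linear:
  assumes "L \<in> carrier (hom_module K V W)"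
  shows "linear_map K V W L" "v \<in> carrier V \<Longrightarrow> L v \<in> carrier W"
  using assms linear_map_closed[of K V W L v] by auto

lemma hom_module_ext:
  assumes "L \<in> carrier (hom_module K V W)" "L' \<in> carrier (hom_module K V W)"
    and "\<And>v. v \<in> carrier V \<Longrightarrow> L v = L' v"
  shows "L = L'"
  using assms by (auto intro: extensionalityI)

lemma hom_module_module: "module K (hom_module K V W)"
proof -
  let ?M = "hom_module K V W"
  note lin = linear_map_closed[OF hom_module_linear(1)] linear_map_add[OF hom_module_linear(1)]
    linear_map_smult[OF hom_module_linear(1)]
  have add: "L \<oplus>\<^bsub>?M\<^esub> L' \<in> carrier ?M" if L: "L \<in> carrier ?M" "L' \<in> carrier ?M" for L L'
    unfolding hom_module_fields(3)
  proof (rule restrict_hom_module, rule linear_mapI)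
    fix v w assume "v \<in> carrier V" "w \<in> carrier V"
    then show "L (v \<oplus>\<^bsub>V\<^esub> w) \<oplus>\<^bsub>W\<^esub> L' (v \<oplus>\<^bsub>V\<^esub> w) = (L v \<oplus>\<^bsub>W\<^esub> L' v) \<oplus>\<^bsub>W\<^esub> (L w \<oplus>\<^bsub>W\<^esub> L' w)"
      using lin[OF L(1)] lin[OF L(2)] by (simp add: W.M.a_ac)
  qed (use lin[OF L(1)] lin[OF L(2)] in \<open>simp_all add: W.smult_r_distr\<close>)
  have smult: "r \<odot>\<^bsub>?M\<^esub> L \<in> carrier ?M" if r: "r \<in> carrier K" and L: "L \<in> carrier ?M" for r L
    unfolding hom_module_fields(4)
  proof (rule restrict_hom_module, rule linear_mapI)
    show "r \<odot>\<^bsub>W\<^esub> L (s \<odot>\<^bsub>V\<^esub> v) = s \<odot>\<^bsub>W\<^esub> (r \<odot>\<^bsub>W\<^esub> L v)" if "s \<in> carrier K" "v \<in> carrier V" for s v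
      using lin[OF L] r that by (simp add: W.smult_assoc1[symmetric] V.R.m_comm)
  qed (use lin[OF L] r in \<open>simp_all add: W.smult_r_distr\<close>)
  have zero: "\<zero>\<^bsub>?M\<^esub> \<in> carrier ?M"
    unfolding hom_module_fields(2) by (rule restrict_hom_module, rule linear_mapI) simp_all
  have closed: "L v \<in> carrier W" if "L \<in> carrier ?M" "v \<in> carrier V" for L v
    using that by (rule hom_module_linear(2))
  show ?thesis
  proof (rule moduleI)
    show "abelian_group ?M"
    proof (rule abelian_groupI)
      fix L assume L: "L \<in> carrier ?M"
      have neg: "(\<ominus>\<^bsub>K\<^esub> \<one>\<^bsub>K\<^esub>) \<odot>\<^bsub>?M\<^esub> L \<in> carrier ?M" using L by (intro smult) simp_all
      have "((\<ominus>\<^bsub>K\<^esub> \<one>\<^bsub>K\<^esub>) \<odot>\<^bsub>?M\<^esub> L) \<oplus>\<^bsub>?M\<^esub> L = \<zero>\<^bsub>?M\<^esub>"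
        using closed[OF L] by (intro hom_module_ext add neg L zero) (simp add: W.smult_l_minus W.M.l_neg)
      with neg show "\<exists>L'\<in>carrier ?M. L' \<oplus>\<^bsub>?M\<^esub> L = \<zero>\<^bsub>?M\<^esub>" by blast
      show "\<zero>\<^bsub>?M\<^esub> \<oplus>\<^bsub>?M\<^esub> L = L"
        using closed[OF L] by (intro hom_module_ext add L zero) simp
      fix L' assume L': "L' \<in> carrier ?M"
      show "L \<oplus>\<^bsub>?M\<^esub> L' \<in> carrier ?M" using L L' by (rule add)
      show "L \<oplus>\<^bsub>?M\<^esub> L' = L' \<oplus>\<^bsub>?M\<^esub> L"
        using closed[OF L] closed[OF L'] by (intro hom_module_ext add L L') (simp add: W.M.a_comm)
      fix L'' assume L'': "L'' \<in> carrier ?M"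
      show "(L \<oplus>\<^bsub>?M\<^esub> L') \<oplus>\<^bsub>?M\<^esub> L'' = L \<oplus>\<^bsub>?M\<^esub> (L' \<oplus>\<^bsub>?M\<^esub> L'')"
        using closed[OF L] closed[OF L'] closed[OF L'']
        by (intro hom_module_ext add L L' L'') (simp add: W.M.a_assoc)
    qed (rule zero)
    fix L assume L: "L \<in> carrier ?M"
    show "\<one>\<^bsub>K\<^esub> \<odot>\<^bsub>?M\<^esub> L = L"
      using closed[OF L] by (intro hom_module_ext smult L) simp_all
    fix r assume r: "r \<in> carrier K"
    show "r \<odot>\<^bsub>?M\<^esub> L \<in> carrier ?M" using r L by (rule smult)
    show "r \<odot>\<^bsub>?M\<^esub> (L \<oplus>\<^bsub>?M\<^esub> L') = r \<odot>\<^bsub>?M\<^esub> L \<oplus>\<^bsub>?M\<^esub> r \<odot>\<^bsub>?M\<^esub> L'" if L': "L' \<in> carrier ?M" for L'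
      using closed[OF L] closed[OF L'] r
      by (intro hom_module_ext add smult L L' r) (simp add: W.smult_r_distr)
    fix s assume s: "s \<in> carrier K"
    show "(r \<oplus>\<^bsub>K\<^esub> s) \<odot>\<^bsub>?M\<^esub> L = r \<odot>\<^bsub>?M\<^esub> L \<oplus>\<^bsub>?M\<^esub> s \<odot>\<^bsub>?M\<^esub> L"
      using closed[OF L] r s
      by (intro hom_module_ext add smult L r s V.R.a_closed) (simp add: W.smult_l_distr)
    show "(r \<otimes>\<^bsub>K\<^esub> s) \<odot>\<^bsub>?M\<^esub> L = r \<odot>\<^bsub>?M\<^esub> (s \<odot>\<^bsub>?M\<^esub> L)"
      using closed[OF L] r s
      by (intro hom_module_ext smult L r s V.R.m_closed) (simp add: W.smult_assoc1)
  qed (rule V.R.cring_axioms)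
qed

text \<open>Currying: a bilinear map is a linear map into a module of homomorphisms.\<close>

lemma linear_map_into_hom_module:
  assumes "\<And>v. v \<in> carrier V \<Longrightarrow> linear_map K U W (\<lambda>u. f u v)"
    and "\<And>u. u \<in> carrier U \<Longrightarrow> linear_map K V W (\<lambda>v. f u v)"
  shows "linear_map K U (hom_module K V W) (\<lambda>u. \<lambda>v\<in>carrier V. f u v)"
proof (rule linear_mapI)
  show "(\<lambda>v\<in>carrier V. f u v) \<in> carrier (hom_module K V W)" if "u \<in> carrier U" for u
    using assms(2)[OF that] by (rule restrict_hom_module)
qed (auto simp: linear_map_add[OF assms(1)] linear_map_smult[OF assms(1)])

lemma linear_map_hom_module_eval:
  assumes "linear_map K U (hom_module K V W) f" "v \<in> carrier V"
  shows "linear_map K U W (\<lambda>u. f u v)"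
proof (rule linear_mapI)
  show "f u v \<in> carrier W" if "u \<in> carrier U" for u
    using linear_map_closed[OF assms(1) that] assms(2) by (rule hom_module_linear(2))
qed (use assms(2) in \<open>simp_all add: linear_map_add[OF assms(1)] linear_map_smult[OF assms(1)]\<close>)

end

\<comment> \<open>maps in the module of homomorphisms are henceforth compared at the points of their domain\<close>
declare hom_module_fields [simp del]

context quasi_hopf_algebra
begin

interpretation T: unital_algebra K "T n" for n by (rule unital_algebra_tpow)

context
  fixes V :: "('k, 'h, 'v) hmod" and W :: "('k, 'h, 'w) hmod"
  assumes V [simp]: "left_module K H V" and W [simp]: "left_module K H W"
begin

abbreviation (input) homs where "homs \<equiv> hom_module K V W"

lemma homs_module [simp]: "module K homs"
  by (rule hom_module_module) simp_all

lemma homs_closed [simp]: "\<lbrakk>L \<in> carrier homs; v \<in> carrier V\<rbrakk> \<Longrightarrow> L v \<in> carrier W"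
  by (rule hom_module_linear(2)[where V = V and W = W]) simp_all

lemma linear_map_hom_apply:
  "\<lbrakk>L \<in> carrier homs; linear_map K U V f\<rbrakk> \<Longrightarrow> linear_map K U W (\<lambda>u. L (f u))"
  by (rule linear_map_comp[OF hom_module_linear(1)[where V = V and W = W]]) simp_all

lemma linear_map_homs_eval:
  "\<lbrakk>linear_map K U homs f; v \<in> carrier V\<rbrakk> \<Longrightarrow> linear_map K U W (\<lambda>u. f u v)"
  by (rule linear_map_hom_module_eval[where V = V]) simp_all

lemma conj_linear:
  "\<lbrakk>b \<in> carrier H; L \<in> carrier homs\<rbrakk>
    \<Longrightarrow> linear_map K H homs (\<lambda>a. \<lambda>v\<in>carrier V. act W a (L (act V (S b) v)))"
  "\<lbrakk>a \<in> carrier H; L \<in> carrier homs\<rbrakk>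
    \<Longrightarrow> linear_map K H homs (\<lambda>b. \<lambda>v\<in>carrier V. act W a (L (act V (S b) v)))"
  "\<lbrakk>a \<in> carrier H; b \<in> carrier H; linear_map K U homs f\<rbrakk>
    \<Longrightarrow> linear_map K U homs (\<lambda>u. \<lambda>v\<in>carrier V. act W a (f u (act V (S b) v)))"
proof -
  show "linear_map K H homs (\<lambda>a. \<lambda>v\<in>carrier V. act W a (L (act V (S b) v)))"
    if "b \<in> carrier H" "L \<in> carrier homs"
    using that by (intro linear_map_into_hom_module linear_intros linear_map_hom_apply) simp_all
  show "linear_map K H homs (\<lambda>b. \<lambda>v\<in>carrier V. act W a (L (act V (S b) v)))"
    if "a \<in> carrier H" "L \<in> carrier homs"
    using that by (intro linear_map_into_hom_module linear_intros linear_map_hom_apply) simp_all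
  show "linear_map K U homs (\<lambda>u. \<lambda>v\<in>carrier V. act W a (f u (act V (S b) v)))"
    if "a \<in> carrier H" "b \<in> carrier H" "linear_map K U homs f"
  proof (rule linear_map_into_hom_module)
    show "linear_map K U W (\<lambda>u. act W a (f u (act V (S b) v)))" if "v \<in> carrier V" for v
      using \<open>a \<in> carrier H\<close> \<open>b \<in> carrier H\<close> that
      by (intro linear_map_act_right linear_map_homs_eval \<open>linear_map K U homs f\<close>) simp_all
    show "linear_map K V W (\<lambda>v. act W a (f u (act V (S b) v)))" if "u \<in> carrier U" for u
      using \<open>a \<in> carrier H\<close> \<open>b \<in> carrier H\<close> linear_map_closed[OF \<open>linear_map K U homs f\<close> that]
      by (intro linear_intros linear_map_hom_apply) simp_all
  qed simp_all
qed

lemma linear_map_hom_conj_left [linear_intros]: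
  assumes "linear_map K U (T 2) f" "L \<in> carrier homs"
  shows "linear_map K U homs (\<lambda>u. hom_conj K H V W (f u) L)"
  unfolding hom_conj_def using assms(2)
  by (intro linear_map_leg2 assms(1) conj_linear) simp_all

lemma linear_map_hom_conj [linear_intros]:
  assumes "module K U" "X \<in> carrier (T 2)" "linear_map K U homs f"
  shows "linear_map K U homs (\<lambda>u. hom_conj K H V W X (f u))"
  unfolding hom_conj_def using assms(1,2)
  by (intro linear_map_leg2_param conj_linear assms(3)) simp_all

lemma hom_conj_closed [simp]:
  "\<lbrakk>X \<in> carrier (T 2); L \<in> carrier homs\<rbrakk> \<Longrightarrow> hom_conj K H V W X L \<in> carrier homs"
  by (rule linear_map_closed[OF linear_map_hom_conj_left[OF linear_map_id]])

lemma hom_conj_pt: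
  "\<lbrakk>a \<in> carrier H; b \<in> carrier H; L \<in> carrier homs\<rbrakk>
    \<Longrightarrow> hom_conj K H V W (pt [a, b]) L = (\<lambda>v\<in>carrier V. act W a (L (act V (S b) v)))"
  unfolding hom_conj_def by (intro lin_ext_leg2 conj_linear) simp_all

lemma hom_conj_pt_apply [simp]:
  "\<lbrakk>a \<in> carrier H; b \<in> carrier H; L \<in> carrier homs; v \<in> carrier V\<rbrakk>
    \<Longrightarrow> hom_conj K H V W (pt [a, b]) L v = act W a (L (act V (S b) v))"
  by (simp add: hom_conj_pt)

lemma hom_conj_one [simp]: "L \<in> carrier homs \<Longrightarrow> hom_conj K H V W \<one>\<^bsub>T 2\<^esub> L = L"
  by (rule hom_module_ext[where K = K and V = V and W = W])
    (simp_all add: hom_conj_closed[of "\<one>\<^bsub>T 2\<^esub>"], simp add: pt2_one[symmetric])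

lemma hom_conj_mult [rule_format, simp]:
  "L \<in> carrier homs \<Longrightarrow> \<forall>X\<in>carrier (T 2). \<forall>Y\<in>carrier (T 2).
    hom_conj K H V W (X \<cdot>\<^sub>2 Y) L = hom_conj K H V W X (hom_conj K H V W Y L)"
  by (intro tpow2_ext2[where X = homs] tpow2_ext[where X = homs] linear_intros)
    (auto intro!: hom_module_ext[where K = K and V = V and W = W])

lemma act_hmod_ihom [simp]: "act (hmod_ihom K G V W) h = hom_conj K G V W (comul G h)"
  by (simp add: hmod_ihom_def)

lemma hmod_ihom_simps [simp]:
  "carrier (hmod_ihom K G V W) = carrier homs"
  "tensor K (hmod_ihom K G V W) X = tensor K homs X"
  "tens K (hmod_ihom K G V W) X = tens K homs X"
  "linear_map K (hmod_ihom K G V W) Y f = linear_map K homs Y f"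
  "linear_map K Y (hmod_ihom K G V W) g = linear_map K Y homs g"
  by (simp_all add: hmod_ihom_def)

lemma left_module_hmod_ihom [simp]: "left_module K H (hmod_ihom K H V W)"
proof (rule left_moduleI)
  show "module K (hmod_ihom K H V W)" by (simp add: hmod_ihom_def)
  show "linear_map K (hmod_ihom K H V W) (hmod_ihom K H V W) (act (hmod_ihom K H V W) h)"
    if "h \<in> carrier H" for h
    using linear_map_hom_conj[OF _ _ linear_map_id, of "comul H h"] that by simp
  show "linear_map K H (hmod_ihom K H V W) (\<lambda>h. act (hmod_ihom K H V W) h L)"
    if "L \<in> carrier (hmod_ihom K H V W)" for L
    using that by simp (intro linear_intros; simp)
qed simp_all

subsection \<open>Evaluation\<close>

text \<open>The value of the evaluation at \<open>L \<otimes> v\<close>, with variable elements \<open>\<theta>\<close> and \<open>g\<close> instead of \<open>\<phi>\<close> and \<open>\<alpha>\<close>, since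
  the twist changes both.\<close>

definition eval_val where
  "eval_val g \<theta> L v = lin_ext K W (leg3 (\<lambda>a b c.
     act W a (L (act V (S b \<cdot> g \<cdot> c) v)))) \<theta>"

definition eval_act where
  "eval_act g \<theta> = lin_ext K W (\<lambda>(L, v). eval_val g \<theta> L v)"

lemma linear_map_eval_val:
  "\<lbrakk>module K U; linear_map K U H f; \<theta> \<in> carrier (T 3); L \<in> carrier homs; v \<in> carrier V\<rbrakk>
    \<Longrightarrow> linear_map K U W (\<lambda>u. eval_val (f u) \<theta> L v)"
  "\<lbrakk>g \<in> carrier H; linear_map K U' (T 3) f'; L \<in> carrier homs; v \<in> carrier V\<rbrakk>
    \<Longrightarrow> linear_map K U' W (\<lambda>u. eval_val g (f' u) L v)"
  "\<lbrakk>g \<in> carrier H; \<theta> \<in> carrier (T 3); v \<in> carrier V\<rbrakk> \<Longrightarrow> linear_map K homs W (\<lambda>L. eval_val g \<theta> L v)"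
  "\<lbrakk>g \<in> carrier H; \<theta> \<in> carrier (T 3); L \<in> carrier homs\<rbrakk> \<Longrightarrow> linear_map K V W (\<lambda>v. eval_val g \<theta> L v)"
  unfolding eval_val_def
  by (intro linear_intros linear_map_hom_apply linear_map_homs_eval[OF linear_map_id]; simp add: unital_algebra_self)+

lemma eval_val_pt:
  "\<lbrakk>g \<in> carrier H; a \<in> carrier H; b \<in> carrier H; c \<in> carrier H; L \<in> carrier homs; v \<in> carrier V\<rbrakk>
    \<Longrightarrow> eval_val g (pt [a, b, c]) L v = act W a (L (act V (S b \<cdot> g \<cdot> c) v))"
  unfolding eval_val_def
  by (intro lin_ext_leg3 linear_intros linear_map_hom_apply) (simp_all add: unital_algebra_self)

lemma linear_map_eval_act [linear_intros]:
  assumes "g \<in> carrier H" "\<theta> \<in> carrier (T 3)" "linear_map K U (tensor K homs V) f"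
  shows "linear_map K U W (\<lambda>u. eval_act g \<theta> (f u))"
  unfolding eval_act_def using assms(1,2)
  by (intro linear_map_comp[OF linear_map_lin_ext_tensor assms(3)] linear_map_eval_val) simp_all

lemma linear_map_eval_act_mid [linear_intros]:
  assumes "g \<in> carrier H" "module K U" "linear_map K U (T 3) f" "t \<in> carrier (tensor K homs V)"
  shows "linear_map K U W (\<lambda>u. eval_act g (f u) t)"
  unfolding eval_act_def
  by (rule linear_map_lin_ext_tensor_param[OF _ _ _ _ assms(4)])
    (simp_all add: assms linear_map_eval_val)

lemma linear_map_eval_act_left [linear_intros]:
  assumes "module K U" "linear_map K U H f" "\<theta> \<in> carrier (T 3)" "t \<in> carrier (tensor K homs V)"
  shows "linear_map K U W (\<lambda>u. eval_act (f u) \<theta> t)"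
  unfolding eval_act_def
  by (rule linear_map_lin_ext_tensor_param[OF _ _ _ _ assms(4)])
    (simp_all add: assms linear_map_eval_val)

lemma eval_act_closed [simp]:
  "\<lbrakk>g \<in> carrier H; \<theta> \<in> carrier (T 3); t \<in> carrier (tensor K homs V)\<rbrakk> \<Longrightarrow> eval_act g \<theta> t \<in> carrier W"
  by (rule linear_map_closed[OF linear_map_eval_act[OF _ _ linear_map_id]])

lemma eval_act_pt [simp]:
  assumes "g \<in> carrier H" "a \<in> carrier H" "b \<in> carrier H" "c \<in> carrier H" "L \<in> carrier homs" "v \<in> carrier V"
  shows "eval_act g (pt [a, b, c]) (tens K homs V L v) = act W a (L (act V (S b \<cdot> g \<cdot> c) v))"
  unfolding eval_act_def using assms by (simp add: lin_ext_tens linear_map_eval_val eval_val_pt)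

lemma hmod_eval_eq:
  "hmod_eval K H V W = (\<lambda>t\<in>carrier (tensor K homs V). eval_act \<alpha> (reassoc H) t)"
  by (simp add: hmod_eval_def eval_act_def eval_val_def)

lemma eval_act_ext:
  assumes "t \<in> carrier (tensor K homs V)" "\<theta> \<in> carrier (T 3)"
    and "\<And>\<theta>. \<theta> \<in> carrier (T 3) \<Longrightarrow> linear_map K (tensor K homs V) W (f \<theta>)"
    and "\<And>\<theta>. \<theta> \<in> carrier (T 3) \<Longrightarrow> linear_map K (tensor K homs V) W (g \<theta>)"
    and "\<And>t. t \<in> carrier (tensor K homs V) \<Longrightarrow> linear_map K (T 3) W (\<lambda>\<theta>. f \<theta> t)"
    and "\<And>t. t \<in> carrier (tensor K homs V) \<Longrightarrow> linear_map K (T 3) W (\<lambda>\<theta>. g \<theta> t)"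
    and eq: "\<And>a b c L v. \<lbrakk>a \<in> carrier H; b \<in> carrier H; c \<in> carrier H; L \<in> carrier homs; v \<in> carrier V\<rbrakk>
      \<Longrightarrow> f (pt [a, b, c]) (tens K homs V L v) = g (pt [a, b, c]) (tens K homs V L v)"
  shows "f \<theta> t = g \<theta> t"
proof -
  have "\<forall>\<theta>\<in>carrier (T 3). f \<theta> t = g \<theta> t"
  proof (rule tpow3_ext)
    fix a b c assume abc: "a \<in> carrier H" "b \<in> carrier H" "c \<in> carrier H"
    have "\<forall>t\<in>carrier (tensor K homs V). f (pt [a, b, c]) t = g (pt [a, b, c]) t"
      using eq abc by (intro tensor_ext[where X = W] assms(3,4)) simp_all
    then show "f (pt [a, b, c]) t = g (pt [a, b, c]) t" using assms(1) by blast
  qed (use assms(1) in \<open>auto intro!: assms(5,6)\<close>)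
  then show ?thesis using assms(2) by blast
qed

text \<open>As for \<open>zigzag\<close>, a factor on legs 2 and 3 meets the element \<open>g\<close> between them and is absorbed into it.\<close>

lemma eval_act_place_23:
  assumes g: "g \<in> carrier H" and Y: "Y \<in> carrier (T 2)" and "\<theta> \<in> carrier (T 3)" "t \<in> carrier (tensor K homs V)"
  shows "eval_act g (P 3 [2, 3] Y \<cdot>\<^sub>3 \<theta>) t = eval_act (conj_alpha g Y) \<theta> t"
proof (rule eval_act_ext[OF assms(4,3)])
  fix a b c L v assume *: "a \<in> carrier H" "b \<in> carrier H" "c \<in> carrier H" "L \<in> carrier homs" "v \<in> carrier V"
  have "\<forall>Y\<in>carrier (T 2). eval_act g (P 3 [2, 3] Y \<cdot>\<^sub>3 pt [a, b, c]) (tens K homs V L v)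
      = eval_act (conj_alpha g Y) (pt [a, b, c]) (tens K homs V L v)"
    using * g by (intro tpow2_ext[where X = W] linear_intros) (simp_all add: place_list_simps)
  then show "eval_act g (P 3 [2, 3] Y \<cdot>\<^sub>3 pt [a, b, c]) (tens K homs V L v)
      = eval_act (conj_alpha g Y) (pt [a, b, c]) (tens K homs V L v)" using Y by blast
qed (use g Y in \<open>auto intro!: linear_intros\<close>)

lemma eval_act_pt_mult:
  assumes g: "g \<in> carrier H" and x: "x \<in> carrier H" and "\<theta> \<in> carrier (T 3)" "t \<in> carrier (tensor K homs V)"
  shows "eval_act g (pt [x, \<one>\<^sub>H, \<one>\<^sub>H] \<cdot>\<^sub>3 \<theta>) t = act W x (eval_act g \<theta> t)"
  by (rule eval_act_ext[OF assms(4,3)]) (use g x in \<open>auto intro!: linear_intros\<close>)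

text \<open>The coproduct of the second leg of \<open>Y\<close> surrounds \<open>\<alpha>\<close>, where it becomes a counit; the first leg of \<open>Y\<close>
  acts last, on \<open>W\<close>.\<close>

lemma eval_act_comul_2:
  assumes "Y \<in> carrier (T 2)" and \<theta>: "\<theta> \<in> carrier (T 3)" and t: "t \<in> carrier (tensor K homs V)"
  shows "eval_act \<alpha> (D 2 2 Y \<cdot>\<^sub>3 \<theta>) t = act W (counit2 Y) (eval_act \<alpha> \<theta> t)"
proof -
  interpret W: module K W by simp
  have "\<forall>Y\<in>carrier (T 2). eval_act \<alpha> (D 2 2 Y \<cdot>\<^sub>3 \<theta>) t = act W (counit2 Y) (eval_act \<alpha> \<theta> t)"
    using \<theta> t by (intro tpow2_ext[where X = W] linear_intros)
      (simp_all add: T.H.m_assoc eval_act_pt_mult eval_act_place_23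
        linear_map_smult[OF linear_map_eval_act_left[OF module_self linear_map_id]]
        linear_map_smult[OF linear_map_act_right[OF _ _ linear_map_id, of W]]
        left_module.act_smult[OF W])
  then show ?thesis using assms by blast
qed

lemma linear_map_restrict_hom_conj:
  "Y \<in> carrier (T 2) \<Longrightarrow> linear_map K homs homs (\<lambda>L\<in>carrier homs. hom_conj K H V W Y L)"
  using linear_map_hom_conj[OF _ _ linear_map_id, of Y] by (simp add: linear_map_restrict)

lemma eval_act_place_12:
  assumes g: "g \<in> carrier H" and Y: "Y \<in> carrier (T 2)" and "\<theta> \<in> carrier (T 3)" "t \<in> carrier (tensor K homs V)"
  shows "eval_act g \<theta> (tensor_map K homs V homs V
      (\<lambda>L\<in>carrier homs. hom_conj K H V W Y L) (\<lambda>v\<in>carrier V. v) t)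
    = eval_act g (\<theta> \<cdot>\<^sub>3 P 3 [1, 2] Y) t" (is "eval_act g \<theta> (?M t) = _")
proof (rule eval_act_ext[OF assms(4,3)])
  have lin: "linear_map K (tensor K homs V) (tensor K homs V) ?M"
    by (intro tensor_map_linear linear_map_restrict_id linear_map_restrict_hom_conj Y) simp_all
  show "linear_map K (tensor K homs V) W (\<lambda>t. eval_act g \<theta> (?M t))" if "\<theta> \<in> carrier (T 3)" for \<theta>
    using that g by (intro linear_map_eval_act lin)
  show "linear_map K (T 3) W (\<lambda>\<theta>. eval_act g \<theta> (?M t))" if "t \<in> carrier (tensor K homs V)" for t
    using g linear_map_closed[OF lin that] by (intro linear_intros) simp_all
  fix a b c L v assume *: "a \<in> carrier H" "b \<in> carrier H" "c \<in> carrier H" "L \<in> carrier homs" "v \<in> carrier V"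
  have "\<forall>Y\<in>carrier (T 2). eval_act g (pt [a, b, c]) (tens K homs V (hom_conj K H V W Y L) v)
      = eval_act g (pt [a, b, c] \<cdot>\<^sub>3 P 3 [1, 2] Y) (tens K homs V L v)"
    using * g by (intro tpow2_ext[where X = W] linear_intros) (simp_all add: place_list_simps)
  moreover have "?M (tens K homs V L v) = tens K homs V (hom_conj K H V W Y L) v"
    using * by (subst tensor_map_tens; simp add: linear_map_restrict_id linear_map_restrict_hom_conj Y)
  ultimately show "eval_act g (pt [a, b, c]) (?M (tens K homs V L v))
      = eval_act g (pt [a, b, c] \<cdot>\<^sub>3 P 3 [1, 2] Y) (tens K homs V L v)" using Y by simp
qed (use g Y in \<open>auto intro!: linear_intros\<close>)

lemma eval_act_comul_1:
  assumes g: "g \<in> carrier H" and Y: "Y \<in> carrier (T 2)" and "\<theta> \<in> carrier (T 3)" "t \<in> carrier (tensor K homs V)"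
  shows "eval_act g \<theta> (tensor_act (hmod_ihom K H V W) V Y t) = eval_act g (\<theta> \<cdot>\<^sub>3 D 2 1 Y) t"
proof (rule eval_act_ext[OF assms(4,3)])
  note lin = linear_map_tensor_act[OF left_module_hmod_ihom V _ linear_map_id, simplified]
  show "linear_map K (tensor K homs V) W (\<lambda>t. eval_act g \<theta> (tensor_act (hmod_ihom K H V W) V Y t))"
    if "\<theta> \<in> carrier (T 3)" for \<theta>
    using that g Y by (intro linear_map_eval_act lin)
  show "linear_map K (T 3) W (\<lambda>\<theta>. eval_act g \<theta> (tensor_act (hmod_ihom K H V W) V Y t))"
    if "t \<in> carrier (tensor K homs V)" for t
    using g linear_map_closed[OF lin[OF Y] that] by (intro linear_intros) simp_all
  fix a b c L v assume *: "a \<in> carrier H" "b \<in> carrier H" "c \<in> carrier H" "L \<in> carrier homs" "v \<in> carrier V"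
  let ?t = "tens K homs V L v"
  have "\<forall>Y\<in>carrier (T 2). eval_act g (pt [a, b, c]) (tensor_act (hmod_ihom K H V W) V Y ?t)
      = eval_act g (pt [a, b, c] \<cdot>\<^sub>3 D 2 1 Y) ?t"
  proof (rule tpow2_ext)
    fix p q assume pq: "p \<in> carrier H" "q \<in> carrier H"
    have "\<forall>Z\<in>carrier (T 2). eval_act g (pt [a, b, c]) (tens K homs V (hom_conj K H V W Z L) (act V q v))
        = eval_act g (pt [a, b, c] \<cdot>\<^sub>3 (pt [\<one>\<^sub>H, \<one>\<^sub>H, q] \<cdot>\<^sub>3 P 3 [1, 2] Z)) ?t"
      using * g pq by (intro tpow2_ext[where X = W] linear_intros) (simp_all add: place_list_simps)
    moreover have "tensor_act (hmod_ihom K H V W) V (pt [p, q]) ?t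
        = tens K homs V (hom_conj K H V W (comul H p) L) (act V q v)"
      using * pq tensor_act_pt[OF left_module_hmod_ihom V, of p q L v] by simp
    ultimately show "eval_act g (pt [a, b, c]) (tensor_act (hmod_ihom K H V W) V (pt [p, q]) ?t)
        = eval_act g (pt [a, b, c] \<cdot>\<^sub>3 D 2 1 (pt [p, q])) ?t"
      using pq by simp
  next
    show "linear_map K (T 2) W (\<lambda>Y. eval_act g (pt [a, b, c]) (tensor_act (hmod_ihom K H V W) V Y ?t))"
      using linear_map_tensor_act_left[OF left_module_hmod_ihom V _ linear_map_id, of ?t] * g
      by (intro linear_intros) simp_all
    show "linear_map K (T 2) W (\<lambda>Y. eval_act g (pt [a, b, c] \<cdot>\<^sub>3 D 2 1 Y) ?t)"
      using * g by (intro linear_intros) simp_all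
  qed simp
  then show "eval_act g (pt [a, b, c]) (tensor_act (hmod_ihom K H V W) V Y ?t)
      = eval_act g (pt [a, b, c] \<cdot>\<^sub>3 D 2 1 Y) ?t" using Y by blast
qed (use g Y in \<open>auto intro!: linear_intros\<close>)

end

end

section \<open>The twisting functor\<close>

text \<open>The inverse of an equivariant bijection is equivariant. Morphisms are extensional, hence the
  restriction to the carrier.\<close>

lemma hmod_isoI:
  assumes V: "left_module K G V" and W: "left_module K G W"
    and f: "linear_map K V W f" and g: "linear_map K W V g"
    and equivariant: "\<And>h v. \<lbrakk>h \<in> carrier G; v \<in> carrier V\<rbrakk> \<Longrightarrow> f (act V h v) = act W h (f v)"
    and gf: "\<And>v. v \<in> carrier V \<Longrightarrow> g (f v) = v" and fg: "\<And>w. w \<in> carrier W \<Longrightarrow> f (g w) = w"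
  shows "hmod_iso K G V W (\<lambda>v\<in>carrier V. f v)"
proof -
  interpret V: left_module K G V by fact
  interpret W: left_module K G W by fact
  note closed = linear_map_closed[OF f] linear_map_closed[OF g]
    linear_map_closed[OF V.act_linear] linear_map_closed[OF W.act_linear]
  have equivariant': "g (act W h w) = act V h (g w)" if "h \<in> carrier G" "w \<in> carrier W" for h w
    using equivariant[of h "g w"] gf[of "act V h (g w)"] fg that closed by simp
  have "linear_map K V W (\<lambda>v\<in>carrier V. f v)" "linear_map K W V (\<lambda>w\<in>carrier W. g w)"
    using f g by (simp_all add: linear_map_restrict[OF V.V.module_axioms] linear_map_restrict[OF W.V.module_axioms])
  then show ?thesis
    unfolding hmod_iso_def hmod_hom_def using closed equivariant equivariant' gf fg V W
    by (auto intro!: bexI[of _ "\<lambda>w\<in>carrier W. g w"])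
qed

lemma hmod_iso_id:
  assumes "left_module K G V"
  shows "hmod_iso K G V V (\<lambda>v\<in>carrier V. v)"
  by (rule hmod_isoI[where g = "\<lambda>v. v"]) (simp_all add: assms linear_map_id)

lemma hmod_homD:
  assumes "f \<in> hmod_hom K G V W"
  shows "linear_map K V W f" "\<lbrakk>h \<in> carrier G; v \<in> carrier V\<rbrakk> \<Longrightarrow> f (act V h v) = act W h (f v)"
  using assms by (auto simp: hmod_hom_def)

lemma tensor_map_identity:
  assumes V: "module K V" and W: "module K W" and t: "t \<in> carrier (tensor K V W)"
  shows "tensor_map K V W V W (\<lambda>v\<in>carrier V. v) (\<lambda>w\<in>carrier W. w) t = t"
proof -
  have "\<forall>t\<in>carrier (tensor K V W). tensor_map K V W V W (\<lambda>v\<in>carrier V. v) (\<lambda>w\<in>carrier W. w) t = t"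
  proof (rule tensor_ext)
    show "linear_map K (tensor K V W) (tensor K V W)
        (tensor_map K V W V W (\<lambda>v\<in>carrier V. v) (\<lambda>w\<in>carrier W. w))"
      by (intro tensor_map_linear V W linear_map_restrict_id)
    show "tensor_map K V W V W (\<lambda>v\<in>carrier V. v) (\<lambda>w\<in>carrier W. w) (tens K V W v w) = tens K V W v w"
      if "v \<in> carrier V" "w \<in> carrier W" for v w
      using that by (subst tensor_map_tens; simp add: V W linear_map_restrict_id)
  qed (simp_all add: V W linear_map_id)
  then show ?thesis using t by blast
qed

text \<open>A tensor product of \<open>H\<close>-modules and the tensor product of the underlying modules have the same further
  tensor products, but they are different records.\<close>

lemma tensor_map_cong:
  assumes "tensor K V1 W1 = tensor K V W" "tensor K V2 W2 = tensor K V' W'" "tens K V2 W2 = tens K V' W'"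
  shows "tensor_map K V1 W1 V2 W2 = tensor_map K V W V' W'"
proof -
  have "carrier (tensor K V1 W1) = carrier (tensor K V W)" by (simp only: assms)
  then show ?thesis by (simp add: tensor_map_def assms fun_eq_iff)
qed

context coproduct_algebra
begin

interpretation T: unital_algebra K "T n" for n by (rule unital_algebra_tpow)

text \<open>Equivariant maps commute with each leg of \<open>X\<close>.\<close>

lemma tensor_act_natural:
  assumes [simp]: "left_module K H V" "left_module K H W" "left_module K H V'" "left_module K H W'"
    and f: "f \<in> hmod_hom K H V V'" and g: "g \<in> hmod_hom K H W W'"
    and X: "X \<in> carrier (T 2)" and t: "t \<in> carrier (tensor K V W)"
  shows "tensor_act V' W' X (tensor_map K V W V' W' f g t) = tensor_map K V W V' W' f g (tensor_act V W X t)"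
proof -
  let ?M = "tensor_map K V W V' W' f g"
  have lin: "linear_map K (tensor K V W) (tensor K V' W') ?M"
    using hmod_homD[OF f] hmod_homD[OF g] by (intro tensor_map_linear) simp_all
  have M: "?M (tens K V W v w) = tens K V' W' (f v) (g w)" if "v \<in> carrier V" "w \<in> carrier W" for v w
    using hmod_homD[OF f] hmod_homD[OF g] that by (subst tensor_map_tens; simp)
  note fg = linear_map_closed[OF hmod_homD(1)[OF f]] linear_map_closed[OF hmod_homD(1)[OF g]]
  have "\<forall>X\<in>carrier (T 2). tensor_act V' W' X (?M t) = ?M (tensor_act V W X t)"
  proof (rule tpow2_ext)
    fix a b assume ab: "a \<in> carrier H" "b \<in> carrier H"
    have "\<forall>t\<in>carrier (tensor K V W). tensor_act V' W' (pt [a, b]) (?M t) = ?M (tensor_act V W (pt [a, b]) t)"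
      using ab fg hmod_homD(2)[OF f] hmod_homD(2)[OF g]
      by (intro tensor_ext[where X = "tensor K V' W'"] linear_map_tensor_act lin
          linear_map_comp[OF lin linear_map_tensor_act[OF _ _ _ linear_map_id]])
        (simp_all add: M)
    then show "tensor_act V' W' (pt [a, b]) (?M t) = ?M (tensor_act V W (pt [a, b]) t)" using t by blast
  next
    show "linear_map K (T 2) (tensor K V' W') (\<lambda>X. tensor_act V' W' X (?M t))"
      using linear_map_closed[OF lin t] by (intro linear_intros) simp_all
    show "linear_map K (T 2) (tensor K V' W') (\<lambda>X. ?M (tensor_act V W X t))"
      using t by (intro linear_map_comp[OF lin] linear_intros) simp_all
  qed simp
  then show ?thesis using X by blast
qed

end

context quasi_bialgebra
begin

interpretation T: unital_algebra K "T n" for n by (rule unital_algebra_tpow)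

lemma hmod_unit_fields [simp]:
  "carrier (hmod_unit K H) = carrier K" "zero (hmod_unit K H) = zero K" "add (hmod_unit K H) = add K"
  "smult (hmod_unit K H) = mult K" "act (hmod_unit K H) = (\<lambda>h r. counit H h \<otimes>\<^bsub>K\<^esub> r)"
  by (simp_all add: hmod_unit_def)

lemma hmod_unit_module [simp]: "module K (hmod_unit K H)"
proof (rule moduleI)
  show "abelian_group (hmod_unit K H)"
  proof (rule abelian_groupI)
    show "\<exists>y\<in>carrier (hmod_unit K H). y \<oplus>\<^bsub>hmod_unit K H\<^esub> x = \<zero>\<^bsub>hmod_unit K H\<^esub>"
      if "x \<in> carrier (hmod_unit K H)" for x
      using that by (intro bexI[of _ "\<ominus>\<^bsub>K\<^esub> x"]) (simp_all add: R.l_neg)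
  qed (simp_all add: R.a_ac)
qed (simp_all add: R.l_distr R.r_distr R.m_assoc R.cring_axioms)

lemma left_module_hmod_unit [simp]: "left_module K H (hmod_unit K H)"
proof (rule left_moduleI)
  show "linear_map K (hmod_unit K H) (hmod_unit K H) (act (hmod_unit K H) h)" if "h \<in> carrier H" for h
    using that by (intro linear_mapI) (simp_all add: R.r_distr R.m_lcomm)
  show "linear_map K H (hmod_unit K H) (\<lambda>h. act (hmod_unit K H) h v)" if "v \<in> carrier (hmod_unit K H)" for v
    using that by (intro linear_mapI) (simp_all add: counit_add counit_smult R.l_distr R.m_assoc)
qed (simp_all add: R.m_assoc)

context
  fixes V :: "('k, 'h, 'v) hmod" assumes V [simp]: "left_module K H V"
begin

interpretation V: module K V by simp

lemma smult_commute:
  "\<lbrakk>r \<in> carrier K; s \<in> carrier K; v \<in> carrier V\<rbrakk> \<Longrightarrow> r \<odot>\<^bsub>V\<^esub> (s \<odot>\<^bsub>V\<^esub> v) = s \<odot>\<^bsub>V\<^esub> (r \<odot>\<^bsub>V\<^esub> v)"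
  by (simp add: V.smult_assoc1[symmetric] R.m_comm)

lemma scalar_bilinear:
  "v \<in> carrier V \<Longrightarrow> linear_map K (hmod_unit K H) V (\<lambda>r. r \<odot>\<^bsub>V\<^esub> v)"
  "r \<in> carrier (hmod_unit K H) \<Longrightarrow> linear_map K V V (\<lambda>v. r \<odot>\<^bsub>V\<^esub> v)"
  by (rule linear_mapI; simp add: V.smult_l_distr V.smult_assoc1)
    (intro linear_intros; simp)

lemma lunit_linear: "linear_map K (tensor K (hmod_unit K H) V) V (lin_ext K V (\<lambda>(r, v). r \<odot>\<^bsub>V\<^esub> v))"
  by (rule linear_map_lin_ext_tensor) (simp_all only: hmod_unit_module left_module_module[OF V] scalar_bilinear)

lemma runit_linear: "linear_map K (tensor K V (hmod_unit K H)) V (lin_ext K V (\<lambda>(v, r). r \<odot>\<^bsub>V\<^esub> v))"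
  by (rule linear_map_lin_ext_tensor) (simp_all only: hmod_unit_module left_module_module[OF V] scalar_bilinear)

lemma lunit_tens:
  "\<lbrakk>r \<in> carrier K; v \<in> carrier V\<rbrakk>
    \<Longrightarrow> lin_ext K V (\<lambda>(r, v). r \<odot>\<^bsub>V\<^esub> v) (tens K (hmod_unit K H) V r v) = r \<odot>\<^bsub>V\<^esub> v"
  by (rule lin_ext_tens) (simp_all only: hmod_unit_module left_module_module[OF V] scalar_bilinear hmod_unit_fields)

lemma runit_tens:
  "\<lbrakk>r \<in> carrier K; v \<in> carrier V\<rbrakk>
    \<Longrightarrow> lin_ext K V (\<lambda>(v, r). r \<odot>\<^bsub>V\<^esub> v) (tens K V (hmod_unit K H) v r) = r \<odot>\<^bsub>V\<^esub> v"
  by (rule lin_ext_tens) (simp_all only: hmod_unit_module left_module_module[OF V] scalar_bilinear hmod_unit_fields)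

text \<open>On the unit object the leg of \<open>X\<close> acts by the counit. For \<open>X = F\<^sup>-\<^sup>1\<close>, whose counits are \<open>1\<close>, the unit
  constraints are thus compatible with the coherence map.\<close>

lemma lunit_tensor_act:
  assumes X: "X \<in> carrier (T 2)" and t: "t \<in> carrier (tensor K (hmod_unit K H) V)"
  shows "lin_ext K V (\<lambda>(r, v). r \<odot>\<^bsub>V\<^esub> v) (tensor_act (hmod_unit K H) V X t)
    = act V (counit1 X) (lin_ext K V (\<lambda>(r, v). r \<odot>\<^bsub>V\<^esub> v) t)" (is "?l (tensor_act _ _ _ _) = _")
proof -
  have "\<forall>X\<in>carrier (T 2). ?l (tensor_act (hmod_unit K H) V X t) = act V (counit1 X) (?l t)"
  proof (rule tpow2_ext)
    fix a b assume ab: "a \<in> carrier H" "b \<in> carrier H"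
    have "\<forall>t\<in>carrier (tensor K (hmod_unit K H) V). ?l (tensor_act (hmod_unit K H) V (pt [a, b]) t)
        = act V (counit1 (pt [a, b])) (?l t)"
      using ab
      by (intro tensor_ext[where X = V] linear_map_act_right lunit_linear
          linear_map_comp[OF lunit_linear linear_map_tensor_act[OF _ _ _ linear_map_id]])
        (simp_all add: lunit_tens V.smult_assoc1 smult_commute left_module.act_smult[OF V]
          linear_map_smult[OF left_module.act_linear[OF V]])
    then show "?l (tensor_act (hmod_unit K H) V (pt [a, b]) t) = act V (counit1 (pt [a, b])) (?l t)"
      using t by blast
  next
    show "linear_map K (T 2) V (\<lambda>X. ?l (tensor_act (hmod_unit K H) V X t))"
      using t by (intro linear_map_comp[OF lunit_linear] linear_intros) simp_all
    show "linear_map K (T 2) V (\<lambda>X. act V (counit1 X) (?l t))"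
      using linear_map_closed[OF lunit_linear t] by (intro linear_intros) simp_all
  qed simp
  then show ?thesis using X by blast
qed

lemma runit_tensor_act:
  assumes X: "X \<in> carrier (T 2)" and t: "t \<in> carrier (tensor K V (hmod_unit K H))"
  shows "lin_ext K V (\<lambda>(v, r). r \<odot>\<^bsub>V\<^esub> v) (tensor_act V (hmod_unit K H) X t)
    = act V (counit2 X) (lin_ext K V (\<lambda>(v, r). r \<odot>\<^bsub>V\<^esub> v) t)" (is "?l (tensor_act _ _ _ _) = _")
proof -
  have "\<forall>X\<in>carrier (T 2). ?l (tensor_act V (hmod_unit K H) X t) = act V (counit2 X) (?l t)"
  proof (rule tpow2_ext)
    fix a b assume ab: "a \<in> carrier H" "b \<in> carrier H"
    have "\<forall>t\<in>carrier (tensor K V (hmod_unit K H)). ?l (tensor_act V (hmod_unit K H) (pt [a, b]) t)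
        = act V (counit2 (pt [a, b])) (?l t)"
      using ab
      by (intro tensor_ext[where X = V] linear_map_act_right runit_linear
          linear_map_comp[OF runit_linear linear_map_tensor_act[OF _ _ _ linear_map_id]])
        (simp_all add: runit_tens V.smult_assoc1 smult_commute left_module.act_smult[OF V]
          linear_map_smult[OF left_module.act_linear[OF V]])
    then show "?l (tensor_act V (hmod_unit K H) (pt [a, b]) t) = act V (counit2 (pt [a, b])) (?l t)"
      using t by blast
  next
    show "linear_map K (T 2) V (\<lambda>X. ?l (tensor_act V (hmod_unit K H) X t))"
      using t by (intro linear_map_comp[OF runit_linear] linear_intros) simp_all
    show "linear_map K (T 2) V (\<lambda>X. act V (counit2 X) (?l t))"
      using linear_map_closed[OF runit_linear t] by (intro linear_intros) simp_all
  qed simp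
  then show ?thesis using X by blast
qed

end

end

context quasi_hopf_algebra
begin

interpretation T: unital_algebra K "T n" for n by (rule unital_algebra_tpow)

lemma hom_conj_natural:
  assumes [simp]: "left_module K H V" "left_module K H W" "left_module K H V'" "left_module K H W'"
    and f: "f \<in> hmod_hom K H V' V" and g: "g \<in> hmod_hom K H W W'"
    and X: "X \<in> carrier (T 2)" and L: "L \<in> carrier (hom_module K V W)"
  shows "hmod_ihom_map K V V' W f g L \<in> carrier (hom_module K V' W')"
    "hom_conj K H V' W' X (hmod_ihom_map K V V' W f g L) = hmod_ihom_map K V V' W f g (hom_conj K H V W X L)"
proof -
  note lf = hmod_homD(1)[OF f] and lg = hmod_homD(1)[OF g]
  have lin: "linear_map K V' W' (\<lambda>v. g (L (f v)))" if "L \<in> carrier (hom_module K V W)" for L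
    by (rule linear_map_comp[OF lg linear_map_hom_apply[OF _ _ that lf]]) simp_all
  have map: "hmod_ihom_map K V V' W f g L = (\<lambda>v\<in>carrier V'. g (L (f v)))"
    if "L \<in> carrier (hom_module K V W)" for L
    using that by (simp add: hmod_ihom_map_def)
  show closed: "hmod_ihom_map K V V' W f g L \<in> carrier (hom_module K V' W')"
    unfolding map[OF L] using L lin by (intro restrict_hom_module) simp_all
  have "\<forall>X\<in>carrier (T 2). hom_conj K H V' W' X (hmod_ihom_map K V V' W f g L)
      = (\<lambda>v\<in>carrier V'. g (hom_conj K H V W X L (f v)))"
  proof (rule tpow2_ext)
    fix a b assume ab: "a \<in> carrier H" "b \<in> carrier H"
    show "hom_conj K H V' W' (pt [a, b]) (hmod_ihom_map K V V' W f g L)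
      = (\<lambda>v\<in>carrier V'. g (hom_conj K H V W (pt [a, b]) L (f v)))"
    proof (rule hom_module_ext[where K = K and V = V' and W = W'])
      fix v assume v: "v \<in> carrier V'"
      have "L u \<in> carrier W" if "u \<in> carrier V" for u
        using L that by (rule hom_module_linear(2)[rotated 2]) simp_all
      then show "hom_conj K H V' W' (pt [a, b]) (hmod_ihom_map K V V' W f g L) v
          = (\<lambda>v\<in>carrier V'. g (hom_conj K H V W (pt [a, b]) L (f v))) v"
        using v ab L closed linear_map_closed[OF lf] by (simp add: map hmod_homD(2)[OF f] hmod_homD(2)[OF g])
    qed (use ab L closed lin in \<open>auto intro!: restrict_hom_module\<close>)
  next
    show "linear_map K (T 2) (hom_module K V' W') (\<lambda>X. hom_conj K H V' W' X (hmod_ihom_map K V V' W f g L))"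
      using closed by (intro linear_intros) simp_all
    show "linear_map K (T 2) (hom_module K V' W') (\<lambda>X. \<lambda>v\<in>carrier V'. g (hom_conj K H V W X L (f v)))"
    proof (rule linear_map_into_hom_module)
      fix v assume "v \<in> carrier V'"
      then have "f v \<in> carrier V" by (rule linear_map_closed[OF lf])
      then show "linear_map K (T 2) W' (\<lambda>X. g (hom_conj K H V W X L (f v)))"
        by (intro linear_map_comp[OF lg linear_map_homs_eval[OF assms(1,2)
                linear_map_hom_conj_left[OF assms(1,2) linear_map_id L]]])
    next
      fix X assume "X \<in> carrier (T 2)"
      then show "linear_map K V' W' (\<lambda>v. g (hom_conj K H V W X L (f v)))"
        using L by (intro lin hom_conj_closed) simp_all
    qed simp_all
  qed simp
  then show "hom_conj K H V' W' X (hmod_ihom_map K V V' W f g L) = hmod_ihom_map K V V' W f g (hom_conj K H V W X L)"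
    using X L by (simp add: map)
qed

end

context twisted_quasi_hopf
begin

interpretation T: unital_algebra K "T n" for n by (rule unital_algebra_tpow)
interpretation tq: quasi_hopf_algebra K H' by (rule quasi_hopf_algebra_twist)

lemma left_module_twist [simp]: "left_module K H' V \<longleftrightarrow> left_module K H V"
  using unital_algebra_self tw.unital_algebra_self
  unfolding left_module_def left_module_axioms_def by simp

lemma hmod_hom_twist [simp]: "hmod_hom K H' V W = hmod_hom K H V W"
  by (simp add: hmod_hom_def)

lemma hom_conj_twist [simp]: "hom_conj K H' = hom_conj K H"
  by (simp add: hom_conj_def fun_eq_iff)

lemma hmod_unit_twist [simp]: "hmod_unit K H' = hmod_unit K H"
  by (simp add: hmod_unit_def)

lemma tw_phi_eq: "tw_phi K H F V W = (\<lambda>t\<in>carrier (tensor K V W). tensor_act V W Fi t)"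
  by (simp add: tw_phi_def tensor_act_def)

lemma tw_gamma_eq: "tw_gamma K H F V W = (\<lambda>L\<in>carrier (hom_module K V W). hom_conj K H V W Fi L)"
  by (simp add: tw_gamma_def)

text \<open>The two categories have the same modules and the same morphisms.\<close>

lemma twist_equivalence: "twist_equivalence K H F tu tv tw"
  unfolding twist_equivalence_def Let_def
proof (intro conjI allI impI ballI)
  fix W :: "('k, 'h, 'u) hmod" assume "left_module K H' W"
  then show "\<exists>V f. left_module K H (V :: ('k, 'h, 'u) hmod) \<and> hmod_iso K H' (tw_obj V) W f"
    by (intro exI[of _ W] exI[of _ "\<lambda>v\<in>carrier W. v"]) (simp add: tw_obj_def hmod_iso_id)
qed (auto simp: tw_obj_def tw_mor_def bij_betw_def inj_on_def image_def)

text \<open>The inverse is the action of \<open>F\<close>. Equivariance is \<open>F\<^sup>-\<^sup>1 \<Delta>\<^sub>F(h) = \<Delta>(h) F\<^sup>-\<^sup>1\<close>.\<close>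

lemma tw_phi_iso:
  assumes V: "left_module K H V" and W: "left_module K H W"
  shows "hmod_iso K H' (hmod_tensor K H' V W) (hmod_tensor K H V W) (tw_phi K H F V W)"
proof -
  note [simp] = V W
  have "hmod_iso K H' (hmod_tensor K H' V W) (hmod_tensor K H V W)
      (\<lambda>t\<in>carrier (hmod_tensor K H' V W). tensor_act V W Fi t)"
  proof (rule hmod_isoI)
    show "left_module K H' (hmod_tensor K H' V W)" by (rule tw.left_module_hmod_tensor) simp_all
    show "linear_map K (hmod_tensor K H' V W) (hmod_tensor K H V W) (\<lambda>t. tensor_act V W Fi t)"
      "linear_map K (hmod_tensor K H V W) (hmod_tensor K H' V W) (\<lambda>t. tensor_act V W F t)"
      using linear_map_tensor_act[OF V W F_closed(2) linear_map_id]
        linear_map_tensor_act[OF V W F_closed(1) linear_map_id] by simp_all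
  qed (simp_all add: tw.act_hmod_tensor tensor_act_mult[symmetric] T.H.m_assoc del: tensor_act_mult)
  then show ?thesis by (simp add: tw_phi_eq)
qed

text \<open>Both sides are \<open>assoc_act\<close> at elements of \<open>T 3\<close>, and these agree because
  \<open>(id \<otimes> \<Delta>)(F\<^sup>-\<^sup>1) (1 \<otimes> F\<^sup>-\<^sup>1) \<phi>\<^sub>F = \<phi> (\<Delta> \<otimes> id)(F\<^sup>-\<^sup>1) (F\<^sup>-\<^sup>1 \<otimes> 1)\<close>.\<close>

lemma tw_phi_assoc:
  assumes V: "left_module K H V" and W: "left_module K H W" and X: "left_module K H X"
    and t: "t \<in> carrier (tensor K (tensor K V W) X)"
  shows "tw_phi K H F V (hmod_tensor K H W X)
      (tensor_map K V (hmod_tensor K H' W X) V (hmod_tensor K H W X)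
        (\<lambda>v\<in>carrier V. v) (tw_phi K H F W X) (hmod_assoc K H' V W X t))
    = hmod_assoc K H V W X (tw_phi K H F (hmod_tensor K H V W) X
        (tensor_map K (hmod_tensor K H' V W) X (hmod_tensor K H V W) X
          (tw_phi K H F V W) (\<lambda>x\<in>carrier X. x) t))"
proof -
  note [simp] = V W X
  have \<phi>F [simp]: "\<phi>F \<in> carrier (T 3)" using reassoc_twist_Units(1) by auto
  have map1: "tensor_map K V (hmod_tensor K H' W X) V (hmod_tensor K H W X)
      = tensor_map K V (tensor K W X) V (tensor K W X)" by (rule tensor_map_cong) simp_all
  have map2: "tensor_map K (hmod_tensor K H' V W) X (hmod_tensor K H V W) X
      = tensor_map K (tensor K V W) X (tensor K V W) X" by (rule tensor_map_cong) simp_all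
  let ?M = "tensor_map K (tensor K V W) X (tensor K V W) X
    (\<lambda>s\<in>carrier (tensor K V W). tensor_act V W Fi s) (\<lambda>x\<in>carrier X. x)"
  have "linear_map K (tensor K (tensor K V W) X) (tensor K (tensor K V W) X) ?M"
    by (intro tensor_map_linear linear_map_restrict_id linear_map_restrict_tensor_act F_closed) simp_all
  from linear_map_closed[OF this t] have M: "?M t \<in> carrier (tensor K (tensor K V W) X)" .
  have left: "tensor_map K V (tensor K W X) V (tensor K W X) (\<lambda>v\<in>carrier V. v)
      (\<lambda>s\<in>carrier (tensor K W X). tensor_act W X Fi s) (assoc_act V W X \<phi>F t)
    = assoc_act V W X (P 3 [2, 3] Fi \<cdot>\<^sub>3 \<phi>F) t"
    by (rule assoc_act_place_23) (simp_all add: t)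
  have "tensor_act V (hmod_tensor K H W X) Fi (assoc_act V W X (P 3 [2, 3] Fi \<cdot>\<^sub>3 \<phi>F) t)
    = assoc_act V W X (D 2 2 Fi \<cdot>\<^sub>3 (P 3 [2, 3] Fi \<cdot>\<^sub>3 \<phi>F)) t"
    using t by (intro assoc_act_comul_2) simp_all
  also have "D 2 2 Fi \<cdot>\<^sub>3 (P 3 [2, 3] Fi \<cdot>\<^sub>3 \<phi>F)
    = \<phi> \<cdot>\<^sub>3 D 2 1 Fi \<cdot>\<^sub>3 P 3 [1, 2] Fi"
    by (simp add: reassoc_twist T.H.m_assoc)
  also have "assoc_act V W X \<dots> t = assoc_act V W X (\<phi> \<cdot>\<^sub>3 D 2 1 Fi) (?M t)"
    using t by (intro assoc_act_place_12[symmetric]) simp_all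
  also have "\<dots> = assoc_act V W X \<phi> (tensor_act (hmod_tensor K H V W) X Fi (?M t))"
    using M by (intro assoc_act_comul_1[symmetric]) simp_all
  finally have main: "tensor_act V (hmod_tensor K H W X) Fi
      (assoc_act V W X (P 3 [2, 3] Fi \<cdot>\<^sub>3 \<phi>F) t)
    = assoc_act V W X \<phi> (tensor_act (hmod_tensor K H V W) X Fi (?M t))" .
  have M': "tensor_act (hmod_tensor K H V W) X Fi (?M t) \<in> carrier (tensor K (tensor K V W) X)"
    using tensor_act_closed[OF left_module_hmod_tensor[OF V W] X F_closed(2)] M by simp
  have closed: "assoc_act V W X \<phi>F t \<in> carrier (tensor K V (tensor K W X))"
    "assoc_act V W X (P 3 [2, 3] Fi \<cdot>\<^sub>3 \<phi>F) t \<in> carrier (tensor K V (tensor K W X))"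
    using t by simp_all
  show ?thesis
    unfolding map1 map2 tw_phi_eq hmod_assoc_eq[OF V W X]
    by (simp only: restrict_apply' t left M M' closed hmod_tensor_simps main)
qed

lemma tw_phi_units:
  assumes V: "left_module K H V"
  shows "t \<in> carrier (tensor K (hmod_unit K H) V) \<Longrightarrow>
      hmod_lunit K H V (tw_phi K H F (hmod_unit K H) V
        (tensor_map K (hmod_unit K H) V (hmod_unit K H) V (tw_psi K) (\<lambda>v\<in>carrier V. v) t))
      = hmod_lunit K H V t"
    and "t' \<in> carrier (tensor K V (hmod_unit K H)) \<Longrightarrow>
      hmod_runit K H V (tw_phi K H F V (hmod_unit K H)
        (tensor_map K V (hmod_unit K H) V (hmod_unit K H) (\<lambda>v\<in>carrier V. v) (tw_psi K) t'))
      = hmod_runit K H V t'"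
proof -
  note [simp] = V
  have psi: "tw_psi K = (\<lambda>r\<in>carrier (hmod_unit K H). r)" by (simp add: tw_psi_def)
  show "hmod_lunit K H V (tw_phi K H F (hmod_unit K H) V
        (tensor_map K (hmod_unit K H) V (hmod_unit K H) V (tw_psi K) (\<lambda>v\<in>carrier V. v) t))
      = hmod_lunit K H V t" if t: "t \<in> carrier (tensor K (hmod_unit K H) V)"
  proof -
    have "tensor_map K (hmod_unit K H) V (hmod_unit K H) V (tw_psi K) (\<lambda>v\<in>carrier V. v) t = t"
      unfolding psi using t by (intro tensor_map_identity) simp_all
    then show ?thesis
      using linear_map_closed[OF lunit_linear[OF V] t] t
      by (simp add: tw_phi_eq hmod_lunit_def lunit_tensor_act)
  qed
  show "hmod_runit K H V (tw_phi K H F V (hmod_unit K H)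
        (tensor_map K V (hmod_unit K H) V (hmod_unit K H) (\<lambda>v\<in>carrier V. v) (tw_psi K) t'))
      = hmod_runit K H V t'" if t: "t' \<in> carrier (tensor K V (hmod_unit K H))"
  proof -
    have "tensor_map K V (hmod_unit K H) V (hmod_unit K H) (\<lambda>v\<in>carrier V. v) (tw_psi K) t' = t'"
      unfolding psi using t by (intro tensor_map_identity) simp_all
    then show ?thesis
      using linear_map_closed[OF runit_linear[OF V] t] t
      by (simp add: tw_phi_eq hmod_runit_def runit_tensor_act)
  qed
qed

lemma tw_phi_natural:
  assumes "left_module K H V" "left_module K H W" "left_module K H V'" "left_module K H W'"
    and "f \<in> hmod_hom K H V V'" "g \<in> hmod_hom K H W W'" and t: "t \<in> carrier (tensor K V W)"
  shows "tw_phi K H F V' W' (tensor_map K V W V' W' f g t) = tensor_map K V W V' W' f g (tw_phi K H F V W t)"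
proof -
  have "tensor_map K V W V' W' f g t \<in> carrier (tensor K V' W')"
    using assms hmod_homD(1)[OF assms(5)] hmod_homD(1)[OF assms(6)] by simp
  then show ?thesis using tensor_act_natural[OF assms(1-6) F_closed(2) t] t by (simp add: tw_phi_eq)
qed

lemma twist_monoidal: "twist_monoidal K H F tu tv tw tx"
  unfolding twist_monoidal_def Let_def tw_obj_def tw_mor_def
proof (intro conjI allI impI ballI; (elim conjE)?)
  show "hmod_iso K H' (hmod_unit K H') (hmod_unit K H) (tw_psi K)"
    using hmod_iso_id[of K H' "hmod_unit K H"] by (simp add: tw_psi_def)
next
  fix V :: "('k, 'h, 'u) hmod" and W :: "('k, 'h, 'v) hmod"
  assume "left_module K H V" "left_module K H W"
  then show "hmod_iso K H' (hmod_tensor K H' V W) (hmod_tensor K H V W) (tw_phi K H F V W)"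
    by (rule tw_phi_iso)
next
  fix V :: "('k, 'h, 'u) hmod" and V' :: "('k, 'h, 'v) hmod"
    and W :: "('k, 'h, 'w) hmod" and W' :: "('k, 'h, 'x) hmod" and f g t
  assume "left_module K H V" "left_module K H V'" "left_module K H W" "left_module K H W'"
    "f \<in> hmod_hom K H V V'" "g \<in> hmod_hom K H W W'" "t \<in> carrier (hmod_tensor K H' V W)"
  then show "tw_phi K H F V' W' (tensor_map K V W V' W' f g t) = tensor_map K V W V' W' f g (tw_phi K H F V W t)"
    by (intro tw_phi_natural) simp_all
next
  fix V :: "('k, 'h, 'u) hmod" and W :: "('k, 'h, 'v) hmod" and X :: "('k, 'h, 'w) hmod" and t
  assume "left_module K H V" "left_module K H W" "left_module K H X"
    "t \<in> carrier (hmod_tensor K H' (hmod_tensor K H' V W) X)"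
  then show "tw_phi K H F V (hmod_tensor K H W X)
      (tensor_map K V (hmod_tensor K H' W X) V (hmod_tensor K H W X)
        (\<lambda>v\<in>carrier V. v) (tw_phi K H F W X) (hmod_assoc K H' V W X t))
    = hmod_assoc K H V W X (tw_phi K H F (hmod_tensor K H V W) X
        (tensor_map K (hmod_tensor K H' V W) X (hmod_tensor K H V W) X
          (tw_phi K H F V W) (\<lambda>x\<in>carrier X. x) t))"
    by (intro tw_phi_assoc) simp_all
next
  fix V :: "('k, 'h, 'u) hmod" and t
  assume V: "left_module K H V" and t: "t \<in> carrier (hmod_tensor K H' (hmod_unit K H') V)"
  have "hmod_lunit K H' V = hmod_lunit K H V" by (simp add: hmod_lunit_def)
  then show "hmod_lunit K H V (tw_phi K H F (hmod_unit K H) V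
        (tensor_map K (hmod_unit K H') V (hmod_unit K H) V (tw_psi K) (\<lambda>v\<in>carrier V. v) t))
      = hmod_lunit K H' V t"
    using tw_phi_units(1)[OF V, of t] t by simp
next
  fix V :: "('k, 'h, 'u) hmod" and t
  assume V: "left_module K H V" and t: "t \<in> carrier (hmod_tensor K H' V (hmod_unit K H'))"
  have "hmod_runit K H' V = hmod_runit K H V" by (simp add: hmod_runit_def)
  then show "hmod_runit K H V (tw_phi K H F V (hmod_unit K H)
        (tensor_map K V (hmod_unit K H') V (hmod_unit K H) (\<lambda>v\<in>carrier V. v) (tw_psi K) t))
      = hmod_runit K H' V t"
    using tw_phi_units(2)[OF V, of t] t by simp
qed

lemma tw_gamma_iso:
  assumes V: "left_module K H V" and W: "left_module K H W"
  shows "hmod_iso K H' (hmod_ihom K H' V W) (hmod_ihom K H V W) (tw_gamma K H F V W)"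
proof -
  note [simp] = V W
  have "hmod_iso K H' (hmod_ihom K H' V W) (hmod_ihom K H V W)
      (\<lambda>L\<in>carrier (hmod_ihom K H' V W). hom_conj K H V W Fi L)"
  proof (rule hmod_isoI)
    show "left_module K H' (hmod_ihom K H' V W)" by (rule tq.left_module_hmod_ihom) simp_all
    show "linear_map K (hmod_ihom K H' V W) (hmod_ihom K H V W) (\<lambda>L. hom_conj K H V W Fi L)"
      "linear_map K (hmod_ihom K H V W) (hmod_ihom K H' V W) (\<lambda>L. hom_conj K H V W F L)"
      using linear_map_hom_conj[OF V W _ F_closed(2) linear_map_id]
        linear_map_hom_conj[OF V W _ F_closed(1) linear_map_id] by simp_all
  qed (simp_all add: hom_conj_mult[symmetric] T.H.m_assoc del: hom_conj_mult)
  then show ?thesis by (simp add: tw_gamma_eq)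
qed

lemma tw_gamma_natural:
  assumes "left_module K H V" "left_module K H W" "left_module K H V'" "left_module K H W'"
    and "f \<in> hmod_hom K H V' V" "g \<in> hmod_hom K H W W'" and L: "L \<in> carrier (hom_module K V W)"
  shows "tw_gamma K H F V' W' (hmod_ihom_map K V V' W f g L)
    = hmod_ihom_map K V V' W f g (tw_gamma K H F V W L)"
  using hom_conj_natural[OF assms(1-6) F_closed(2) L] L by (simp add: tw_gamma_eq)

text \<open>The left-hand side is \<open>eval_act\<close> at \<open>\<alpha>\<close> and \<open>\<phi> (\<Delta> \<otimes> id)(F\<^sup>-\<^sup>1) (F\<^sup>-\<^sup>1 \<otimes> 1)\<close>. To reach \<open>\<alpha>\<^sub>F\<close> and \<open>\<phi>\<^sub>F\<close>, the
  factor \<open>(id \<otimes> \<Delta>)(F)\<close> is inserted, which evaluates to the counit \<open>1\<close>, and \<open>\<alpha>\<close> is written as the image of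
  \<open>\<alpha>\<^sub>F\<close> under \<open>F\<close>, which supplies the factor \<open>1 \<otimes> F\<close>.\<close>

lemma tw_eval:
  assumes V: "left_module K H V" and W: "left_module K H W" and t: "t \<in> carrier (tensor K (hom_module K V W) V)"
  shows "hmod_eval K H V W (tw_phi K H F (hmod_ihom K H V W) V
      (tensor_map K (hmod_ihom K H' V W) V (hmod_ihom K H V W) V
        (tw_gamma K H F V W) (\<lambda>v\<in>carrier V. v) t))
    = hmod_eval K H' V W t"
proof -
  note [simp] = V W
  let ?L = "hom_module K V W"
  let ?M = "tensor_map K ?L V ?L V (\<lambda>L\<in>carrier ?L. hom_conj K H V W Fi L) (\<lambda>v\<in>carrier V. v)"
  have map: "tensor_map K (hmod_ihom K H' V W) V (hmod_ihom K H V W) V = tensor_map K ?L V ?L V"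
    by (rule tensor_map_cong) simp_all
  have "linear_map K (tensor K ?L V) (tensor K ?L V) ?M"
    by (intro tensor_map_linear linear_map_restrict_id linear_map_restrict_hom_conj F_closed) simp_all
  from linear_map_closed[OF this t] have M: "?M t \<in> carrier (tensor K ?L V)" .
  have M': "tensor_act (hmod_ihom K H V W) V Fi (?M t) \<in> carrier (tensor K ?L V)"
    using tensor_act_closed[OF left_module_hmod_ihom[OF V W] V F_closed(2)] M by simp
  let ?\<theta> = "\<phi> \<cdot>\<^sub>3 (D 2 1 Fi \<cdot>\<^sub>3 P 3 [1, 2] Fi)"
  have "eval_act V W \<alpha> \<phi> (tensor_act (hmod_ihom K H V W) V Fi (?M t))
      = eval_act V W \<alpha> (\<phi> \<cdot>\<^sub>3 D 2 1 Fi) (?M t)"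
    using M by (intro eval_act_comul_1) simp_all
  also have "\<dots> = eval_act V W \<alpha> (\<phi> \<cdot>\<^sub>3 D 2 1 Fi \<cdot>\<^sub>3 P 3 [1, 2] Fi) t"
    using t by (intro eval_act_place_12) simp_all
  also have "\<dots> = eval_act V W \<alpha> ?\<theta> t" by (simp add: T.H.m_assoc)
  also have "\<dots> = eval_act V W \<alpha> (D 2 2 F \<cdot>\<^sub>3 ?\<theta>) t"
    using t by (simp add: eval_act_comul_2)
  also have "\<dots> = eval_act V W (conj_alpha (qalpha H') F) (D 2 2 F \<cdot>\<^sub>3 ?\<theta>) t"
    by (simp add: qalpha_twist)
  also have "\<dots> = eval_act V W (qalpha H') (P 3 [2, 3] F \<cdot>\<^sub>3 (D 2 2 F \<cdot>\<^sub>3 ?\<theta>)) t"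
    using t by (intro eval_act_place_23[symmetric]) (simp_all add: qalpha_twist)
  also have "\<dots> = eval_act V W (qalpha H') \<phi>F t" by (simp add: reassoc_twist T.H.m_assoc)
  finally have main: "eval_act V W \<alpha> \<phi> (tensor_act (hmod_ihom K H V W) V Fi (?M t)) = eval_act V W (qalpha H') \<phi>F t" .
  have eval': "hmod_eval K H' V W = (\<lambda>t\<in>carrier (tensor K ?L V). eval_act V W (qalpha H') \<phi>F t)"
    by (simp add: hmod_eval_def eval_act_def eval_val_def)
  show ?thesis
    unfolding map tw_gamma_eq tw_phi_eq eval' hmod_eval_eq[OF V W]
    by (simp only: restrict_apply' hmod_ihom_simps[OF V W] t M M' main)
qed

lemma twist_closed: "twist_closed K H F tu tv tw tx"
  unfolding twist_closed_def Let_def tw_obj_def tw_mor_def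
proof (intro conjI allI impI ballI; (elim conjE)?)
  fix V :: "('k, 'h, 'u) hmod" and W :: "('k, 'h, 'v) hmod"
  assume "left_module K H V" "left_module K H W"
  then show "hmod_iso K H' (hmod_ihom K H' V W) (hmod_ihom K H V W) (tw_gamma K H F V W)"
    by (rule tw_gamma_iso)
next
  fix V :: "('k, 'h, 'u) hmod" and V' :: "('k, 'h, 'v) hmod"
    and W :: "('k, 'h, 'w) hmod" and W' :: "('k, 'h, 'x) hmod" and f g L
  assume "left_module K H V" "left_module K H V'" "left_module K H W" "left_module K H W'"
    "f \<in> hmod_hom K H V' V" "g \<in> hmod_hom K H W W'" "L \<in> carrier (hmod_ihom K H' V W)"
  then show "tw_gamma K H F V' W' (hmod_ihom_map K V V' W f g L)
      = hmod_ihom_map K V V' W f g (tw_gamma K H F V W L)"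
    by (intro tw_gamma_natural) simp_all
next
  fix V :: "('k, 'h, 'u) hmod" and W :: "('k, 'h, 'v) hmod" and t
  assume "left_module K H V" "left_module K H W" "t \<in> carrier (hmod_tensor K H' (hmod_ihom K H' V W) V)"
  then show "hmod_eval K H V W (tw_phi K H F (hmod_ihom K H V W) V
      (tensor_map K (hmod_ihom K H' V W) V (hmod_ihom K H V W) V
        (tw_gamma K H F V W) (\<lambda>v\<in>carrier V. v) t))
    = hmod_eval K H' V W t"
    by (intro tw_eval) simp_all
qed

end

context twisted_quasitriangular
begin

interpretation T: unital_algebra K "T n" for n by (rule unital_algebra_tpow)

text \<open>Both sides are \<open>flip_act\<close>, at \<open>F\<^sub>2\<^sub>1\<^sup>-\<^sup>1 R\<^sub>F\<close> and at \<open>R F\<^sup>-\<^sup>1\<close>.\<close>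

lemma twist_braided: "twist_braided K H R F RF tu tv"
  unfolding twist_braided_def tw_obj_def tw_mor_def
proof (intro allI impI ballI, elim conjE)
  fix V :: "('k, 'h, 'u) hmod" and W :: "('k, 'h, 'v) hmod" and t
  assume VW [simp]: "left_module K H V" "left_module K H W"
    and "t \<in> carrier (hmod_tensor K H' V W)"
  then have t: "t \<in> carrier (tensor K V W)" by simp
  have "tensor_act W V Fi (flip_act V W RF t) = flip_act V W (P 2 [2, 1] Fi \<cdot>\<^sub>2 RF) t"
    using t by (intro tensor_act_flip_act) (simp_all add: twist_R_eq)
  also have "P 2 [2, 1] Fi \<cdot>\<^sub>2 RF = R \<cdot>\<^sub>2 Fi"
    by (simp add: twist_R_eq T.H.m_assoc)
  also have "flip_act V W (R \<cdot>\<^sub>2 Fi) t = flip_act V W R (tensor_act V W Fi t)"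
    using t by (intro flip_act_tensor_act[symmetric]) simp_all
  finally show "tw_phi K H F W V (hmod_braid K RF V W t) = hmod_braid K R V W (tw_phi K H F V W t)"
    using t by (simp add: tw_phi_eq hmod_braid_eq twist_R_eq)
qed

end

theorem theorem5p12:
  fixes K :: "'k ring" and H :: "('k, 'h) quasi_hopf"
    and R F :: "('h list \<Rightarrow> 'k) set"
  assumes "quasitriangular_quasi_hopf_algebra K H R"
    and "cochain_twist K H F"
  shows "quasitriangular_quasi_hopf_algebra K (twist K H F) (twist_R K H R F) \<and>
    twist_braided_closed_monoidal_equivalence K H R F (twist_R K H R F)
      TYPE('u) TYPE('v) TYPE('w) TYPE('x)"
proof -
  interpret quasitriangular_quasi_hopf_algebra K H R by fact
  interpret twisted_quasitriangular K H R F by unfold_locales (rule assms(2))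
  show ?thesis
    unfolding twist_braided_closed_monoidal_equivalence_def
    using quasitriangular_twist twist_equivalence twist_monoidal twist_closed twist_braided by blast
qed

end
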